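(* Let $G=\mathrm{SL}_n$ with $n\ge 2$. Let $\nabla$ be a $G$-connection on $\mathbb{P}^1$ (over $\mathbb{C}$) which is regular (i.e. has no singularities) away from $\{0,\infty\}$ and satisfies: \begin{itemize} \item the formal connection $\nabla_\infty$ induced at $\infty$ is regular singular with principal unipotent monodromy; \item the formal connection $\nabla_0$ induced at $0$ is irregular with $\mathrm{Irr}(\mathrm{Ad}(\nabla_0))=\mathrm{rank}(G)=n-1$. \end{itemize} Then $\nabla$ is isomorphic to a global Frenkel-Gross connection.
   Context: A $G$-connection on $\mathbb{P}^1$ regular away from $\{0,\infty\}$ is an algebraic principal $G$-bundle with connection on $\mathbb{P}^1\setminus\{0,\infty\}=\mathrm{Spec}\,\mathbb{C}[t,t^{-1}]$; isomorphism is isomorphism of such objects (for trivialized bundles, equivalence under the gauge action $g\cdot[\nabla]=\mathrm{Ad}(g)[\nabla]-(dg)g^{-1}$ of $g\in G(\mathbb{C}[t,t^{-1}])$). Global Frenkel-Gross connection: fix a maximal torus and Borel $H\subset B\subset G$ (with $\mathfrak{g}=\mathrm{Lie}(G)$), simple roots $\alpha_1,\dots,\alpha_r$ ($r=\mathrm{rank}(G)$), highest root $\alpha_0$, and root subspaces $\mathfrak{u}_\alpha\subset\mathfrak{g}$. For nonzero $x_{-\alpha_i}\in\mathfrak{u}_{-\alpha_i}$ and $x_{\alpha_0}\in\mathfrak{u}_{\alpha_0}$, the associated global Frenkel-Gross connection is the connection $d+\bigl(x_{\alpha_0}t^{-1}+\sum_{i=1}^r x_{-\alpha_i}\bigr)\frac{dt}{t}$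 on the trivial bundle. A formal connection (over $\mathbb{C}((z))$, $z$ a local coordinate) is regular singular if in some trivialization its matrix has at most a simple pole, and irregular otherwise. Principal unipotent monodromy means that the monodromy is a regular unipotent element of $G$. $\mathrm{Ad}(\nabla_0)$ is the connection induced by $\nabla_0$ on the adjoint vector bundle. Irregularity of a rank $m$ vector bundle with connection over $\mathbb{C}((t))$: by Levelt–Turrittin, for some $b\ge1$ its pullback to $\mathbb{C}((u))$, $u=t^{1/b}$, has in some trivialization the form $d+(\mathrm{diag}(D_1,\dots,D_m)+N)\frac{du}{u}$ with $D_i\in\mathbb{C}[u^{-1}]$ and $N$ a constant strictly upper triangular matrix commuting with $\mathrm{diag}(D_i)$. The irregularity is $\sum_i \mathrm{ord}_{\mathrm{pole}}(D_i)/b$, where $\mathrm{ord}_{\mathrm{pole}}\ge0$ is the order of the pole in $u$. *)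

theory Defs
  imports
    "HOL-Computational_Algebra.Computational_Algebra"
    "HOL-Computational_Algebra.Field_as_Ring"
    "Jordan_Normal_Form.Gauss_Jordan_Elimination"
    "Jordan_Normal_Form.Matrix_Kernel"
begin

section \<open>Matrix groups, Lie algebras and gauge transformations\<close>

text \<open>Here \<open>R\<close> is (the underlying set of) a subring of the ambient coefficient ring.\<close>

definition SL_mats :: "nat \<Rightarrow> 'a::comm_ring_1 set \<Rightarrow> 'a mat set" where
  "SL_mats n R = {g \<in> carrier_mat n n. elements_mat g \<subseteq> R \<and> det g = 1}"

definition sl_mats :: "nat \<Rightarrow> 'a::comm_ring_1 set \<Rightarrow> 'a mat set" where
  "sl_mats n R = {A \<in> carrier_mat n n. elements_mat A \<subseteq> R \<and> (\<Sum>i<n. A $$ (i,i)) = 0}"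

definition GL_mats :: "nat \<Rightarrow> 'a::field mat set" where
  "GL_mats n = {g \<in> carrier_mat n n. det g \<noteq> 0}"

definition minv :: "'a::field mat \<Rightarrow> 'a mat" where
  "minv g = the (mat_inverse g)"

text \<open>
  All connections are written in logarithmic form: over a field with coordinate \<open>t\<close> and
  derivation \<open>\<delta> = t d/dt\<close>, a matrix \<open>A\<close> stands for the connection \<open>d + A dt/t\<close>.
  No condition on the poles of \<open>A\<close> is implied.
\<close>

definition gauge :: "('a::field \<Rightarrow> 'a) \<Rightarrow> 'a mat \<Rightarrow> 'a mat \<Rightarrow> 'a mat" where
  "gauge \<delta> g A = g * A * minv g - map_mat \<delta> g * minv g"

text \<open>
  The basis of \<open>sl\<^sub>n\<close> consisting of \<open>E\<^sub>i\<^sub>j\<close> for \<open>i \<noteq> j\<close> and of \<open>E\<^sub>i\<^sub>i - E\<^sub>m\<^sub>m\<close> for \<open>i < m\<close>, where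
  \<open>m = n - 1\<close> is the last index, is enumerated by \<open>k = i * n + j < n\<^sup>2 - 1\<close>.  The \<open>k\<close>-th
  coordinate of \<open>X \<in> sl\<^sub>n\<close> in this basis is its entry at \<open>(k div n, k mod n)\<close>.
\<close>

definition sl_basis :: "nat \<Rightarrow> nat \<Rightarrow> 'a::comm_ring_1 mat" where
  "sl_basis n k = mat n n (\<lambda>(i,j).
     if i = k div n \<and> j = k mod n then 1
     else if i = n - 1 \<and> j = n - 1 \<and> k div n = k mod n then - 1
     else 0)"

definition sl_operator :: "nat \<Rightarrow> ('a::comm_ring_1 mat \<Rightarrow> 'a mat) \<Rightarrow> 'a mat" where
  "sl_operator n f = mat (n\<^sup>2 - 1) (n\<^sup>2 - 1) (\<lambda>(k,l). f (sl_basis n l) $$ (k div n, k mod n))"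

text \<open>Adjoint representations of \<open>SL\<^sub>n\<close> and of \<open>sl\<^sub>n\<close> on \<open>sl\<^sub>n\<close>.\<close>

definition Ad_mat :: "nat \<Rightarrow> 'a::field mat \<Rightarrow> 'a mat" where
  "Ad_mat n g = sl_operator n (\<lambda>X. g * X * minv g)"

definition ad_mat :: "nat \<Rightarrow> 'a::comm_ring_1 mat \<Rightarrow> 'a mat" where
  "ad_mat n A = sl_operator n (\<lambda>X. A * X - X * A)"

text \<open>
  An element \<open>u\<close> of \<open>G\<close> is regular if its centralizer has dimension \<open>rank G\<close>.  The dimension of
  the centralizer is that of its Lie algebra \<open>ker (Ad u - 1)\<close>.
\<close>

definition regular_unipotent :: "nat \<Rightarrow> complex mat \<Rightarrow> bool" where
  "regular_unipotent n u \<longleftrightarrow>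
     u \<in> SL_mats n UNIV \<and>
     (\<exists>k. (u - 1\<^sub>m n) ^\<^sub>m k = 0\<^sub>m n n) \<and>
     kernel_dim (Ad_mat n u - 1\<^sub>m (n\<^sup>2 - 1)) = n - 1"


section \<open>Formal connections\<close>

definition fls_theta :: "complex fls \<Rightarrow> complex fls" where
  "fls_theta f = fls_X * fls_deriv f"

text \<open>A simple pole in \<open>d + A dz/z\<close> means that \<open>A\<close> has entries in \<open>C[[z]]\<close>.\<close>

definition regular_singular :: "nat \<Rightarrow> complex fls mat \<Rightarrow> bool" where
  "regular_singular n A \<longleftrightarrow>
     (\<exists>g \<in> SL_mats n UNIV. elements_mat (gauge fls_theta g A) \<subseteq> range fps_to_fls)"

definition exp_mat :: "nat \<Rightarrow> complex mat \<Rightarrow> complex mat" where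
  "exp_mat n C = mat n n (\<lambda>(i,j). \<Sum>k. (C ^\<^sub>m k) $$ (i,j) / fact k)"

text \<open>
  The flat sections of \<open>d + C dz/z\<close> with \<open>C\<close> constant are the \<open>z\<^sup>-\<^sup>C v\<close>, whence the formula for
  the monodromy.  It is a conjugacy class, so this is a relation.  The trivializations
  bringing \<open>A\<close> to constant form are those of the underlying vector bundle: over
  \<open>C((z))\<close> a regular singular \<open>SL\<^sub>n\<close>-connection need not have a constant form by an
  \<open>SL\<^sub>n\<close>-gauge transformation (minus a regular unipotent of \<open>SL\<^sub>2\<close> is not in the image of
  \<open>exp\<close> on \<open>sl\<^sub>2\<close>), and conjugacy in \<open>SL\<^sub>n(C)\<close> and in \<open>GL\<^sub>n(C)\<close> agree.
\<close>

definition has_monodromy :: "nat \<Rightarrow> complex fls mat \<Rightarrow> complex mat \<Rightarrow> bool" where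
  "has_monodromy n A u \<longleftrightarrow>
     (\<exists>g \<in> GL_mats n. \<exists>C \<in> carrier_mat n n.
        gauge fls_theta g A = map_mat fls_const C \<and>
        u = exp_mat n ((- (2 * complex_of_real pi * \<i>)) \<cdot>\<^sub>m C))"

definition principal_unipotent_monodromy :: "nat \<Rightarrow> complex fls mat \<Rightarrow> bool" where
  "principal_unipotent_monodromy n A \<longleftrightarrow> (\<exists>u. has_monodromy n A u \<and> regular_unipotent n u)"

definition eval_at :: "complex fls \<Rightarrow> complex poly \<Rightarrow> complex fls" where
  "eval_at x p = poly (map_poly fls_const p) x"

text \<open>
  Pulling back along \<open>t = u\<^sup>b\<close> turns \<open>B(t) dt/t\<close> into \<open>b B(u\<^sup>b) du/u\<close>.  The Levelt-Turrittin
  form has diagonal entries \<open>p\<^sub>i(u\<^sup>-\<^sup>1)\<close> with polynomials \<open>p\<^sub>i\<close>, whose pole order is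
  \<open>degree p\<^sub>i\<close>.
\<close>

definition levelt_turrittin ::
  "nat \<Rightarrow> complex fls mat \<Rightarrow> nat \<Rightarrow> (nat \<Rightarrow> complex poly) \<Rightarrow> complex mat \<Rightarrow> bool" where
  "levelt_turrittin m B b p N \<longleftrightarrow>
     b \<ge> 1 \<and>
     N \<in> carrier_mat m m \<and> (\<forall>i<m. \<forall>j\<le>i. N $$ (i,j) = 0) \<and>
     (let D = mat_diag m (\<lambda>i. eval_at fls_X_inv (p i)); N' = map_mat fls_const N in
        D * N' = N' * D \<and>
        (\<exists>g \<in> GL_mats m.
           gauge fls_theta g (of_nat b \<cdot>\<^sub>m map_mat (\<lambda>f. fls_compose_power f b) B) = D + N'))"

text \<open>
  The Levelt-Turrittin theorem says that for every \<open>B\<close> there is exactly one such \<open>r\<close>.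
\<close>

definition has_irregularity :: "nat \<Rightarrow> complex fls mat \<Rightarrow> real \<Rightarrow> bool" where
  "has_irregularity m B r \<longleftrightarrow>
     (\<exists>b p N. levelt_turrittin m B b p N \<and> r = (\<Sum>i<m. real (degree (p i))) / real b)"


section \<open>Rational functions\<close>

type_synonym ratfun = "complex poly fract"

abbreviation rat_t :: ratfun where
  "rat_t \<equiv> to_fract [:0, 1:]"

abbreviation rat_const :: "complex \<Rightarrow> ratfun" where
  "rat_const c \<equiv> to_fract [:c:]"

definition rat_theta :: "ratfun \<Rightarrow> ratfun" where
  "rat_theta f = (case quot_of_fract f of (p, q) \<Rightarrow>
     rat_t * Fract (pderiv p * q - p * pderiv q) (q ^ 2))"

text \<open>
  The coordinate ring of a nonempty Zariski open \<open>U\<close> in the affine line, as a subring of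
  \<open>C(t)\<close>; \<open>quot_of_fract\<close> yields lowest terms.
\<close>

definition regular_on :: "complex set \<Rightarrow> ratfun set" where
  "regular_on U = {f. \<forall>a\<in>U. poly (snd (quot_of_fract f)) a \<noteq> 0}"

text \<open>Substitution \<open>t = x\<close>, used for \<open>x = z\<close> and \<open>x = z\<^sup>-\<^sup>1\<close>.\<close>

definition expand :: "complex fls \<Rightarrow> ratfun \<Rightarrow> complex fls" where
  "expand x f = (case quot_of_fract f of (p, q) \<Rightarrow> eval_at x p / eval_at x q)"


section \<open>\<open>SL\<^sub>n\<close>-connections on the projective line regular away from zero and infinity\<close>

text \<open>
  A principal \<open>SL\<^sub>n\<close>-bundle with connection on \<open>Spec C[t,t\<^sup>-\<^sup>1]\<close> is given by local
  trivializations over a finite Zariski open cover (\<open>SL\<^sub>n\<close>-bundles are Zariski locally trivial),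
  transition functions and local connection matrices.  The coordinates of a section are
  related by \<open>s\<^sub>i = trans i j * s\<^sub>j\<close>.  Identities over intersections of charts are identities over
  \<open>C(t)\<close>, since all charts are dense in the integral scheme \<open>Spec C[t,t\<^sup>-\<^sup>1]\<close>.
\<close>

record connection_data =
  nchart :: nat
  chart :: "nat \<Rightarrow> complex set"
  trans :: "nat \<Rightarrow> nat \<Rightarrow> ratfun mat"
  cform :: "nat \<Rightarrow> ratfun mat"

definition SL_connection :: "nat \<Rightarrow> connection_data \<Rightarrow> bool" where
  "SL_connection n X \<longleftrightarrow>
     (\<forall>i<nchart X. finite (- chart X i)) \<and>
     (\<Union>i<nchart X. chart X i) = - {0} \<and>
     (\<forall>i<nchart X. \<forall>j<nchart X.
        trans X i j \<in> SL_mats n (regular_on (chart X i \<inter> chart X j))) \<and>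
     (\<forall>i<nchart X. \<forall>j<nchart X. \<forall>k<nchart X. trans X i j * trans X j k = trans X i k) \<and>
     (\<forall>i<nchart X. cform X i \<in> sl_mats n (regular_on (chart X i))) \<and>
     (\<forall>i<nchart X. \<forall>j<nchart X. cform X i = gauge rat_theta (trans X i j) (cform X j))"

text \<open>
  An isomorphism from \<open>X\<close> to \<open>Y\<close> is given by its matrices \<open>h a i\<close> with respect to the \<open>i\<close>-th
  chart of \<open>X\<close> and the \<open>a\<close>-th chart of \<open>Y\<close>.
\<close>

definition SL_isomorphic :: "nat \<Rightarrow> connection_data \<Rightarrow> connection_data \<Rightarrow> bool" where
  "SL_isomorphic n X Y \<longleftrightarrow>
     (\<exists>h. (\<forall>a<nchart Y. \<forall>i<nchart X. h a i \<in> SL_mats n (regular_on (chart Y a \<inter> chart X i))) \<and>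
          (\<forall>a<nchart Y. \<forall>b<nchart Y. \<forall>i<nchart X. \<forall>j<nchart X.
             h a i * trans X i j = trans Y a b * h b j) \<and>
          (\<forall>a<nchart Y. \<forall>i<nchart X. cform Y a = gauge rat_theta (h a i) (cform X i)))"

definition on_trivial_bundle :: "nat \<Rightarrow> ratfun mat \<Rightarrow> connection_data" where
  "on_trivial_bundle n A =
     \<lparr>nchart = 1, chart = (\<lambda>_. - {0}), trans = (\<lambda>_ _. 1\<^sub>m n), cform = (\<lambda>_. A)\<rparr>"

text \<open>
  The restriction to a formal punctured disc factors through the generic point, hence through
  every chart; another chart gives an equivalent connection.  At infinity \<open>z = t\<^sup>-\<^sup>1\<close> and
  \<open>dt/t = - dz/z\<close>.
\<close>

definition formal_at_0 :: "connection_data \<Rightarrow> complex fls mat" where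
  "formal_at_0 X = map_mat (expand fls_X) (cform X 0)"

definition formal_at_inf :: "connection_data \<Rightarrow> complex fls mat" where
  "formal_at_inf X = - map_mat (expand fls_X_inv) (cform X 0)"


section \<open>Global Frenkel-Gross connections\<close>

text \<open>
  Every maximal torus and Borel subgroup \<open>H \<subset> B\<close> of \<open>SL\<^sub>n(C)\<close> are of the form
  \<open>P T P\<^sup>-\<^sup>1 \<subset> P U P\<^sup>-\<^sup>1\<close> with \<open>P \<in> SL\<^sub>n(C)\<close>, the diagonal torus \<open>T\<close> and the group \<open>U\<close> of
  upper triangular matrices.  The roots are the \<open>\<alpha>\<^sub>i\<^sub>j (P D P\<^sup>-\<^sup>1) = D\<^sub>i\<^sub>i / D\<^sub>j\<^sub>j\<close> for \<open>i \<noteq> j\<close>; with indices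
  starting at 0, the simple ones are the \<open>\<alpha>\<^sub>i\<^sub>,\<^sub>i\<^sub>+\<^sub>1\<close> and the highest one is \<open>\<alpha>\<^sub>0\<^sub>,\<^sub>n\<^sub>-\<^sub>1\<close>.
\<close>

definition root_space :: "nat \<Rightarrow> complex mat \<Rightarrow> nat \<Rightarrow> nat \<Rightarrow> complex mat set" where
  "root_space n P i j =
     {X \<in> sl_mats n UNIV. \<forall>D \<in> SL_mats n UNIV. diagonal_mat D \<longrightarrow>
        (let h = P * D * minv P in h * X * minv h = (D $$ (i,i) / D $$ (j,j)) \<cdot>\<^sub>m X)}"

definition frenkel_gross_mat ::
  "nat \<Rightarrow> complex mat \<Rightarrow> (nat \<Rightarrow> complex mat) \<Rightarrow> ratfun mat" where
  "frenkel_gross_mat n x\<^sub>0 x = mat n n (\<lambda>(k,l).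
     rat_const (x\<^sub>0 $$ (k,l)) / rat_t + (\<Sum>i<n-1. rat_const (x i $$ (k,l))))"

definition frenkel_gross_connection :: "nat \<Rightarrow> complex mat \<Rightarrow> connection_data \<Rightarrow> bool" where
  "frenkel_gross_connection n P Y \<longleftrightarrow>
     (\<exists>x\<^sub>0 x. x\<^sub>0 \<in> root_space n P 0 (n - 1) \<and> x\<^sub>0 \<noteq> 0\<^sub>m n n \<and>
        (\<forall>i<n-1. x i \<in> root_space n P (i + 1) i \<and> x i \<noteq> 0\<^sub>m n n) \<and>
        Y = on_trivial_bundle n (frenkel_gross_mat n x\<^sub>0 x))"

end

theory Submission
  imports Defs "Jordan_Normal_Form.Schur_Decomposition"
begin

text \<open>
  Local analysis at \<open>0\<close>: in a cyclic basis the connection is a companion matrix; let \<open>r / s\<close> be its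
  largest slope.  After pullback to \<open>t = u\<^sup>b\<^sup>s\<close> the leading coefficient \<open>u\<^sup>-\<^sup>b\<^sup>r T\<close> has a spectrum which is
  stable under the \<open>s\<close>-th roots of unity, has sum zero and is not identically zero.  Each pair of
  distinct eigenvalues of \<open>T\<close> contributes \<open>r / s\<close> to the irregularity of the adjoint connection, and
  the value \<open>n - 1\<close> leaves room only for \<open>r = 1\<close>, \<open>s = n\<close>.  Hence there is a valuation on sections
  with values in \<open>(1 / n) Z\<close>, with one-dimensional graded pieces, which the connection lowers by exactly \<open>1 / n\<close>.

  Global argument: consider the sections on \<open>P\<^sup>1 - {0}\<close> of the extension to \<open>\<infinity>\<close> with nilpotent residue,
  filtered by this valuation.  If \<open>v\<close> is a nonzero one of maximal valuation, then the derivatives of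
  \<open>v\<close> exhaust the filtration, so that \<open>t\<^sup>-\<^sup>1 v = p(\<nabla>) v\<close> with \<open>deg p = n\<close>.  Nilpotency of the residue at \<open>\<infinity>\<close>
  forces \<open>p\<close> to be a monomial, and in the basis \<open>v, \<nabla> v, \<dots>, \<nabla>\<^sup>n\<^sup>-\<^sup>1 v\<close> the connection is a
  Frenkel-Gross connection.
\<close>

text \<open>The irregularity is given for the adjoint connection only, so its Levelt-Turrittin form
  cannot be compared entry by entry with a companion matrix of the connection itself. What survives
  arbitrary changes of frame, with poles of any order, is the growth rate of pole orders under
  iterated differentiation: a change of frame moves pole orders by a bounded amount, so after
  \<open>k\<close> derivatives the coefficients of \<open>k\<close> on both sides can be compared.
  All estimates of irregularity are of this kind, made over a common ramified cover. Globally no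
  triviality of the bundle is assumed. A section of maximal valuation exists because the determinant
  of its first \<open>n\<close> iterates is a nonzero Laurent polynomial, whose orders at zero and
  infinity add up to at most \<open>0\<close>; regularity at infinity therefore bounds the valuation
  at zero. The frame built from such a section trivializes the bundle: its determinant is constant
  because both connection matrices have trace zero, and an \<open>n\<close>-th root normalizes
  it.\<close>

no_notation fps_nth (infixl "$" 75)
no_notation fls_nth (infixl "$$" 75)

section \<open>Derivations, connections and gauge transformations\<close>

definition mtrace :: "'a::comm_ring_1 mat \<Rightarrow> 'a" where
  "mtrace A = (\<Sum>i<dim_row A. A $$ (i,i))"

lemma mtrace_mult_commute:
  assumes "A \<in> carrier_mat n n" "B \<in> carrier_mat n n"
  shows "mtrace (A * B) = mtrace (B * A)"
proof -
  have "mtrace (A * B) = (\<Sum>i<n. \<Sum>j<n. A $$ (i,j) * B $$ (j,i))"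
    using assms by (auto simp: mtrace_def scalar_prod_def lessThan_atLeast0 intro!: sum.cong)
  also have "\<dots> = (\<Sum>j<n. \<Sum>i<n. A $$ (i,j) * B $$ (j,i))" by (rule sum.swap)
  also have "\<dots> = mtrace (B * A)"
    using assms by (auto simp: mtrace_def scalar_prod_def lessThan_atLeast0 mult.commute intro!: sum.cong)
  finally show ?thesis .
qed

lemma mtrace_add: "A \<in> carrier_mat n n \<Longrightarrow> B \<in> carrier_mat n n \<Longrightarrow> mtrace (A + B) = mtrace A + mtrace B"
  by (auto simp: mtrace_def sum.distrib)

lemma mtrace_minus: "A \<in> carrier_mat n n \<Longrightarrow> B \<in> carrier_mat n n \<Longrightarrow> mtrace (A - B) = mtrace A - mtrace B"
  by (auto simp: mtrace_def sum_subtractf)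

lemma minv:
  assumes "(g :: 'a::field mat) \<in> carrier_mat n n" "det g \<noteq> 0"
  shows "minv g \<in> carrier_mat n n" "g * minv g = 1\<^sub>m n" "minv g * g = 1\<^sub>m n"
proof -
  obtain B where "mat_inverse g = Some B"
    using mat_inverse(1)[OF assms(1), of "()"] det_non_zero_imp_unit[OF assms, of "()"]
    by (cases "mat_inverse g") auto
  then show "minv g \<in> carrier_mat n n" "g * minv g = 1\<^sub>m n" "minv g * g = 1\<^sub>m n"
    using mat_inverse(2)[OF assms(1)] by (auto simp: minv_def)
qed

lemma right_inverse_det:
  assumes "(g :: 'a::field mat) \<in> carrier_mat n n" "h \<in> carrier_mat n n" "g * h = 1\<^sub>m n"
  shows "det g \<noteq> 0"
  using det_mult[OF assms(1,2)] assms(3) by (auto simp: det_one)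

lemma minv_eqI:
  assumes "(g :: 'a::field mat) \<in> carrier_mat n n" "h \<in> carrier_mat n n" "g * h = 1\<^sub>m n"
  shows "minv g = h"
proof -
  note m = minv[OF assms(1) right_inverse_det[OF assms]]
  have "minv g = minv g * (g * h)" using m assms by simp
  also have "\<dots> = minv g * g * h" using assoc_mult_mat[OF m(1) assms(1,2)] by simp
  finally show ?thesis using m assms by simp
qed

lemma det_minv:
  assumes "(g :: 'a::field mat) \<in> carrier_mat n n" "det g \<noteq> 0"
  shows "det (minv g) = inverse (det g)"
proof -
  have "det g * det (minv g) = 1"
    using det_mult[OF assms(1) minv(1)[OF assms]] minv(2)[OF assms] by simp
  then show ?thesis using assms by (simp add: field_simps)
qed

lemma minv_minv:
  assumes "(g :: 'a::field mat) \<in> carrier_mat n n" "det g \<noteq> 0"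
  shows "minv (minv g) = g"
  by (rule minv_eqI[of _ n]) (use minv[OF assms] assms in auto)

definition nabla :: "('a::comm_ring_1 \<Rightarrow> 'a) \<Rightarrow> 'a mat \<Rightarrow> 'a vec \<Rightarrow> 'a vec" where
  "nabla \<delta> A v = map_vec \<delta> v + A *\<^sub>v v"

lemma nabla_closed [simp]:
  "A \<in> carrier_mat n n \<Longrightarrow> v \<in> carrier_vec n \<Longrightarrow> nabla \<delta> A v \<in> carrier_vec n"
  by (simp add: nabla_def)

lemma nabla_pow_closed [simp]:
  "A \<in> carrier_mat n n \<Longrightarrow> v \<in> carrier_vec n \<Longrightarrow> (nabla \<delta> A ^^ k) v \<in> carrier_vec n"
  by (induction k) auto

lemma index_mult_mat_vec_sum:
  "i < n \<Longrightarrow> A \<in> carrier_mat n n \<Longrightarrow> v \<in> carrier_vec n \<Longrightarrow>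
   (A *\<^sub>v v) $ i = (\<Sum>j<n. A $$ (i,j) * v $ j)"
  by (simp add: scalar_prod_def lessThan_atLeast0)

lemma index_mult_mat_sum:
  "i < n \<Longrightarrow> j < k \<Longrightarrow> A \<in> carrier_mat n m \<Longrightarrow> B \<in> carrier_mat m k \<Longrightarrow>
   (A * B) $$ (i,j) = (\<Sum>l<m. A $$ (i,l) * B $$ (l,j))"
  by (simp add: scalar_prod_def lessThan_atLeast0)

lemma index_nabla:
  "i < n \<Longrightarrow> A \<in> carrier_mat n n \<Longrightarrow> v \<in> carrier_vec n \<Longrightarrow>
   nabla \<delta> A v $ i = \<delta> (v $ i) + (\<Sum>j<n. A $$ (i,j) * v $ j)"
  by (simp add: nabla_def index_mult_mat_vec_sum del: index_mult_mat_vec)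

lemma gauge_closed [simp]:
  assumes "g \<in> carrier_mat n n" "det g \<noteq> 0" "A \<in> carrier_mat n n"
  shows "gauge \<delta> g A \<in> carrier_mat n n"
  using minv[OF assms(1,2)] assms by (auto simp: gauge_def)

locale derivation =
  fixes \<delta> :: "'a::field \<Rightarrow> 'a"
  assumes add: "\<delta> (x + y) = \<delta> x + \<delta> y"
    and mult: "\<delta> (x * y) = \<delta> x * y + x * \<delta> y"
begin

no_notation fps_nth (infixl "$" 75)
no_notation fls_nth (infixl "$$" 75)

lemma zero [simp]: "\<delta> 0 = 0"
proof -
  have "\<delta> 0 = \<delta> 0 + \<delta> 0" using add[of 0 0] by simp
  then show ?thesis by (metis add_cancel_right_right)
qed

lemma one [simp]: "\<delta> 1 = 0"
proof -
  have "\<delta> 1 = \<delta> 1 + \<delta> 1" using mult[of 1 1] by simp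
  then show ?thesis by (metis add_cancel_right_right)
qed

lemma uminus: "\<delta> (- x) = - \<delta> x"
  using add[of x "- x"] by (simp add: eq_neg_iff_add_eq_0 add.commute)

lemma sum: "\<delta> (\<Sum>x\<in>S. f x) = (\<Sum>x\<in>S. \<delta> (f x))"
  by (induction S rule: infinite_finite_induct) (auto simp: add)

lemma of_nat [simp]: "\<delta> (of_nat k) = 0"
  by (induction k) (auto simp: add)

lemma inverse:
  assumes "x \<noteq> 0" shows "\<delta> (inverse x) = - \<delta> x / x\<^sup>2"
proof -
  have "\<delta> (x * inverse x) = 0" using assms by simp
  then show ?thesis using assms unfolding mult by (simp add: field_simps power2_eq_square)
      (metis add.commute add_eq_0_iff)
qed

lemma prod:
  assumes "finite S"
  shows "\<delta> (\<Prod>x\<in>S. f x) = (\<Sum>x\<in>S. \<delta> (f x) * (\<Prod>y\<in>S - {x}. f y))"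
  using assms
proof (induction S)
  case (insert a S)
  have "(\<Sum>x\<in>S. \<delta> (f x) * (\<Prod>y\<in>insert a S - {x}. f y)) =
        (\<Sum>x\<in>S. f a * (\<delta> (f x) * (\<Prod>y\<in>S - {x}. f y)))"
  proof (rule sum.cong)
    fix x assume "x \<in> S"
    then have "insert a S - {x} = insert a (S - {x})" using insert by auto
    then show "\<delta> (f x) * (\<Prod>y\<in>insert a S - {x}. f y) = f a * (\<delta> (f x) * (\<Prod>y\<in>S - {x}. f y))"
      using insert by simp
  qed simp
  moreover have "insert a S - {a} = S" using insert by auto
  ultimately show ?case using insert by (simp add: mult sum_distrib_left)
qed simp

lemma map_mat_mult:
  assumes "A \<in> carrier_mat n m" "B \<in> carrier_mat m k"
  shows "map_mat \<delta> (A * B) = map_mat \<delta> A * B + A * map_mat \<delta> B"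
proof (rule eq_matI)
  fix i j assume "i < dim_row (map_mat \<delta> A * B + A * map_mat \<delta> B)"
    "j < dim_col (map_mat \<delta> A * B + A * map_mat \<delta> B)"
  then show "map_mat \<delta> (A * B) $$ (i,j) = (map_mat \<delta> A * B + A * map_mat \<delta> B) $$ (i,j)"
    using assms by (auto simp: scalar_prod_def sum mult sum.distrib)
qed (use assms in auto)

lemma map_mult_mat_vec:
  assumes "A \<in> carrier_mat n m" "v \<in> carrier_vec m"
  shows "map_vec \<delta> (A *\<^sub>v v) = map_mat \<delta> A *\<^sub>v v + A *\<^sub>v map_vec \<delta> v"
proof (rule eq_vecI)
  fix i assume "i < dim_vec (map_mat \<delta> A *\<^sub>v v + A *\<^sub>v map_vec \<delta> v)"
  then show "map_vec \<delta> (A *\<^sub>v v) $ i = (map_mat \<delta> A *\<^sub>v v + A *\<^sub>v map_vec \<delta> v) $ i"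
    using assms by (auto simp: scalar_prod_def sum mult sum.distrib)
qed (use assms in auto)

lemma nabla_add:
  assumes "A \<in> carrier_mat n n" "v \<in> carrier_vec n" "w \<in> carrier_vec n"
  shows "nabla \<delta> A (v + w) = nabla \<delta> A v + nabla \<delta> A w"
  by (rule eq_vecI) (use assms in \<open>auto simp: nabla_def scalar_prod_def add sum.distrib algebra_simps\<close>)

lemma nabla_smult:
  assumes "A \<in> carrier_mat n n" "v \<in> carrier_vec n"
  shows "nabla \<delta> A (f \<cdot>\<^sub>v v) = \<delta> f \<cdot>\<^sub>v v + f \<cdot>\<^sub>v nabla \<delta> A v"
  by (rule eq_vecI)
    (use assms in \<open>auto simp: nabla_def scalar_prod_def mult sum_distrib_left algebra_simps\<close>)

text \<open>This identity fixes the sign convention of \<open>gauge\<close>: \<open>g\<close>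
  carries the operator of \<open>A\<close> to that of the transformed matrix. Several later facts
  are read off from it instead of being expanded in matrices.\<close>

lemma nabla_gauge:
  assumes g: "g \<in> carrier_mat n n" "det g \<noteq> 0" and A: "A \<in> carrier_mat n n" and v: "v \<in> carrier_vec n"
  shows "nabla \<delta> (gauge \<delta> g A) (g *\<^sub>v v) = g *\<^sub>v nabla \<delta> A v"
proof -
  note m = minv[OF g]
  have dg: "map_mat \<delta> g \<in> carrier_mat n n" using g by auto
  have inv: "minv g *\<^sub>v (g *\<^sub>v v) = v"
    using assoc_mult_mat_vec[OF m(1) g(1) v] m(3) v by simp
  have 1: "gauge \<delta> g A *\<^sub>v (g *\<^sub>v v) = (g * A * minv g) *\<^sub>v (g *\<^sub>v v) - (map_mat \<delta> g * minv g) *\<^sub>v (g *\<^sub>v v)"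
    unfolding gauge_def by (rule minus_mult_distrib_mat_vec[of _ n n]) (use g A v m dg in auto)
  have 2: "(g * A * minv g) *\<^sub>v (g *\<^sub>v v) = g *\<^sub>v (A *\<^sub>v v)"
  proof -
    have "(g * A * minv g) *\<^sub>v (g *\<^sub>v v) = (g * A) *\<^sub>v (minv g *\<^sub>v (g *\<^sub>v v))"
      by (rule assoc_mult_mat_vec[of _ n n _ n]) (use g A v m in auto)
    then show ?thesis unfolding inv using assoc_mult_mat_vec[OF g(1) A v] by simp
  qed
  have 3: "(map_mat \<delta> g * minv g) *\<^sub>v (g *\<^sub>v v) = map_mat \<delta> g *\<^sub>v v"
  proof -
    have "(map_mat \<delta> g * minv g) *\<^sub>v (g *\<^sub>v v) = map_mat \<delta> g *\<^sub>v (minv g *\<^sub>v (g *\<^sub>v v))"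
      by (rule assoc_mult_mat_vec[of _ n n _ n]) (use dg g A v m in auto)
    then show ?thesis unfolding inv .
  qed
  have "g *\<^sub>v nabla \<delta> A v = g *\<^sub>v map_vec \<delta> v + g *\<^sub>v (A *\<^sub>v v)"
    unfolding nabla_def by (rule mult_add_distrib_mat_vec[of _ n n]) (use g A v in auto)
  moreover have "nabla \<delta> (gauge \<delta> g A) (g *\<^sub>v v) =
      map_mat \<delta> g *\<^sub>v v + g *\<^sub>v map_vec \<delta> v + (g *\<^sub>v (A *\<^sub>v v) - map_mat \<delta> g *\<^sub>v v)"
    unfolding nabla_def 1 2 3 map_mult_mat_vec[OF g(1) v] ..
  moreover have "\<dots> = g *\<^sub>v map_vec \<delta> v + g *\<^sub>v (A *\<^sub>v v)"
    by (rule eq_vecI) (use g A v dg in auto)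
  ultimately show ?thesis by simp
qed

lemma nabla_pow_gauge:
  assumes "g \<in> carrier_mat n n" "det g \<noteq> 0" "A \<in> carrier_mat n n" "v \<in> carrier_vec n"
  shows "(nabla \<delta> (gauge \<delta> g A) ^^ k) (g *\<^sub>v v) = g *\<^sub>v (nabla \<delta> A ^^ k) v"
  by (induction k) (use assms in \<open>auto simp: nabla_gauge[where n = n]\<close>)

lemma gauge_eqI:
  assumes "g \<in> carrier_mat n n" "h \<in> carrier_mat n n" "g * h = 1\<^sub>m n"
  shows "gauge \<delta> g A = g * A * h - map_mat \<delta> g * h"
  by (simp add: gauge_def minv_eqI[OF assms])

text \<open>The hypothesis \<open>eq\<close> says that the columns of \<open>W\<close> form a frame
  in which the connection has matrix \<open>C\<close>. Differentiating \<open>h * W = 1\<close> for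
  the inverse \<open>h\<close> turns it into the gauge formula.\<close>

lemma gauge_frame:
  assumes W: "W \<in> carrier_mat n n" "det W \<noteq> 0" and A: "A \<in> carrier_mat n n" and C: "C \<in> carrier_mat n n"
    and eq: "map_mat \<delta> W + A * W = W * C"
  shows "gauge \<delta> (minv W) A = C"
proof -
  note m = minv[OF W]
  define h where "h = minv W"
  have h: "h \<in> carrier_mat n n" "W * h = 1\<^sub>m n" "h * W = 1\<^sub>m n" using m by (auto simp: h_def)
  have dW: "map_mat \<delta> W \<in> carrier_mat n n" and dh: "map_mat \<delta> h \<in> carrier_mat n n" using W h by auto
  have "map_mat \<delta> (1\<^sub>m n) = 0\<^sub>m n n" by (rule eq_matI) auto
  then have z: "map_mat \<delta> h * W + h * map_mat \<delta> W = 0\<^sub>m n n"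
    using map_mat_mult[OF h(1) W(1)] h by simp
  have "C = h * W * C" using h C by simp
  also have "\<dots> = h * (W * C)" by (rule assoc_mult_mat[of _ n n _ n _ n]) (use W h C in auto)
  also have "\<dots> = h * (map_mat \<delta> W) + h * (A * W)"
    unfolding eq[symmetric] by (rule mult_add_distrib_mat[of _ n n]) (use W h A in auto)
  also have "h * (A * W) = h * A * W"
    by (rule assoc_mult_mat[of _ n n _ n _ n, symmetric]) (use W h A in auto)
  also have "h * map_mat \<delta> W + h * A * W = h * A * W - map_mat \<delta> h * W"
  proof (rule eq_matI)
    fix i j assume ij: "i < dim_row (h * A * W - map_mat \<delta> h * W)" "j < dim_col (h * A * W - map_mat \<delta> h * W)"
    then have ij': "i < n" "j < n" using W h A dh by auto
    have "(map_mat \<delta> h * W) $$ (i,j) + (h * map_mat \<delta> W) $$ (i,j) = 0"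
      using arg_cong[OF z, of "\<lambda>M. M $$ (i,j)"] ij' W h dh dW by simp
    moreover have "(h * map_mat \<delta> W + h * A * W) $$ (i,j) =
      (h * map_mat \<delta> W) $$ (i,j) + (h * A * W) $$ (i,j)" using ij' W h A dW
      by (intro index_add_mat(1)) auto
    moreover have "(h * A * W - map_mat \<delta> h * W) $$ (i,j) = (h * A * W) $$ (i,j) - (map_mat \<delta> h * W) $$ (i,j)"
      using ij' W h A dh by (intro index_minus_mat(1)) auto
    ultimately show "(h * map_mat \<delta> W + h * A * W) $$ (i,j) = (h * A * W - map_mat \<delta> h * W) $$ (i,j)"
      by (simp add: add_eq_0_iff del: index_mult_mat)
  qed (use W h A dh in auto)
  also have "\<dots> = gauge \<delta> h A" by (rule gauge_eqI[symmetric]) (use h W in auto)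
  finally show ?thesis by (simp add: h_def)
qed

text \<open>The columns of the inverse of \<open>g * h\<close> are the vectors that
  \<open>g * h\<close> sends to unit vectors, and on unit vectors the operator with matrix
  \<open>C\<close> reads off the columns of \<open>C\<close>. Two applications of
  \<open>nabla_gauge\<close> show that this inverse is a frame with matrix \<open>C\<close>, and
  \<open>gauge_frame\<close> finishes.\<close>

lemma gauge_mult:
  assumes g: "g \<in> carrier_mat n n" "det g \<noteq> 0" and h: "h \<in> carrier_mat n n" "det h \<noteq> 0"
    and A: "A \<in> carrier_mat n n"
  shows "gauge \<delta> g (gauge \<delta> h A) = gauge \<delta> (g * h) A"
proof -
  define W where "W = minv (g * h)"
  have gh: "g * h \<in> carrier_mat n n" "det (g * h) \<noteq> 0" using g h det_mult[OF g(1) h(1)] by auto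
  have W: "W \<in> carrier_mat n n" "det W \<noteq> 0"
    using minv[OF gh] det_minv[OF gh] gh by (auto simp: W_def)
  let ?C = "gauge \<delta> g (gauge \<delta> h A)"
  have C: "?C \<in> carrier_mat n n" using g h A by auto
  have ghW: "g * h * W = 1\<^sub>m n" "W * (g * h) = 1\<^sub>m n" using minv[OF gh] by (auto simp: W_def)
  have "map_mat \<delta> W + A * W = W * ?C"
  proof (rule mat_col_eqI)
    fix j assume "j < dim_col (W * ?C)"
    then have j: "j < n" using C by auto
    have col: "col W j \<in> carrier_vec n" using W j by auto
    have cu: "(g * h) *\<^sub>v col W j = unit_vec n j"
      using ghW(1) j W gh by (metis col_mult2 col_one)
    have cu': "g *\<^sub>v (h *\<^sub>v col W j) = unit_vec n j"
      using assoc_mult_mat_vec[OF g(1) h(1) col] cu by simp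
    have "col ?C j = nabla \<delta> ?C (unit_vec n j)"
    proof (rule eq_vecI)
      fix i assume "i < dim_vec (nabla \<delta> ?C (unit_vec n j))"
      then have i: "i < n" using C by (simp add: nabla_def)
      have "(\<Sum>l<n. ?C $$ (i,l) * (if l = j then 1 else 0)) = ?C $$ (i,j)"
        using j by (subst sum.remove[of _ j]) auto
      then show "col ?C j $ i = nabla \<delta> ?C (unit_vec n j) $ i"
        using C i j by (simp add: index_nabla[OF i C] if_distrib cong: if_cong)
    qed (use C j in \<open>auto simp: nabla_def\<close>)
    also have "\<dots> = g *\<^sub>v (h *\<^sub>v nabla \<delta> A (col W j))"
      unfolding cu'[symmetric]
      by (subst nabla_gauge[OF g]) (use h A col in \<open>auto simp: nabla_gauge[OF h A col]\<close>)
    also have "\<dots> = (g * h) *\<^sub>v nabla \<delta> A (col W j)"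
      using assoc_mult_mat_vec[OF g(1) h(1)] A col by simp
    finally have "W *\<^sub>v col ?C j = W *\<^sub>v ((g * h) *\<^sub>v nabla \<delta> A (col W j))" by simp
    also have "\<dots> = nabla \<delta> A (col W j)"
      using assoc_mult_mat_vec[OF W(1) gh(1), of "nabla \<delta> A (col W j)"] ghW A col by simp
    finally have "W *\<^sub>v col ?C j = map_vec \<delta> (col W j) + A *\<^sub>v col W j"
      by (simp add: nabla_def)
    moreover have "col (W * ?C) j = W *\<^sub>v col ?C j" "col (A * W) j = A *\<^sub>v col W j"
      using W C A j by (auto intro!: col_mult2)
    moreover have "col (map_mat \<delta> W + A * W) j = col (map_mat \<delta> W) j + col (A * W) j"
      by (rule col_add[of _ n n]) (use W A j in auto)
    ultimately show "col (map_mat \<delta> W + A * W) j = col (W * ?C) j"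
      using W j by simp
  qed (use W C A in auto)
  from gauge_frame[OF W A C this] show ?thesis
    unfolding W_def minv_minv[OF gh] by simp
qed

section \<open>Jacobi's formula and the trace of a gauge transform\<close>

lemma det_derivation:
  assumes W: "W \<in> carrier_mat n n"
  shows "\<delta> (det W) = (\<Sum>i<n. \<Sum>j<n. \<delta> (W $$ (i,j)) * cofactor W i j)"
proof -
  \<comment> \<open>\<open>R i\<close> is \<open>W\<close> with row \<open>i\<close> differentiated.
    The product rule gives the derivative of the determinant as the sum of the
    \<open>det (R i)\<close>, and the cofactors along row \<open>i\<close> do not see that
    row.\<close>
  define R where "R i = mat n n (\<lambda>(k,l). if k = i then \<delta> (W $$ (k,l)) else W $$ (k,l))" for i
  have R: "R i \<in> carrier_mat n n" for i by (simp add: R_def)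
  have sg: "\<delta> (signof p * x) = signof p * \<delta> x" for p :: "nat \<Rightarrow> nat" and x
    by (auto simp: sign_def mult uminus)
  let ?P = "{p. p permutes {0..<n}}"
  have "\<delta> (det W) = (\<Sum>p\<in>?P. signof p * (\<Sum>i=0..<n. \<delta> (W $$ (i, p i)) * (\<Prod>k\<in>{0..<n}-{i}. W $$ (k, p k))))"
    unfolding det_def'[OF W] sum sg prod[OF finite_atLeastLessThan] ..
  also have "\<dots> = (\<Sum>p\<in>?P. \<Sum>i=0..<n. signof p * (\<Prod>k=0..<n. R i $$ (k, p k)))"
  proof (rule sum.cong)
    fix p assume "p \<in> ?P"
    then have p: "k < n \<Longrightarrow> p k < n" for k
      using permutes_in_image[of p "{0..<n}" k] by auto
    have "(\<Prod>k=0..<n. R i $$ (k, p k)) = \<delta> (W $$ (i, p i)) * (\<Prod>k\<in>{0..<n}-{i}. W $$ (k, p k))"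
      if "i < n" for i
      using that p by (subst prod.remove[of _ i]) (auto simp: R_def intro!: prod.cong)
    then show "signof p * (\<Sum>i=0..<n. \<delta> (W $$ (i, p i)) * (\<Prod>k\<in>{0..<n}-{i}. W $$ (k, p k))) =
        (\<Sum>i=0..<n. signof p * (\<Prod>k=0..<n. R i $$ (k, p k)))"
      by (simp add: sum_distrib_left)
  qed simp
  also have "\<dots> = (\<Sum>i=0..<n. det (R i))"
    unfolding det_def'[OF R] by (rule sum.swap)
  also have "\<dots> = (\<Sum>i<n. \<Sum>j<n. \<delta> (W $$ (i,j)) * cofactor W i j)"
  proof -
    have "det (R i) = (\<Sum>j<n. \<delta> (W $$ (i,j)) * cofactor W i j)" if i: "i < n" for i
    proof -
      have "cofactor (R i) i j = cofactor W i j" if "j < n" for j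
      proof -
        have "mat_delete (R i) i j = mat_delete W i j"
          by (rule eq_matI) (use W i that in \<open>auto simp: mat_delete_def R_def\<close>)
        then show ?thesis by (simp add: cofactor_def)
      qed
      then show ?thesis
        unfolding laplace_expansion_row[OF R i] using i by (auto simp: R_def intro!: sum.cong)
    qed
    then show ?thesis by (simp add: lessThan_atLeast0)
  qed
  finally show ?thesis .
qed

lemma det_derivation_trace:
  assumes W: "W \<in> carrier_mat n n" "det W \<noteq> 0"
  shows "\<delta> (det W) = det W * mtrace (map_mat \<delta> W * minv W)"
proof -
  note a = adj_mat[OF W(1)]
  have "W * (inverse (det W) \<cdot>\<^sub>m adj_mat W) = 1\<^sub>m n"
  proof -
    have "W * (inverse (det W) \<cdot>\<^sub>m adj_mat W) = inverse (det W) \<cdot>\<^sub>m (W * adj_mat W)"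
      by (rule mult_smult_distrib[of _ n n]) (use W a in auto)
    also have "\<dots> = 1\<^sub>m n" unfolding a(2) by (rule eq_matI) (use W in auto)
    finally show ?thesis .
  qed
  then have "minv W = inverse (det W) \<cdot>\<^sub>m adj_mat W" by (intro minv_eqI[of _ n]) (use W a in auto)
  then have "det W * mtrace (map_mat \<delta> W * minv W) =
      det W * (\<Sum>i<n. \<Sum>j<n. \<delta> (W $$ (i,j)) * (inverse (det W) * cofactor W i j))"
    using W a(1) by (auto simp: mtrace_def scalar_prod_def lessThan_atLeast0 adj_mat_def intro!: sum.cong)
  also have "\<dots> = (\<Sum>i<n. \<Sum>j<n. \<delta> (W $$ (i,j)) * cofactor W i j)"
    unfolding sum_distrib_left by (intro sum.cong refl) (use W in \<open>simp add: field_simps\<close>)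
  finally show ?thesis unfolding det_derivation[OF W(1)] by simp
qed

text \<open>Conjugation preserves the trace; what is left is a logarithmic derivative. At zero this
  shows that the polar leading coefficient of a gauge transform has trace zero, and globally that
  the determinant of the final frame is constant.\<close>

lemma mtrace_gauge:
  assumes g: "g \<in> carrier_mat n n" "det g \<noteq> 0" and A: "A \<in> carrier_mat n n"
  shows "mtrace (gauge \<delta> g A) = mtrace A - \<delta> (det g) / det g"
proof -
  note m = minv[OF g]
  have "mtrace (gauge \<delta> g A) = mtrace (g * A * minv g) - mtrace (map_mat \<delta> g * minv g)"
    unfolding gauge_def by (rule mtrace_minus[of _ n]) (use g A m in auto)
  also have "mtrace (g * A * minv g) = mtrace (minv g * (g * A))"
    by (rule mtrace_mult_commute[of _ n]) (use g A m in auto)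
  also have "minv g * (g * A) = minv g * g * A"
    by (rule assoc_mult_mat[of _ n n _ n _ n, symmetric]) (use g A m in auto)
  also have "\<dots> = A" using m A by simp
  finally show ?thesis unfolding det_derivation_trace[OF g] using g by simp
qed

end

section \<open>Cyclic vectors\<close>

definition cyclic_mat :: "nat \<Rightarrow> ('a::comm_ring_1 \<Rightarrow> 'a) \<Rightarrow> 'a mat \<Rightarrow> 'a vec \<Rightarrow> 'a mat" where
  "cyclic_mat n \<delta> A v = mat n n (\<lambda>(i,j). (nabla \<delta> A ^^ j) v $ i)"

lemma cyclic_mat_carrier [simp]: "cyclic_mat n \<delta> A v \<in> carrier_mat n n"
  by (simp add: cyclic_mat_def)

lemma dim_nabla [simp]: "dim_vec (nabla \<delta> A v) = dim_row A"
  by (simp add: nabla_def)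

lemma det_nonzeroI:
  assumes "(M :: 'a::field mat) \<in> carrier_mat n n"
    and "\<And>w i. w \<in> carrier_vec n \<Longrightarrow> (\<And>i. i < n \<Longrightarrow> (\<Sum>j<n. M $$ (i,j) * w $ j) = 0) \<Longrightarrow> i < n \<Longrightarrow> w $ i = 0"
  shows "det M \<noteq> 0"
proof
  assume "det M = 0"
  then obtain w where w: "w \<in> carrier_vec n" "w \<noteq> 0\<^sub>v n" "M *\<^sub>v w = 0\<^sub>v n"
    using det_0_iff_vec_prod_zero_field[OF assms(1)] by auto
  have z: "(\<Sum>j<n. M $$ (i,j) * w $ j) = 0" if "i < n" for i
    using arg_cong[OF w(3), of "\<lambda>v. v $ i"] that assms(1) w(1)
    by (simp add: index_mult_mat_vec_sum[of _ n] del: index_mult_mat_vec)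
  have "w $ i = 0" if "i < n" for i
    using assms(2)[OF w(1) z that] .
  then have "w = 0\<^sub>v n" using w(1) by (intro eq_vecI) auto
  with w show False by simp
qed

lemma det_zeroE:
  assumes "(M :: 'a::field mat) \<in> carrier_mat n n" "det M = 0"
  obtains w k where "w \<in> carrier_vec n" "k < n" "w $ k \<noteq> 0"
    "\<And>i. i < n \<Longrightarrow> (\<Sum>j<n. M $$ (i,j) * w $ j) = 0"
proof -
  obtain w where w: "w \<in> carrier_vec n" "w \<noteq> 0\<^sub>v n" "M *\<^sub>v w = 0\<^sub>v n"
    using det_0_iff_vec_prod_zero_field[OF assms(1)] assms(2) by auto
  then obtain k where "k < n" "w $ k \<noteq> 0" using eq_vecI[of w "0\<^sub>v n"] by fastforce
  moreover have "(\<Sum>j<n. M $$ (i,j) * w $ j) = 0" if "i < n" for i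
    using arg_cong[OF w(3), of "\<lambda>v. v $ i"] that assms(1) w(1)
    by (simp add: index_mult_mat_vec_sum[of _ n] del: index_mult_mat_vec)
  ultimately show thesis using that w by blast
qed

context derivation
begin

text \<open>Differentiating \<open>t ^ k\<close> times a vector amounts to applying
  \<open>nabla + k\<close> to the vector, and each application adds one degree in \<open>k\<close>.
  The coefficients are field elements, not constants; the one in degree \<open>j\<close> is what
  later contradicts a polynomial identity in \<open>k\<close>.\<close>

lemma shifted_nabla_polynomial:
  fixes u :: "'a vec" and A :: "'a mat"
  assumes A: "A \<in> carrier_mat n n" and u: "u \<in> carrier_vec n"
  shows "\<exists>q. \<forall>i<n. degree (q i) \<le> j \<and> coeff (q i) j = u $ i \<and>
     (\<forall>k::nat. poly (q i) (of_nat k) = ((\<lambda>w. nabla \<delta> A w + of_nat k \<cdot>\<^sub>v w) ^^ j) u $ i)"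
proof (induction j)
  case 0
  show ?case by (rule exI[of _ "\<lambda>i. [:u $ i:]"]) auto
next
  case (Suc j)
  then obtain q where q: "\<And>i. i < n \<Longrightarrow> degree (q i) \<le> j"
    "\<And>i. i < n \<Longrightarrow> coeff (q i) j = u $ i"
    "\<And>i k. i < n \<Longrightarrow> poly (q i) (of_nat k) = ((\<lambda>w. nabla \<delta> A w + of_nat k \<cdot>\<^sub>v w) ^^ j) u $ i"
    by blast
  \<comment> \<open>Evaluation at a natural number commutes with the derivation because natural
    numbers are constants.\<close>
  have mp: "poly (map_poly \<delta> p) (of_nat k) = \<delta> (poly p (of_nat k))" for p and k :: nat
    by (induction p) (auto simp: map_poly_pCons add mult)
  define q' where "q' i = map_poly \<delta> (q i) + (\<Sum>l<n. Polynomial.smult (A $$ (i,l)) (q l)) + pCons 0 (q i)" for i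
  show ?case
  proof (rule exI[of _ q'], intro allI impI conjI)
    fix i assume i: "i < n"
    have s: "degree (\<Sum>l<n. Polynomial.smult (A $$ (i,l)) (q l)) \<le> j"
      using q(1) by (intro degree_sum_le) (auto intro: order.trans[OF degree_smult_le])
    have m: "degree (map_poly \<delta> (q i)) \<le> j"
      by (rule degree_le) (use q(1)[OF i] in \<open>auto simp: coeff_map_poly coeff_eq_0\<close>)
    show "degree (q' i) \<le> Suc j" unfolding q'_def
      using s m q(1)[OF i] by (intro degree_add_le) (auto intro: order.trans[OF degree_pCons_le])
    show "coeff (q' i) (Suc j) = u $ i"
      using s m q(2)[OF i] by (simp add: q'_def coeff_eq_0)
    fix k :: nat
    let ?op = "\<lambda>w. nabla \<delta> A w + of_nat k \<cdot>\<^sub>v w"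
    have c: "(?op ^^ j) u \<in> carrier_vec n" by (induction j) (use A u in auto)
    have "(?op ^^ Suc j) u $ i = \<delta> ((?op ^^ j) u $ i) + (\<Sum>l<n. A $$ (i,l) * (?op ^^ j) u $ l)
       + of_nat k * (?op ^^ j) u $ i"
      using i A c nabla_closed[OF A c, of \<delta>] by (simp add: index_nabla[OF i A c])
    then show "poly (q' i) (of_nat k) = (?op ^^ Suc j) u $ i"
      using q(3) i by (simp add: q'_def poly_sum mp)
  qed
qed

lemma nabla_pow_perturbed:
  assumes A: "A \<in> carrier_mat n n" and v: "v \<in> carrier_vec n" and u: "u \<in> carrier_vec n" and t: "\<delta> t = t"
  shows "(nabla \<delta> A ^^ j) (v + (of_nat c * t ^ k) \<cdot>\<^sub>v u) =
    (nabla \<delta> A ^^ j) v + (of_nat c * t ^ k) \<cdot>\<^sub>v ((\<lambda>w. nabla \<delta> A w + of_nat k \<cdot>\<^sub>v w) ^^ j) u"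
proof (induction j)
  case (Suc j)
  let ?op = "\<lambda>w. nabla \<delta> A w + of_nat k \<cdot>\<^sub>v w"
  have c: "(?op ^^ j) u \<in> carrier_vec n" by (induction j) (use A u in auto)
  have tk: "\<delta> (t ^ k) = of_nat k * t ^ k" for k
    by (induction k) (auto simp: mult t algebra_simps)
  have "nabla \<delta> A ((of_nat c * t ^ k) \<cdot>\<^sub>v (?op ^^ j) u) = (of_nat c * t ^ k) \<cdot>\<^sub>v (?op ^^ Suc j) u"
    unfolding nabla_smult[OF A c] mult tk
    by (rule eq_vecI) (use c A nabla_closed[OF A c, of \<delta>] in \<open>auto simp: algebra_simps\<close>)
  then show ?case using Suc c A v by (simp add: nabla_add[of _ n])
qed simp

text \<open>
  If the iterates of \<open>v\<close> become dependent after \<open>r < n\<close> steps, perturb \<open>v\<close> to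
  \<open>v + c t\<^sup>k u\<close> with \<open>u\<close> outside their span.  Persistent dependence would make a determinant
  vanish to first order in \<open>c\<close>, and this first-order term is a polynomial in \<open>k\<close> of degree
  exactly \<open>r\<close>.
\<close>

lemma cyclic_step:
  fixes A :: "'a mat"
  assumes ch: "inj (of_nat :: nat \<Rightarrow> 'a)"
    and A: "A \<in> carrier_mat n n" and v: "v \<in> carrier_vec n" and t: "\<delta> t = t" "t \<noteq> 0"
    and Q: "Q \<in> carrier_mat n n" "det Q \<noteq> 0" and r: "r < n"
    and colQ: "\<And>j. j < r \<Longrightarrow> col Q j = (nabla \<delta> A ^^ j) v"
  shows "\<exists>v \<in> carrier_vec n. \<exists>Q \<in> carrier_mat n n. det Q \<noteq> 0 \<and> (\<forall>j<Suc r. col Q j = (nabla \<delta> A ^^ j) v)"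
proof (rule ccontr)
  assume neg: "\<not> ?thesis"
  define h where "h = minv Q"
  have h: "h \<in> carrier_mat n n" "Q * h = 1\<^sub>m n" "h * Q = 1\<^sub>m n"
    using minv[OF Q] by (auto simp: h_def)
  define u where "u = col Q r"
  have u: "u \<in> carrier_vec n" using Q r by (auto simp: u_def)
  have hQ: "h *\<^sub>v col Q j = unit_vec n j" if "j < n" for j
    using h Q that by (metis col_mult2 col_one)
  have D: "(nabla \<delta> A ^^ j) w \<in> carrier_vec n" if "w \<in> carrier_vec n" for j w using A that by auto
  \<comment> \<open>Coordinates of the iterates with respect to the columns of \<open>Q\<close>,
    completed by unit vectors beyond column \<open>r\<close>. If this matrix were invertible for
    some \<open>w\<close>, then \<open>Q * full w\<close> would extend the partial cyclic
    basis.\<close>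
  define full where "full w = mat n n (\<lambda>(i,j). if j > r then (if i = j then 1 else 0) else (h *\<^sub>v (nabla \<delta> A ^^ j) w) $ i)" for w
  have full: "full w \<in> carrier_mat n n" for w by (simp add: full_def)
  have det0: "det (full w) = 0" if w: "w \<in> carrier_vec n" for w
  proof (rule ccontr)
    assume "det (full w) \<noteq> 0"
    then have "det (Q * full w) \<noteq> 0" using det_mult[OF Q(1) full] Q by simp
    moreover have "col (Q * full w) j = (nabla \<delta> A ^^ j) w" if j: "j < Suc r" for j
    proof -
      have "col (full w) j = h *\<^sub>v (nabla \<delta> A ^^ j) w"
        by (rule eq_vecI) (use j r h D[OF w] in \<open>auto simp: full_def\<close>)
      moreover have "col (Q * full w) j = Q *\<^sub>v col (full w) j"
        by (rule col_mult2[of _ n n _ n]) (use Q full j r in auto)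
      ultimately show ?thesis
        using assoc_mult_mat_vec[OF Q(1) h(1) D[OF w]] h D[OF w] by simp
    qed
    ultimately have "\<exists>Q \<in> carrier_mat n n. det Q \<noteq> 0 \<and> (\<forall>j<Suc r. col Q j = (nabla \<delta> A ^^ j) w)"
      by (intro bexI[of _ "Q * full w"]) (use Q full in auto)
    with neg w show False by metis
  qed
  define x where "x = h *\<^sub>v (nabla \<delta> A ^^ r) v"
  have x: "x \<in> carrier_vec n" using h D[OF v] by (simp add: x_def)
  have fv: "full v $$ (i,j) = (if j = r then x $ i else if i = j then 1 else 0)" if "i < n" "j < n" for i j
  proof (cases "j < r")
    case True
    then show ?thesis using that hQ[of j] colQ[of j] by (simp add: full_def del: index_mult_mat_vec)
  qed (use that in \<open>auto simp: full_def x_def\<close>)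
  have split: "(\<Sum>j<n. f j) = f r + (\<Sum>j\<in>{..<n}-{r}. f j)" for f :: "nat \<Rightarrow> 'a"
    using r by (simp add: sum.remove)
  have pick: "(\<Sum>j\<in>{..<n}-{r}. (if i = j then 1 else 0) * w $ j) = (if i = r then 0 else w $ i)"
    if "i < n" for i and w :: "'a vec"
  proof -
    have "(\<Sum>j\<in>{..<n}-{r}. (if i = j then 1 else 0) * w $ j) = (\<Sum>j\<in>{..<n}-{r}. if i = j then w $ j else 0)"
      by (rule sum.cong) auto
    then show ?thesis using that by (simp add: sum.delta')
  qed
  \<comment> \<open>The unperturbed \<open>v\<close> already fails, so its \<open>r\<close>-th
    iterate has no component along column \<open>r\<close> of \<open>Q\<close>.\<close>
  have xr: "x $ r = 0"
  proof (rule ccontr)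
    assume xr: "x $ r \<noteq> 0"
    have "det (full v) \<noteq> 0"
    proof (rule det_nonzeroI[OF full])
      fix w i assume w: "w \<in> carrier_vec n" and i: "i < n"
        and z: "\<And>i. i < n \<Longrightarrow> (\<Sum>j<n. full v $$ (i,j) * w $ j) = 0"
      have "(\<Sum>j<n. full v $$ (i,j) * w $ j) = x $ i * w $ r + (if i = r then 0 else w $ i)" if "i < n" for i
        unfolding pick[OF that, symmetric] split using that r
        by (intro arg_cong2[where f = "(+)"] sum.cong) (auto simp: fv)
      then have e: "x $ i * w $ r + (if i = r then 0 else w $ i) = 0" if "i < n" for i using z that by simp
      from e[OF r] xr have "w $ r = 0" by simp
      with e[OF i] show "w $ i = 0" by (cases "i = r") auto
    qed
    with det0[OF v] show False by simp
  qed
  define Y where "Y k j = h *\<^sub>v ((\<lambda>w. nabla \<delta> A w + of_nat k \<cdot>\<^sub>v w) ^^ j) u" for k j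
  have S: "((\<lambda>w. nabla \<delta> A w + of_nat k \<cdot>\<^sub>v w) ^^ j) u \<in> carrier_vec n" for k :: nat and j
    by (induction j) (use A u in auto)
  have Y: "Y k j \<in> carrier_vec n" for k j using h S by (simp add: Y_def)
  have rel: "Y k r $ r = (\<Sum>j<r. x $ j * Y k j $ r)" for k
  proof -
    \<comment> \<open>\<open>a + c b\<close> is the matrix of the perturbed vector after row
      \<open>r\<close>, divisible by \<open>c t^k\<close> thanks to \<open>xr\<close>, has been
      divided by this factor. The division makes the first-order term visible at
      \<open>c = 0\<close>.\<close>
    define a where "a i j = (if j > r then (if i = j then 1 else 0) else if i = r then Y k j $ r
        else if j = r then x $ i else if i = j then 1 else 0)" for i j
    define b where "b i j = (if j > r \<or> i = r then 0 else t ^ k * Y k j $ i)" for i j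
    define MP where "MP = mat n n (\<lambda>(i,j). [:a i j, b i j:])"
    have MP: "MP \<in> carrier_mat n n" by (simp add: MP_def)
    have ev: "det (map_mat (\<lambda>p. poly p c) MP) = poly (det MP) c" for c
      by (rule comm_ring_hom.hom_det) (unfold_locales, auto)
    have z: "poly (det MP) (of_nat c) = 0" if c: "c > 0" for c
    proof (rule ccontr)
      assume "poly (det MP) (of_nat c) \<noteq> 0"
      then have nz: "det (map_mat (\<lambda>p. poly p (of_nat c)) MP) \<noteq> 0" by (simp add: ev)
      have c0: "of_nat c \<noteq> (0::'a)" using ch c by (metis injD less_numeral_extra(3) of_nat_0)
      define v' where "v' = v + (of_nat c * t ^ k) \<cdot>\<^sub>v u"
      have v': "v' \<in> carrier_vec n" using v u by (simp add: v'_def)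
      have hv': "h *\<^sub>v (nabla \<delta> A ^^ j) v' = h *\<^sub>v (nabla \<delta> A ^^ j) v + (of_nat c * t ^ k) \<cdot>\<^sub>v Y k j" for j
        unfolding v'_def nabla_pow_perturbed[OF A v u t(1)] Y_def
        by (subst mult_add_distrib_mat_vec[OF h(1)]) (use D[OF v] S h in \<open>auto simp: mult_mat_vec[of _ n n]\<close>)
      have "full v' $$ (i,j) = (if i = r then of_nat c * t ^ k else 1) * poly (MP $$ (i,j)) (of_nat c)"
        if ij: "i < n" "j < n" for i j
      proof (cases "j > r")
        case True
        then show ?thesis using ij by (auto simp: full_def MP_def a_def b_def)
      next
        case False
        then have "full v' $$ (i,j) = full v $$ (i,j) + of_nat c * t ^ k * Y k j $ i"
          using ij hv' Y[of k j] h D[OF v] by (simp add: full_def del: index_mult_mat_vec)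
        then show ?thesis using False ij xr r
          by (auto simp: fv MP_def a_def b_def)
      qed
      note fv' = this
      have "det (full v') \<noteq> 0"
      proof (rule det_nonzeroI[OF full])
        fix w i assume w: "w \<in> carrier_vec n" and i: "i < n"
          and z: "\<And>i. i < n \<Longrightarrow> (\<Sum>j<n. full v' $$ (i,j) * w $ j) = 0"
        have "(\<Sum>j<n. map_mat (\<lambda>p. poly p (of_nat c)) MP $$ (i,j) * w $ j) = 0" if i: "i < n" for i
        proof -
          have "(if i = r then of_nat c * t ^ k else 1) * (\<Sum>j<n. map_mat (\<lambda>p. poly p (of_nat c)) MP $$ (i,j) * w $ j)
            = (\<Sum>j<n. full v' $$ (i,j) * w $ j)"
            unfolding sum_distrib_left using i MP by (intro sum.cong) (auto simp: fv')
          with z[OF i] c0 t show ?thesis by (simp split: if_splits)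
        qed
        then have "map_mat (\<lambda>p. poly p (of_nat c)) MP *\<^sub>v w = 0\<^sub>v n"
          using w MP by (intro eq_vecI) (auto simp: index_mult_mat_vec_sum[of _ n] simp del: index_mult_mat_vec)
        then have "w = 0\<^sub>v n"
          using nz det_0_iff_vec_prod_zero_field[of "map_mat (\<lambda>p. poly p (of_nat c)) MP" n] MP w by auto
        then show "w $ i = 0" using i by simp
      qed
      with det0[OF v'] show False by simp
    qed
    have "det MP = 0"
    proof (rule ccontr)
      assume "det MP \<noteq> 0"
      then have "finite {y. poly (det MP) y = 0}" by (rule poly_roots_finite)
      moreover have "of_nat ` {0<..} \<subseteq> {y. poly (det MP) y = 0}" using z by auto
      ultimately have "finite (of_nat ` {0::nat<..} :: 'a set)" by (rule rev_finite_subset)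
      then have "finite {0::nat<..}" using ch by (metis finite_imageD inj_on_subset subset_UNIV)
      then show False by (simp add: infinite_Ioi)
    qed
    then have "det (map_mat (\<lambda>p. poly p 0) MP) = 0" by (simp add: ev)
    moreover have "map_mat (\<lambda>p. poly p 0) MP = mat n n (\<lambda>(i,j). a i j)"
      by (rule eq_matI) (auto simp: MP_def)
    ultimately obtain w m where w: "w \<in> carrier_vec n" "m < n" "w $ m \<noteq> 0"
      "\<And>i. i < n \<Longrightarrow> (\<Sum>j<n. mat n n (\<lambda>(i,j). a i j) $$ (i,j) * w $ j) = 0"
      by (metis det_zeroE mat_carrier)
    \<comment> \<open>At \<open>c = 0\<close> all rows but the \<open>r\<close>-th are those of
      \<open>full v\<close>. They determine the kernel vector up to its \<open>r\<close>-th entry,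
      and row \<open>r\<close> then gives the relation.\<close>
    have e: "x $ i * w $ r + w $ i = 0" if i: "i < n" "i \<noteq> r" for i
    proof -
      have "(\<Sum>j<n. mat n n (\<lambda>(i,j). a i j) $$ (i,j) * w $ j) = x $ i * w $ r + w $ i"
      proof -
        have "(\<Sum>j\<in>{..<n}-{r}. mat n n (\<lambda>(i,j). a i j) $$ (i,j) * w $ j)
            = (\<Sum>j\<in>{..<n}-{r}. (if i = j then 1 else 0) * w $ j)"
          by (rule sum.cong) (use i in \<open>auto simp: a_def\<close>)
        then show ?thesis unfolding split using i r pick[OF i(1), of w] by (simp add: a_def)
      qed
      then show ?thesis using w(4)[OF i(1)] by simp
    qed
    have wr: "w $ r \<noteq> 0"
    proof
      assume "w $ r = 0" then have "w $ m = 0" using e[OF w(2)] by (cases "m = r") auto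
      with w show False by simp
    qed
    have "(\<Sum>j<n. mat n n (\<lambda>(i,j). a i j) $$ (r,j) * w $ j) = Y k r $ r * w $ r + (\<Sum>j<r. Y k j $ r * w $ j)"
      unfolding split using r
      by (intro arg_cong2[where f = "(+)"] sum.mono_neutral_cong_right) (auto simp: a_def)
    also have "(\<Sum>j<r. Y k j $ r * w $ j) = (\<Sum>j<r. Y k j $ r * (- (x $ j * w $ r)))"
    proof (intro sum.cong refl)
      fix j assume "j \<in> {..<r}"
      then have "w $ j = - (x $ j * w $ r)" using e[of j] r by (simp add: eq_neg_iff_add_eq_0 add.commute)
      then show "Y k j $ r * w $ j = Y k j $ r * (- (x $ j * w $ r))" by simp
    qed
    also have "\<dots> = - (\<Sum>j<r. x $ j * Y k j $ r) * w $ r"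
      by (simp add: sum_distrib_left sum_distrib_right sum_negf mult_ac)
    finally show ?thesis using w(4)[OF r] wr by (simp add: left_diff_distrib[symmetric])
  qed
  have "\<forall>j. \<exists>q. degree q \<le> j \<and> coeff q j = 1 \<and> (\<forall>k. poly q (of_nat k) = Y k j $ r)"
  proof
    fix j
    obtain q where q: "\<And>i. i < n \<Longrightarrow> degree (q i) \<le> j"
      "\<And>i. i < n \<Longrightarrow> coeff (q i) j = u $ i"
      "\<And>i k. i < n \<Longrightarrow> poly (q i) (of_nat k) = ((\<lambda>w. nabla \<delta> A w + of_nat k \<cdot>\<^sub>v w) ^^ j) u $ i"
      using shifted_nabla_polynomial[OF A u, of j] by blast
    let ?q = "\<Sum>l<n. Polynomial.smult (h $$ (r,l)) (q l)"
    have "(\<Sum>l<n. h $$ (r,l) * u $ l) = (h *\<^sub>v u) $ r"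
      using h u r by (simp add: index_mult_mat_vec_sum[of _ n] del: index_mult_mat_vec)
    also have "\<dots> = 1" using hQ[OF r] r by (simp add: u_def)
    finally have "coeff ?q j = 1" using q(2) by (simp add: coeff_sum)
    moreover have "degree ?q \<le> j"
      using q(1) by (intro degree_sum_le) (auto intro: order.trans[OF degree_smult_le])
    moreover have "poly ?q (of_nat k) = Y k j $ r" for k
      unfolding Y_def using q(3) r h S by (simp add: poly_sum index_mult_mat_vec_sum[of _ n] del: index_mult_mat_vec)
    ultimately show "\<exists>q. degree q \<le> j \<and> coeff q j = 1 \<and> (\<forall>k. poly q (of_nat k) = Y k j $ r)" by blast
  qed
  then obtain q where q: "\<And>j. degree (q j) \<le> j" "\<And>j. coeff (q j) j = 1"
      "\<And>j k. poly (q j) (of_nat k) = Y k j $ r" by metis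
  \<comment> \<open>The coefficient \<open>1\<close> in degree \<open>r\<close> comes from
    \<open>q r\<close> alone, while \<open>rel\<close> makes \<open>p\<close> vanish at every
    natural number.\<close>
  define p where "p = q r - (\<Sum>j<r. Polynomial.smult (x $ j) (q j))"
  have "coeff (q j) r = 0" if "j < r" for j using q(1)[of j] that by (simp add: coeff_eq_0)
  then have "coeff p r = 1" by (simp add: p_def coeff_sum q)
  then have "p \<noteq> 0" by auto
  then have "finite {y. poly p y = 0}" by (rule poly_roots_finite)
  moreover have "range of_nat \<subseteq> {y. poly p y = 0}"
    using rel by (auto simp: p_def poly_sum q)
  ultimately have "finite (range (of_nat :: nat \<Rightarrow> 'a))" by (rule rev_finite_subset)
  then show False using ch finite_imageD infinite_UNIV_nat by blast
qed

theorem cyclic_vector: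
  fixes A :: "'a mat"
  assumes ch: "inj (of_nat :: nat \<Rightarrow> 'a)"
    and A: "A \<in> carrier_mat n n" and t: "\<delta> t = t" "t \<noteq> 0"
  shows "\<exists>v \<in> carrier_vec n. det (cyclic_mat n \<delta> A v) \<noteq> 0"
proof -
  have "\<exists>v \<in> carrier_vec n. \<exists>Q \<in> carrier_mat n n. det Q \<noteq> 0 \<and> (\<forall>j<r. col Q j = (nabla \<delta> A ^^ j) v)"
    if "r \<le> n" for r
    using that
  proof (induction r)
    case 0
    show ?case by (rule bexI[of _ "0\<^sub>v n"], rule bexI[of _ "1\<^sub>m n"]) auto
  next
    case (Suc r)
    then show ?case using cyclic_step[OF ch A _ t, of _ _ r] by (metis Suc_leD Suc_le_eq)
  qed
  from this[of n] obtain v Q where v: "v \<in> carrier_vec n" and Q: "Q \<in> carrier_mat n n" "det Q \<noteq> 0"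
    and col: "\<And>j. j < n \<Longrightarrow> col Q j = (nabla \<delta> A ^^ j) v" by auto
  have "Q = cyclic_mat n \<delta> A v"
  proof (rule eq_matI)
    fix i j assume "i < dim_row (cyclic_mat n \<delta> A v)" "j < dim_col (cyclic_mat n \<delta> A v)"
    then show "Q $$ (i,j) = cyclic_mat n \<delta> A v $$ (i,j)"
      using col[of j] Q by (auto simp: cyclic_mat_def) (metis carrier_matD index_col)
  qed (use Q in \<open>auto simp: cyclic_mat_def\<close>)
  with v Q show ?thesis by blast
qed

end

section \<open>Orders of Laurent series\<close>

text \<open>\<open>fls_ge N q f\<close> says that \<open>f\<close> has order at least \<open>q / N\<close>.\<close>

definition fls_ge :: "nat \<Rightarrow> int \<Rightarrow> 'a::zero fls \<Rightarrow> bool" where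
  "fls_ge N q f \<longleftrightarrow> (\<forall>m. int N * m < q \<longrightarrow> fls_nth f m = 0)"

lemma fls_ge_0 [simp]: "fls_ge N q 0"
  by (simp add: fls_ge_def)

lemma fls_ge_add: "fls_ge N q f \<Longrightarrow> fls_ge N q g \<Longrightarrow> fls_ge N q (f + g :: 'a::monoid_add fls)"
  by (simp add: fls_ge_def)

lemma fls_ge_diff: "fls_ge N q f \<Longrightarrow> fls_ge N q g \<Longrightarrow> fls_ge N q (f - g :: 'a::group_add fls)"
  by (simp add: fls_ge_def)

lemma fls_ge_uminus: "fls_ge N q f \<Longrightarrow> fls_ge N q (- f :: 'a::group_add fls)"
  by (simp add: fls_ge_def)

lemma fls_ge_sum: "(\<And>x. x \<in> S \<Longrightarrow> fls_ge N q (f x)) \<Longrightarrow> fls_ge N q (\<Sum>x\<in>S. f x :: 'a::comm_monoid_add fls)"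
  by (induction S rule: infinite_finite_induct) (auto intro: fls_ge_add)

lemma fls_ge_mono: "fls_ge N q f \<Longrightarrow> q' \<le> q \<Longrightarrow> fls_ge N q' f"
  by (auto simp: fls_ge_def)

lemma fls_ge_mult:
  fixes f g :: "'a::field fls"
  assumes "N > 0" "fls_ge N q f" "fls_ge N r g"
  shows "fls_ge N (q + r) (f * g)"
proof (cases "f = 0 \<or> g = 0")
  case False
  then have "int N * fls_subdegree f \<ge> q" "int N * fls_subdegree g \<ge> r"
    using assms(2,3) nth_fls_subdegree_nonzero unfolding fls_ge_def by (metis linorder_not_le)+
  then have *: "int N * fls_subdegree (f * g) \<ge> q + r"
    using False by (simp add: algebra_simps)
  show ?thesis unfolding fls_ge_def
  proof (intro allI impI)
    fix m assume "int N * m < q + r"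
    then have "int N * m < int N * fls_subdegree (f * g)" using * by simp
    then show "fls_nth (f * g) m = 0" using assms(1) by (intro fls_eq0_below_subdegree) simp
  qed
qed auto

lemma fls_ge_1_0: "fls_ge N 0 (1 :: 'a::field fls)"
  by (auto simp: fls_ge_def)

lemma fls_ge_const: "fls_ge N 0 (fls_const c)"
  by (auto simp: fls_ge_def)

lemma fls_ge_of_nat: "fls_ge N 0 (of_nat k :: 'a::field fls)"
  by (auto simp: fls_ge_def fls_of_nat_nth)

lemma fls_ge_prod:
  fixes f :: "'b \<Rightarrow> 'a::field fls"
  assumes "N > 0" "\<And>x. x \<in> S \<Longrightarrow> fls_ge N (q x) (f x)"
  shows "fls_ge N (\<Sum>x\<in>S. q x) (\<Prod>x\<in>S. f x)"
  using assms(2) by (induction S rule: infinite_finite_induct) (auto intro: fls_ge_mult[OF assms(1)] fls_ge_1_0)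

text \<open>Row weights \<open>e\<close> and column weights \<open>f\<close> contribute the same
  total to every term of the Leibniz expansion.\<close>

lemma fls_ge_det:
  fixes M :: "'a::field fls mat"
  assumes N: "N > 0" and M: "M \<in> carrier_mat n n"
    and ge: "\<And>i j. i < n \<Longrightarrow> j < n \<Longrightarrow> fls_ge N (e i + f j) (M $$ (i,j))"
  shows "fls_ge N ((\<Sum>i<n. e i) + (\<Sum>j<n. f j)) (det M)"
  unfolding det_def'[OF M]
proof (rule fls_ge_sum)
  fix p assume "p \<in> {p. p permutes {0..<n}}"
  then have p: "p permutes {0..<n}" by simp
  have "(\<Sum>i=0..<n. f (p i)) = (\<Sum>j=0..<n. f j)"
    using sum.permute[OF p, of f] by (simp add: o_def)
  then have eq: "(\<Sum>i=0..<n. e i + f (p i)) = (\<Sum>i<n. e i) + (\<Sum>j<n. f j)"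
    by (simp add: sum.distrib lessThan_atLeast0)
  have "fls_ge N (\<Sum>i=0..<n. e i + f (p i)) (\<Prod>i=0..<n. M $$ (i, p i))"
    using permutes_in_image[OF p] by (intro fls_ge_prod N ge) auto
  then have "fls_ge N ((\<Sum>i<n. e i) + (\<Sum>j<n. f j)) (\<Prod>i=0..<n. M $$ (i, p i))"
    by (simp only: eq)
  then show "fls_ge N ((\<Sum>i<n. e i) + (\<Sum>j<n. f j)) (signof p * (\<Prod>i=0..<n. M $$ (i, p i)))"
    by (auto simp: sign_def fls_ge_uminus)
qed

lemma fls_ge_exists: "N > 0 \<Longrightarrow> \<exists>c::nat. fls_ge N (- int c) (f :: 'a::zero fls)"
proof (rule exI[of _ "N * nat \<bar>fls_subdegree f\<bar>"])
  assume N: "N > 0"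
  show "fls_ge N (- int (N * nat \<bar>fls_subdegree f\<bar>)) f"
    unfolding fls_ge_def
  proof (intro allI impI)
    fix m assume "int N * m < - int (N * nat \<bar>fls_subdegree f\<bar>)"
    then have "int N * m < int N * (- \<bar>fls_subdegree f\<bar>)" by simp
    then have "m < - \<bar>fls_subdegree f\<bar>"
      using N by (subst (asm) mult_less_cancel_left_pos) auto
    then show "fls_nth f m = 0" by (intro fls_eq0_below_subdegree) simp
  qed
qed

lemma fls_ge_exists_uniform:
  assumes "N > 0" "finite S"
  shows "\<exists>c::nat. \<forall>x\<in>S. fls_ge N (- int c) (f x :: 'a::zero fls)"
  using assms(2)
proof (induction S)
  case (insert a S)
  then obtain c where c: "\<And>x. x \<in> S \<Longrightarrow> fls_ge N (- int c) (f x)" by auto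
  obtain d where d: "fls_ge N (- int d) (f a)" using fls_ge_exists[OF assms(1)] by blast
  have "\<forall>x\<in>insert a S. fls_ge N (- int (max c d)) (f x)"
  proof
    fix x assume "x \<in> insert a S"
    then show "fls_ge N (- int (max c d)) (f x)"
      using fls_ge_mono[OF c, of x] fls_ge_mono[OF d] by auto
  qed
  then show ?case by blast
qed simp

lemma fls_ge_det_exists:
  assumes "(M :: 'a::zero fls mat) \<in> carrier_mat n m"
  shows "\<exists>c::nat. \<forall>i<n. \<forall>j<m. fls_ge 1 (- int c) (M $$ (i,j))"
  using fls_ge_exists_uniform[of 1 "{..<n} \<times> {..<m}" "\<lambda>(i,j). M $$ (i,j)"] by auto

lemma fls_ge_vec_exists:
  "\<exists>c::nat. \<forall>i<n. fls_ge 1 (- int c) ((v :: 'a::zero fls vec) $ i)"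
  using fls_ge_exists_uniform[of 1 "{..<n}" "\<lambda>i. v $ i"] by auto

lemma fls_ge_compose_power:
  assumes "b > 0" "s > 0" "fls_ge s q f"
  shows "fls_ge 1 (int b * q) (fls_compose_power f (b * s))"
  unfolding fls_ge_def
proof (intro allI impI)
  fix m assume m: "int 1 * m < int b * q"
  show "fls_nth (fls_compose_power f (b * s)) m = 0"
  proof (cases "int (b * s) dvd m")
    case True
    then obtain l where l: "m = int (b * s) * l" by auto
    then have "int b * (int s * l) < int b * q" using m by (simp add: mult.assoc)
    then have "int s * l < q" using assms(1) by simp
    then have "fls_nth f l = 0" using assms(3) by (auto simp: fls_ge_def)
    moreover have "m div int (b * s) = l" using l assms by simp
    ultimately show ?thesis using assms by (simp add: fls_nth_compose_power del: of_nat_mult)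
  next
    case False
    then show ?thesis using assms by (simp add: fls_nth_compose_power del: of_nat_mult)
  qed
qed

lemma fls_nth_mult_leading:
  fixes f g :: "'a::field fls"
  assumes f: "fls_ge 1 q f" and g: "fls_ge 1 r g"
  shows "fls_nth (f * g) (q + r) = fls_nth f q * fls_nth g r"
proof -
  define f' where "f' = f - fls_shift (-q) (fls_const (fls_nth f q))"
  have f': "fls_ge 1 (q + 1) f'" using f unfolding fls_ge_def f'_def by auto
  have "f * g = fls_shift (-q) (fls_const (fls_nth f q)) * g + f' * g"
    by (simp add: f'_def algebra_simps)
  moreover have "fls_ge 1 (q + 1 + r) (f' * g)" by (rule fls_ge_mult[OF _ f' g]) simp
  then have "fls_nth (f' * g) (q + r) = 0" by (auto simp: fls_ge_def)
  moreover have "fls_nth (fls_shift (-q) (fls_const (fls_nth f q)) * g) (q + r) = fls_nth f q * fls_nth g r"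
    by (simp add: fls_shifted_times_simps)
  ultimately show ?thesis by simp
qed

section \<open>The Euler derivation on Laurent series and ramified pullback\<close>

lemma fls_theta_nth [simp]: "fls_nth (fls_theta f) m = of_int m * fls_nth f m"
  by (simp add: fls_theta_def fls_X_times_conv_shift)

lemma fls_ge_theta: "fls_ge N q f \<Longrightarrow> fls_ge N q (fls_theta f)"
  by (simp add: fls_ge_def)

interpretation fls_theta: derivation fls_theta
proof
  fix f g :: "complex fls"
  show "fls_theta (f + g) = fls_theta f + fls_theta g"
    by (simp add: fls_theta_def algebra_simps)
  show "fls_theta (f * g) = fls_theta f * g + f * fls_theta g"
    by (simp add: fls_theta_def algebra_simps)
qed

lemma fls_theta_X: "fls_theta fls_X = fls_X"
  by (simp add: fls_theta_def)

lemma fls_theta_const [simp]: "fls_theta (fls_const c) = 0"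
  by (simp add: fls_theta_def)

lemma fls_theta_X_intpow: "fls_theta (fls_X_intpow k) = of_int k * fls_X_intpow k"
  by (rule fls_eqI) (auto simp: fls_of_int fls_shifted_times_simps)

lemma fls_theta_compose_power:
  "b > 0 \<Longrightarrow> fls_theta (fls_compose_power f b) = of_nat b * fls_compose_power (fls_theta f) b"
proof (rule fls_eqI)
  fix m assume b: "b > 0"
  show "fls_nth (fls_theta (fls_compose_power f b)) m = fls_nth (of_nat b * fls_compose_power (fls_theta f) b) m"
    using b by (auto simp: fls_nth_compose_power fls_of_nat_nth fls_of_nat[symmetric] elim!: dvdE)
qed

lemma fls_const_hom: "comm_ring_hom (fls_const :: complex \<Rightarrow> complex fls)"
  by unfold_locales (auto simp: fls_plus_const fls_const_mult_const)

lemma fls_compose_power_hom: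
  assumes "b > 0" shows "comm_ring_hom (\<lambda>f :: complex fls. fls_compose_power f b)"
  by unfold_locales (use assms in auto)

declare One_nat_def [simp del]

section \<open>The adjoint representation in coordinates\<close>

definition sl_vec :: "nat \<Rightarrow> 'a::comm_ring_1 mat \<Rightarrow> 'a vec" where
  "sl_vec n X = vec (n\<^sup>2 - 1) (\<lambda>k. X $$ (k div n, k mod n))"

text \<open>The last diagonal entry is not among the \<open>n^2 - 1\<close> coordinates; it is
  recovered from the trace condition.\<close>

definition sl_of_vec :: "nat \<Rightarrow> 'a::comm_ring_1 vec \<Rightarrow> 'a mat" where
  "sl_of_vec n w = mat n n (\<lambda>(i,j). if i = n - 1 \<and> j = n - 1 then - (\<Sum>a<n-1. w $ (a * n + a)) else w $ (i * n + j))"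

lemma sl_vec_carrier [simp]: "sl_vec n X \<in> carrier_vec (n\<^sup>2 - 1)"
  by (simp add: sl_vec_def)

lemma sl_index:
  fixes n k :: nat
  assumes "n \<ge> 1" "k < n\<^sup>2 - 1"
  shows "k div n < n" "k mod n < n" "\<not> (k div n = n - 1 \<and> k mod n = n - 1)"
proof -
  have k: "k < n * n" using assms by (simp add: power2_eq_square)
  then show "k div n < n" by (simp add: less_mult_imp_div_less)
  show "k mod n < n" using assms by simp
  show "\<not> (k div n = n - 1 \<and> k mod n = n - 1)"
  proof
    assume *: "k div n = n - 1 \<and> k mod n = n - 1"
    have "k = k div n * n + k mod n" by simp
    also have "\<dots> = (n - 1) * n + (n - 1)" using * by simp
    also have "\<dots> = n\<^sup>2 - 1" using assms(1) by (simp add: power2_eq_square diff_mult_distrib)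
    finally show False using assms by simp
  qed
qed

lemma sl_index_less:
  fixes n i j :: nat
  assumes "i < n" "j < n" "\<not> (i = n - 1 \<and> j = n - 1)"
  shows "i * n + j < n\<^sup>2 - 1"
proof -
  have "i * n + j < n * n - 1"
  proof (cases "i = n - 1")
    case True
    then have "j < n - 1" using assms by auto
    then have "i * n + j < (n - 1) * n + (n - 1)" using True by simp
    also have "\<dots> = n * n - 1" using assms by (simp add: diff_mult_distrib)
    finally show ?thesis .
  next
    case False
    then have "i + 1 \<le> n - 1" using assms by simp
    then have "(i + 1) * n \<le> (n - 1) * n" by (rule mult_right_mono) simp
    then have "i * n + j < (n - 1) * n" using assms(2) by (simp add: algebra_simps)
    also have "\<dots> \<le> n * n - 1" using assms by (simp add: diff_mult_distrib)
    finally show ?thesis .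
  qed
  then show ?thesis by (simp add: power2_eq_square)
qed

lemma sl_mats_UNIV: "X \<in> sl_mats n UNIV \<longleftrightarrow> X \<in> carrier_mat n n \<and> mtrace X = 0"
  by (auto simp: sl_mats_def mtrace_def)

lemma sl_of_vec_carrier [simp]: "sl_of_vec n w \<in> carrier_mat n n"
  by (simp add: sl_of_vec_def)

lemma sl_of_vec_sl: "n \<ge> 1 \<Longrightarrow> sl_of_vec n w \<in> sl_mats n UNIV"
proof -
  assume n: "n \<ge> 1"
  then obtain m where m: "n = Suc m" by (cases n) auto
  show ?thesis unfolding sl_mats_UNIV by (auto simp: mtrace_def sl_of_vec_def m)
qed

lemma sl_vec_of_vec:
  assumes "n \<ge> 1" "w \<in> carrier_vec (n\<^sup>2 - 1)" shows "sl_vec n (sl_of_vec n w) = w"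
proof (rule eq_vecI)
  fix k assume "k < dim_vec w"
  then have k: "k < n\<^sup>2 - 1" using assms by simp
  show "sl_vec n (sl_of_vec n w) $ k = w $ k"
    using sl_index[OF assms(1) k] k by (auto simp: sl_vec_def sl_of_vec_def)
qed (use assms in \<open>auto simp: sl_vec_def\<close>)

text \<open>Only the last diagonal position needs an argument: there the diagonal basis vectors
  contribute with sign \<open>-1\<close>, and the vanishing trace turns their sum into the
  entry.\<close>

lemma sum_sl_basis:
  assumes n: "n \<ge> 1" and X: "X \<in> sl_mats n UNIV" and ij: "i < n" "j < n"
  shows "(\<Sum>l<n\<^sup>2 - 1. sl_basis n l $$ (i,j) * X $$ (l div n, l mod n)) = X $$ (i,j)"
proof (cases "i = n - 1 \<and> j = n - 1")
  case False
  have "(\<Sum>l<n\<^sup>2 - 1. sl_basis n l $$ (i,j) * X $$ (l div n, l mod n)) =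
        (\<Sum>l<n\<^sup>2 - 1. if l = i * n + j then X $$ (i,j) else 0)"
  proof (intro sum.cong refl)
    fix l assume "l \<in> {..<n\<^sup>2 - 1}"
    have "i = l div n \<and> j = l mod n \<longleftrightarrow> l = i * n + j"
      using ij by (auto simp: mult.commute)
    then show "sl_basis n l $$ (i,j) * X $$ (l div n, l mod n) = (if l = i * n + j then X $$ (i,j) else 0)"
      using ij False by (auto simp: sl_basis_def)
  qed
  then show ?thesis using sl_index_less[OF ij False] by simp
next
  case True
  define S where "S = (\<lambda>a. a * n + a) ` {..<n - 1}"
  have inj: "inj_on (\<lambda>a. a * n + a) {..<n - 1}"
  proof (rule inj_onI)
    fix a b assume "a \<in> {..<n - 1}" "b \<in> {..<n - 1}" and e: "a * n + a = b * n + b"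
    have "a * (n + 1) = b * (n + 1)" using e by (simp add: algebra_simps)
    then show "a = b" by (simp only: mult_cancel2) simp
  qed
  have S: "S \<subseteq> {..<n\<^sup>2 - 1}"
    unfolding S_def using sl_index_less by auto
  have dm: "(a * n + a) div n = a" "(a * n + a) mod n = a" if "a < n" for a
    using that by auto
  have "(\<Sum>l<n\<^sup>2 - 1. sl_basis n l $$ (i,j) * X $$ (l div n, l mod n)) =
        (\<Sum>l\<in>S. - X $$ (l div n, l mod n))"
  proof (rule sum.mono_neutral_cong_right)
    show "\<forall>l\<in>{..<n\<^sup>2 - 1} - S. sl_basis n l $$ (i,j) * X $$ (l div n, l mod n) = 0"
    proof
      fix l assume l: "l \<in> {..<n\<^sup>2 - 1} - S"
      have "l div n \<noteq> l mod n"
      proof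
        assume eq: "l div n = l mod n"
        have "l = (l div n) * n + l mod n" by simp
        then have "l = (l div n) * n + l div n" by (simp only: eq)
        moreover have "l div n < n - 1" using sl_index[OF n, of l] l eq by force
        ultimately have "l \<in> S" unfolding S_def by blast
        with l show False by simp
      qed
      then show "sl_basis n l $$ (i,j) * X $$ (l div n, l mod n) = 0"
        using True ij sl_index[OF n, of l] l by (auto simp: sl_basis_def)
    qed
    fix l assume "l \<in> S"
    then obtain a where a: "l = a * n + a" "a < n - 1" by (auto simp: S_def)
    then have "l div n = a" "l mod n = a" using dm[of a] by auto
    then show "sl_basis n l $$ (i,j) * X $$ (l div n, l mod n) = - X $$ (l div n, l mod n)"
      using True ij a by (auto simp: sl_basis_def)
  qed (use S in auto)
  also have "\<dots> = (\<Sum>a<n - 1. - X $$ (a,a))"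
    unfolding S_def sum.reindex[OF inj] using dm by (auto intro!: sum.cong)
  also have "\<dots> = X $$ (n - 1, n - 1)"
  proof -
    obtain m where m: "n = Suc m" using n by (cases n) auto
    have "(\<Sum>a<Suc m. X $$ (a,a)) = 0" using X by (auto simp: sl_mats_def m)
    then show ?thesis by (simp add: m sum_negf eq_neg_iff_add_eq_0 add.commute neg_eq_iff_add_eq_0)
  qed
  finally show ?thesis using True by simp
qed

lemma sl_operator_carrier [simp]: "sl_operator n F \<in> carrier_mat (n\<^sup>2 - 1) (n\<^sup>2 - 1)"
  by (simp add: sl_operator_def)

lemma sl_basis_carrier [simp]: "sl_basis n k \<in> carrier_mat n n"
  by (simp add: sl_basis_def)

text \<open>Linearity of \<open>F\<close> is expressed by coefficients \<open>c\<close> of its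
  entries, so that one computation serves both \<open>ad\<close> and \<open>Ad\<close>.\<close>

lemma sl_operator_apply:
  assumes n: "n \<ge> 1" and X: "X \<in> sl_mats n UNIV"
    and F: "\<And>X a b. X \<in> carrier_mat n n \<Longrightarrow> a < n \<Longrightarrow> b < n \<Longrightarrow>
      F X $$ (a,b) = (\<Sum>i<n. \<Sum>j<n. c a b i j * X $$ (i,j))"
  shows "sl_operator n F *\<^sub>v sl_vec n X = sl_vec n (F X)"
proof (rule eq_vecI)
  let ?m = "n\<^sup>2 - 1"
  fix k assume "k < dim_vec (sl_vec n (F X))"
  then have k: "k < ?m" by (simp add: sl_vec_def)
  note ki = sl_index[OF n k]
  have Xc: "X \<in> carrier_mat n n" using X by (simp add: sl_mats_UNIV)
  let ?c = "c (k div n) (k mod n)"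
  have "(sl_operator n F *\<^sub>v sl_vec n X) $ k =
      (\<Sum>l<?m. sl_operator n F $$ (k,l) * sl_vec n X $ l)"
    by (rule index_mult_mat_vec_sum) (use k in auto)
  also have "\<dots> = (\<Sum>l<?m. (\<Sum>i<n. \<Sum>j<n. ?c i j * sl_basis n l $$ (i,j)) * X $$ (l div n, l mod n))"
    using k ki by (intro sum.cong refl) (auto simp: sl_operator_def sl_vec_def F)
  also have "\<dots> = (\<Sum>l<?m. \<Sum>i<n. \<Sum>j<n. ?c i j * (sl_basis n l $$ (i,j) * X $$ (l div n, l mod n)))"
    by (simp add: sum_distrib_right mult.assoc)
  also have "\<dots> = (\<Sum>i<n. \<Sum>l<?m. \<Sum>j<n. ?c i j * (sl_basis n l $$ (i,j) * X $$ (l div n, l mod n)))"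
    by (rule sum.swap)
  also have "\<dots> = (\<Sum>i<n. \<Sum>j<n. \<Sum>l<?m. ?c i j * (sl_basis n l $$ (i,j) * X $$ (l div n, l mod n)))"
    by (intro sum.cong refl sum.swap)
  also have "\<dots> = (\<Sum>i<n. \<Sum>j<n. ?c i j * X $$ (i,j))"
    unfolding sum_distrib_left[symmetric] by (intro sum.cong refl) (simp add: sum_sl_basis[OF n X])
  also have "\<dots> = sl_vec n (F X) $ k" using k ki Xc by (simp add: sl_vec_def F)
  finally show "(sl_operator n F *\<^sub>v sl_vec n X) $ k = sl_vec n (F X) $ k" .
qed (simp add: sl_vec_def sl_operator_def)

lemma ad_mat_apply:
  assumes n: "n \<ge> 1" and X: "X \<in> sl_mats n UNIV" and A: "A \<in> carrier_mat n n"
  shows "ad_mat n A *\<^sub>v sl_vec n X = sl_vec n (A * X - X * A)"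
  unfolding ad_mat_def
proof (rule sl_operator_apply[OF n X])
  fix X :: "'a mat" and a b assume X: "X \<in> carrier_mat n n" and ab: "a < n" "b < n"
  let ?c = "\<lambda>i j. (if j = b then A $$ (a,i) else 0) - (if i = a then A $$ (j,b) else 0)"
  have "(\<Sum>i<n. \<Sum>j<n. ?c i j * X $$ (i,j)) =
     (\<Sum>i<n. \<Sum>j<n. if j = b then A $$ (a,i) * X $$ (i,j) else 0) - (\<Sum>i<n. \<Sum>j<n. if i = a then A $$ (j,b) * X $$ (i,j) else 0)"
    unfolding sum_subtractf[symmetric] by (intro sum.cong refl) (auto simp: algebra_simps)
  also have "(\<Sum>i<n. \<Sum>j<n. if j = b then A $$ (a,i) * X $$ (i,j) else 0) = (\<Sum>i<n. A $$ (a,i) * X $$ (i,b))"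
    using ab by (intro sum.cong refl) simp
  also have "(\<Sum>i<n. \<Sum>j<n. if i = a then A $$ (j,b) * X $$ (i,j) else 0) = (\<Sum>j<n. A $$ (j,b) * X $$ (a,j))"
    using ab by (subst sum.swap) (intro sum.cong refl, simp)
  finally show "(A * X - X * A) $$ (a,b) = (\<Sum>i<n. \<Sum>j<n. ?c i j * X $$ (i,j))"
    using X A ab by (simp add: index_mult_mat_sum[of _ n _ n _ n] mult.commute del: index_mult_mat(1))
qed

lemma conj_mat_index:
  fixes g h X :: "'a::comm_ring_1 mat"
  assumes "g \<in> carrier_mat n n" "h \<in> carrier_mat n n" "X \<in> carrier_mat n n" "a < n" "b < n"
  shows "(g * X * h) $$ (a,b) = (\<Sum>i<n. \<Sum>j<n. (g $$ (a,i) * h $$ (j,b)) * X $$ (i,j))"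
proof -
  have "(g * X * h) $$ (a,b) = (\<Sum>j<n. (\<Sum>i<n. g $$ (a,i) * X $$ (i,j)) * h $$ (j,b))"
    using assms by (subst index_mult_mat_sum[of _ n _ n _ n])
      (auto simp: index_mult_mat_sum[of _ n _ n _ n] simp del: index_mult_mat(1))
  also have "\<dots> = (\<Sum>j<n. \<Sum>i<n. (g $$ (a,i) * h $$ (j,b)) * X $$ (i,j))"
    unfolding sum_distrib_right by (intro sum.cong refl) (simp add: mult_ac)
  also have "\<dots> = (\<Sum>i<n. \<Sum>j<n. (g $$ (a,i) * h $$ (j,b)) * X $$ (i,j))" by (rule sum.swap)
  finally show ?thesis .
qed

lemma Ad_mat_apply:
  assumes n: "n \<ge> 1" and X: "X \<in> sl_mats n UNIV" and g: "g \<in> carrier_mat n n" "det g \<noteq> 0"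
  shows "Ad_mat n g *\<^sub>v sl_vec n X = sl_vec n (g * X * minv g)"
  unfolding Ad_mat_def
  by (rule sl_operator_apply[OF n X, where c = "\<lambda>a b i j. g $$ (a,i) * minv g $$ (j,b)"])
    (use g minv[OF g] conj_mat_index[of g n "minv g"] in auto)

lemma mtrace_conj:
  assumes g: "(g :: 'a::field mat) \<in> carrier_mat n n" "det g \<noteq> 0" and X: "X \<in> carrier_mat n n"
  shows "mtrace (g * X * minv g) = mtrace X"
proof -
  note m = minv[OF g]
  have "mtrace (g * X * minv g) = mtrace (minv g * (g * X))"
    by (rule mtrace_mult_commute[of _ n]) (use g X m in auto)
  also have "minv g * (g * X) = minv g * g * X"
    by (rule assoc_mult_mat[of _ n n _ n _ n, symmetric]) (use g X m in auto)
  finally show ?thesis using m X by simp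
qed

lemma conj_sl_mats:
  assumes g: "(g :: 'a::field mat) \<in> carrier_mat n n" "det g \<noteq> 0" and X: "X \<in> sl_mats n UNIV"
  shows "g * X * minv g \<in> sl_mats n UNIV"
proof -
  have X: "X \<in> carrier_mat n n" "mtrace X = 0" using X by (auto simp: sl_mats_UNIV)
  have "g * X * minv g \<in> carrier_mat n n" using g minv(1)[OF g] X by (intro mult_carrier_mat) auto
  then show ?thesis using mtrace_conj[OF g X(1)] X(2) by (simp only: sl_mats_UNIV)
qed

lemma conj_conj_minv:
  assumes g: "(g :: 'a::field mat) \<in> carrier_mat n n" "det g \<noteq> 0" and X: "X \<in> carrier_mat n n"
  shows "minv g * (g * X * minv g) * g = X"
proof -
  note m = minv[OF g]
  have "minv g * (g * X * minv g) = minv g * (g * X) * minv g"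
    by (rule assoc_mult_mat[of _ n n _ n _ n, symmetric]) (use g X m in auto)
  also have "minv g * (g * X) = minv g * g * X"
    by (rule assoc_mult_mat[of _ n n _ n _ n, symmetric]) (use g X m in auto)
  finally have "minv g * (g * X * minv g) = X * minv g" using m X by simp
  moreover have "X * minv g * g = X * (minv g * g)"
    by (rule assoc_mult_mat[of _ n n _ n _ n]) (use g X m in auto)
  ultimately show ?thesis using m X by simp
qed

text \<open>A kernel vector is the coordinate vector of a trace-zero matrix whose conjugate by
  \<open>g\<close> vanishes; conjugating back shows that it is zero.\<close>

lemma det_Ad_mat_nonzero:
  assumes n: "n \<ge> 1" and g: "(g :: 'a::field mat) \<in> carrier_mat n n" "det g \<noteq> 0"
  shows "det (Ad_mat n g) \<noteq> 0"
proof (rule det_nonzeroI)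
  let ?m = "n\<^sup>2 - 1"
  show c: "Ad_mat n g \<in> carrier_mat ?m ?m" by (simp add: Ad_mat_def)
  fix w i assume w: "w \<in> carrier_vec ?m" and i: "i < ?m"
    and z: "\<And>i. i < ?m \<Longrightarrow> (\<Sum>j<?m. Ad_mat n g $$ (i,j) * w $ j) = 0"
  define X where "X = sl_of_vec n w"
  have X: "X \<in> sl_mats n UNIV" "sl_vec n X = w"
    using sl_of_vec_sl[OF n] sl_vec_of_vec[OF n w] by (auto simp: X_def)
  have X': "X \<in> carrier_mat n n" using X by (simp add: sl_mats_UNIV)
  note m = minv[OF g]
  let ?Y = "g * X * minv g"
  have Y: "?Y \<in> sl_mats n UNIV" by (rule conj_sl_mats[OF g X(1)])
  have "Ad_mat n g *\<^sub>v w = 0\<^sub>v ?m"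
    using z c w by (intro eq_vecI) (auto simp: index_mult_mat_vec_sum[of _ ?m] simp del: index_mult_mat_vec)
  then have "sl_vec n ?Y = 0\<^sub>v ?m" using Ad_mat_apply[OF n X(1) g] X(2) by simp
  moreover have "Ad_mat n (minv g) *\<^sub>v sl_vec n ?Y = sl_vec n (minv g * ?Y * minv (minv g))"
    by (rule Ad_mat_apply[OF n Y]) (use m g det_minv[OF g] in auto)
  ultimately have "w = Ad_mat n (minv g) *\<^sub>v 0\<^sub>v ?m"
    using conj_conj_minv[OF g X'] minv_minv[OF g] X(2) by simp
  then have "w $ i = (Ad_mat n (minv g) *\<^sub>v 0\<^sub>v ?m) $ i" by (rule arg_cong)
  also have "\<dots> = 0"
    by (subst index_mult_mat_vec_sum[OF i]) (use i in \<open>auto simp: Ad_mat_def\<close>)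
  finally show "w $ i = 0" .
qed

section \<open>The connection on endomorphisms\<close>

definition nabla_ad :: "('a::comm_ring_1 \<Rightarrow> 'a) \<Rightarrow> 'a mat \<Rightarrow> 'a mat \<Rightarrow> 'a mat" where
  "nabla_ad \<delta> A X = map_mat \<delta> X + (A * X - X * A)"

lemma nabla_ad_closed [simp]:
  "A \<in> carrier_mat n n \<Longrightarrow> X \<in> carrier_mat n n \<Longrightarrow> nabla_ad \<delta> A X \<in> carrier_mat n n"
  unfolding nabla_ad_def by (intro add_carrier_mat minus_carrier_mat mult_carrier_mat)

lemma nabla_ad_pow_closed [simp]:
  "A \<in> carrier_mat n n \<Longrightarrow> X \<in> carrier_mat n n \<Longrightarrow> (nabla_ad \<delta> A ^^ k) X \<in> carrier_mat n n"
  by (induction k) auto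

context derivation
begin

lemma nabla_ad_sl:
  assumes "A \<in> carrier_mat n n" "X \<in> sl_mats n UNIV"
  shows "nabla_ad \<delta> A X \<in> sl_mats n UNIV"
proof -
  have X: "X \<in> carrier_mat n n" "mtrace X = 0" using assms by (auto simp: sl_mats_UNIV)
  have "mtrace (map_mat \<delta> X) = \<delta> (mtrace X)" using X(1) by (auto simp: mtrace_def sum)
  then have "mtrace (nabla_ad \<delta> A X) = mtrace (A * X - X * A)"
    unfolding nabla_ad_def using X assms(1) by (subst mtrace_add[of _ n]) auto
  also have "\<dots> = 0"
    using X assms(1) mtrace_mult_commute[OF assms(1) X(1)] by (subst mtrace_minus[of _ n]) auto
  finally show ?thesis using X assms(1) by (simp add: sl_mats_UNIV)
qed

lemma nabla_ad_mat:
  assumes n: "n \<ge> 1" and A: "A \<in> carrier_mat n n" and X: "X \<in> sl_mats n UNIV"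
  shows "nabla \<delta> (ad_mat n A) (sl_vec n X) = sl_vec n (nabla_ad \<delta> A X)"
proof -
  have Xc: "X \<in> carrier_mat n n" using X by (simp add: sl_mats_UNIV)
  show ?thesis unfolding nabla_def ad_mat_apply[OF n X A]
    by (rule eq_vecI) (use sl_index[OF n] Xc A in \<open>auto simp: sl_vec_def nabla_ad_def\<close>)
qed

lemma nabla_ad_mat_pow:
  assumes n: "n \<ge> 1" and A: "A \<in> carrier_mat n n" and X: "X \<in> sl_mats n UNIV"
  shows "(nabla \<delta> (ad_mat n A) ^^ k) (sl_vec n X) = sl_vec n ((nabla_ad \<delta> A ^^ k) X)
    \<and> (nabla_ad \<delta> A ^^ k) X \<in> sl_mats n UNIV"
  by (induction k) (use nabla_ad_mat[OF n A] nabla_ad_sl[OF A] X in auto)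

text \<open>Leibniz rule for an endomorphism applied to a section. The gauge behaviour of
  \<open>nabla_ad\<close> follows from it without expanding brackets.\<close>

lemma nabla_mult_mat_vec:
  assumes A: "A \<in> carrier_mat n n" and X: "X \<in> carrier_mat n n" and v: "v \<in> carrier_vec n"
  shows "nabla \<delta> A (X *\<^sub>v v) = nabla_ad \<delta> A X *\<^sub>v v + X *\<^sub>v nabla \<delta> A v"
proof -
  have dX: "map_mat \<delta> X \<in> carrier_mat n n" using X by simp
  have 1: "nabla_ad \<delta> A X *\<^sub>v v = map_mat \<delta> X *\<^sub>v v + (A *\<^sub>v (X *\<^sub>v v) - X *\<^sub>v (A *\<^sub>v v))"
  proof -
    have c: "A * X \<in> carrier_mat n n" "X * A \<in> carrier_mat n n" using A X by auto
    show ?thesis unfolding nabla_ad_def add_mult_distrib_mat_vec[OF dX minus_carrier_mat[OF c(2)] v]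
      minus_mult_distrib_mat_vec[OF c v] assoc_mult_mat_vec[OF A X v] assoc_mult_mat_vec[OF X A v] ..
  qed
  have 2: "X *\<^sub>v nabla \<delta> A v = X *\<^sub>v map_vec \<delta> v + X *\<^sub>v (A *\<^sub>v v)"
    unfolding nabla_def by (rule mult_add_distrib_mat_vec[OF X]) (use A v in auto)
  show ?thesis unfolding 1 2 unfolding nabla_def map_mult_mat_vec[OF X v]
    by (rule eq_vecI) (use A X v dX in auto)
qed

text \<open>Both sides are compared on vectors \<open>g v\<close>: the Leibniz rule for the
  transformed data and the image under \<open>g\<close> of the Leibniz rule for the original data
  agree in all terms but the ones to be identified.\<close>

lemma nabla_ad_gauge:
  assumes g: "g \<in> carrier_mat n n" "det g \<noteq> 0" and A: "A \<in> carrier_mat n n" and X: "X \<in> carrier_mat n n"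
  shows "nabla_ad \<delta> (gauge \<delta> g A) (g * X * minv g) = g * nabla_ad \<delta> A X * minv g"
proof -
  note m = minv[OF g]
  let ?A = "gauge \<delta> g A" and ?Y = "g * X * minv g"
  have A': "?A \<in> carrier_mat n n" using g A by simp
  have Y: "?Y \<in> carrier_mat n n" using g m X by auto
  have conj: "(g * Z * minv g) *\<^sub>v (g *\<^sub>v v) = g *\<^sub>v (Z *\<^sub>v v)"
    if Z: "Z \<in> carrier_mat n n" and v: "v \<in> carrier_vec n" for Z v
  proof -
    have "(g * Z * minv g) *\<^sub>v (g *\<^sub>v v) = (g * Z) *\<^sub>v (minv g *\<^sub>v (g *\<^sub>v v))"
      by (rule assoc_mult_mat_vec[of _ n n _ n]) (use g Z v m in auto)
    also have "minv g *\<^sub>v (g *\<^sub>v v) = v"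
      using assoc_mult_mat_vec[OF m(1) g(1) v] m(3) v by simp
    finally show ?thesis using assoc_mult_mat_vec[OF g(1) Z v] by simp
  qed
  have key: "nabla_ad \<delta> ?A ?Y *\<^sub>v u = (g * nabla_ad \<delta> A X * minv g) *\<^sub>v u" if u: "u \<in> carrier_vec n" for u
  proof -
    define v where "v = minv g *\<^sub>v u"
    have v: "v \<in> carrier_vec n" using m u by (simp add: v_def)
    have u': "u = g *\<^sub>v v" unfolding v_def
      using assoc_mult_mat_vec[OF g(1) m(1) u] m(2) u by simp
    have "nabla \<delta> ?A (?Y *\<^sub>v u) = nabla_ad \<delta> ?A ?Y *\<^sub>v u + ?Y *\<^sub>v nabla \<delta> ?A u"
      by (rule nabla_mult_mat_vec[OF A' Y u])
    moreover have "nabla \<delta> ?A (?Y *\<^sub>v u) = g *\<^sub>v (nabla_ad \<delta> A X *\<^sub>v v) + g *\<^sub>v (X *\<^sub>v nabla \<delta> A v)"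
    proof -
      have c: "X *\<^sub>v v \<in> carrier_vec n" "nabla_ad \<delta> A X *\<^sub>v v \<in> carrier_vec n" "X *\<^sub>v nabla \<delta> A v \<in> carrier_vec n"
        using X v A by (auto intro!: mult_mat_vec_carrier)
      show ?thesis unfolding u' conj[OF X v] nabla_gauge[OF g A c(1)] nabla_mult_mat_vec[OF A X v]
        by (rule mult_add_distrib_mat_vec[OF g(1) c(2,3)])
    qed
    moreover have "?Y *\<^sub>v nabla \<delta> ?A u = g *\<^sub>v (X *\<^sub>v nabla \<delta> A v)"
      unfolding u' nabla_gauge[OF g A v] using A v by (intro conj[OF X]) auto
    ultimately have eq: "nabla_ad \<delta> ?A ?Y *\<^sub>v u + g *\<^sub>v (X *\<^sub>v nabla \<delta> A v) =
        g *\<^sub>v (nabla_ad \<delta> A X *\<^sub>v v) + g *\<^sub>v (X *\<^sub>v nabla \<delta> A v)" by simp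
    have c: "nabla_ad \<delta> ?A ?Y *\<^sub>v u \<in> carrier_vec n" "g *\<^sub>v (nabla_ad \<delta> A X *\<^sub>v v) \<in> carrier_vec n"
      "g *\<^sub>v (X *\<^sub>v nabla \<delta> A v) \<in> carrier_vec n"
      using nabla_ad_closed[OF A' Y] u nabla_ad_closed[OF A X] v nabla_closed[OF A v] g(1) X
      by (meson mult_mat_vec_carrier)+
    have "nabla_ad \<delta> ?A ?Y *\<^sub>v u = g *\<^sub>v (nabla_ad \<delta> A X *\<^sub>v v)"
    proof (rule eq_vecI)
      fix i assume i: "i < dim_vec (g *\<^sub>v (nabla_ad \<delta> A X *\<^sub>v v))"
      then have "(nabla_ad \<delta> ?A ?Y *\<^sub>v u) $ i + (g *\<^sub>v (X *\<^sub>v nabla \<delta> A v)) $ i =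
        (g *\<^sub>v (nabla_ad \<delta> A X *\<^sub>v v)) $ i + (g *\<^sub>v (X *\<^sub>v nabla \<delta> A v)) $ i"
        using arg_cong[OF eq, of "\<lambda>v. v $ i"] c by (simp del: index_mult_mat_vec)
      then show "(nabla_ad \<delta> ?A ?Y *\<^sub>v u) $ i = (g *\<^sub>v (nabla_ad \<delta> A X *\<^sub>v v)) $ i" by simp
    qed (simp only: carrier_vecD[OF c(1)] carrier_vecD[OF c(2)])
    then show ?thesis unfolding u' using conj[of "nabla_ad \<delta> A X" v] A X v by simp
  qed
  have cl: "nabla_ad \<delta> ?A ?Y \<in> carrier_mat n n" using A' Y by simp
  have cr: "g * nabla_ad \<delta> A X * minv g \<in> carrier_mat n n"
    using g m nabla_ad_closed[OF A X] by (intro mult_carrier_mat) auto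
  show ?thesis
  proof (rule mat_col_eqI)
    fix j assume "j < dim_col (g * nabla_ad \<delta> A X * minv g)"
    then have j: "j < n" using m by simp
    have u: "M *\<^sub>v unit_vec n j = col M j" if "M \<in> carrier_mat n n" for M :: "'a mat"
    proof -
      have "col (M * 1\<^sub>m n) j = M *\<^sub>v col (1\<^sub>m n) j"
        by (rule col_mult2[OF that _ j]) simp
      then show ?thesis using that j by simp
    qed
    show "col (nabla_ad \<delta> ?A ?Y) j = col (g * nabla_ad \<delta> A X * minv g) j"
      using key[of "unit_vec n j"] unfolding u[OF cl] u[OF cr] by simp
  qed (simp_all only: carrier_matD[OF cl] carrier_matD[OF cr])
qed

lemma nabla_ad_pow_gauge:
  assumes g: "g \<in> carrier_mat n n" "det g \<noteq> 0" and A: "A \<in> carrier_mat n n" and X: "X \<in> carrier_mat n n"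
  shows "(nabla_ad \<delta> (gauge \<delta> g A) ^^ k) (g * X * minv g) = g * (nabla_ad \<delta> A ^^ k) X * minv g"
  by (induction k) (use nabla_ad_gauge[OF g A] A X in auto)

end

section \<open>Growth of iterated derivatives and irregularity\<close>

lemma map_mat_minv:
  fixes h :: "'a::field \<Rightarrow> 'b::field"
  assumes "comm_ring_hom h" and g: "g \<in> carrier_mat n n" "det g \<noteq> 0"
  shows "minv (map_mat h g) = map_mat h (minv g)"
proof -
  interpret comm_ring_hom h by fact
  note m = minv[OF g]
  have "map_mat h g * map_mat h (minv g) = map_mat h (g * minv g)"
    by (rule mat_hom_mult[symmetric]) (use g m in auto)
  then have "map_mat h g * map_mat h (minv g) = 1\<^sub>m n" using m by (simp add: mat_hom_one)
  then show ?thesis by (intro minv_eqI[of _ n]) (use g m in auto)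
qed

text \<open>The factor \<open>c\<close> absorbs the change of the derivation: under
  \<open>t = u^b\<close> the form \<open>dt/t\<close> becomes \<open>b du/u\<close>.\<close>

lemma gauge_hom:
  fixes h :: "'a::field \<Rightarrow> 'b::field"
  assumes h: "comm_ring_hom h" and \<delta>: "\<And>x. \<delta>' (h x) = c * h (\<delta> x)"
    and g: "g \<in> carrier_mat n n" "det g \<noteq> 0" and A: "A \<in> carrier_mat n n"
  shows "gauge \<delta>' (map_mat h g) (c \<cdot>\<^sub>m map_mat h A) = c \<cdot>\<^sub>m map_mat h (gauge \<delta> g A)"
proof -
  interpret comm_ring_hom h by fact
  note m = minv[OF g]
  have dg: "map_mat \<delta> g \<in> carrier_mat n n" using g by simp
  have 1: "map_mat h (g * A * minv g) = map_mat h g * map_mat h A * map_mat h (minv g)"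
    using g A m mat_hom_mult[of "g * A" n n "minv g" n] mat_hom_mult[OF g(1) A] by simp
  have 2: "map_mat h (map_mat \<delta> g * minv g) = map_mat h (map_mat \<delta> g) * map_mat h (minv g)"
    by (rule mat_hom_mult) (use dg m in auto)
  have 3: "map_mat \<delta>' (map_mat h g) = c \<cdot>\<^sub>m map_mat h (map_mat \<delta> g)"
    by (rule eq_matI) (auto simp: \<delta>)
  have 4: "map_mat h g * (c \<cdot>\<^sub>m map_mat h A) * map_mat h (minv g) = c \<cdot>\<^sub>m (map_mat h g * map_mat h A * map_mat h (minv g))"
  proof -
    have "map_mat h g * (c \<cdot>\<^sub>m map_mat h A) = c \<cdot>\<^sub>m (map_mat h g * map_mat h A)"
      by (rule mult_smult_distrib[of _ n n _ n]) (use g A in auto)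
    moreover have "(c \<cdot>\<^sub>m (map_mat h g * map_mat h A)) * map_mat h (minv g) = c \<cdot>\<^sub>m (map_mat h g * map_mat h A * map_mat h (minv g))"
      by (rule mult_smult_assoc_mat[of _ n n _ n]) (use g A m in auto)
    ultimately show ?thesis by simp
  qed
  have 5: "(c \<cdot>\<^sub>m map_mat h (map_mat \<delta> g)) * map_mat h (minv g) = c \<cdot>\<^sub>m (map_mat h (map_mat \<delta> g) * map_mat h (minv g))"
    by (rule mult_smult_assoc_mat[of _ n n _ n]) (use dg m in auto)
  have 6: "map_mat h (gauge \<delta> g A) = map_mat h (g * A * minv g) - map_mat h (map_mat \<delta> g * minv g)"
    unfolding gauge_def using g A m by (intro eq_matI) (auto simp: hom_minus)
  show ?thesis
    unfolding 6 unfolding gauge_def map_mat_minv[OF h g] 3 4 5 1 2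
    by (rule eq_matI) (use g A m in \<open>auto simp: algebra_simps\<close>)
qed

abbreviation fls_pullback :: "nat \<Rightarrow> complex fls mat \<Rightarrow> complex fls mat" where
  "fls_pullback b A \<equiv> of_nat b \<cdot>\<^sub>m map_mat (\<lambda>f. fls_compose_power f b) A"

lemma gauge_pullback:
  assumes "b > 0" "g \<in> carrier_mat n n" "det g \<noteq> 0" "A \<in> carrier_mat n n"
  shows "gauge fls_theta (map_mat (\<lambda>f. fls_compose_power f b) g) (fls_pullback b A) =
    fls_pullback b (gauge fls_theta g A)"
  by (rule gauge_hom[where h = "\<lambda>f. fls_compose_power f b" and \<delta> = fls_theta and n = n])
    (use assms fls_theta_compose_power fls_compose_power_hom in auto)

lemma det_compose_power:
  assumes "b > 0" "det g \<noteq> (0 :: complex fls)"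
  shows "det (map_mat (\<lambda>f. fls_compose_power f b) g) \<noteq> 0"
proof
  interpret comm_ring_hom "\<lambda>f :: complex fls. fls_compose_power f b" by (rule fls_compose_power_hom[OF assms(1)])
  assume "det (map_mat (\<lambda>f. fls_compose_power f b) g) = 0"
  then have z: "fls_compose_power (det g) b = 0" by simp
  have "fls_nth (fls_compose_power (det g) b) (int b * fls_subdegree (det g)) = fls_nth (det g) (fls_subdegree (det g))"
    using assms(1) by (simp add: fls_nth_compose_power)
  then show False using z assms(2) by simp
qed

lemma ad_mat_pullback:
  assumes n: "n \<ge> 1" and A: "A \<in> carrier_mat n n" and b: "b > 0"
  shows "ad_mat n (fls_pullback b A) = fls_pullback b (ad_mat n A)"
proof (rule eq_matI)
  let ?m = "n\<^sup>2 - 1"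
  interpret comm_ring_hom "\<lambda>f :: complex fls. fls_compose_power f b" by (rule fls_compose_power_hom[OF b])
  fix k l assume "k < dim_row (fls_pullback b (ad_mat n A))" "l < dim_col (fls_pullback b (ad_mat n A))"
  then have kl: "k < ?m" "l < ?m" by (auto simp: ad_mat_def sl_operator_def)
  note i = sl_index[OF n kl(1)]
  have sb: "fls_compose_power (sl_basis n l $$ (i,j)) b = sl_basis n l $$ (i,j)" if "i < n" "j < n" for i j
    using that b by (auto simp: sl_basis_def)
  have e: "(M * X - X * M) $$ (k div n, k mod n) =
      (\<Sum>p<n. M $$ (k div n, p) * X $$ (p, k mod n)) - (\<Sum>p<n. X $$ (k div n, p) * M $$ (p, k mod n))"
    if "M \<in> carrier_mat n n" "X \<in> carrier_mat n n" for M X :: "complex fls mat"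
    using that i by (simp add: index_mult_mat_sum[of _ n _ n _ n] del: index_mult_mat(1))
  have pb: "fls_pullback b A \<in> carrier_mat n n" using A by simp
  show "ad_mat n (fls_pullback b A) $$ (k,l) = fls_pullback b (ad_mat n A) $$ (k,l)"
    unfolding ad_mat_def sl_operator_def using kl i A
    by (simp add: e[OF pb] e[OF A] hom_distribs hom_sum sb sum_distrib_left right_diff_distrib mult_ac)
qed (auto simp: ad_mat_def sl_operator_def)

lemma ad_mat_carrier [simp]: "ad_mat n A \<in> carrier_mat (n\<^sup>2 - 1) (n\<^sup>2 - 1)"
  by (simp add: ad_mat_def)

text \<open>The shape of a Levelt-Turrittin form which controls the orders of iterated derivatives.\<close>

definition slope_form :: "nat \<Rightarrow> (nat \<Rightarrow> nat) \<Rightarrow> complex fls mat \<Rightarrow> bool" where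
  "slope_form m d H \<longleftrightarrow> H \<in> carrier_mat m m \<and>
     (\<forall>i<m. \<forall>j<m. H $$ (i,j) = 0 \<or> d j \<le> d i \<and> fls_ge 1 (- int (d i)) (H $$ (i,j)))"

text \<open>A nonzero entry \<open>H(i,j)\<close> feeds only a coordinate of slope
  \<open>d j \<le> d i\<close> into row \<open>i\<close>, so each derivative costs coordinate
  \<open>i\<close> at most \<open>d i\<close>, not the maximal slope. Inside a determinant this
  row-by-row bound adds up to the sum of all slopes.\<close>

lemma slope_growth:
  assumes H: "slope_form m d H" and y: "y \<in> carrier_vec m" "\<And>i. i < m \<Longrightarrow> fls_ge 1 (- c) (y $ i)"
    and i: "i < m"
  shows "fls_ge 1 (- int (k * d i) - c) ((nabla fls_theta H ^^ k) y $ i)"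
  using i
proof (induction k arbitrary: i)
  case (Suc k)
  have Hc: "H \<in> carrier_mat m m" using H by (simp add: slope_form_def)
  let ?z = "(nabla fls_theta H ^^ k) y"
  have z: "?z \<in> carrier_vec m" using Hc y by simp
  have "fls_ge 1 (- int (Suc k * d i) - c) (H $$ (i,j) * ?z $ j)" if j: "j < m" for j
  proof (cases "H $$ (i,j) = 0")
    case False
    then have d: "d j \<le> d i" "fls_ge 1 (- int (d i)) (H $$ (i,j))"
      using H Suc.prems j by (auto simp: slope_form_def)
    have "int (k * d j) \<le> int (k * d i)" using mult_le_mono2[OF d(1), of k] by (simp only: of_nat_le_iff)
    moreover have "int (Suc k * d i) = int (d i) + int (k * d i)" by simp
    ultimately have "- int (Suc k * d i) - c \<le> - int (d i) + (- int (k * d j) - c)" by linarith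
    then show ?thesis
      by (rule fls_ge_mono[OF fls_ge_mult[OF _ d(2) Suc.IH[OF j]], rotated]) simp
  qed simp
  moreover have "fls_ge 1 (- int (Suc k * d i) - c) (fls_theta (?z $ i))"
    by (rule fls_ge_mono[OF fls_ge_theta[OF Suc.IH[OF Suc.prems]]]) simp
  ultimately have "fls_ge 1 (- int (Suc k * d i) - c) (fls_theta (?z $ i) + (\<Sum>j<m. H $$ (i,j) * ?z $ j))"
    by (intro fls_ge_add fls_ge_sum) auto
  then show ?case by (simp add: index_nabla[OF Suc.prems Hc z])
qed (use y in simp)

lemma slope_form_pullback:
  assumes "slope_form m d H" "s > 0"
  shows "slope_form m (\<lambda>i. s * d i) (fls_pullback s H)"
  unfolding slope_form_def
proof (intro conjI allI impI)
  fix i j assume ij: "i < m" "j < m"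
  have H: "H \<in> carrier_mat m m" using assms by (simp add: slope_form_def)
  have "H $$ (i,j) = 0 \<or> d j \<le> d i \<and> fls_ge 1 (- int (d i)) (H $$ (i,j))"
    using assms ij by (simp add: slope_form_def)
  then show "fls_pullback s H $$ (i,j) = 0 \<or> s * d j \<le> s * d i \<and> fls_ge 1 (- int (s * d i)) (fls_pullback s H $$ (i,j))"
  proof
    assume *: "d j \<le> d i \<and> fls_ge 1 (- int (d i)) (H $$ (i,j))"
    then have "fls_ge 1 (int s * - int (d i)) (fls_compose_power (H $$ (i,j)) s)"
      using fls_ge_compose_power[OF assms(2), of 1 "- int (d i)" "H $$ (i,j)"] by simp
    then have "fls_ge 1 (0 + int s * - int (d i)) (of_nat s * fls_compose_power (H $$ (i,j)) s)"
      by (intro fls_ge_mult fls_ge_of_nat) auto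
    then show ?thesis using * ij H by simp
  qed (use ij H in simp)
qed (use assms in \<open>simp add: slope_form_def\<close>)

lemma eval_at_X_inv_nth: "fls_nth (eval_at fls_X_inv p) (- int k) = coeff p k"
  and eval_at_X_inv_ge: "fls_ge 1 (- int (degree p)) (eval_at fls_X_inv p)"
proof -
  have e: "eval_at fls_X_inv p = (\<Sum>i\<le>degree p. fls_const (coeff p i) * fls_X_inv ^ i)"
    unfolding eval_at_def poly_altdef by (simp add: coeff_map_poly degree_map_poly)
  have t: "fls_nth (fls_const c * fls_X_inv ^ i) m = (if m = - int i then c else 0)" for c :: complex and i m
    by simp
  have "fls_nth (eval_at fls_X_inv p) (- int k) = (\<Sum>i\<le>degree p. if i = k then coeff p i else 0)"
    unfolding e fls_nth_sum t by (rule sum.cong) auto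
  then show "fls_nth (eval_at fls_X_inv p) (- int k) = coeff p k"
    by (simp add: coeff_eq_0)
  show "fls_ge 1 (- int (degree p)) (eval_at fls_X_inv p)"
    unfolding e by (rule fls_ge_sum) (auto simp: fls_ge_def)
qed

text \<open>Since \<open>N\<close> commutes with the diagonal part, a nonzero entry of
  \<open>N\<close> forces the two polynomials to be equal; hence \<open>N\<close> mixes only
  coordinates of the same slope. Being strictly triangular, it does not disturb the diagonal leading
  coefficients.\<close>

lemma irregularity_form:
  assumes irr: "has_irregularity m B r" and B: "B \<in> carrier_mat m m"
  shows "\<exists>b g H d. b > 0 \<and> g \<in> carrier_mat m m \<and> det g \<noteq> 0 \<and>
    H = gauge fls_theta g (fls_pullback b B) \<and> slope_form m d H \<and>
    (\<forall>i<m. \<forall>j<i. H $$ (i,j) = 0) \<and> (\<forall>j<m. d j > 0 \<longrightarrow> fls_nth (H $$ (j,j)) (- int (d j)) \<noteq> 0) \<and>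
    real (\<Sum>i<m. d i) = real b * r"
proof -
  obtain b p N where lt: "levelt_turrittin m B b p N" and r: "r = (\<Sum>i<m. real (degree (p i))) / real b"
    using irr unfolding has_irregularity_def by blast
  define D where "D = mat_diag m (\<lambda>i. eval_at fls_X_inv (p i))"
  define N' where "N' = map_mat fls_const N"
  from lt obtain g where b: "b > 0" and N: "N \<in> carrier_mat m m" "\<And>i j. i < m \<Longrightarrow> j \<le> i \<Longrightarrow> N $$ (i,j) = 0"
    and comm: "D * N' = N' * D" and g: "g \<in> carrier_mat m m" "det g \<noteq> 0"
    and eq: "gauge fls_theta g (fls_pullback b B) = D + N'"
    unfolding levelt_turrittin_def Let_def D_def N'_def GL_mats_def by auto
  have D: "D \<in> carrier_mat m m" by (simp add: D_def)
  have N': "N' \<in> carrier_mat m m" using N by (simp add: N'_def)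
  have Dij: "D $$ (i,j) = (if i = j then eval_at fls_X_inv (p i) else 0)" if "i < m" "j < m" for i j
    using that by (simp add: D_def mat_diag_def)
  have Nij: "N' $$ (i,j) = fls_const (N $$ (i,j))" if "i < m" "j < m" for i j
    using that N by (simp add: N'_def)
  have deg: "p i = p j" if ij: "i < m" "j < m" "N $$ (i,j) \<noteq> 0" for i j
  proof -
    have "(D * N') $$ (i,j) = (\<Sum>l<m. D $$ (i,l) * N' $$ (l,j))"
      by (rule index_mult_mat_sum) (use ij D N' in auto)
    also have "\<dots> = D $$ (i,i) * N' $$ (i,j)"
      using ij by (subst sum.remove[of _ i]) (auto simp: Dij)
    finally have 1: "(D * N') $$ (i,j) = D $$ (i,i) * N' $$ (i,j)" .
    have "(N' * D) $$ (i,j) = (\<Sum>l<m. N' $$ (i,l) * D $$ (l,j))"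
      by (rule index_mult_mat_sum) (use ij D N' in auto)
    also have "\<dots> = N' $$ (i,j) * D $$ (j,j)"
      using ij by (subst sum.remove[of _ j]) (auto simp: Dij)
    finally have "D $$ (i,i) * N' $$ (i,j) = N' $$ (i,j) * D $$ (j,j)" using 1 by (simp only: comm)
    then have "eval_at fls_X_inv (p i) = eval_at fls_X_inv (p j)"
      using ij by (simp add: Dij Nij mult.commute)
    then have "coeff (p i) k = coeff (p j) k" for k by (metis eval_at_X_inv_nth)
    then show ?thesis by (simp add: poly_eq_iff)
  qed
  define d where "d i = degree (p i)" for i
  have f1: "slope_form m d (D + N')" unfolding slope_form_def
  proof (intro conjI allI impI)
    fix i j assume ij: "i < m" "j < m"
    have e: "(D + N') $$ (i,j) = D $$ (i,j) + N' $$ (i,j)" using ij D N' by simp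
    show "(D + N') $$ (i,j) = 0 \<or> d j \<le> d i \<and> fls_ge 1 (- int (d i)) ((D + N') $$ (i,j))"
    proof (cases "i = j")
      case True
      then show ?thesis unfolding e Dij[OF ij] Nij[OF ij] using ij N(2)[of i j] by (simp add: d_def eval_at_X_inv_ge)
    next
      case False
      have "fls_ge 1 (- int (d i)) (fls_const (N $$ (i,j)))" by (rule fls_ge_mono[OF fls_ge_const]) simp
      then show ?thesis unfolding e Dij[OF ij] Nij[OF ij] using False deg[OF ij]
        by (cases "N $$ (i,j) = 0") (simp_all add: d_def)
    qed
  qed (use D N' in auto)
  have f2: "(D + N') $$ (i,j) = 0" if "i < m" "j < i" for i j
    using that D N' N(2)[of i j] by (simp add: Dij Nij)
  have f3: "fls_nth ((D + N') $$ (j,j)) (- int (d j)) \<noteq> 0" if "j < m" "d j > 0" for j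
    using that D N' N(2)[of j j] by (auto simp: Dij Nij eval_at_X_inv_nth d_def)
  have f4: "real (\<Sum>i<m. d i) = real b * r" using b by (simp add: r d_def)
  show ?thesis
    by (rule exI[of _ b], rule exI[of _ g], rule exI[of _ "D + N'"], rule exI[of _ d],
        intro conjI allI impI) (fact b g eq[symmetric] f1 f4 | erule f2 f3, assumption)+
qed

lemma fls_ge_mat_vec:
  fixes g :: "'a::field fls mat"
  assumes "g \<in> carrier_mat n n" "v \<in> carrier_vec n" "i < n"
    and "\<And>j. j < n \<Longrightarrow> fls_ge 1 q (g $$ (i,j))" "\<And>j. j < n \<Longrightarrow> fls_ge 1 r (v $ j)"
  shows "fls_ge 1 (q + r) ((g *\<^sub>v v) $ i)"
  unfolding index_mult_mat_vec_sum[OF assms(3,1,2)] by (intro fls_ge_sum fls_ge_mult) (use assms in auto)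

lemma fls_ge_conj:
  fixes g :: "'a::field fls mat"
  assumes "g \<in> carrier_mat n n" "h \<in> carrier_mat n n" "X \<in> carrier_mat n n" "a < n" "b < n"
    and "\<And>i j. i < n \<Longrightarrow> j < n \<Longrightarrow> fls_ge 1 p (g $$ (i,j))"
    and "\<And>i j. i < n \<Longrightarrow> j < n \<Longrightarrow> fls_ge 1 q (h $$ (i,j))"
    and "\<And>i j. i < n \<Longrightarrow> j < n \<Longrightarrow> fls_ge 1 r (X $$ (i,j))"
  shows "fls_ge 1 (p + q + r) ((g * X * h) $$ (a,b))"
  unfolding conj_mat_index[OF assms(1-5)] by (intro fls_ge_sum fls_ge_mult) (use assms in auto)

lemma nabla_ad_index:
  assumes "A \<in> carrier_mat n n" "X \<in> carrier_mat n n" "a < n" "b < n"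
  shows "nabla_ad \<delta> A X $$ (a,b) = \<delta> (X $$ (a,b)) + ((\<Sum>l<n. A $$ (a,l) * X $$ (l,b)) - (\<Sum>l<n. X $$ (a,l) * A $$ (l,b)))"
proof -
  have "A * X \<in> carrier_mat n n" "X * A \<in> carrier_mat n n" using assms by auto
  then show ?thesis using assms unfolding nabla_ad_def
    by (simp add: index_mult_mat_sum[of _ n _ n _ n] del: index_mult_mat(1))
qed

lemma nabla_ad_integral:
  assumes A: "A \<in> carrier_mat n n" "\<And>i j. i < n \<Longrightarrow> j < n \<Longrightarrow> fls_ge 1 0 (A $$ (i,j))"
    and X: "X \<in> carrier_mat n n" "\<And>i j. i < n \<Longrightarrow> j < n \<Longrightarrow> fls_ge 1 q (X $$ (i,j))"
    and ab: "a < n" "b < n"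
  shows "fls_ge 1 q ((nabla_ad fls_theta A ^^ k) X $$ (a,b))"
  using ab
proof (induction k arbitrary: a b)
  case (Suc k)
  let ?Z = "(nabla_ad fls_theta A ^^ k) X"
  have Z: "?Z \<in> carrier_mat n n" using A X by simp
  have "fls_ge 1 (0 + q) (A $$ (a,l) * ?Z $$ (l,b))" "fls_ge 1 (q + 0) (?Z $$ (a,l) * A $$ (l,b))" if "l < n" for l
    by (rule fls_ge_mult; use that Suc A in simp)+
  then show ?case unfolding funpow.simps o_def nabla_ad_index[OF A(1) Z Suc.prems]
    using Suc by (intro fls_ge_add fls_ge_diff fls_ge_sum fls_ge_theta) auto
qed (use X in simp)

text \<open>Translates between the two frames in play: coordinates of the adjoint bundle changed by
  \<open>g\<close>, and matrices conjugated by a frame change \<open>G\<close> of the original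
  bundle.\<close>

lemma nabla_pow_ad_gauge:
  assumes n: "n \<ge> 1" and A: "A \<in> carrier_mat n n" and G: "G \<in> carrier_mat n n" "det G \<noteq> 0"
    and g: "g \<in> carrier_mat (n\<^sup>2 - 1) (n\<^sup>2 - 1)" "det g \<noteq> 0" and Y: "Y \<in> sl_mats n UNIV"
  shows "(nabla fls_theta (gauge fls_theta g (ad_mat n A)) ^^ k) (g *\<^sub>v sl_vec n (minv G * Y * G)) =
     g *\<^sub>v sl_vec n (minv G * (nabla_ad fls_theta (gauge fls_theta G A) ^^ k) Y * G)"
proof -
  note m = minv[OF G]
  have Yc: "Y \<in> carrier_mat n n" using Y by (simp add: sl_mats_UNIV)
  have mG: "det (minv G) \<noteq> 0" "minv (minv G) = G" using det_minv[OF G] G minv_minv[OF G] by auto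
  define X where "X = minv G * Y * G"
  have X: "X \<in> sl_mats n UNIV"
    using conj_sl_mats[OF m(1) mG(1) Y] unfolding X_def mG(2) .
  then have Xc: "X \<in> carrier_mat n n" by (simp add: sl_mats_UNIV)
  have Y': "Y = G * X * minv G"
    using conj_conj_minv[OF m(1) mG(1) Yc] unfolding mG(2) X_def by simp
  have "(nabla fls_theta (gauge fls_theta g (ad_mat n A)) ^^ k) (g *\<^sub>v sl_vec n X) =
      g *\<^sub>v (nabla fls_theta (ad_mat n A) ^^ k) (sl_vec n X)"
    by (rule fls_theta.nabla_pow_gauge) (use g in auto)
  also have "(nabla fls_theta (ad_mat n A) ^^ k) (sl_vec n X) = sl_vec n ((nabla_ad fls_theta A ^^ k) X)"
    using fls_theta.nabla_ad_mat_pow[OF n A X] by blast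
  also have "(nabla_ad fls_theta A ^^ k) X = minv G * (G * (nabla_ad fls_theta A ^^ k) X * minv G) * G"
    by (rule conj_conj_minv[OF G, symmetric]) (use A Xc in simp)
  also have "G * (nabla_ad fls_theta A ^^ k) X * minv G = (nabla_ad fls_theta (gauge fls_theta G A) ^^ k) Y"
    unfolding Y' by (rule fls_theta.nabla_ad_pow_gauge[OF G A Xc, symmetric])
  finally show ?thesis unfolding X_def .
qed

text \<open>The span of the first \<open>j + 1\<close> unit vectors is stable. On its last
  coordinate the derivation term has smaller pole order than multiplication by the diagonal entry,
  so leading coefficients multiply.\<close>

lemma upper_triangular_nabla_pow:
  assumes H: "H \<in> carrier_mat m m" "\<And>i j. i < m \<Longrightarrow> j < i \<Longrightarrow> H $$ (i,j) = 0"
    and j: "j < m" and d: "d > 0" "fls_ge 1 (- int d) (H $$ (j,j))" "fls_nth (H $$ (j,j)) (- int d) \<noteq> 0"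
  shows "(\<forall>i<m. i > j \<longrightarrow> (nabla fls_theta H ^^ k) (unit_vec m j) $ i = 0) \<and>
    fls_ge 1 (- int (k * d)) ((nabla fls_theta H ^^ k) (unit_vec m j) $ j) \<and>
    fls_nth ((nabla fls_theta H ^^ k) (unit_vec m j) $ j) (- int (k * d)) \<noteq> 0"
proof (induction k)
  case 0
  show ?case using j by (auto simp: fls_ge_1_0)
next
  case (Suc k)
  let ?z = "(nabla fls_theta H ^^ k) (unit_vec m j)"
  have z: "?z \<in> carrier_vec m" using H by simp
  have ix: "(nabla fls_theta H ^^ Suc k) (unit_vec m j) $ i = fls_theta (?z $ i) + (\<Sum>l<m. H $$ (i,l) * ?z $ l)"
    if "i < m" for i using index_nabla[OF that H(1) z] by simp
  have 0: "H $$ (i,l) * ?z $ l = 0" if "i < m" "l < m" "i > j \<or> i = j \<and> l \<noteq> j" for i l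
  proof (cases "l < i")
    case True then show ?thesis using H(2)[OF that(1) True] by simp
  next
    case False then have "l > j" using that by auto
    then show ?thesis using Suc that by simp
  qed
  have "(nabla fls_theta H ^^ Suc k) (unit_vec m j) $ i = 0" if i: "i < m" "i > j" for i
    unfolding ix[OF i(1)] using Suc i 0[OF i(1)] by (simp add: sum.neutral)
  moreover have e: "(nabla fls_theta H ^^ Suc k) (unit_vec m j) $ j = fls_theta (?z $ j) + H $$ (j,j) * ?z $ j"
    unfolding ix[OF j] using j 0[OF j] by (subst sum.remove[of _ j]) (auto simp: sum.neutral)
  have s: "- int (Suc k * d) = - int d + - int (k * d)" by simp
  have zge: "fls_ge 1 (- int (k * d)) (?z $ j)" and znz: "fls_nth (?z $ j) (- int (k * d)) \<noteq> 0" using Suc by auto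
  have "fls_ge 1 (- int (Suc k * d)) (H $$ (j,j) * ?z $ j)" unfolding s
    by (rule fls_ge_mult[OF _ d(2) zge]) simp
  moreover have "fls_ge 1 (- int (Suc k * d)) (fls_theta (?z $ j))"
    by (rule fls_ge_mono[OF fls_ge_theta[OF zge]]) simp
  moreover have "fls_nth (H $$ (j,j) * ?z $ j) (- int (Suc k * d)) \<noteq> 0"
    unfolding s fls_nth_mult_leading[OF d(2) zge] using d(3) znz by simp
  moreover have "fls_nth (?z $ j) (- int (Suc k * d)) = 0"
    using zge d(1) unfolding fls_ge_def by auto
  ultimately show ?case unfolding e by (auto intro: fls_ge_add)
qed

text \<open>In an integral frame iterated derivatives keep a bounded pole order, while a positive
  slope \<open>d j\<close> would make the \<open>j\<close>-th coordinate of the iterates of a unit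
  vector grow by exactly \<open>d j\<close> at each step. The two frames differ by bounded pole
  orders only.\<close>

lemma irregularity_zero_of_integral:
  assumes n: "n \<ge> 1" and A: "A \<in> carrier_mat n n" and G: "G \<in> carrier_mat n n" "det G \<noteq> 0"
    and int: "\<And>i j. i < n \<Longrightarrow> j < n \<Longrightarrow> fls_ge 1 0 (gauge fls_theta G A $$ (i,j))"
    and irr: "has_irregularity (n\<^sup>2 - 1) (ad_mat n A) r"
  shows "r = 0"
proof -
  let ?m = "n\<^sup>2 - 1"
  obtain b g H d where b: "b > 0" and g: "g \<in> carrier_mat ?m ?m" "det g \<noteq> 0"
    and H: "H = gauge fls_theta g (fls_pullback b (ad_mat n A))" and sf: "slope_form ?m d H"
    and ut: "\<And>i j. i < ?m \<Longrightarrow> j < i \<Longrightarrow> H $$ (i,j) = 0"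
    and ld: "\<And>j. j < ?m \<Longrightarrow> d j > 0 \<Longrightarrow> fls_nth (H $$ (j,j)) (- int (d j)) \<noteq> 0"
    and sum: "real (\<Sum>i<?m. d i) = real b * r"
    using irregularity_form[OF irr] by auto
  have Hc: "H \<in> carrier_mat ?m ?m" using sf by (simp add: slope_form_def)
  define Ab where "Ab = fls_pullback b A"
  have Ab: "Ab \<in> carrier_mat n n" using A by (simp add: Ab_def)
  have H': "H = gauge fls_theta g (ad_mat n Ab)" unfolding H Ab_def ad_mat_pullback[OF n A b] ..
  define Gb where "Gb = map_mat (\<lambda>f. fls_compose_power f b) G"
  have Gb: "Gb \<in> carrier_mat n n" "det Gb \<noteq> 0"
    using G det_compose_power[OF b, of G] by (auto simp: Gb_def)
  let ?A' = "gauge fls_theta Gb Ab"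
  have A'c: "?A' \<in> carrier_mat n n" using Gb Ab by simp
  have A'int: "fls_ge 1 0 (?A' $$ (i,j))" if ij: "i < n" "j < n" for i j
  proof -
    have "?A' $$ (i,j) = of_nat b * fls_compose_power (gauge fls_theta G A $$ (i,j)) b"
      unfolding Gb_def Ab_def gauge_pullback[OF b G A] using ij gauge_closed[OF G A, of fls_theta] by simp
    moreover have "fls_ge 1 (0 + int b * 0) (of_nat b * fls_compose_power (gauge fls_theta G A $$ (i,j)) b)"
      using fls_ge_compose_power[OF b, of 1 0 "gauge fls_theta G A $$ (i,j)"] int[OF ij]
      by (intro fls_ge_mult fls_ge_of_nat) auto
    ultimately show ?thesis by simp
  qed
  have "d j = 0" if j: "j < ?m" for j
  proof (rule ccontr)
    assume "d j \<noteq> 0"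
    then have dj: "d j > 0" by simp
    have Hjj: "fls_ge 1 (- int (d j)) (H $$ (j,j))"
      using sf j ld[OF j dj] unfolding slope_form_def by fastforce
    note mg = minv[OF g] note mG = minv[OF Gb]
    define w where "w = minv g *\<^sub>v unit_vec ?m j"
    have w: "w \<in> carrier_vec ?m" using mg(1) by (simp add: w_def)
    define X where "X = sl_of_vec n w"
    have X: "X \<in> sl_mats n UNIV" "sl_vec n X = w"
      using sl_of_vec_sl[OF n] sl_vec_of_vec[OF n w] by (auto simp: X_def)
    then have Xc: "X \<in> carrier_mat n n" by (simp add: sl_mats_UNIV)
    define Y where "Y = Gb * X * minv Gb"
    have Y: "Y \<in> sl_mats n UNIV" unfolding Y_def by (rule conj_sl_mats[OF Gb X(1)])
    then have Yc: "Y \<in> carrier_mat n n" by (simp add: sl_mats_UNIV)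
    have XY: "minv Gb * Y * Gb = X" unfolding Y_def by (rule conj_conj_minv[OF Gb Xc])
    have gw: "g *\<^sub>v w = unit_vec ?m j" unfolding w_def
      using assoc_mult_mat_vec[OF g(1) mg(1), of "unit_vec ?m j"] mg(2) by simp
    obtain c1 where c1: "\<And>i j. i < n \<Longrightarrow> j < n \<Longrightarrow> fls_ge 1 (- int c1) (Y $$ (i,j))"
      using fls_ge_det_exists[OF Yc] by auto
    obtain c2 where c2: "\<And>i j. i < n \<Longrightarrow> j < n \<Longrightarrow> fls_ge 1 (- int c2) (Gb $$ (i,j))"
      using fls_ge_det_exists[OF Gb(1)] by auto
    obtain c3 where c3: "\<And>i j. i < n \<Longrightarrow> j < n \<Longrightarrow> fls_ge 1 (- int c3) (minv Gb $$ (i,j))"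
      using fls_ge_det_exists[OF mG(1)] by auto
    obtain c4 where c4: "\<And>i j. i < ?m \<Longrightarrow> j < ?m \<Longrightarrow> fls_ge 1 (- int c4) (g $$ (i,j))"
      using fls_ge_det_exists[OF g(1)] by auto
    \<comment> \<open>Total pole order allowed by the starting matrix and the changes of frame; one
      more derivative than this number gives the contradiction.\<close>
    define c where "c = c4 + (c3 + c2 + c1)"
    define k where "k = Suc c"
    let ?Z = "(nabla_ad fls_theta ?A' ^^ k) Y"
    have Zc: "?Z \<in> carrier_mat n n" using A'c Yc by simp
    have Z: "fls_ge 1 (- int c1) (?Z $$ (p,q))" if "p < n" "q < n" for p q
      by (rule nabla_ad_integral[OF A'c A'int Yc c1 that])
    have v: "fls_ge 1 (- int c3 + - int c2 + - int c1) (sl_vec n (minv Gb * ?Z * Gb) $ l)" if l: "l < ?m" for l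
    proof -
      have "fls_ge 1 (- int c3 + - int c2 + - int c1) ((minv Gb * ?Z * Gb) $$ (l div n, l mod n))"
        by (rule fls_ge_conj[OF mG(1) Gb(1) Zc sl_index(1,2)[OF n l] c3 c2 Z])
      then show ?thesis using l by (simp only: sl_vec_def index_vec)
    qed
    have "fls_ge 1 (- int c4 + (- int c3 + - int c2 + - int c1)) ((g *\<^sub>v sl_vec n (minv Gb * ?Z * Gb)) $ j)"
      by (rule fls_ge_mat_vec[OF g(1) _ j c4[OF j] v]) auto
    then have "fls_ge 1 (- int c) ((g *\<^sub>v sl_vec n (minv Gb * ?Z * Gb)) $ j)"
      by (rule fls_ge_mono) (simp add: c_def)
    moreover have "g *\<^sub>v sl_vec n (minv Gb * ?Z * Gb) = (nabla fls_theta H ^^ k) (unit_vec ?m j)"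
      unfolding H' gw[symmetric] X(2)[symmetric] XY[symmetric]
      by (rule nabla_pow_ad_gauge[OF n Ab Gb g Y, symmetric])
    ultimately have "fls_ge 1 (- int c) ((nabla fls_theta H ^^ k) (unit_vec ?m j) $ j)" by simp
    moreover have "fls_nth ((nabla fls_theta H ^^ k) (unit_vec ?m j) $ j) (- int (k * d j)) \<noteq> 0"
      using upper_triangular_nabla_pow[OF Hc ut j dj Hjj ld[OF j dj]] by blast
    moreover have "- int (k * d j) < - int c"
    proof -
      have "c < k * 1" by (simp add: k_def)
      also have "\<dots> \<le> k * d j" using dj by (intro mult_le_mono) auto
      finally show ?thesis by linarith
    qed
    ultimately show False by (auto simp: fls_ge_def)
  qed
  then have "real b * r = 0" using sum by simp
  then show ?thesis using b by simp
qed

section \<open>Leading coefficients of determinants and of the adjoint action\<close>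

lemma fls_nth_prod_leading:
  fixes f :: "'b \<Rightarrow> 'a::field fls"
  assumes "finite S" "\<And>x. x \<in> S \<Longrightarrow> fls_ge 1 (q x) (f x)"
  shows "fls_nth (\<Prod>x\<in>S. f x) (\<Sum>x\<in>S. q x) = (\<Prod>x\<in>S. fls_nth (f x) (q x))"
  using assms
proof (induction S)
  case (insert a S)
  have "fls_ge 1 (\<Sum>x\<in>S. q x) (\<Prod>x\<in>S. f x)" by (rule fls_ge_prod) (use insert in auto)
  then show ?case using insert by (simp add: fls_nth_mult_leading)
qed simp

lemma det_leading:
  fixes M :: "'a::field fls mat"
  assumes M: "M \<in> carrier_mat n n" and ge: "\<And>i j. i < n \<Longrightarrow> j < n \<Longrightarrow> fls_ge 1 (q j) (M $$ (i,j))"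
  shows "fls_nth (det M) (\<Sum>j<n. q j) = det (mat n n (\<lambda>(i,j). fls_nth (M $$ (i,j)) (q j)))"
proof -
  let ?T = "mat n n (\<lambda>(i,j). fls_nth (M $$ (i,j)) (q j))"
  have T: "?T \<in> carrier_mat n n" by simp
  have "fls_nth (signof p * (\<Prod>i=0..<n. M $$ (i, p i))) (\<Sum>j<n. q j) = signof p * (\<Prod>i=0..<n. ?T $$ (i, p i))"
    if "p permutes {0..<n}" for p
  proof -
    have pi: "i < n \<Longrightarrow> p i < n" for i using permutes_in_image[OF that, of i] by simp
    have "(\<Sum>j<n. q j) = (\<Sum>i=0..<n. q (p i))"
      using sum.permute[OF that, of q] by (simp add: o_def lessThan_atLeast0)
    then have "fls_nth (\<Prod>i=0..<n. M $$ (i, p i)) (\<Sum>j<n. q j) = (\<Prod>i=0..<n. fls_nth (M $$ (i, p i)) (q (p i)))"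
      using fls_nth_prod_leading[of "{0..<n}" "\<lambda>i. q (p i)" "\<lambda>i. M $$ (i, p i)"] ge pi by simp
    also have "\<dots> = (\<Prod>i=0..<n. ?T $$ (i, p i))" using pi by (intro prod.cong) auto
    finally show ?thesis by (auto simp: sign_def)
  qed
  then show ?thesis unfolding det_def'[OF M] det_def'[OF T] fls_nth_sum by (intro sum.cong) auto
qed

text \<open>A permutation with nonzero contribution never increases \<open>key\<close> and strictly
  decreases it at every point it moves, yet a permutation preserves the sum of the keys; only the
  identity survives. The form with keys suits a basis indexed by pairs, where no linear order is at
  hand.\<close>

lemma det_key_triangular:
  fixes M :: "'a::comm_ring_1 mat" and key :: "nat \<Rightarrow> int"
  assumes M: "M \<in> carrier_mat n n"
    and tri: "\<And>i j. i < n \<Longrightarrow> j < n \<Longrightarrow> i \<noteq> j \<Longrightarrow> M $$ (i,j) \<noteq> 0 \<Longrightarrow> key j < key i"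
  shows "det M = (\<Prod>i<n. M $$ (i,i))"
proof -
  have "signof p * (\<Prod>i=0..<n. M $$ (i, p i)) = 0" if p: "p permutes {0..<n}" "p \<noteq> id" for p
  proof (rule ccontr)
    assume "signof p * (\<Prod>i=0..<n. M $$ (i, p i)) \<noteq> 0"
    then have "(\<Prod>i=0..<n. M $$ (i, p i)) \<noteq> 0" by auto
    then have nz: "M $$ (i, p i) \<noteq> 0" if "i < n" for i
    proof -
      have "\<exists>i\<in>{0..<n}. M $$ (i, p i) = 0 \<Longrightarrow> (\<Prod>i=0..<n. M $$ (i, p i)) = 0"
        by (rule prod_zero) auto
      then show ?thesis using that \<open>(\<Prod>i=0..<n. M $$ (i, p i)) \<noteq> 0\<close> by fastforce
    qed
    have pi: "i < n \<Longrightarrow> p i < n" for i using permutes_in_image[OF p(1), of i] by simp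
    obtain a where a: "p a \<noteq> a" using p(2) by (metis eq_id_iff)
    then have an: "a < n" using p(1) by (meson atLeastLessThan_iff le0 permutes_not_in)
    have le: "key (p i) \<le> key i" if "i < n" for i
      using tri[OF that pi[OF that]] nz[OF that] by (cases "p i = i") auto
    have "(\<Sum>i=0..<n. key (p i)) < (\<Sum>i=0..<n. key i)"
      by (rule sum_strict_mono_ex1) (use le tri[OF an pi[OF an]] nz[OF an] a an in auto)
    moreover have "(\<Sum>i=0..<n. key (p i)) = (\<Sum>i=0..<n. key i)"
      using sum.permute[OF p(1), of key] by (simp add: o_def)
    ultimately show False by simp
  qed
  then have "det M = (\<Sum>p\<in>{id}. signof p * (\<Prod>i=0..<n. M $$ (i, p i)))"
    unfolding det_def'[OF M]
    by (intro sum.mono_neutral_right) (auto simp: permutes_id finite_permutations)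
  then show ?thesis by (simp add: lessThan_atLeast0)
qed

text \<open>For triangular \<open>T\<close> the matrices supported above and to the right of the
  corner \<open>(i,j)\<close> are stable under \<open>ad T\<close>, which multiplies the corner
  entry by a difference of diagonal entries.\<close>

lemma ad_pow_elementary:
  fixes T Z :: "'a::idom mat"
  assumes T: "T \<in> carrier_mat n n" "upper_triangular T" and ij: "i < n" "j < n"
    and Z: "Z \<in> carrier_mat n n" "\<And>a b. a < n \<Longrightarrow> b < n \<Longrightarrow> Z $$ (a,b) \<noteq> 0 \<Longrightarrow> a \<le> i \<and> j \<le> b"
  shows "T * Z - Z * T \<in> carrier_mat n n"
    "\<And>a b. a < n \<Longrightarrow> b < n \<Longrightarrow> (T * Z - Z * T) $$ (a,b) \<noteq> 0 \<Longrightarrow> a \<le> i \<and> j \<le> b"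
    "(T * Z - Z * T) $$ (i,j) = (T $$ (i,i) - T $$ (j,j)) * Z $$ (i,j)"
proof -
  have c: "T * Z \<in> carrier_mat n n" "Z * T \<in> carrier_mat n n" using T Z by auto
  then show "T * Z - Z * T \<in> carrier_mat n n" by (intro minus_carrier_mat)
  have ix: "(T * Z - Z * T) $$ (a,b) = (\<Sum>l<n. T $$ (a,l) * Z $$ (l,b)) - (\<Sum>l<n. Z $$ (a,l) * T $$ (l,b))"
    if "a < n" "b < n" for a b
    using that c T Z by (simp add: index_mult_mat_sum[of _ n _ n _ n] del: index_mult_mat(1))
  have ut: "T $$ (a,b) = 0" if "a < n" "b < a" for a b
    using T that by (auto simp: upper_triangular_def)
  show "a \<le> i \<and> j \<le> b" if ab: "a < n" "b < n" and nz: "(T * Z - Z * T) $$ (a,b) \<noteq> 0" for a b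
  proof -
    have "(\<exists>l<n. T $$ (a,l) * Z $$ (l,b) \<noteq> 0) \<or> (\<exists>l<n. Z $$ (a,l) * T $$ (l,b) \<noteq> 0)"
    proof (rule ccontr)
      assume "\<not> ?thesis"
      then have "(T * Z - Z * T) $$ (a,b) = 0" unfolding ix[OF ab] by (simp add: sum.neutral)
      with nz show False by simp
    qed
    then show ?thesis
    proof
      assume "\<exists>l<n. T $$ (a,l) * Z $$ (l,b) \<noteq> 0"
      then obtain l where l: "l < n" "T $$ (a,l) \<noteq> 0" "Z $$ (l,b) \<noteq> 0" by auto
      then show ?thesis using ut[OF ab(1), of l] Z(2)[of l b] ab by force
    next
      assume "\<exists>l<n. Z $$ (a,l) * T $$ (l,b) \<noteq> 0"
      then obtain l where l: "l < n" "T $$ (l,b) \<noteq> 0" "Z $$ (a,l) \<noteq> 0" by auto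
      then show ?thesis using ut[OF l(1), of b] Z(2)[of a l] ab by force
    qed
  qed
  have "(\<Sum>l<n. T $$ (i,l) * Z $$ (l,j)) = T $$ (i,i) * Z $$ (i,j)"
  proof (subst sum.remove[of _ i])
    have "T $$ (i,l) * Z $$ (l,j) = 0" if "l < n" "l \<noteq> i" for l
      using ut[OF ij(1), of l] Z(2)[OF that(1) ij(2)] that by (cases "l < i") auto
    then show "T $$ (i,i) * Z $$ (i,j) + (\<Sum>l\<in>{..<n}-{i}. T $$ (i,l) * Z $$ (l,j)) = T $$ (i,i) * Z $$ (i,j)"
      by (simp add: sum.neutral)
  qed (use ij in auto)
  moreover have "(\<Sum>l<n. Z $$ (i,l) * T $$ (l,j)) = Z $$ (i,j) * T $$ (j,j)"
  proof (subst sum.remove[of _ j])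
    have "Z $$ (i,l) * T $$ (l,j) = 0" if "l < n" "l \<noteq> j" for l
      using ut[OF that(1), of j] Z(2)[OF ij(1) that(1)] that by (cases "j < l") auto
    then show "Z $$ (i,j) * T $$ (j,j) + (\<Sum>l\<in>{..<n}-{j}. Z $$ (i,l) * T $$ (l,j)) = Z $$ (i,j) * T $$ (j,j)"
      by (simp add: sum.neutral)
  qed (use ij in auto)
  ultimately show "(T * Z - Z * T) $$ (i,j) = (T $$ (i,i) - T $$ (j,j)) * Z $$ (i,j)"
    unfolding ix[OF ij] by (simp add: algebra_simps)
qed

text \<open>Since \<open>R > 0\<close>, differentiating the entries yields a smaller pole order than
  the bracket, so leading coefficients evolve by \<open>ad T\<close>.\<close>

lemma nabla_ad_leading:
  assumes R: "R > 0" and A: "A \<in> carrier_mat n n" "\<And>a b. a < n \<Longrightarrow> b < n \<Longrightarrow> fls_ge 1 (- int R) (A $$ (a,b))"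
    and T: "\<And>a b. a < n \<Longrightarrow> b < n \<Longrightarrow> fls_nth (A $$ (a,b)) (- int R) = T $$ (a,b)" "T \<in> carrier_mat n n"
    and X: "X \<in> carrier_mat n n" "\<And>a b. a < n \<Longrightarrow> b < n \<Longrightarrow> fls_ge 1 (- int q) (X $$ (a,b))"
    and Z: "\<And>a b. a < n \<Longrightarrow> b < n \<Longrightarrow> fls_nth (X $$ (a,b)) (- int q) = Z $$ (a,b)" "Z \<in> carrier_mat n n"
    and ab: "a < n" "b < n"
  shows "fls_ge 1 (- int (q + R)) (nabla_ad fls_theta A X $$ (a,b))"
    "fls_nth (nabla_ad fls_theta A X $$ (a,b)) (- int (q + R)) = (T * Z - Z * T) $$ (a,b)"
proof -
  have s: "- int (q + R) = - int R + - int q" "- int (q + R) = - int q + - int R" by auto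
  have p: "fls_ge 1 (- int (q + R)) (A $$ (a,l) * X $$ (l,b))" "fls_ge 1 (- int (q + R)) (X $$ (a,l) * A $$ (l,b))"
    if "l < n" for l
    using fls_ge_mult[OF _ A(2)[OF ab(1) that] X(2)[OF that ab(2)]]
      fls_ge_mult[OF _ X(2)[OF ab(1) that] A(2)[OF that ab(2)]] by (simp_all add: algebra_simps)
  have l1: "fls_nth (A $$ (a,l) * X $$ (l,b)) (- int (q + R)) = T $$ (a,l) * Z $$ (l,b)" if "l < n" for l
    unfolding s(1) fls_nth_mult_leading[OF A(2)[OF ab(1) that] X(2)[OF that ab(2)]] using that ab T Z by simp
  have l2: "fls_nth (X $$ (a,l) * A $$ (l,b)) (- int (q + R)) = Z $$ (a,l) * T $$ (l,b)" if "l < n" for l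
    unfolding s(2) fls_nth_mult_leading[OF X(2)[OF ab(1) that] A(2)[OF that ab(2)]] using that ab T Z by simp
  have th: "fls_ge 1 (- int (q + R)) (fls_theta (X $$ (a,b)))"
    by (rule fls_ge_mono[OF fls_ge_theta[OF X(2)[OF ab]]]) simp
  then show "fls_ge 1 (- int (q + R)) (nabla_ad fls_theta A X $$ (a,b))"
    unfolding nabla_ad_index[OF A(1) X(1) ab] using p by (intro fls_ge_add fls_ge_diff fls_ge_sum) auto
  have "fls_nth (X $$ (a,b)) (- int (q + R)) = 0"
    using X(2)[OF ab] R unfolding fls_ge_def by auto
  moreover have "(T * Z - Z * T) $$ (a,b) = (\<Sum>l<n. T $$ (a,l) * Z $$ (l,b)) - (\<Sum>l<n. Z $$ (a,l) * T $$ (l,b))"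
    using ab T(2) Z(2) by (simp add: index_mult_mat_sum[of _ n _ n _ n] del: index_mult_mat(1))
  ultimately show "fls_nth (nabla_ad fls_theta A X $$ (a,b)) (- int (q + R)) = (T * Z - Z * T) $$ (a,b)"
    unfolding nabla_ad_index[OF A(1) X(1) ab] using l1 l2 by (simp add: fls_nth_sum)
qed

lemma mat_mult_col_mat:
  assumes M: "M \<in> carrier_mat n n" and f: "\<And>j. j < n \<Longrightarrow> f j \<in> carrier_vec n"
  shows "M * mat n n (\<lambda>(i,j). f j $ i) = mat n n (\<lambda>(i,j). (M *\<^sub>v f j) $ i)"
proof (rule eq_matI)
  fix i j assume "i < dim_row (mat n n (\<lambda>(i,j). (M *\<^sub>v f j) $ i))" "j < dim_col (mat n n (\<lambda>(i,j). (M *\<^sub>v f j) $ i))"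
  then have ij: "i < n" "j < n" by auto
  have "col (mat n n (\<lambda>(i,j). f j $ i)) j = f j" by (rule eq_vecI) (use ij f[OF ij(2)] in auto)
  then show "(M * mat n n (\<lambda>(i,j). f j $ i)) $$ (i,j) = mat n n (\<lambda>(i,j). (M *\<^sub>v f j) $ i) $$ (i,j)"
    using ij M by simp
qed (use M in auto)

lemma sl_vec_basis:
  assumes n: "n \<ge> 1" and l: "l < n\<^sup>2 - 1"
  shows "sl_vec n (sl_basis n l) = unit_vec (n\<^sup>2 - 1) l"
proof (rule eq_vecI)
  let ?m = "n\<^sup>2 - 1"
  fix k assume "k < dim_vec (unit_vec ?m l)"
  then have k: "k < ?m" by simp
  have "k = l" if "k div n = l div n" "k mod n = l mod n" using that by (metis div_mult_mod_eq)
  then show "sl_vec n (sl_basis n l) $ k = unit_vec ?m l $ k"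
    using k l sl_index[OF n k] by (auto simp: sl_vec_def sl_basis_def)
qed (simp add: sl_vec_def)

text \<open>
  Differentiate \<open>k\<close> times those basis vectors \<open>E\<^sub>i\<^sub>j\<close> for which the eigenvalue \<open>T\<^sub>i\<^sub>i - T\<^sub>j\<^sub>j\<close> of
  \<open>ad T\<close> is nonzero and leave the others alone.  The determinant of the resulting vectors has
  a pole of order \<open>R k\<close> times the number of such pairs, up to a constant, whereas in the
  slope form its pole order is at most \<open>k \<Sum> d\<^sub>i\<close> up to a constant.
\<close>

lemma irregularity_lower_bound:
  assumes n: "n \<ge> 1" and A: "A \<in> carrier_mat n n" and G: "G \<in> carrier_mat n n" "det G \<noteq> 0"
    and g: "g \<in> carrier_mat (n\<^sup>2 - 1) (n\<^sup>2 - 1)" "det g \<noteq> 0"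
    and sf: "slope_form (n\<^sup>2 - 1) d (gauge fls_theta g (ad_mat n A))"
    and R: "R > 0" and ge: "\<And>a b. a < n \<Longrightarrow> b < n \<Longrightarrow> fls_ge 1 (- int R) (gauge fls_theta G A $$ (a,b))"
    and T: "T \<in> carrier_mat n n" "upper_triangular T"
      "\<And>a b. a < n \<Longrightarrow> b < n \<Longrightarrow> fls_nth (gauge fls_theta G A $$ (a,b)) (- int R) = T $$ (a,b)"
  shows "R * card {(i,j). i < n \<and> j < n \<and> T $$ (i,i) \<noteq> T $$ (j,j)} \<le> (\<Sum>l<n\<^sup>2 - 1. d l)"
proof -
  let ?m = "n\<^sup>2 - 1"
  let ?A = "gauge fls_theta G A"
  let ?H = "gauge fls_theta g (ad_mat n A)"
  \<comment> \<open>Coordinates on which \<open>ad T\<close> has a nonzero eigenvalue. The condition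
    excludes equal row and column, so the diagonal part of the basis is avoided.\<close>
  define S where "S = {l. l < ?m \<and> T $$ (l div n, l div n) \<noteq> T $$ (l mod n, l mod n)}"
  have Ac: "?A \<in> carrier_mat n n" using G A by simp
  have "card {(i,j). i < n \<and> j < n \<and> T $$ (i,i) \<noteq> T $$ (j,j)} = card S"
  proof (rule bij_betw_same_card[OF bij_betw_byWitness[where f' = "\<lambda>l. (l div n, l mod n)"]])
    show "\<forall>a\<in>{(i,j). i < n \<and> j < n \<and> T $$ (i,i) \<noteq> T $$ (j,j)}. ((case a of (i,j) \<Rightarrow> i * n + j) div n, (case a of (i,j) \<Rightarrow> i * n + j) mod n) = a"
      by auto
    show "\<forall>l\<in>S. (case (l div n, l mod n) of (i,j) \<Rightarrow> i * n + j) = l" by auto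
    show "(\<lambda>(i,j). i * n + j) ` {(i,j). i < n \<and> j < n \<and> T $$ (i,i) \<noteq> T $$ (j,j)} \<subseteq> S"
    proof (clarsimp simp: S_def)
      fix i j assume "i < n" "j < n" "T $$ (i,i) \<noteq> T $$ (j,j)"
      then show "i * n + j < ?m" using sl_index_less[of i n j] by auto
    qed
    show "(\<lambda>l. (l div n, l mod n)) ` S \<subseteq> {(i,j). i < n \<and> j < n \<and> T $$ (i,i) \<noteq> T $$ (j,j)}"
      using sl_index[OF n] by (auto simp: S_def)
  qed
  moreover have "R * card S \<le> (\<Sum>l<?m. d l)"
  proof -
    define E where "E l = (sl_basis n l :: complex fls mat)" for l
    define E' where "E' l = (sl_basis n l :: complex mat)" for l
    have Ec: "E l \<in> carrier_mat n n" "E' l \<in> carrier_mat n n" for l by (auto simp: E_def E'_def)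
    have Esl: "E l \<in> sl_mats n UNIV" if "l < ?m" for l
    proof -
      define X where "X = sl_of_vec n (unit_vec ?m l :: complex fls vec)"
      have X: "X \<in> sl_mats n UNIV" "sl_vec n X = unit_vec ?m l"
        using sl_of_vec_sl[OF n, of "unit_vec ?m l"] sl_vec_of_vec[OF n, of "unit_vec ?m l"] by (auto simp: X_def)
      then have Xc: "X \<in> carrier_mat n n" by (simp add: sl_mats_UNIV)
      have "E l = X"
      proof (rule eq_matI)
        fix i j assume "i < dim_row X" "j < dim_col X"
        then have ij: "i < n" "j < n" using Xc by auto
        have "(\<Sum>k<?m. sl_basis n k $$ (i,j) * X $$ (k div n, k mod n)) = (\<Sum>k<?m. if k = l then E l $$ (i,j) else 0)"
        proof (intro sum.cong refl)
          fix k assume "k \<in> {..<?m}"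
          then have "X $$ (k div n, k mod n) = (if k = l then 1 else 0)"
            using arg_cong[OF X(2), of "\<lambda>v. v $ k"] that by (auto simp: sl_vec_def)
          then show "sl_basis n k $$ (i,j) * X $$ (k div n, k mod n) = (if k = l then E l $$ (i,j) else 0)"
            by (simp add: E_def)
        qed
        then show "E l $$ (i,j) = X $$ (i,j)" using sum_sl_basis[OF n X(1) ij] that by simp
      qed (use Ec Xc in auto)
      then show ?thesis using X by simp
    qed
    define W where "W k l = ((\<lambda>Z. T * Z - Z * T) ^^ k) (E' l)" for k l
    have Wc: "W k l \<in> carrier_mat n n" for k l
      unfolding W_def by (induction k) (use Ec T in \<open>auto intro!: minus_carrier_mat\<close>)
    define V where "V k l = (nabla_ad fls_theta ?A ^^ k) (E l)" for k l
    have Vc: "V k l \<in> carrier_mat n n" for k l unfolding V_def using Ac Ec by simp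
    have VW: "fls_ge 1 (- int (k * R)) (V k l $$ (a,b)) \<and> fls_nth (V k l $$ (a,b)) (- int (k * R)) = W k l $$ (a,b)"
      if "a < n" "b < n" for k l a b
      using that
    proof (induction k arbitrary: a b)
      case 0
      then show ?case by (auto simp: V_def W_def E_def E'_def sl_basis_def fls_ge_def)
    next
      case (Suc k)
      have e: "V (Suc k) l = nabla_ad fls_theta ?A (V k l)" "W (Suc k) l = T * W k l - W k l * T"
        by (simp_all add: V_def W_def)
      have s: "Suc k * R = k * R + R" by simp
      show ?case unfolding e s
        by (intro conjI nabla_ad_leading[OF R Ac ge T(3) T(1) Vc]) (use Suc Wc in auto)
    qed
    have Wtri: "W k l $$ (l div n, l mod n) = (T $$ (l div n, l div n) - T $$ (l mod n, l mod n)) ^ k \<and>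
        (\<forall>a<n. \<forall>b<n. W k l $$ (a,b) \<noteq> 0 \<longrightarrow> a \<le> l div n \<and> l mod n \<le> b)" if l: "l \<in> S" for k l
    proof (induction k)
      case 0
      have "l div n \<noteq> l mod n" "l < ?m" using l by (auto simp: S_def)
      then show ?case using sl_index[OF n, of l] by (auto simp: W_def E'_def sl_basis_def split: if_splits)
    next
      case (Suc k)
      have lm: "l < ?m" using l by (simp add: S_def)
      have e: "W (Suc k) l = T * W k l - W k l * T" by (simp add: W_def)
      note ad = ad_pow_elementary[OF T(1,2) sl_index(1,2)[OF n lm] Wc[of k l]]
      have "W (Suc k) l $$ (l div n, l mod n) = (T $$ (l div n, l div n) - T $$ (l mod n, l mod n)) * W k l $$ (l div n, l mod n)"
        unfolding e by (rule ad(3)) (use Suc in auto)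
      moreover have "a \<le> l div n \<and> l mod n \<le> b" if "a < n" "b < n" "W (Suc k) l $$ (a,b) \<noteq> 0" for a b
        by (rule ad(2)[OF _ that(1,2) that(3)[unfolded e]]) (use Suc in auto)
      ultimately show ?case using Suc by simp
    qed
    define Y where "Y k l = (if l \<in> S then V k l else E l)" for k l
    have Ysl: "Y k l \<in> sl_mats n UNIV" if "l < ?m" for k l
    proof -
      have "V k l \<in> sl_mats n UNIV" unfolding V_def
        using fls_theta.nabla_ad_mat_pow[OF n Ac Esl[OF that]] by blast
      then show ?thesis using Esl[OF that] by (simp add: Y_def)
    qed
    define M where "M k = mat ?m ?m (\<lambda>(i,l). sl_vec n (Y k l) $ i)" for k
    have Mc: "M k \<in> carrier_mat ?m ?m" for k by (simp add: M_def)
    define q where "q k l = (if l \<in> S then - int (k * R) else 0)" for k l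
    have Mge: "fls_ge 1 (q k l) (M k $$ (i,l)) \<and> fls_nth (M k $$ (i,l)) (q k l) =
        (if l \<in> S then W k l $$ (i div n, i mod n) else if i = l then 1 else 0)"
      if il: "i < ?m" "l < ?m" for k i l
    proof (cases "l \<in> S")
      case True
      then show ?thesis using il sl_index[OF n il(1)] VW[of "i div n" "i mod n" k l]
        by (simp add: M_def Y_def q_def sl_vec_def)
    next
      case False
      have "M k $$ (i,l) = (if i = l then 1 else 0)"
        using False il sl_vec_basis[OF n il(2), where 'a = "complex fls"] by (simp add: M_def Y_def E_def)
      then show ?thesis using False fls_ge_1_0 by (auto simp: q_def)
    qed
    have qs: "(\<Sum>l<?m. q k l) = - int (k * R * card S)" for k
    proof -
      have "(\<Sum>l<?m. q k l) = (\<Sum>l\<in>S. - int (k * R))"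
        unfolding q_def by (rule sum.mono_neutral_cong_right) (auto simp: S_def)
      then show ?thesis by simp
    qed
    have detM: "fls_nth (det (M k)) (- int (k * R * card S)) \<noteq> 0" for k
    proof -
      let ?T = "mat ?m ?m (\<lambda>(i,l). fls_nth (M k $$ (i,l)) (q k l))"
      have ix: "?T $$ (i,l) = (if l \<in> S then W k l $$ (i div n, i mod n) else if i = l then 1 else 0)"
        if "i < ?m" "l < ?m" for i l using Mge[OF that] that by simp
      have "det ?T = (\<Prod>i<?m. ?T $$ (i,i))"
      \<comment> \<open>\<open>ad T\<close> moves a matrix unit up and to the right, that is,
        towards larger column minus row.\<close>
      proof (rule det_key_triangular[where key = "\<lambda>i. int (i mod n) - int (i div n)"])
        fix i l assume il: "i < ?m" "l < ?m" "i \<noteq> l" "?T $$ (i,l) \<noteq> 0"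
        then have lS: "l \<in> S" and nz: "W k l $$ (i div n, i mod n) \<noteq> 0"
          using ix[OF il(1,2)] by (auto split: if_splits)
        have "i div n \<le> l div n" "l mod n \<le> i mod n"
          using Wtri[OF lS, of k] nz sl_index(1,2)[OF n il(1)] by blast+
        moreover have "i div n \<noteq> l div n \<or> i mod n \<noteq> l mod n" using il(3) by (metis div_mult_mod_eq)
        ultimately show "int (l mod n) - int (l div n) < int (i mod n) - int (i div n)" by linarith
      qed simp
      also have "\<dots> \<noteq> 0"
      proof -
        have "?T $$ (i,i) \<noteq> 0" if "i < ?m" for i
          using ix[OF that that] Wtri[of i k] by (auto simp: S_def)
        then show ?thesis by (simp add: prod_zero_iff)
      qed
      finally have nz: "det ?T \<noteq> 0" .
      have "fls_nth (det (M k)) (\<Sum>l<?m. q k l) = det ?T"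
        by (rule det_leading[OF Mc]) (use Mge in blast)
      then show ?thesis using nz unfolding qs by simp
    qed
    note mG = minv[OF G]
    have mG': "det (minv G) \<noteq> 0" "minv (minv G) = G" using det_minv[OF G] G minv_minv[OF G] by auto
    \<comment> \<open>Passes from coordinates in the frame \<open>G\<close> to those of the slope
      form. Its determinant does not depend on \<open>k\<close> and enters the comparison as a
      constant.\<close>
    define P where "P = g * Ad_mat n (minv G)"
    have Ad: "Ad_mat n (minv G) \<in> carrier_mat ?m ?m" by (simp add: Ad_mat_def)
    have Pc: "P \<in> carrier_mat ?m ?m" using g Ad by (simp add: P_def)
    have detP: "det P \<noteq> 0"
      using det_mult[OF g(1) Ad] g det_Ad_mat_nonzero[OF n mG(1) mG'(1)] by (simp add: P_def)
    have col: "P *\<^sub>v sl_vec n X = g *\<^sub>v sl_vec n (minv G * X * G)" if "X \<in> sl_mats n UNIV" for X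
    proof -
      have "P *\<^sub>v sl_vec n X = g *\<^sub>v (Ad_mat n (minv G) *\<^sub>v sl_vec n X)"
        unfolding P_def by (rule assoc_mult_mat_vec[OF g(1) Ad]) simp
      then show ?thesis using Ad_mat_apply[OF n that mG(1) mG'(1)] mG'(2) by simp
    qed
    have Hc: "?H \<in> carrier_mat ?m ?m" using g by simp
    have y0: "\<exists>c::nat. \<forall>x\<in>{..<?m} \<times> {..<?m}. fls_ge 1 (- int c) ((\<lambda>(i,l). (P *\<^sub>v sl_vec n (E l)) $ i) x)"
      by (rule fls_ge_exists_uniform) auto
    then obtain c where c: "\<And>i l. i < ?m \<Longrightarrow> l < ?m \<Longrightarrow> fls_ge 1 (- int c) ((P *\<^sub>v sl_vec n (E l)) $ i)"
      by force
    have row: "fls_ge 1 ((- int (k * d i)) + (- int c)) ((P *\<^sub>v sl_vec n (Y k l)) $ i)" if il: "i < ?m" "l < ?m" for k i l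
    proof (cases "l \<in> S")
      case False
      then show ?thesis using fls_ge_mono[OF c[OF il]] by (simp add: Y_def)
    next
      case True
      have "P *\<^sub>v sl_vec n (Y k l) = (nabla fls_theta ?H ^^ k) (P *\<^sub>v sl_vec n (E l))"
        unfolding col[OF Ysl[OF il(2)]] col[OF Esl[OF il(2)]] using True
        by (simp add: Y_def V_def nabla_pow_ad_gauge[OF n A G g Esl[OF il(2)]])
      moreover have "fls_ge 1 (- int (k * d i) - int c) ((nabla fls_theta ?H ^^ k) (P *\<^sub>v sl_vec n (E l)) $ i)"
        by (rule slope_growth[OF sf _ c[OF _ il(2)] il(1)]) (use Pc in auto)
      ultimately show ?thesis by simp
    qed
    \<comment> \<open>Row weights \<open>k * d i\<close> together with constant column weights: the
      determinant turns the growth bounds of the rows into the sum of the slopes.\<close>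
    have dPM: "fls_ge 1 (- int (k * (\<Sum>l<?m. d l)) - int (?m * c)) (det P * det (M k))" for k
    proof -
      have "P * M k = mat ?m ?m (\<lambda>(i,l). (P *\<^sub>v sl_vec n (Y k l)) $ i)"
        unfolding M_def by (rule mat_mult_col_mat[OF Pc]) simp
      then have "fls_ge 1 ((\<Sum>i<?m. - int (k * d i)) + (\<Sum>l<?m. - int c)) (det (P * M k))"
        by (intro fls_ge_det) (use row in auto)
      moreover have "(\<Sum>i<?m. - int (k * d i)) + (\<Sum>l<?m. - int c) = - int (k * (\<Sum>l<?m. d l)) - int (?m * c)"
        by (simp add: sum_negf sum_distrib_left)
      ultimately show ?thesis using det_mult[OF Pc Mc] by simp
    qed
    \<comment> \<open>The two estimates differ by a constant independent of \<open>k\<close>; once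
      \<open>k\<close> exceeds it, the inequality descends to the integer coefficients of
      \<open>k\<close>.\<close>
    define k where "k = ?m * c + nat \<bar>fls_subdegree (det P)\<bar> + 1"
    have nz: "det P * det (M k) \<noteq> 0" using detP detM[of k] by auto
    have "fls_subdegree (det (M k)) \<le> - int (k * R * card S)"
      by (rule fls_subdegree_leI) (rule detM)
    then have "fls_subdegree (det P * det (M k)) \<le> fls_subdegree (det P) - int (k * R * card S)"
      using nz by simp
    moreover have "- int (k * (\<Sum>l<?m. d l)) - int (?m * c) \<le> fls_subdegree (det P * det (M k))"
      using dPM[of k] nth_fls_subdegree_nonzero[OF nz] unfolding fls_ge_def by force
    ultimately have "int (k * (R * card S)) \<le> int (k * (\<Sum>l<?m. d l)) + (int (?m * c) + fls_subdegree (det P))"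
      by (simp add: mult.assoc)
    also have "\<dots> < int (k * (\<Sum>l<?m. d l)) + int k" by (simp add: k_def)
    finally have "int (k * (R * card S)) < int (k * ((\<Sum>l<?m. d l) + 1))" by (simp add: algebra_simps)
    then have "k * (R * card S) < k * ((\<Sum>l<?m. d l) + 1)" by (simp only: of_nat_less_iff)
    then show ?thesis by simp
  qed
  ultimately show ?thesis by simp
qed

section \<open>The spectrum of the leading coefficient\<close>

lemma order_prod_linear:
  fixes e :: "nat \<Rightarrow> 'a::idom"
  shows "Polynomial.order c (\<Prod>i<n. [:- e i, 1:]) = card {i. i < n \<and> e i = c}"
proof (induction n)
  case (Suc n)
  have nz: "(\<Prod>i<n. [:- e i, 1:]) * [:- e n, 1:] \<noteq> 0"
    by (simp only: mult_eq_0_iff prod_zero_iff finite_lessThan) auto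
  have o: "Polynomial.order c [:- e n, 1:] = (if e n = c then 1 else 0)"
  proof (cases "e n = c")
    case True
    then show ?thesis using order_power_n_n[of c 1] by simp
  next
    case False
    then show ?thesis by (auto intro: order_0I)
  qed
  have "{i. i < Suc n \<and> e i = c} = (if e n = c then insert n {i. i < n \<and> e i = c} else {i. i < n \<and> e i = c})"
    by (auto simp: less_Suc_eq)
  then have "card {i. i < Suc n \<and> e i = c} = card {i. i < n \<and> e i = c} + (if e n = c then 1 else 0)"
    by (simp add: card_insert_if)
  then show ?case using order_mult[OF nz] Suc o by (simp only: prod.lessThan_Suc)
qed simp

lemma order_char_poly_upper_triangular:
  assumes "(T :: 'a::idom mat) \<in> carrier_mat n n" "upper_triangular T"
  shows "Polynomial.order c (char_poly T) = card {i. i < n \<and> T $$ (i,i) = c}"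
proof -
  have "char_poly T = (\<Prod>a\<leftarrow>diag_mat T. [:- a, 1:])"
    by (rule char_poly_upper_triangular[OF assms])
  also have "\<dots> = (\<Prod>i<n. [:- T $$ (i,i), 1:])"
    using assms(1) prod.distinct_set_conv_list[of "[0..<n]" "\<lambda>i. [:- T $$ (i,i), 1:]"]
    by (simp add: diag_mat_def lessThan_atLeast0 o_def)
  finally show ?thesis by (simp add: order_prod_linear)
qed

text \<open>\<open>rot\<close> says that conjugation by the diagonal matrix of the
  \<open>z ^ i\<close> multiplies \<open>A\<close> by \<open>z\<close>, so \<open>A\<close> is
  similar to \<open>z A\<close>. Multiplicities are read off from a triangular form through the
  characteristic polynomial.\<close>

lemma rotation_invariant_spectrum:
  fixes A T :: "'a::field mat"
  assumes A: "A \<in> carrier_mat n n" and T: "T \<in> carrier_mat n n" "upper_triangular T"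
    and sim: "similar_mat A T" and z: "z \<noteq> 0"
    and rot: "\<And>i j. i < n \<Longrightarrow> j < n \<Longrightarrow> z ^ i * A $$ (i,j) = z * A $$ (i,j) * z ^ j"
  shows "card {i. i < n \<and> T $$ (i,i) = z * c} = card {i. i < n \<and> T $$ (i,i) = c}"
proof -
  define P where "P = mat_diag n (\<lambda>i. inverse (z ^ i))"
  define Q where "Q = mat_diag n (\<lambda>i. z ^ i)"
  have PQ: "P \<in> carrier_mat n n" "Q \<in> carrier_mat n n" by (auto simp: P_def Q_def)
  have "P * Q = 1\<^sub>m n" "Q * P = 1\<^sub>m n" unfolding P_def Q_def mat_diag_diag
    using z by (simp_all add: mat_diag_def one_mat_def cong: if_cong)
  moreover have "A = P * (z \<cdot>\<^sub>m A) * Q"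
  proof (rule eq_matI)
    fix i j assume "i < dim_row (P * (z \<cdot>\<^sub>m A) * Q)" "j < dim_col (P * (z \<cdot>\<^sub>m A) * Q)"
    then have ij: "i < n" "j < n" using PQ by auto
    have "(P * (z \<cdot>\<^sub>m A) * Q) $$ (i,j) = inverse (z ^ i) * (z * A $$ (i,j)) * z ^ j"
      using ij A unfolding P_def Q_def
      by (subst mat_diag_mult_right[of _ n n]) (auto simp: mat_diag_mult_left[of _ n n])
    also have "\<dots> = inverse (z ^ i) * (z ^ i * A $$ (i,j))"
      unfolding rot[OF ij] by (simp only: mult.assoc)
    also have "\<dots> = A $$ (i,j)" using z by simp
    finally show "A $$ (i,j) = (P * (z \<cdot>\<^sub>m A) * Q) $$ (i,j)" ..
  qed (use A PQ in auto)
  ultimately have s1: "similar_mat A (z \<cdot>\<^sub>m A)"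
    by (intro similar_matI[of _ _ P Q n]) (use A PQ in auto)
  have "similar_mat (z \<cdot>\<^sub>m A) (z \<cdot>\<^sub>m T)"
  proof -
    obtain P Q where w: "similar_mat_wit A T P Q" using sim by (auto simp: similar_mat_def)
    note d = similar_mat_witD2[OF A w]
    show ?thesis
    proof (rule similar_matI[of _ _ P Q n])
      have "P * (z \<cdot>\<^sub>m T) * Q = z \<cdot>\<^sub>m (P * T * Q)"
        using d mult_smult_distrib[of P n n T n z] mult_smult_assoc_mat[of "P * T" n n Q n z] by simp
      then show "z \<cdot>\<^sub>m A = P * (z \<cdot>\<^sub>m T) * Q" using d(3) by simp
    qed (use d in auto)
  qed
  then have "similar_mat T (z \<cdot>\<^sub>m T)"
    using s1 sim by (meson similar_mat_sym similar_mat_trans)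
  then have "char_poly T = char_poly (z \<cdot>\<^sub>m T)" by (rule char_poly_similar)
  moreover have "upper_triangular (z \<cdot>\<^sub>m T)" using T by (auto simp: upper_triangular_def)
  ultimately have "card {i. i < n \<and> T $$ (i,i) = z * c} = card {i. i < n \<and> (z \<cdot>\<^sub>m T) $$ (i,i) = z * c}"
    using order_char_poly_upper_triangular[OF T, of "z * c"]
      order_char_poly_upper_triangular[of "z \<cdot>\<^sub>m T" n "z * c"] T by simp
  also have "{i. i < n \<and> (z \<cdot>\<^sub>m T) $$ (i,i) = z * c} = {i. i < n \<and> T $$ (i,i) = c}"
    using T z by auto
  finally show ?thesis .
qed

lemma card_distinct_pairs:
  "card {(i,j). i < n \<and> j < n \<and> e i \<noteq> e j} = (\<Sum>i<n. n - card {j. j < n \<and> e j = e i})"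
proof -
  have "{(i,j). i < n \<and> j < n \<and> e i \<noteq> e j} = Sigma {..<n} (\<lambda>i. {..<n} - {j. j < n \<and> e j = e i})" by auto
  then have "card {(i,j). i < n \<and> j < n \<and> e i \<noteq> e j} = (\<Sum>i<n. card ({..<n} - {j. j < n \<and> e j = e i}))" by simp
  also have "\<dots> = (\<Sum>i<n. n - card {j. j < n \<and> e j = e i})"
    by (intro sum.cong refl, subst card_Diff_subset) auto
  finally show ?thesis .
qed

text \<open>\<open>s = 1\<close> is impossible: with sum zero and not all zero, every eigenvalue
  differs from some other one, giving at least \<open>n\<close> pairs. For \<open>s \<ge> 2\<close>
  a nonzero eigenvalue has \<open>s\<close> distinct rotations of equal multiplicity, so this
  multiplicity is at most \<open>x / s\<close>, where \<open>x\<close> counts the nonzero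
  eigenvalues. This produces so many pairs that the bound holds only in the extreme case of a single
  simple orbit without zero eigenvalues. The name recalls that \<open>n\<close> is the Coxeter
  number of the group.\<close>

lemma coxeter_spectrum:
  fixes e :: "nat \<Rightarrow> complex"
  assumes n: "n \<ge> 2" and r: "r > 0" and s: "s > 0"
    and bound: "r * card {(i,j). i < n \<and> j < n \<and> e i \<noteq> e j} \<le> s * (n - 1)"
    and sum0: "(\<Sum>i<n. e i) = 0" and nz: "\<exists>i<n. e i \<noteq> 0"
    and rot: "\<And>z c. z ^ s = 1 \<Longrightarrow> card {i. i < n \<and> e i = z * c} = card {i. i < n \<and> e i = c}"
  shows "r = 1 \<and> s = n"
proof -
  define N where "N c = card {i. i < n \<and> e i = c}" for c
  define \<rho> where "\<rho> = (\<Sum>i<n. n - N (e i))"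
  have Nn: "N c \<le> n" for c
    using card_mono[of "{..<n}" "{i. i < n \<and> e i = c}"] by (auto simp: N_def)
  have b: "r * \<rho> \<le> s * (n - 1)" using bound unfolding card_distinct_pairs \<rho>_def N_def .
  have lt: "N (e i) < n" if i: "i < n" for i
  proof (rule ccontr)
    assume "\<not> N (e i) < n"
    then have "card {j. j < n \<and> e j = e i} = card {..<n}" using Nn[of "e i"] by (simp add: N_def)
    then have "{j. j < n \<and> e j = e i} = {..<n}" by (intro card_subset_eq) auto
    then have all: "e j = e i" if "j < n" for j using that by auto
    then have "(\<Sum>j<n. e j) = of_nat n * e i" by simp
    then have "e i = 0" using sum0 n by simp
    then show False using nz all by auto
  qed
  have "s \<noteq> 1"
  proof
    assume "s = 1"
    have "(\<Sum>i<n. 1) \<le> \<rho>" unfolding \<rho>_def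
    proof (rule sum_mono)
      fix i assume "i \<in> {..<n}" then show "1 \<le> n - N (e i)" using lt[of i] by simp
    qed
    then have "n \<le> r * \<rho>" using r by (cases r) auto
    then show False using b \<open>s = 1\<close> n by simp
  qed
  then have s2: "s \<ge> 2" using s by simp
  define y x where "y = N 0" and "x = n - N 0"
  have xy: "n = x + y" using Nn[of 0] by (simp add: x_def y_def)
  have xcard: "x = card {i. i < n \<and> e i \<noteq> 0}"
  proof -
    have "{i. i < n \<and> e i \<noteq> 0} = {..<n} - {i. i < n \<and> e i = 0}" by auto
    then show ?thesis unfolding x_def N_def by (simp, subst card_Diff_subset) auto
  qed
  have orbit: "s * N c \<le> x" if c: "c \<noteq> 0" for c
  proof -
    have fin: "finite {z::complex. z ^ s = 1}" and card: "card {z::complex. z ^ s = 1} = s"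
      using card_nth_roots[of 1 s] s finite_nth_roots[of s 1] by auto
    have "card (\<Union>z\<in>{z. z ^ s = 1}. {i. i < n \<and> e i = z * c}) = (\<Sum>z\<in>{z. z ^ s = 1}. card {i. i < n \<and> e i = z * c})"
      by (rule card_UN_disjoint) (use fin c in auto)
    also have "\<dots> = (\<Sum>z\<in>{z::complex. z ^ s = 1}. N c)"
      by (rule sum.cong) (auto simp: rot N_def)
    also have "\<dots> = s * N c" by (simp add: card)
    finally have "s * N c = card (\<Union>z\<in>{z. z ^ s = 1}. {i. i < n \<and> e i = z * c})" ..
    also have "\<dots> \<le> card {i. i < n \<and> e i \<noteq> 0}"
    proof (rule card_mono)
      show "(\<Union>z\<in>{z. z ^ s = 1}. {i. i < n \<and> e i = z * c}) \<subseteq> {i. i < n \<and> e i \<noteq> 0}"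
        using c s by (auto simp: power_0_left)
    qed simp
    finally show ?thesis by (simp add: xcard)
  qed
  have xs: "s \<le> x"
  proof -
    obtain i where i: "i < n" "e i \<noteq> 0" using nz by auto
    have "{j. j < n \<and> e j = e i} \<noteq> {}" using i by auto
    then have "N (e i) > 0" unfolding N_def by (simp add: card_gt_0_iff)
    then show ?thesis using orbit[OF i(2)] by (metis Suc_leI mult_le_mono2 mult.right_neutral One_nat_def order.trans)
  qed
  \<comment> \<open>A zero eigenvalue differs from the \<open>x\<close> nonzero ones, a nonzero one
    from at least \<open>n - x / s\<close> others; multiplication by \<open>s\<close> keeps the
    estimate in the integers.\<close>
  have rho: "int s * int \<rho> \<ge> int y * (int s * int x) + int x * (int s * int n - int x)"
  proof -
    have "int s * int \<rho> = (\<Sum>i<n. int s * int n - int s * int (N (e i)))"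
      unfolding \<rho>_def of_nat_sum sum_distrib_left using Nn
      by (intro sum.cong refl) (simp add: of_nat_diff right_diff_distrib)
    also have "\<dots> \<ge> (\<Sum>i<n. if e i = 0 then int s * int x else int s * int n - int x)"
    proof (rule sum_mono)
      fix i assume "i \<in> {..<n}"
      show "(if e i = 0 then int s * int x else int s * int n - int x) \<le> int s * int n - int s * int (N (e i))"
      proof (cases "e i = 0")
        case True
        then show ?thesis by (simp add: xy y_def algebra_simps)
      next
        case False
        have "int (s * N (e i)) \<le> int x" using orbit[OF False] by (simp only: of_nat_le_iff)
        then show ?thesis using False by simp
      qed
    qed
    also have "(\<Sum>i<n. if e i = 0 then int s * int x else int s * int n - int x) =
        (\<Sum>i\<in>{..<n} \<inter> {i. e i = 0}. int s * int x) + (\<Sum>i\<in>{..<n} \<inter> - {i. e i = 0}. int s * int n - int x)"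
      by (rule sum.If_cases) simp
    also have "{..<n} \<inter> {i. e i = 0} = {i. i < n \<and> e i = 0}" by auto
    also have "{..<n} \<inter> - {i. e i = 0} = {i. i < n \<and> e i \<noteq> 0}" by auto
    finally show ?thesis by (simp add: xcard[symmetric] y_def N_def)
  qed
  define X Y S \<R> where "X = int x" and "Y = int y" and "S = int s" and "\<R> = int r"
  have pos: "X \<ge> S" "S \<ge> 2" "Y \<ge> 0" "\<R> \<ge> 1" using xs s2 r by (auto simp: X_def Y_def S_def \<R>_def)
  have "int (r * \<rho>) \<le> int (s * (n - 1))" using b by (simp only: of_nat_le_iff)
  then have "\<R> * int \<rho> \<le> S * (X + Y - 1)" using n by (simp add: \<R>_def S_def X_def Y_def xy)
  then have "S * (\<R> * int \<rho>) \<le> S * (S * (X + Y - 1))" using pos by (intro mult_left_mono) auto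
  moreover have "\<R> * (Y * (S * X) + X * (S * (X + Y) - X)) \<le> \<R> * (S * int \<rho>)"
    using rho pos by (intro mult_left_mono) (auto simp: X_def Y_def S_def xy)
  ultimately have main: "\<R> * (Y * (S * X) + X * (S * (X + Y) - X)) \<le> S * (S * (X + Y - 1))"
    by (simp add: mult.left_commute)
  have q: "Y * (S * X) + X * (S * (X + Y) - X) = 2 * (S * X * Y) + (S - 1) * X\<^sup>2"
    by (simp add: algebra_simps power2_eq_square)
  have qpos: "2 * (S * X * Y) + (S - 1) * X\<^sup>2 > 0"
  proof -
    have "S * X * Y \<ge> 0" "(S - 1) * X\<^sup>2 > 0" using pos by (auto intro!: mult_nonneg_nonneg mult_pos_pos)
    then show ?thesis by linarith
  qed
  have "1 * (2 * (S * X * Y) + (S - 1) * X\<^sup>2) \<le> \<R> * (2 * (S * X * Y) + (S - 1) * X\<^sup>2)"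
    using pos qpos by (intro mult_right_mono) auto
  then have le: "2 * (S * X * Y) + (S - 1) * X\<^sup>2 \<le> S * (S * (X + Y - 1))"
    using order.trans[OF _ main[unfolded q]] by simp
  have "S * X * Y \<ge> S * S * Y" using pos by (intro mult_right_mono mult_left_mono) auto
  \<comment> \<open>Both summands are nonnegative because \<open>X \<ge> S\<close> and
    \<open>S \<ge> 2\<close>, so both vanish.\<close>
  then have "S * S * Y + (X - S) * ((S - 1) * X - S) \<le> 0"
    using le by (simp add: algebra_simps power2_eq_square)
  moreover have p1: "(S - 1) * X - S \<ge> 0"
  proof -
    have "1 * S \<le> (S - 1) * X" using pos by (intro mult_mono) auto
    then show ?thesis by simp
  qed
  moreover have "(X - S) * ((S - 1) * X - S) \<ge> 0" using p1 pos by (intro mult_nonneg_nonneg) auto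
  moreover have "S * S * Y \<ge> 0" using pos by auto
  ultimately have "S * S * Y = 0" and z: "(X - S) * ((S - 1) * X - S) = 0" by linarith+
  then have Y0: "Y = 0" using pos by auto
  have XS: "X = S"
  proof (rule ccontr)
    assume "X \<noteq> S"
    then have gt: "X > S" and e: "(S - 1) * X = S" using z pos by auto
    have "1 * X \<le> (S - 1) * X" using pos by (intro mult_right_mono) auto
    then show False using gt e by simp
  qed
  have "\<R> * ((S - 1) * S\<^sup>2) \<le> 1 * ((S - 1) * S\<^sup>2)"
    using main unfolding q by (simp add: Y0 XS algebra_simps power2_eq_square)
  then have "\<R> \<le> 1" using pos by (subst (asm) mult_le_cancel_right) auto
  then show ?thesis using XS Y0 pos r by (auto simp: X_def Y_def S_def \<R>_def xy)
qed

section \<open>The local normal form at the irregular point\<close>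

definition companion :: "nat \<Rightarrow> 'a::comm_ring_1 vec \<Rightarrow> 'a mat" where
  "companion n c = mat n n (\<lambda>(i,j). if j = n - 1 then c $ i else if i = j + 1 then 1 else 0)"

lemma companion_carrier [simp]: "companion n c \<in> carrier_mat n n"
  by (simp add: companion_def)

lemma companion_mult_vec:
  assumes v: "v \<in> carrier_vec n" and i: "i < n"
  shows "(companion n c *\<^sub>v v) $ i = (if i = 0 then 0 else v $ (i - 1)) + c $ i * v $ (n - 1)"
proof -
  have "(companion n c *\<^sub>v v) $ i = (\<Sum>j<n. companion n c $$ (i,j) * v $ j)"
    by (rule index_mult_mat_vec_sum[OF i companion_carrier v])
  also have "\<dots> = companion n c $$ (i, n - 1) * v $ (n - 1) + (\<Sum>j\<in>{..<n} - {n - 1}. companion n c $$ (i,j) * v $ j)"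
    using i by (subst sum.remove[of _ "n - 1"]) auto
  also have "(\<Sum>j\<in>{..<n} - {n - 1}. companion n c $$ (i,j) * v $ j) = (\<Sum>j\<in>{..<n} - {n - 1}. if j + 1 = i then v $ j else 0)"
    by (rule sum.cong) (use i in \<open>auto simp: companion_def\<close>)
  also have "\<dots> = (if i = 0 then 0 else v $ (i - 1))"
  proof (cases "i = 0")
    case False
    have "(\<Sum>j\<in>{..<n} - {n - 1}. if j + 1 = i then v $ j else 0) = (\<Sum>j\<in>{i - 1}. v $ j)"
      by (rule sum.mono_neutral_cong_right) (use False i in auto)
    then show ?thesis using False by simp
  qed (simp add: sum.neutral)
  finally show ?thesis using i by (simp add: companion_def)
qed

text \<open>Differentiation shifts the columns of the cyclic matrix by one; only the last column
  calls for \<open>rel\<close>.\<close>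

lemma (in derivation) cyclic_frame:
  assumes n: "n \<ge> 1" and A: "A \<in> carrier_mat n n" and v: "v \<in> carrier_vec n" and c: "c \<in> carrier_vec n"
    and rel: "cyclic_mat n \<delta> A v *\<^sub>v c = (nabla \<delta> A ^^ n) v"
  shows "map_mat \<delta> (cyclic_mat n \<delta> A v) + A * cyclic_mat n \<delta> A v = cyclic_mat n \<delta> A v * companion n c"
proof (rule eq_matI)
  let ?W = "cyclic_mat n \<delta> A v"
  have D: "(nabla \<delta> A ^^ j) v \<in> carrier_vec n" for j using A v by simp
  fix i j assume "i < dim_row (?W * companion n c)" "j < dim_col (?W * companion n c)"
  then have ij: "i < n" "j < n" by (auto simp: cyclic_mat_def companion_def)
  have AW: "A * ?W \<in> carrier_mat n n" using A by (intro mult_carrier_mat) auto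
  have "(map_mat \<delta> ?W + A * ?W) $$ (i,j) = \<delta> (?W $$ (i,j)) + (\<Sum>l<n. A $$ (i,l) * ?W $$ (l,j))"
    using ij A AW by (simp add: index_mult_mat_sum[of _ n _ n _ n] cyclic_mat_def del: index_mult_mat(1))
  also have "\<dots> = (nabla \<delta> A ^^ Suc j) v $ i"
    using index_nabla[OF ij(1) A D, of \<delta> j] ij by (simp add: cyclic_mat_def)
  finally have 1: "(map_mat \<delta> ?W + A * ?W) $$ (i,j) = (nabla \<delta> A ^^ Suc j) v $ i" .
  have 2: "(?W * companion n c) $$ (i,j) = (\<Sum>l<n. ?W $$ (i,l) * companion n c $$ (l,j))"
    by (rule index_mult_mat_sum[OF ij]) auto
  show "(map_mat \<delta> ?W + A * ?W) $$ (i,j) = (?W * companion n c) $$ (i,j)"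
  proof (cases "j = n - 1")
    case True
    have "(\<Sum>l<n. ?W $$ (i,l) * companion n c $$ (l,j)) = (\<Sum>l<n. ?W $$ (i,l) * c $ l)"
      by (rule sum.cong) (use True ij in \<open>auto simp: companion_def\<close>)
    also have "\<dots> = (?W *\<^sub>v c) $ i"
      by (rule index_mult_mat_vec_sum[OF ij(1) _ c, symmetric]) simp
    finally show ?thesis using 1 2 rel True n by simp
  next
    case False
    then have "(\<Sum>l<n. ?W $$ (i,l) * companion n c $$ (l,j)) = (\<Sum>l\<in>{j + 1}. ?W $$ (i,l))"
      by (intro sum.mono_neutral_cong_right) (use ij in \<open>auto simp: companion_def\<close>)
    moreover have "?W $$ (i, j + 1) = (nabla \<delta> A ^^ Suc j) v $ i"
      using False ij by (simp add: cyclic_mat_def flip: Suc_eq_plus1)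
    ultimately show ?thesis using 1 2 by simp
  qed
qed (use A in \<open>auto simp: cyclic_mat_def companion_def\<close>)

text \<open>A shear by powers of the coordinate: differences of weights shift the orders of the
  entries, and the derivative contributes the integers \<open>k i\<close> on the diagonal. At zero
  it equalizes pole orders, at infinity it shifts exponents by integers.\<close>

lemma gauge_diag_index:
  fixes C :: "complex fls mat"
  assumes C: "C \<in> carrier_mat n n" and ij: "i < n" "j < n"
  shows "gauge fls_theta (mat_diag n (\<lambda>i. fls_X_intpow (k i))) C $$ (i,j) =
    fls_X_intpow (k i - k j) * C $$ (i,j) - (if i = j then of_int (k i) else 0)"
    and "det (mat_diag n (\<lambda>i. fls_X_intpow (k i)) :: complex fls mat) \<noteq> 0"
proof -
  let ?D = "mat_diag n (\<lambda>i. fls_X_intpow (k i)) :: complex fls mat"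
  let ?E = "mat_diag n (\<lambda>i. fls_X_intpow (- k i)) :: complex fls mat"
  have DE: "?D * ?E = 1\<^sub>m n" by (simp add: fls_shifted_times_simps)
  show "det ?D \<noteq> 0" by (rule right_inverse_det[OF _ _ DE]) auto
  have g: "gauge fls_theta ?D C = ?D * C * ?E - map_mat fls_theta ?D * ?E"
    by (rule fls_theta.gauge_eqI[OF _ _ DE]) auto
  have 1: "(?D * C * ?E) $$ (i,j) = fls_X_intpow (k i) * C $$ (i,j) * fls_X_intpow (- k j)"
    using ij C by (subst mat_diag_mult_right[of _ n n]) (auto simp: mat_diag_mult_left[of _ n n])
  have 2: "(map_mat fls_theta ?D * ?E) $$ (i,j) = (if i = j then of_int (k i) else 0)"
    using ij by (subst mat_diag_mult_right[of _ n n]) (auto simp: mat_diag_def fls_theta_X_intpow fls_shifted_times_simps)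
  have c2: "map_mat fls_theta ?D * ?E \<in> carrier_mat n n"
    by (rule mult_carrier_mat[OF _ mat_diag_dim]) simp
  have "gauge fls_theta ?D C $$ (i,j) = (?D * C * ?E) $$ (i,j) - (map_mat fls_theta ?D * ?E) $$ (i,j)"
    unfolding g by (rule index_minus_mat(1)) (simp_all only: carrier_matD[OF c2] ij)
  also have "\<dots> = fls_X_intpow (k i) * C $$ (i,j) * fls_X_intpow (- k j) - (if i = j then of_int (k i) else 0)"
    unfolding 1 2 ..
  also have "fls_X_intpow (k i) * C $$ (i,j) * fls_X_intpow (- k j) = fls_X_intpow (k i - k j) * C $$ (i,j)"
    by (simp add: fls_shifted_times_simps)
  finally show "gauge fls_theta ?D C $$ (i,j) =
    fls_X_intpow (k i - k j) * C $$ (i,j) - (if i = j then of_int (k i) else 0)" .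
qed

lemma gauge_const_index:
  fixes C :: "complex fls mat" and P Q :: "complex mat"
  assumes C: "C \<in> carrier_mat n n" and PQ: "P \<in> carrier_mat n n" "Q \<in> carrier_mat n n" "Q * P = 1\<^sub>m n"
    and ij: "i < n" "j < n"
  shows "gauge fls_theta (map_mat fls_const Q) C $$ (i,j) =
     (\<Sum>a<n. \<Sum>b<n. fls_const (Q $$ (i,a) * P $$ (b,j)) * C $$ (a,b))"
    and "det (map_mat fls_const Q) \<noteq> (0 :: complex fls)"
proof -
  interpret comm_ring_hom "fls_const :: complex \<Rightarrow> complex fls" by (rule fls_const_hom)
  let ?Q = "map_mat fls_const Q" and ?P = "map_mat fls_const P :: complex fls mat"
  have c: "?Q \<in> carrier_mat n n" "?P \<in> carrier_mat n n" using PQ by auto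
  have inv: "?Q * ?P = 1\<^sub>m n" using mat_hom_mult[OF PQ(2,1)] PQ(3) by (simp add: mat_hom_one)
  show "det ?Q \<noteq> (0 :: complex fls)" by (rule right_inverse_det[OF c inv])
  have "gauge fls_theta ?Q C = ?Q * C * ?P - map_mat fls_theta ?Q * ?P"
    by (rule fls_theta.gauge_eqI[OF c inv])
  also have "map_mat fls_theta ?Q = 0\<^sub>m n n" by (rule eq_matI) (use PQ in auto)
  also have "?Q * C * ?P - 0\<^sub>m n n * ?P = ?Q * C * ?P"
    by (rule eq_matI) (use c C in auto)
  finally show "gauge fls_theta ?Q C $$ (i,j) =
     (\<Sum>a<n. \<Sum>b<n. fls_const (Q $$ (i,a) * P $$ (b,j)) * C $$ (a,b))"
    using conj_mat_index[OF c C ij] ij PQ by (simp add: fls_const_mult_const)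
qed

lemma strictly_upper_nilpotent:
  fixes T :: "'a::comm_ring_1 mat"
  assumes T: "T \<in> carrier_mat n n" "\<And>i j. i < n \<Longrightarrow> j \<le> i \<Longrightarrow> T $$ (i,j) = 0" and v: "v \<in> carrier_vec n"
  shows "((\<lambda>v. T *\<^sub>v v) ^^ n) v = 0\<^sub>v n"
proof -
  have c: "((\<lambda>v. T *\<^sub>v v) ^^ k) v \<in> carrier_vec n" for k
    by (induction k) (use T v in \<open>auto intro!: mult_mat_vec_carrier\<close>)
  have "((\<lambda>v. T *\<^sub>v v) ^^ k) v $ i = 0" if "i < n" "n \<le> i + k" for k i
    using that
  proof (induction k arbitrary: i)
    case (Suc k)
    have "((\<lambda>v. T *\<^sub>v v) ^^ Suc k) v $ i = (\<Sum>j<n. T $$ (i,j) * ((\<lambda>v. T *\<^sub>v v) ^^ k) v $ j)"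
      using index_mult_mat_vec_sum[OF Suc.prems(1) T(1) c] by simp
    also have "\<dots> = 0"
    proof (rule sum.neutral, rule ballI)
      fix j assume j: "j \<in> {..<n}"
      show "T $$ (i,j) * ((\<lambda>v. T *\<^sub>v v) ^^ k) v $ j = 0"
        using Suc.IH[of j] T(2)[OF Suc.prems(1), of j] j Suc.prems by (cases "j \<le> i") auto
    qed
    finally show ?case .
  qed simp
  then show ?thesis using c[of n] by (intro eq_vecI) auto
qed

text \<open>\<open>r / s\<close> is the largest quotient of a pole order by \<open>n - i\<close>, in
  lowest terms: the steepest slope of the Newton polygon of the scalar equation. An index where it
  is attained later keeps the leading matrix from being nilpotent.\<close>

lemma slope_choice:
  fixes c :: "nat \<Rightarrow> complex fls"
  assumes "\<exists>i<n. \<not> fls_ge 1 0 (c i)"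
  shows "\<exists>r s. r > 0 \<and> s > 0 \<and> coprime r s \<and> (\<forall>i<n. fls_ge s (- int (r * (n - i))) (c i)) \<and>
    (\<exists>i<n. \<exists>m. int s * m = - int (r * (n - i)) \<and> fls_nth (c i) m \<noteq> 0)"
proof -
  define I where "I = {i. i < n \<and> fls_subdegree (c i) < 0}"
  define f where "f i = real_of_int (- fls_subdegree (c i)) / real (n - i)" for i
  obtain i where i: "i < n" "\<not> fls_ge 1 0 (c i)" using assms by auto
  then obtain m where m: "m < 0" "fls_nth (c i) m \<noteq> 0" by (auto simp: fls_ge_def)
  then have "fls_subdegree (c i) \<le> m" by (intro fls_subdegree_leI)
  then have "i \<in> I" using i m by (auto simp: I_def)
  moreover have fin: "finite I" by (simp add: I_def)
  ultimately have "Max (f ` I) \<in> f ` I" by (intro Max_in) auto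
  then obtain k where k: "k \<in> I" "f k = Max (f ` I)" by auto
  have fk: "f i \<le> f k" if "i \<in> I" for i unfolding k(2) using that fin by simp
  define p q where "p = nat (- fls_subdegree (c k))" and "q = n - k"
  define g where "g = gcd p q"
  define r s where "r = p div g" and "s = q div g"
  have pq: "p > 0" "q > 0" "int p = - fls_subdegree (c k)" using k by (auto simp: p_def q_def I_def)
  have g: "g > 0" "p = g * r" "q = g * s" using pq by (auto simp: g_def r_def s_def)
  have rs: "r > 0" "s > 0" using pq g by (auto intro: Nat.gr0I)
  have cop: "coprime r s" unfolding r_def s_def g_def by (rule div_gcd_coprime) (use pq in auto)
  have "fls_ge s (- int (r * (n - i))) (c i)" if i: "i < n" for i
    unfolding fls_ge_def
  proof (intro allI impI)
    fix m assume m: "int s * m < - int (r * (n - i))"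
    have m0: "m < 0"
    proof (rule ccontr)
      assume "\<not> m < 0"
      then have "0 \<le> int s * m" by simp
      then show False using m by linarith
    qed
    show "fls_nth (c i) m = 0"
    proof (cases "i \<in> I")
      case False
      then show ?thesis using i m0 by (intro fls_eq0_below_subdegree) (auto simp: I_def)
    next
      case True
      have "real_of_int (- fls_subdegree (c i)) * real q \<le> real_of_int (- fls_subdegree (c k)) * real (n - i)"
        using fk[OF True] i k pq(2) unfolding f_def q_def by (simp add: I_def field_simps)
      then have "real_of_int (- fls_subdegree (c i) * int q) \<le> real_of_int (- fls_subdegree (c k) * int (n - i))" by simp
      then have "- fls_subdegree (c i) * int q \<le> int p * int (n - i)" unfolding pq(3) by (simp only: of_int_le_iff)
      then have "int g * (- fls_subdegree (c i) * int s) \<le> int g * (int r * int (n - i))"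
        unfolding g(2,3) by (simp add: mult_ac)
      then have "- fls_subdegree (c i) * int s \<le> int r * int (n - i)" using g(1) by (subst (asm) mult_le_cancel_left_pos) auto
      then have "int s * m < int s * fls_subdegree (c i)" using m by (simp add: mult.commute)
      then have "m < fls_subdegree (c i)" using rs by simp
      then show ?thesis by (rule fls_eq0_below_subdegree)
    qed
  qed
  moreover have "int s * fls_subdegree (c k) = - int (r * (n - k))"
  proof -
    have "int g * (int s * fls_subdegree (c k)) = int q * fls_subdegree (c k)" by (simp add: g(3))
    also have "\<dots> = - (int p * int q)" by (simp add: pq(3))
    also have "\<dots> = int g * (- int (r * (n - k)))" unfolding q_def[symmetric] by (simp add: g(2))
    finally show ?thesis using g(1) by (simp only: mult_cancel_left) simp
  qed
  moreover have "c k \<noteq> 0" "k < n" using k by (auto simp: I_def)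
  moreover have "fls_nth (c k) (fls_subdegree (c k)) \<noteq> 0"
    using \<open>c k \<noteq> 0\<close> by (rule nth_fls_subdegree_nonzero)
  ultimately show ?thesis using rs cop by blast
qed

text \<open>The trace of the gauge transform is minus a logarithmic derivative, which has no pole in
  logarithmic form and contributes nothing in order \<open>- R\<close>.\<close>

lemma sum_diag_trace_zero:
  assumes G: "G \<in> carrier_mat n n" "det G \<noteq> 0" and A: "A \<in> carrier_mat n n" "mtrace A = 0" and R: "R > 0"
    and T: "\<And>i. i < n \<Longrightarrow> fls_nth (gauge fls_theta G A $$ (i,i)) (- int R) = e i"
  shows "(\<Sum>i<n. e i) = 0"
proof -
  let ?f = "det G"
  have "fls_ge 1 (fls_subdegree ?f) ?f" by (auto simp: fls_ge_def)
  then have "fls_ge 1 (fls_subdegree ?f) (fls_theta ?f)" by (rule fls_ge_theta)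
  moreover have "fls_ge 1 (- fls_subdegree ?f) (inverse ?f)"
    using G by (auto simp: fls_ge_def fls_inverse_subdegree intro!: fls_eq0_below_subdegree)
  ultimately have "fls_ge 1 (fls_subdegree ?f + - fls_subdegree ?f) (fls_theta ?f * inverse ?f)"
    by (intro fls_ge_mult) auto
  then have z: "fls_nth (fls_theta ?f / ?f) (- int R) = 0" using R by (simp add: fls_ge_def field_class.field_divide_inverse)
  have "mtrace (gauge fls_theta G A) = - (fls_theta ?f / ?f)"
    using fls_theta.mtrace_gauge[OF G A(1)] A(2) by simp
  then have "fls_nth (mtrace (gauge fls_theta G A)) (- int R) = 0" using z by simp
  moreover have "mtrace (gauge fls_theta G A) = (\<Sum>i<n. gauge fls_theta G A $$ (i,i))"
    using gauge_closed[OF G A(1), of fls_theta] by (simp add: mtrace_def)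
  ultimately show ?thesis using T by (simp add: fls_nth_sum)
qed

lemma fls_compose_power_compose_power:
  assumes "b > 0" "s > 0"
  shows "fls_compose_power (fls_compose_power f b) s = fls_compose_power f (b * s)"
proof (rule fls_eqI)
  fix m
  show "fls_nth (fls_compose_power (fls_compose_power f b) s) m = fls_nth (fls_compose_power f (b * s)) m"
  proof (cases "int s dvd m")
    case True
    then obtain l where l: "m = int s * l" by auto
    have "int (b * s) dvd m \<longleftrightarrow> int b dvd l" using assms unfolding l by (simp add: mult.commute)
    moreover have "m div int (b * s) = l div int b" using assms unfolding l by (simp add: mult.commute)
    moreover have "m div int s = l" using assms unfolding l by simp
    ultimately show ?thesis using assms True by (simp add: fls_nth_compose_power del: of_nat_mult)
  next
    case False
    then have "\<not> int (b * s) dvd m" by (metis dvd_mult_right of_nat_mult)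
    then show ?thesis using assms False by (simp add: fls_nth_compose_power del: of_nat_mult)
  qed
qed

lemma fls_pullback_pullback:
  assumes "b > 0" "s > 0"
  shows "fls_pullback s (fls_pullback b A) = fls_pullback (b * s) A"
proof (rule eq_matI)
  fix i j assume "i < dim_row (fls_pullback (b * s) A)" "j < dim_col (fls_pullback (b * s) A)"
  then show "fls_pullback s (fls_pullback b A) $$ (i,j) = fls_pullback (b * s) A $$ (i,j)"
    using assms by (simp add: fls_compose_power_compose_power fls_of_nat mult_ac)
qed auto

text \<open>
  The pullback of a companion form, rescaled so that all entries have the same pole order \<open>R\<close>,
  and then triangularized at leading order.
\<close>

lemma companion_leading_form:
  fixes c :: "complex fls vec"
  assumes n: "n \<ge> 2" and rs: "r > 0" "s > 0" "b > 0"
    and c: "\<And>i. i < n \<Longrightarrow> fls_ge s (- int (r * (n - i))) (c $ i)"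
    and k: "k < n" "int s * l = - int (r * (n - k))" "fls_nth (c $ k) l \<noteq> 0"
  shows "\<exists>G T. G \<in> carrier_mat n n \<and> det G \<noteq> 0 \<and> T \<in> carrier_mat n n \<and> upper_triangular T \<and>
    (\<forall>i<n. \<forall>j<n. fls_ge 1 (- int (b * r)) (gauge fls_theta G (fls_pullback (b * s) (companion n c)) $$ (i,j)) \<and>
       fls_nth (gauge fls_theta G (fls_pullback (b * s) (companion n c)) $$ (i,j)) (- int (b * r)) = T $$ (i,j)) \<and>
    (\<exists>i<n. T $$ (i,i) \<noteq> 0) \<and>
    (coprime r s \<longrightarrow> (\<forall>z e. z ^ s = 1 \<longrightarrow> card {i. i < n \<and> T $$ (i,i) = z * e} = card {i. i < n \<and> T $$ (i,i) = e}))"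
proof -
  define \<beta> R where "\<beta> = b * s" and "R = b * r"
  have \<beta>: "\<beta> > 0" "of_nat \<beta> \<noteq> (0::complex)" and R: "R > 0" using rs by (auto simp: \<beta>_def R_def)
  let ?B = "fls_pullback \<beta> (companion n c)"
  have B: "?B \<in> carrier_mat n n" by (simp add: companion_def)
  define \<alpha> where "\<alpha> i = fls_nth (fls_compose_power (c $ i) \<beta>) (- int (R * (n - i)))" for i
  have cge: "fls_ge 1 (- int (R * (n - i))) (fls_compose_power (c $ i) \<beta>)" if "i < n" for i
  proof -
    have "fls_ge 1 (int b * - int (r * (n - i))) (fls_compose_power (c $ i) (b * s))"
      by (rule fls_ge_compose_power[OF rs(3,2) c[OF that]])
    then show ?thesis by (simp add: \<beta>_def R_def mult.assoc)
  qed
  have \<alpha>k: "\<alpha> k \<noteq> 0"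
  proof -
    have e: "- int (R * (n - k)) = int \<beta> * l"
    proof -
      have "int \<beta> * l = int b * (int s * l)" by (simp add: \<beta>_def)
      also have "\<dots> = - int (R * (n - k))" unfolding k(2) by (simp add: R_def)
      finally show ?thesis ..
    qed
    show ?thesis unfolding \<alpha>_def e using \<beta> k(3) by (simp add: fls_nth_compose_power)
  qed
  \<comment> \<open>After pullback only exponents divisible by \<open>b * s\<close> occur, and
    \<open>b * r * (n - i)\<close> is one of them only if \<open>s\<close> divides
    \<open>n - i\<close>, as \<open>r\<close> and \<open>s\<close> are coprime. This is the source
    of the rotational symmetry.\<close>
  have \<alpha>s: "s dvd n - i" if i: "i < n" "\<alpha> i \<noteq> 0" and cop: "coprime r s" for i
  proof -
    have "int \<beta> dvd - int (R * (n - i))"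
      using i(2) \<beta> unfolding \<alpha>_def by (simp add: fls_nth_compose_power split: if_splits)
    then have "b * s dvd b * (r * (n - i))"
      unfolding \<beta>_def R_def dvd_minus_iff int_dvd_int_iff by (simp add: mult.assoc)
    then have "s dvd r * (n - i)" using rs by simp
    then show ?thesis using cop by (simp add: coprime_dvd_mult_right_iff coprime_commute)
  qed
  \<comment> \<open>The weights \<open>- R * i\<close> give the subdiagonal ones pole order
    \<open>R\<close> and reduce the pole order \<open>R * (n - i)\<close> in the last column to
    \<open>R\<close> as well.\<close>
  define D where "D = (mat_diag n (\<lambda>i. fls_X_intpow (- int (R * i))) :: complex fls mat)"
  have D: "D \<in> carrier_mat n n" "det D \<noteq> 0"
    using gauge_diag_index(2)[OF B, of 0 0 "\<lambda>i. - int (R * i)"] n by (auto simp: D_def)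
  let ?C = "gauge fls_theta D ?B"
  have C: "?C \<in> carrier_mat n n" using D B by simp
  define A0 where "A0 = mat n n (\<lambda>(i,j). of_nat \<beta> * (if j = n - 1 then \<alpha> i else if i = j + 1 then 1 else 0))"
  have A0: "A0 \<in> carrier_mat n n" by (simp add: A0_def)
  have CA: "fls_ge 1 (- int R) (?C $$ (i,j)) \<and> fls_nth (?C $$ (i,j)) (- int R) = A0 $$ (i,j)" if ij: "i < n" "j < n" for i j
  proof -
    have Cij: "?C $$ (i,j) = fls_X_intpow (int (R * j) - int (R * i)) * ?B $$ (i,j) - (if i = j then of_int (- int (R * i)) else 0)"
      using gauge_diag_index(1)[OF B ij, of "\<lambda>i. - int (R * i)"] by (simp add: D_def algebra_simps)
    let ?d = "(if i = j then of_int (- int (R * i)) else 0) :: complex fls"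
    have d: "fls_ge 1 (- int R) ?d" "fls_nth ?d (- int R) = 0"
      using R by (auto simp: fls_ge_def fls_of_int)
    let ?x = "fls_X_intpow (int (R * j) - int (R * i)) * ?B $$ (i,j)"
    have X: "fls_ge 1 p (fls_X_intpow p :: complex fls)" "fls_nth (fls_X_intpow p :: complex fls) p = 1" for p
      by (auto simp: fls_ge_def)
    consider "j = n - 1" | "j \<noteq> n - 1" "i = j + 1" | "j \<noteq> n - 1" "i \<noteq> j + 1" by blast
    then have "fls_ge 1 (- int R) ?x \<and> fls_nth ?x (- int R) = A0 $$ (i,j)"
    proof cases
      case 1
      have Bij: "?B $$ (i,j) = fls_const (of_nat \<beta>) * fls_compose_power (c $ i) \<beta>"
        using 1 ij by (simp add: companion_def fls_of_nat)
      have m: "fls_ge 1 (0 + - int (R * (n - i))) (fls_const (of_nat \<beta>) * fls_compose_power (c $ i) \<beta>)"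
        by (intro fls_ge_mult fls_ge_const cge ij) simp
      have "int (R * (n - i)) = int (R * j) - int (R * i) + int R"
        using 1 ij n by (simp add: of_nat_diff algebra_simps)
      then have e: "- int R = (int (R * j) - int (R * i)) + (0 + - int (R * (n - i)))" by simp
      show ?thesis unfolding Bij
      proof
        show "fls_ge 1 (- int R) (fls_X_intpow (int (R * j) - int (R * i)) * (fls_const (of_nat \<beta>) * fls_compose_power (c $ i) \<beta>))"
          unfolding e by (rule fls_ge_mult[OF _ X(1) m]) simp
        show "fls_nth (fls_X_intpow (int (R * j) - int (R * i)) * (fls_const (of_nat \<beta>) * fls_compose_power (c $ i) \<beta>)) (- int R) = A0 $$ (i,j)"
          unfolding e fls_nth_mult_leading[OF X(1) m] X(2) using 1 ij by (simp add: A0_def \<alpha>_def)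
      qed
    next
      case 2
      have Bij: "?B $$ (i,j) = fls_const (of_nat \<beta>)"
        using 2 ij \<beta> by (simp add: companion_def fls_of_nat)
      have e: "int (R * j) - int (R * i) = - int R" using 2 by (simp add: algebra_simps)
      show ?thesis unfolding Bij e using 2 ij by (auto simp: A0_def fls_ge_def fls_shifted_times_simps)
    next
      case 3
      have "?B $$ (i,j) = 0" using 3 ij by (simp add: companion_def)
      then show ?thesis using 3 ij by (simp add: A0_def)
    qed
    then have x: "fls_ge 1 (- int R) ?x" "fls_nth ?x (- int R) = A0 $$ (i,j)" by auto
    show ?thesis unfolding Cij fls_minus_nth x(2) d(2) using fls_ge_diff[OF x(1) d(1)] by simp
  qed
  obtain es where es: "char_poly A0 = (\<Prod>a\<leftarrow>es. [:- a, 1:])" using char_poly_factorized[OF A0] by blast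
  obtain T P Q where sch: "schur_decomposition A0 es = (T, P, Q)" by (cases "schur_decomposition A0 es") auto
  have sim: "similar_mat_wit A0 T P Q" and ut: "upper_triangular T"
    using schur_decomposition[OF A0 es sch] by auto
  note w = similar_mat_witD2[OF A0 sim]
  define G where "G = map_mat fls_const Q * D"
  have Qc: "map_mat fls_const Q \<in> carrier_mat n n" using w by simp
  have dQ: "det (map_mat fls_const Q) \<noteq> (0 :: complex fls)"
    using gauge_const_index(2)[OF C w(6,7,2), of 0 0] n by simp
  have G: "G \<in> carrier_mat n n" "det G \<noteq> 0" using Qc D det_mult[OF Qc D(1)] dQ by (auto simp: G_def)
  have GB: "gauge fls_theta G ?B = gauge fls_theta (map_mat fls_const Q) ?C"
    unfolding G_def by (rule fls_theta.gauge_mult[OF Qc dQ D B, symmetric])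
  have lead: "fls_ge 1 (- int R) (gauge fls_theta G ?B $$ (i,j)) \<and> fls_nth (gauge fls_theta G ?B $$ (i,j)) (- int R) = T $$ (i,j)"
    if ij: "i < n" "j < n" for i j
  proof -
    have e: "gauge fls_theta G ?B $$ (i,j) = (\<Sum>a<n. \<Sum>b<n. fls_const (Q $$ (i,a) * P $$ (b,j)) * ?C $$ (a,b))"
      unfolding GB by (rule gauge_const_index(1)[OF C w(6,7,2) ij])
    have m: "fls_ge 1 (0 + - int R) (fls_const (Q $$ (i,a) * P $$ (b,j)) * ?C $$ (a,b))" if "a < n" "b < n" for a b
      using CA[OF that] by (intro fls_ge_mult fls_ge_const) auto
    have "T = Q * A0 * P"
    proof -
      have "Q * A0 * P = Q * (P * T * Q) * P" using w(3) by simp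
      also have "P * T * Q = P * (T * Q)" by (rule assoc_mult_mat[of _ n n _ n _ n]) (use w in auto)
      also have "Q * (P * (T * Q)) = Q * P * (T * Q)" by (rule assoc_mult_mat[of _ n n _ n _ n, symmetric]) (use w in auto)
      also have "\<dots> = T * Q" using w by simp
      also have "T * Q * P = T * (Q * P)" by (rule assoc_mult_mat[of _ n n _ n _ n]) (use w in auto)
      finally show ?thesis using w by simp
    qed
    then have "T $$ (i,j) = (\<Sum>a<n. \<Sum>b<n. Q $$ (i,a) * P $$ (b,j) * A0 $$ (a,b))"
      using conj_mat_index[OF w(7,6) A0 ij] by simp
    moreover have "fls_nth (gauge fls_theta G ?B $$ (i,j)) (- int R) = (\<Sum>a<n. \<Sum>b<n. Q $$ (i,a) * P $$ (b,j) * A0 $$ (a,b))"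
      unfolding e fls_nth_sum using CA by (intro sum.cong refl) (simp add: fls_mult_const_nth)
    ultimately show ?thesis unfolding e using m by (auto intro!: fls_ge_sum)
  qed
  \<comment> \<open>If all eigenvalues were zero, \<open>A0\<close> would be nilpotent. But the
    iterates of the first unit vector run down the subdiagonal, and the \<open>n\<close>-th of them
    has the nonzero entry \<open>\<beta> ^ n * \<alpha> k\<close> at \<open>k\<close>.\<close>
  have "\<exists>i<n. T $$ (i,i) \<noteq> 0"
  proof (rule ccontr)
    assume "\<not> ?thesis"
    then have strict: "T $$ (i,j) = 0" if "i < n" "j \<le> i" for i j
      using ut w(5) that by (cases "i = j") (auto simp: upper_triangular_def)
    let ?A = "\<lambda>v. A0 *\<^sub>v v" and ?T = "\<lambda>v. T *\<^sub>v v"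
    have it: "(?A ^^ m) v \<in> carrier_vec n \<and> Q *\<^sub>v (?A ^^ m) v = (?T ^^ m) (Q *\<^sub>v v)" if v: "v \<in> carrier_vec n" for m v
    proof (induction m)
      case (Suc m)
      let ?u = "(?A ^^ m) v"
      have u: "?u \<in> carrier_vec n" using Suc by simp
      have "Q *\<^sub>v (A0 *\<^sub>v ?u) = (Q * A0) *\<^sub>v ?u" by (rule assoc_mult_mat_vec[symmetric]) (use w A0 u in auto)
      also have "Q * A0 = T * Q"
      proof -
        have "Q * A0 = Q * (P * T * Q)" using w(3) by simp
        also have "P * T * Q = P * (T * Q)" by (rule assoc_mult_mat[of _ n n _ n _ n]) (use w in auto)
        also have "Q * (P * (T * Q)) = Q * P * (T * Q)" by (rule assoc_mult_mat[of _ n n _ n _ n, symmetric]) (use w in auto)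
        finally show ?thesis using w by simp
      qed
      also have "(T * Q) *\<^sub>v ?u = T *\<^sub>v (Q *\<^sub>v ?u)" by (rule assoc_mult_mat_vec) (use w u in auto)
      finally show ?case using Suc mult_mat_vec_carrier[OF A0 u] by simp
    qed (use v in simp)
    let ?e = "unit_vec n 0 :: complex vec"
    have "Q *\<^sub>v (?A ^^ n) ?e = 0\<^sub>v n"
      using it[of ?e n] strictly_upper_nilpotent[OF w(5) strict, of "Q *\<^sub>v ?e"] w by simp
    moreover have "P *\<^sub>v 0\<^sub>v n = 0\<^sub>v n" by (rule eq_vecI) (use w(6) in auto)
    ultimately have "P *\<^sub>v (Q *\<^sub>v (?A ^^ n) ?e) = 0\<^sub>v n" by simp
    then have z: "(?A ^^ n) ?e = 0\<^sub>v n"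
      using assoc_mult_mat_vec[OF w(6,7), of "(?A ^^ n) ?e"] it[of ?e n] w(1) by simp
    have A0v: "(A0 *\<^sub>v v) $ i = of_nat \<beta> * ((if i = 0 then 0 else v $ (i - 1)) + \<alpha> i * v $ (n - 1))"
      if "v \<in> carrier_vec n" "i < n" for v i
    proof -
      have "(A0 *\<^sub>v v) $ i = (\<Sum>j<n. A0 $$ (i,j) * v $ j)"
        by (rule index_mult_mat_vec_sum[OF that(2) A0 that(1)])
      also have "\<dots> = (\<Sum>j<n. of_nat \<beta> * (companion n (vec n \<alpha>) $$ (i,j) * v $ j))"
        by (rule sum.cong) (use that in \<open>auto simp: A0_def companion_def\<close>)
      also have "\<dots> = of_nat \<beta> * (companion n (vec n \<alpha>) *\<^sub>v v) $ i"
        unfolding index_mult_mat_vec_sum[OF that(2) companion_carrier that(1)] sum_distrib_left ..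
      finally show ?thesis unfolding companion_mult_vec[OF that] using that by simp
    qed
    have low: "(?A ^^ m) ?e $ i = (if i = m then of_nat \<beta> ^ m else 0)" if "m < n" "i < n" for m i
      using that
    proof (induction m arbitrary: i)
      case (Suc m)
      have "(?A ^^ Suc m) ?e $ i = (A0 *\<^sub>v (?A ^^ m) ?e) $ i" by simp
      also have "\<dots> = of_nat \<beta> * ((if i = 0 then 0 else (?A ^^ m) ?e $ (i - 1)) + \<alpha> i * (?A ^^ m) ?e $ (n - 1))"
        by (rule A0v) (use it[of ?e m] Suc.prems in auto)
      also have "\<dots> = (if i = Suc m then of_nat \<beta> ^ Suc m else 0)"
        using Suc.IH[of "i - 1"] Suc.IH[of "n - 1"] Suc.prems by auto
      finally show ?case .
    qed (use n in auto)
    have "(?A ^^ n) ?e $ k = (A0 *\<^sub>v (?A ^^ (n - 1)) ?e) $ k"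
      using n by (cases n) auto
    also have "\<dots> = of_nat \<beta> * ((if k = 0 then 0 else (?A ^^ (n - 1)) ?e $ (k - 1)) + \<alpha> k * (?A ^^ (n - 1)) ?e $ (n - 1))"
      by (rule A0v) (use it[of ?e "n - 1"] k in auto)
    also have "\<dots> = of_nat \<beta> * (\<alpha> k * of_nat \<beta> ^ (n - 1))"
      using low[of "n - 1" "k - 1"] low[of "n - 1" "n - 1"] n k by (cases "k = 0") auto
    finally show False using z \<alpha>k \<beta> k by simp
  qed
  moreover have "card {i. i < n \<and> T $$ (i,i) = z * e} = card {i. i < n \<and> T $$ (i,i) = e}"
    if cop: "coprime r s" and z: "z ^ s = 1" for z e :: complex
  proof (rule rotation_invariant_spectrum[OF A0 w(5) ut])
    show "similar_mat A0 T" using sim by (auto simp: similar_mat_def)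
    show "z \<noteq> 0" using z rs by (auto simp: power_0_left)
    fix i j assume ij: "i < n" "j < n"
    \<comment> \<open>An entry of the last column survives only if \<open>s\<close> divides
      \<open>n - i\<close>, which makes \<open>z ^ (n - i) = 1\<close>; subdiagonal entries satisfy
      the condition for every \<open>z\<close>.\<close>
    consider "j = n - 1" "\<alpha> i \<noteq> 0" | "j \<noteq> n - 1" "i = j + 1" | "A0 $$ (i,j) = 0"
      using ij by (cases "j = n - 1"; cases "\<alpha> i = 0"; cases "i = j + 1") (auto simp: A0_def)
    then show "z ^ i * A0 $$ (i,j) = z * A0 $$ (i,j) * z ^ j"
    proof cases
      case 1
      obtain q where q: "n - i = s * q" using \<alpha>s[OF ij(1) 1(2) cop] by auto
      have "z * z ^ j = z ^ (n - i) * z ^ i" using 1 ij n by (simp flip: power_Suc power_add)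
      then have "z * z ^ j = z ^ i" unfolding q power_mult z by simp
      then show ?thesis by (simp add: mult_ac)
    next
      case 2
      have "z ^ i = z * z ^ j" using 2 by (simp flip: Suc_eq_plus1)
      then show ?thesis by (simp only: mult_ac)
    next
      case 3
      then show ?thesis by simp
    qed
  qed
  ultimately show ?thesis
    unfolding \<beta>_def[symmetric] R_def[symmetric] using G w(5) ut lead by blast
qed

text \<open>The companion form in a cyclic basis has a largest slope \<open>r / s\<close>, and
  counting pairs of eigenvalues against the value \<open>n - 1\<close> gives
  \<open>r / s = 1 / n\<close>. Since orders are integers, this slope bound allows a simple pole in
  \<open>c $ 0\<close> and no pole elsewhere.\<close>

theorem local_companion_form:
  fixes A :: "complex fls mat"
  assumes n: "n \<ge> 2" and A: "A \<in> sl_mats n UNIV"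
    and irr: "has_irregularity (n\<^sup>2 - 1) (ad_mat n A) (real (n - 1))"
  shows "\<exists>W c. W \<in> carrier_mat n n \<and> det W \<noteq> 0 \<and> c \<in> carrier_vec n \<and>
    gauge fls_theta (minv W) A = companion n c \<and> (\<forall>i<n. i > 0 \<longrightarrow> fls_ge 1 0 (c $ i)) \<and>
    fls_ge 1 (-1) (c $ 0) \<and> fls_nth (c $ 0) (-1) \<noteq> 0"
proof -
  let ?m = "n\<^sup>2 - 1"
  have n1: "n \<ge> 1" using n by simp
  have Ac: "A \<in> carrier_mat n n" "mtrace A = 0" using A by (auto simp: sl_mats_UNIV)
  have inj: "inj (of_nat :: nat \<Rightarrow> complex fls)"
  proof (rule injI)
    fix x y assume "(of_nat x :: complex fls) = of_nat y"
    then have "fls_nth (of_nat x :: complex fls) 0 = fls_nth (of_nat y) 0" by simp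
    then show "x = y" by (simp add: fls_of_nat_nth)
  qed
  obtain v where v: "v \<in> carrier_vec n" "det (cyclic_mat n fls_theta A v) \<noteq> 0"
    using fls_theta.cyclic_vector[OF inj Ac(1) fls_theta_X] by auto
  define W where "W = cyclic_mat n fls_theta A v"
  have W: "W \<in> carrier_mat n n" "det W \<noteq> 0" using v by (auto simp: W_def)
  note mW = minv[OF W]
  define c where "c = minv W *\<^sub>v (nabla fls_theta A ^^ n) v"
  have Dn: "(nabla fls_theta A ^^ n) v \<in> carrier_vec n" using Ac v by simp
  have c: "c \<in> carrier_vec n" using mW Dn by (simp add: c_def)
  have Wc: "W *\<^sub>v c = (nabla fls_theta A ^^ n) v"
    unfolding c_def using assoc_mult_mat_vec[OF W(1) mW(1) Dn] mW Dn by simp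
  have comp: "gauge fls_theta (minv W) A = companion n c"
    by (rule fls_theta.gauge_frame[OF W Ac(1) companion_carrier])
      (use fls_theta.cyclic_frame[OF n1 Ac(1) v(1) c Wc[unfolded W_def]] in \<open>simp add: W_def\<close>)
  have mW': "det (minv W) \<noteq> 0" using det_minv[OF W] W by simp
  \<comment> \<open>An integral companion matrix would give irregularity \<open>0\<close>, whereas
    \<open>n - 1\<close> is positive.\<close>
  have ex: "\<exists>i<n. \<not> fls_ge 1 0 (c $ i)"
  proof (rule ccontr)
    assume "\<not> ?thesis"
    then have "fls_ge 1 0 (companion n c $$ (i,j))" if "i < n" "j < n" for i j
      using that by (auto simp: companion_def fls_ge_1_0)
    then have "real (n - 1) = 0"
      by (intro irregularity_zero_of_integral[OF n1 Ac(1) mW(1) mW' _ irr]) (simp add: comp)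
    then show False using n by simp
  qed
  obtain r s k l where rs: "r > 0" "s > 0" "coprime r s"
    and cge: "\<And>i. i < n \<Longrightarrow> fls_ge s (- int (r * (n - i))) (c $ i)"
    and k: "k < n" "int s * l = - int (r * (n - k))" "fls_nth (c $ k) l \<noteq> 0"
    using slope_choice[OF ex] by blast
  obtain b g H d where b: "b > 0" and g: "g \<in> carrier_mat ?m ?m" "det g \<noteq> 0"
    and H: "H = gauge fls_theta g (fls_pullback b (ad_mat n A))" and sf: "slope_form ?m d H"
    and sum: "real (\<Sum>i<?m. d i) = real b * real (n - 1)"
    using irregularity_form[OF irr ad_mat_carrier] by blast
  \<comment> \<open>A common cover: \<open>b\<close> for the Levelt-Turrittin form of the adjoint
    connection, \<open>s\<close> to make the slope \<open>r / s\<close> integral. Pulling back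
    further by \<open>s\<close> multiplies all slopes \<open>d i\<close> by \<open>s\<close>, so the
    factor \<open>b\<close> cancels in the comparison.\<close>
  define \<beta> where "\<beta> = b * s"
  have \<beta>: "\<beta> > 0" using b rs by (simp add: \<beta>_def)
  let ?A = "fls_pullback \<beta> A"
  have A': "?A \<in> carrier_mat n n" using Ac by simp
  define g' where "g' = map_mat (\<lambda>f. fls_compose_power f s) g"
  have g': "g' \<in> carrier_mat ?m ?m" "det g' \<noteq> 0" using g det_compose_power[OF rs(2), of g] by (auto simp: g'_def)
  have gH: "gauge fls_theta g' (ad_mat n ?A) = fls_pullback s H"
  proof -
    have B: "fls_pullback b (ad_mat n A) \<in> carrier_mat ?m ?m" by simp
    have "ad_mat n ?A = fls_pullback \<beta> (ad_mat n A)" by (rule ad_mat_pullback[OF n1 Ac(1) \<beta>])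
    also have "\<dots> = fls_pullback s (fls_pullback b (ad_mat n A))"
      unfolding \<beta>_def by (rule fls_pullback_pullback[OF b rs(2), symmetric])
    finally show ?thesis unfolding H g'_def by (simp only: gauge_pullback[OF rs(2) g B])
  qed
  have sf': "slope_form ?m (\<lambda>i. s * d i) (gauge fls_theta g' (ad_mat n ?A))"
    unfolding gH by (rule slope_form_pullback[OF sf rs(2)])
  obtain G T where G: "G \<in> carrier_mat n n" "det G \<noteq> 0" and T: "T \<in> carrier_mat n n" "upper_triangular T"
    and lead: "\<And>i j. i < n \<Longrightarrow> j < n \<Longrightarrow> fls_ge 1 (- int (b * r)) (gauge fls_theta G (fls_pullback (b * s) (companion n c)) $$ (i,j))"
      "\<And>i j. i < n \<Longrightarrow> j < n \<Longrightarrow> fls_nth (gauge fls_theta G (fls_pullback (b * s) (companion n c)) $$ (i,j)) (- int (b * r)) = T $$ (i,j)"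
    and nz: "\<exists>i<n. T $$ (i,i) \<noteq> 0"
    and rot: "\<And>z e. z ^ s = 1 \<Longrightarrow> card {i. i < n \<and> T $$ (i,i) = z * e} = card {i. i < n \<and> T $$ (i,i) = e}"
    using companion_leading_form[OF n rs(1,2) b cge k] rs(3) by blast
  define V where "V = map_mat (\<lambda>f. fls_compose_power f \<beta>) (minv W)"
  have V: "V \<in> carrier_mat n n" "det V \<noteq> 0"
    using mW(1) det_compose_power[OF \<beta> mW'] by (auto simp: V_def)
  have VA: "gauge fls_theta V ?A = fls_pullback \<beta> (companion n c)"
    unfolding V_def gauge_pullback[OF \<beta> mW(1) mW' Ac(1)] comp ..
  define GV where "GV = G * V"
  have GV: "GV \<in> carrier_mat n n" "det GV \<noteq> 0" using G V det_mult[OF G(1) V(1)] by (auto simp: GV_def)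
  have GVA: "gauge fls_theta GV ?A = gauge fls_theta G (fls_pullback (b * s) (companion n c))"
  proof -
    have "gauge fls_theta GV ?A = gauge fls_theta G (gauge fls_theta V ?A)"
      unfolding GV_def by (rule fls_theta.gauge_mult[OF G V A', symmetric])
    then show ?thesis unfolding VA unfolding \<beta>_def .
  qed
  have R: "b * r > 0" using b rs by simp
  have tr: "mtrace ?A = 0"
  proof -
    interpret comm_ring_hom "\<lambda>f :: complex fls. fls_compose_power f \<beta>" by (rule fls_compose_power_hom[OF \<beta>])
    have "mtrace ?A = of_nat \<beta> * fls_compose_power (mtrace A) \<beta>"
      using Ac(1) by (simp add: mtrace_def hom_sum sum_distrib_left)
    then show ?thesis using Ac(2) by simp
  qed
  have "(\<Sum>i<n. T $$ (i,i)) = 0"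
    by (rule sum_diag_trace_zero[OF GV A' tr R]) (use lead(2) in \<open>simp add: GVA\<close>)
  moreover have "r * card {(i,j). i < n \<and> j < n \<and> T $$ (i,i) \<noteq> T $$ (j,j)} \<le> s * (n - 1)"
  proof -
    have "b * r * card {(i,j). i < n \<and> j < n \<and> T $$ (i,i) \<noteq> T $$ (j,j)} \<le> (\<Sum>l<?m. s * d l)"
      by (rule irregularity_lower_bound[OF n1 A' GV g' sf' R _ T]) (use lead in \<open>simp_all add: GVA\<close>)
    also have "(\<Sum>l<?m. s * d l) = s * (\<Sum>l<?m. d l)" by (simp add: sum_distrib_left)
    also have "(\<Sum>l<?m. d l) = b * (n - 1)" using sum by (simp only: of_nat_mult[symmetric] of_nat_eq_iff)
    finally have "b * (r * card {(i,j). i < n \<and> j < n \<and> T $$ (i,i) \<noteq> T $$ (j,j)}) \<le> b * (s * (n - 1))"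
      by (simp add: mult_ac)
    then show ?thesis using b by simp
  qed
  ultimately have "r = 1 \<and> s = n"
    by (intro coxeter_spectrum[where e = "\<lambda>i. T $$ (i,i)"] n rs(1,2) nz rot)
  then have r: "r = 1" and s: "s = n" by auto
  have "fls_ge 1 0 (c $ i)" if i: "i < n" "i > 0" for i
    unfolding fls_ge_def
  proof (intro allI impI)
    fix m assume "int 1 * m < 0"
    then have "int n * m \<le> int n * (-1)" by (intro mult_left_mono) auto
    also have "\<dots> < - int (r * (n - i))" using i by (simp add: r)
    finally show "fls_nth (c $ i) m = 0" using cge[OF i(1)] by (simp add: fls_ge_def s)
  qed
  moreover have "fls_ge 1 (-1) (c $ 0)"
    unfolding fls_ge_def
  proof (intro allI impI)
    fix m assume "int 1 * m < - 1"
    then have "int n * m \<le> int n * (-2)" by (intro mult_left_mono) auto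
    also have "\<dots> < - int (r * (n - 0))" using n by (simp add: r)
    finally show "fls_nth (c $ 0) m = 0" using cge[of 0] n by (simp add: fls_ge_def s)
  qed
  moreover have "fls_nth (c $ 0) (-1) \<noteq> 0"
  proof -
    \<comment> \<open>The slope is attained at an index \<open>k\<close> for which \<open>n\<close>
      divides \<open>n - k\<close>, and \<open>k < n\<close> leaves only
      \<open>k = 0\<close>.\<close>
    have e: "int n * (- l) = int (n - k)" using k(2) by (simp add: r s)
    have "- l > 0"
    proof (rule ccontr)
      assume "\<not> - l > 0"
      then have "int n * (- l) \<le> 0" by (intro mult_nonneg_nonpos) auto
      then show False using e k(1) by simp
    qed
    then have l1: "int n * 1 \<le> int n * (- l)" by (intro mult_left_mono) auto
    then have "k = 0" using e k(1) by simp
    then have "int n * (- l) = int n * 1" using e by simp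
    then have "l = - 1" using n by (simp only: mult_cancel_left) auto
    then show ?thesis using k(3) \<open>k = 0\<close> by simp
  qed
  ultimately show ?thesis using W c comp by blast
qed

section \<open>The regular singular point\<close>

text \<open>Geometric growth of the entries makes the entrywise exponential series converge
  absolutely.\<close>

lemma pow_mat_entry_bound:
  fixes C :: "complex mat"
  assumes C: "C \<in> carrier_mat n n"
  shows "\<exists>M. \<forall>k. \<forall>i<n. \<forall>j<n. norm ((C ^\<^sub>m k) $$ (i,j)) \<le> M ^ k"
proof -
  define K where "K = (\<Sum>i<n. \<Sum>j<n. norm (C $$ (i,j)))"
  have K: "norm (C $$ (i,j)) \<le> K" if "i < n" "j < n" for i j
  proof -
    have "norm (C $$ (i,j)) \<le> (\<Sum>j<n. norm (C $$ (i,j)))"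
      by (rule member_le_sum) (use that in auto)
    also have "\<dots> \<le> K" unfolding K_def
      by (rule member_le_sum[where f = "\<lambda>i. \<Sum>j<n. norm (C $$ (i,j))"]) (use that in \<open>auto intro: sum_nonneg\<close>)
    finally show ?thesis .
  qed
  have "norm ((C ^\<^sub>m k) $$ (i,j)) \<le> (of_nat n * K) ^ k" if "i < n" "j < n" for i j k
    using that
  proof (induction k arbitrary: i j)
    case 0
    then show ?case using C by simp
  next
    case (Suc k)
    have "(C ^\<^sub>m Suc k) $$ (i,j) = (\<Sum>l<n. (C ^\<^sub>m k) $$ (i,l) * C $$ (l,j))"
      using index_mult_mat_sum[OF Suc.prems pow_carrier_mat[OF C, of k] C] by simp
    also have "norm \<dots> \<le> (\<Sum>l<n. (of_nat n * K) ^ k * K)"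
      by (rule sum_norm_le) (use Suc K in \<open>auto simp: norm_mult intro!: mult_mono order.trans[OF norm_ge_zero]\<close>)
    also have "\<dots> = (of_nat n * K) ^ Suc k" by simp
    finally show ?case .
  qed
  then show ?thesis by blast
qed

lemma exp_mat_eigenvector:
  assumes C: "C \<in> carrier_mat n n" and v: "v \<in> carrier_vec n" and ev: "C *\<^sub>v v = l \<cdot>\<^sub>v v" and nz: "v \<noteq> 0\<^sub>v n"
  shows "exp_mat n C *\<^sub>v v = exp l \<cdot>\<^sub>v v"
proof (rule eq_vecI)
  obtain M where M: "\<And>k i j. i < n \<Longrightarrow> j < n \<Longrightarrow> norm ((C ^\<^sub>m k) $$ (i,j)) \<le> M ^ k"
    using pow_mat_entry_bound[OF C] by blast
  have sm: "summable (\<lambda>k. (C ^\<^sub>m k) $$ (i,j) / fact k)" if ij: "i < n" "j < n" for i j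
  proof (rule summable_comparison_test)
    show "\<exists>N. \<forall>k\<ge>N. norm ((C ^\<^sub>m k) $$ (i,j) / fact k) \<le> M ^ k / fact k"
      using M[OF ij] by (auto simp: norm_divide intro!: divide_right_mono)
    show "summable (\<lambda>k. M ^ k / fact k)"
      using summable_exp[of M] by (simp add: divide_inverse mult.commute)
  qed
  fix i assume "i < dim_vec (exp l \<cdot>\<^sub>v v)"
  then have i: "i < n" using v by simp
  have pw: "(\<Sum>j<n. (C ^\<^sub>m k) $$ (i,j) * v $ j) = l ^ k * v $ i" for k
  proof -
    have "eigenvector C v l" using C v ev nz by (simp add: eigenvector_def)
    then have "C ^\<^sub>m k *\<^sub>v v = l ^ k \<cdot>\<^sub>v v" by (rule eigenvector_pow[OF C])
    then have "(C ^\<^sub>m k *\<^sub>v v) $ i = l ^ k * v $ i" using i v by simp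
    then show ?thesis using index_mult_mat_vec_sum[OF i pow_carrier_mat[OF C] v, of k] by simp
  qed
  have E: "exp_mat n C \<in> carrier_mat n n" by (simp add: exp_mat_def)
  have "(exp_mat n C *\<^sub>v v) $ i = (\<Sum>j<n. exp_mat n C $$ (i,j) * v $ j)"
    by (rule index_mult_mat_vec_sum[OF i E v])
  also have "\<dots> = (\<Sum>j<n. \<Sum>k. (C ^\<^sub>m k) $$ (i,j) / fact k * v $ j)"
    using i by (intro sum.cong refl) (simp add: exp_mat_def suminf_mult2[OF sm])
  also have "\<dots> = (\<Sum>k. \<Sum>j<n. (C ^\<^sub>m k) $$ (i,j) / fact k * v $ j)"
    by (rule suminf_sum[symmetric]) (rule summable_mult2, rule sm, use i in auto)
  also have "\<dots> = (\<Sum>k. l ^ k /\<^sub>R fact k * v $ i)"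
  proof (rule suminf_cong)
    fix k
    have "(\<Sum>j<n. (C ^\<^sub>m k) $$ (i,j) / fact k * v $ j) = (\<Sum>j<n. (C ^\<^sub>m k) $$ (i,j) * v $ j) / fact k"
      by (simp add: sum_divide_distrib)
    also have "\<dots> = l ^ k /\<^sub>R fact k * v $ i" unfolding pw
      by (simp add: scaleR_conv_of_real divide_inverse mult_ac)
    finally show "(\<Sum>j<n. (C ^\<^sub>m k) $$ (i,j) / fact k * v $ j) = l ^ k /\<^sub>R fact k * v $ i" .
  qed
  also have "\<dots> = exp l * v $ i"
    unfolding exp_def by (rule suminf_mult2[symmetric]) (rule summable_exp_generic)
  finally show "(exp_mat n C *\<^sub>v v) $ i = (exp l \<cdot>\<^sub>v v) $ i" using i v by simp
qed (use v in \<open>simp add: exp_mat_def\<close>)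

lemma exp_eq_1_imp:
  assumes "exp (z :: complex) = 1"
  shows "\<exists>m::int. z = of_int m * (2 * complex_of_real pi * \<i>)"
proof -
  have "norm (exp z) = 1" using assms by simp
  then have re: "Re z = 0" by (simp add: norm_exp_eq_Re)
  have "cos (Im z) = 1" using assms re by (simp add: complex_eq_iff Re_exp)
  then obtain m :: int where "Im z = of_int m * 2 * pi" by (auto simp: cos_one_2pi_int)
  then have "z = of_int m * (2 * complex_of_real pi * \<i>)" using re by (simp add: complex_eq_iff)
  then show ?thesis ..
qed

text \<open>\<open>v\<close> is also an eigenvector of the unipotent \<open>u\<close>, with
  eigenvalue \<open>exp (- 2 pi i l)\<close>, which must therefore be \<open>1\<close>.\<close>

lemma unipotent_exponents_integral:
  assumes C: "C \<in> carrier_mat n n" and v: "v \<in> carrier_vec n" "v \<noteq> 0\<^sub>v n" and ev: "C *\<^sub>v v = l \<cdot>\<^sub>v v"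
    and u: "u = exp_mat n ((- (2 * complex_of_real pi * \<i>)) \<cdot>\<^sub>m C)" and k: "(u - 1\<^sub>m n) ^\<^sub>m k = 0\<^sub>m n n"
  shows "l \<in> \<int>"
proof -
  let ?c = "- (2 * complex_of_real pi * \<i>)"
  have cC: "?c \<cdot>\<^sub>m C \<in> carrier_mat n n" using C by simp
  have "(?c \<cdot>\<^sub>m C) *\<^sub>v v = (?c * l) \<cdot>\<^sub>v v"
  proof (rule eq_vecI)
    fix i assume "i < dim_vec ((?c * l) \<cdot>\<^sub>v v)"
    then have i: "i < n" using v by simp
    have "((?c \<cdot>\<^sub>m C) *\<^sub>v v) $ i = ?c * (C *\<^sub>v v) $ i"
      unfolding index_mult_mat_vec_sum[OF i cC v(1)] index_mult_mat_vec_sum[OF i C v(1)] sum_distrib_left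
      by (rule sum.cong) (use i C in auto)
    then show "((?c \<cdot>\<^sub>m C) *\<^sub>v v) $ i = ((?c * l) \<cdot>\<^sub>v v) $ i" using ev i v by simp
  qed (use C v in simp)
  then have uv: "u *\<^sub>v v = exp (?c * l) \<cdot>\<^sub>v v"
    unfolding u by (rule exp_mat_eigenvector[OF cC v(1) _ v(2)])
  have uc: "u \<in> carrier_mat n n" by (simp add: u exp_mat_def)
  have u1: "u - 1\<^sub>m n \<in> carrier_mat n n" using uc by (intro minus_carrier_mat) simp
  have "(u - 1\<^sub>m n) *\<^sub>v v = (exp (?c * l) - 1) \<cdot>\<^sub>v v"
    unfolding minus_mult_distrib_mat_vec[OF uc one_carrier_mat v(1)] uv
    by (rule eq_vecI) (use v in \<open>auto simp: algebra_simps\<close>)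
  then have "eigenvector (u - 1\<^sub>m n) v (exp (?c * l) - 1)"
    using u1 v by (simp add: eigenvector_def)
  then have "(u - 1\<^sub>m n) ^\<^sub>m k *\<^sub>v v = (exp (?c * l) - 1) ^ k \<cdot>\<^sub>v v"
    by (rule eigenvector_pow[OF u1])
  moreover have "0\<^sub>m n n *\<^sub>v v = 0\<^sub>v n" by (rule eq_vecI) (use v in auto)
  ultimately have z: "(exp (?c * l) - 1) ^ k \<cdot>\<^sub>v v = 0\<^sub>v n" unfolding k by simp
  obtain i where i: "i < n" "v $ i \<noteq> 0" using v eq_vecI[of v "0\<^sub>v n"] by fastforce
  have "(exp (?c * l) - 1) ^ k * v $ i = 0" using arg_cong[OF z, of "\<lambda>w. w $ i"] i v by simp
  then have "exp (?c * l) = 1" using i by simp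
  then obtain m :: int where "?c * l = of_int m * (2 * complex_of_real pi * \<i>)" using exp_eq_1_imp by blast
  then have "(2 * complex_of_real pi * \<i>) * (- l) = (2 * complex_of_real pi * \<i>) * of_int m"
    by (simp add: mult_ac)
  then have "- l = of_int m" by (subst (asm) mult_left_cancel) auto
  then have "l = of_int (- m)" by (metis minus_minus of_int_minus)
  then show ?thesis by (simp only: Ints_of_int)
qed

text \<open>Unipotent monodromy makes the eigenvalues of the constant matrix integers. A shear by
  these integers removes them from the diagonal of a triangular form, and the residue becomes
  strictly upper triangular.\<close>

lemma unipotent_normal_form:
  assumes B: "B \<in> carrier_mat n n" and mon: "principal_unipotent_monodromy n B"
  shows "\<exists>g. g \<in> carrier_mat n n \<and> det g \<noteq> 0 \<and>
    (\<forall>i<n. \<forall>j<n. fls_ge 1 0 (gauge fls_theta g B $$ (i,j)) \<and> (j \<le> i \<longrightarrow> fls_nth (gauge fls_theta g B $$ (i,j)) 0 = 0))"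
proof -
  obtain u k where mu: "has_monodromy n B u" and uk: "(u - 1\<^sub>m n) ^\<^sub>m k = 0\<^sub>m n n"
    using mon by (auto simp: principal_unipotent_monodromy_def regular_unipotent_def)
  obtain g C where g: "g \<in> carrier_mat n n" "det g \<noteq> 0" and C: "C \<in> carrier_mat n n"
    and gB: "gauge fls_theta g B = map_mat fls_const C"
    and u: "u = exp_mat n ((- (2 * complex_of_real pi * \<i>)) \<cdot>\<^sub>m C)"
    using mu by (auto simp: has_monodromy_def GL_mats_def)
  obtain es0 where es0: "char_poly C = (\<Prod>a\<leftarrow>es0. [:- a, 1:])" using char_poly_factorized[OF C] by blast
  \<comment> \<open>Eigenvalues are arranged in decreasing order along the diagonal of the Schur
    form: the shear multiplies an entry above the diagonal by the power \<open>e i - e j\<close> of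
    the coordinate, which must not be negative.\<close>
  define es where "es = rev (sort_key Re es0)"
  have "(\<Prod>a\<leftarrow>es. [:- a, 1:]) = prod_mset (image_mset (\<lambda>a. [:- a, 1:]) (mset es))"
    by (metis mset_map prod_mset_prod_list)
  also have "mset es = mset es0" by (simp add: es_def)
  also have "prod_mset (image_mset (\<lambda>a. [:- a, 1:]) (mset es0)) = (\<Prod>a\<leftarrow>es0. [:- a, 1:])"
    by (metis mset_map prod_mset_prod_list)
  finally have es: "char_poly C = (\<Prod>a\<leftarrow>es. [:- a, 1:])" using es0 by simp
  have int: "a \<in> \<int>" if a: "a \<in> set es" for a
  proof -
    have "poly (char_poly C) a = 0" unfolding es using a by (auto simp: poly_prod_list prod_list_zero_iff)
    then have "eigenvalue C a" using eigenvalue_root_char_poly[OF C] by simp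
    then obtain v where "eigenvector C v a" by (auto simp: eigenvalue_def)
    then have "v \<in> carrier_vec n" "v \<noteq> 0\<^sub>v n" "C *\<^sub>v v = a \<cdot>\<^sub>v v" using C by (auto simp: eigenvector_def)
    then show ?thesis by (rule unipotent_exponents_integral[OF C _ _ _ u uk])
  qed
  obtain T P Q where sch: "schur_decomposition C es = (T, P, Q)" by (cases "schur_decomposition C es") auto
  have sim: "similar_mat_wit C T P Q" and ut: "upper_triangular T" and dT: "diag_mat T = es"
    using schur_decomposition[OF C es sch] by auto
  note w = similar_mat_witD2[OF C sim]
  have len: "length es = n" using dT w(5) by (auto simp: diag_mat_def)
  have Tii: "T $$ (i,i) = es ! i" if "i < n" for i using dT w(5) that by (auto simp: diag_mat_def)
  define e where "e i = \<lfloor>Re (es ! i)\<rfloor>" for i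
  have Te: "T $$ (i,i) = of_int (e i)" if "i < n" for i
    using int[of "es ! i"] that len by (auto simp: Tii e_def elim!: Ints_cases)
  have mono: "e j \<le> e i" if "i \<le> j" "j < n" for i j
  proof -
    have "sorted (map Re (rev es))" by (simp add: es_def)
    then have "sorted (rev (map Re es))" by (simp add: rev_map)
    then have "map Re es ! j \<le> map Re es ! i"
      by (rule sorted_rev_nth_mono) (use that len in auto)
    then show ?thesis using that len unfolding e_def by (simp add: floor_mono)
  qed
  have cC: "map_mat fls_const C \<in> carrier_mat n n" using C by simp
  define Q' where "Q' = (map_mat fls_const Q :: complex fls mat)"
  have Q': "Q' \<in> carrier_mat n n" using w by (simp add: Q'_def)
  have dQ': "n > 0 \<Longrightarrow> det Q' \<noteq> 0" using gauge_const_index(2)[OF cC w(6,7,2), of 0 0] by (simp add: Q'_def)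
  show ?thesis
  proof (cases "n = 0")
    case True
    then show ?thesis using g by blast
  next
    case False
    have TQ: "T = Q * C * P"
    proof -
      have "Q * C * P = Q * (P * T * Q) * P" using w(3) by simp
      also have "P * T * Q = P * (T * Q)" by (rule assoc_mult_mat[of _ n n _ n _ n]) (use w in auto)
      also have "Q * (P * (T * Q)) = Q * P * (T * Q)" by (rule assoc_mult_mat[of _ n n _ n _ n, symmetric]) (use w in auto)
      also have "\<dots> = T * Q" using w by simp
      also have "T * Q * P = T * (Q * P)" by (rule assoc_mult_mat[of _ n n _ n _ n]) (use w in auto)
      finally show ?thesis using w by simp
    qed
    have QC: "gauge fls_theta Q' (map_mat fls_const C) = map_mat fls_const T"
    proof (rule eq_matI)
      interpret comm_ring_hom "fls_const :: complex \<Rightarrow> complex fls" by (rule fls_const_hom)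
      fix i j assume "i < dim_row (map_mat fls_const T :: complex fls mat)" "j < dim_col (map_mat fls_const T :: complex fls mat)"
      then have ij: "i < n" "j < n" using w by auto
      have "gauge fls_theta Q' (map_mat fls_const C) $$ (i,j) =
        (\<Sum>a<n. \<Sum>b<n. fls_const (Q $$ (i,a) * P $$ (b,j)) * map_mat fls_const C $$ (a,b))"
        unfolding Q'_def by (rule gauge_const_index(1)[OF cC w(6,7,2) ij])
      also have "\<dots> = fls_const (\<Sum>a<n. \<Sum>b<n. Q $$ (i,a) * P $$ (b,j) * C $$ (a,b))"
        unfolding hom_sum using C by (intro sum.cong refl) (simp add: fls_const_mult_const)
      also have "(\<Sum>a<n. \<Sum>b<n. Q $$ (i,a) * P $$ (b,j) * C $$ (a,b)) = T $$ (i,j)"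
        unfolding TQ using conj_mat_index[OF w(7,6) C ij] by simp
      finally show "gauge fls_theta Q' (map_mat fls_const C) $$ (i,j) = map_mat fls_const T $$ (i,j)"
        using ij w by simp
    qed (use gauge_closed[OF Q' dQ' cC, of fls_theta] False w in auto)
    define D where "D = (mat_diag n (\<lambda>i. fls_X_intpow (e i)) :: complex fls mat)"
    have cT: "map_mat fls_const T \<in> carrier_mat n n" using w by simp
    have D: "D \<in> carrier_mat n n" "det D \<noteq> 0"
      using gauge_diag_index(2)[OF cT, of 0 0 e] False by (auto simp: D_def)
    define h where "h = D * (Q' * g)"
    have Qg: "Q' * g \<in> carrier_mat n n" "det (Q' * g) \<noteq> 0"
      using Q' g dQ' False det_mult[OF Q' g(1)] by auto
    have h: "h \<in> carrier_mat n n" "det h \<noteq> 0" using D Qg det_mult[OF D(1) Qg(1)] by (auto simp: h_def)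
    have "gauge fls_theta h B = gauge fls_theta D (gauge fls_theta (Q' * g) B)"
      unfolding h_def by (rule fls_theta.gauge_mult[OF D Qg B, symmetric])
    also have "gauge fls_theta (Q' * g) B = gauge fls_theta Q' (gauge fls_theta g B)"
      by (rule fls_theta.gauge_mult[OF Q' dQ' g B, symmetric]) (use False in simp)
    finally have hB: "gauge fls_theta h B = gauge fls_theta D (map_mat fls_const T)"
      unfolding gB QC .
    have ix: "gauge fls_theta h B $$ (i,j) = (if j \<le> i then 0 else fls_X_intpow (e i - e j) * fls_const (T $$ (i,j)))"
      if ij: "i < n" "j < n" for i j
    proof -
      have "gauge fls_theta h B $$ (i,j) = fls_X_intpow (e i - e j) * fls_const (T $$ (i,j)) - (if i = j then of_int (e i) else 0)"
        unfolding hB D_def using gauge_diag_index(1)[OF cT ij, of e] ij w by simp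
      moreover have "T $$ (i,j) = 0" if "j < i" using ut w(5) ij that by (auto simp: upper_triangular_def)
      ultimately show ?thesis using ij by (auto simp: Te fls_of_int)
    qed
    have "fls_ge 1 0 (gauge fls_theta h B $$ (i,j)) \<and> (j \<le> i \<longrightarrow> fls_nth (gauge fls_theta h B $$ (i,j)) 0 = 0)"
      if ij: "i < n" "j < n" for i j
      unfolding ix[OF ij] using mono[of i j] ij by (auto simp: fls_ge_def fls_shifted_times_simps)
    then show ?thesis using h by blast
  qed
qed

section \<open>Rational functions and their expansions\<close>

lemma map_poly_fls_const_pCons:
  "map_poly fls_const (pCons c p) = pCons (fls_const c) (map_poly fls_const p)"
  by (rule poly_eqI) (simp add: coeff_map_poly coeff_pCons split: nat.split)

lemma eval_at_hom:
  shows "eval_at x 0 = 0" "eval_at x 1 = 1" "eval_at x (p + q) = eval_at x p + eval_at x q"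
    "eval_at x (p - q) = eval_at x p - eval_at x q"
    "eval_at x (p * q) = eval_at x p * eval_at x q" "eval_at x [:c:] = fls_const c"
proof -
  interpret map_poly_comm_ring_hom "fls_const :: complex \<Rightarrow> complex fls"
    using fls_const_hom by (simp add: map_poly_comm_ring_hom_def)
  show "eval_at x 0 = 0" "eval_at x 1 = 1" "eval_at x (p + q) = eval_at x p + eval_at x q"
    "eval_at x (p - q) = eval_at x p - eval_at x q"
    "eval_at x (p * q) = eval_at x p * eval_at x q"
    by (simp_all add: eval_at_def hom_add hom_mult hom_minus)
  show "eval_at x [:c:] = fls_const c" by (simp add: eval_at_def map_poly_fls_const_pCons)
qed

lemma eval_at_pCons: "eval_at x (pCons c p) = fls_const c + x * eval_at x p"
  by (simp add: eval_at_def map_poly_fls_const_pCons)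

lemma theta_eval_at:
  assumes "fls_theta x = fls_const d * x"
  shows "fls_theta (eval_at x p) = fls_const d * x * eval_at x (pderiv p)"
proof (induction p)
  case 0
  show ?case by (simp add: eval_at_hom)
next
  case (pCons c p)
  have "eval_at x (pderiv (pCons c p)) = eval_at x p + x * eval_at x (pderiv p)"
    by (simp add: pderiv_pCons eval_at_hom eval_at_pCons)
  then show ?case using pCons assms
    by (simp add: eval_at_pCons fls_theta.add fls_theta.mult algebra_simps)
qed

lemma eval_at_X: "eval_at fls_X p = fps_to_fls (fps_of_poly p)"
proof (induction p)
  case (pCons c p)
  then show ?case
  proof -
    have "fps_to_fls fps_X = (fls_X :: complex fls)" by (rule fls_eqI) auto
    then show ?thesis using pCons
      by (simp add: eval_at_pCons fps_of_poly_pCons fls_times_fps_to_fls mult.commute)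
  qed
qed (simp add: eval_at_hom)

lemma eval_at_X_nth: "fls_nth (eval_at fls_X p) (int k) = coeff p k"
  by (simp add: eval_at_X)

text \<open>Keeps denominators nonzero under substitution, so that \<open>expand\<close> may be
  computed from any representing fraction.\<close>

definition transcendental :: "complex fls \<Rightarrow> bool" where
  "transcendental x \<longleftrightarrow> (\<forall>p. eval_at x p = 0 \<longrightarrow> p = 0)"

lemma transcendental_X: "transcendental fls_X"
  unfolding transcendental_def
proof (intro allI impI)
  fix p assume "eval_at fls_X p = 0"
  then have "coeff p k = 0" for k using eval_at_X_nth[of p k] by simp
  then show "p = 0" by (simp add: poly_eq_iff)
qed

lemma transcendental_X_inv: "transcendental fls_X_inv"
  unfolding transcendental_def
proof (intro allI impI)
  fix p assume "eval_at fls_X_inv p = 0"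
  then have "coeff p k = 0" for k using eval_at_X_inv_nth[of p k] by simp
  then show "p = 0" by (simp add: poly_eq_iff)
qed

lemma expand_Fract:
  assumes x: "transcendental x" and q: "q \<noteq> 0"
  shows "expand x (Fract p q) = eval_at x p / eval_at x q"
proof -
  obtain p0 q0 where pq: "quot_of_fract (Fract p q) = (p0, q0)" by (cases "quot_of_fract (Fract p q)")
  have q0: "q0 \<noteq> 0" using pq by (metis snd_conv snd_quot_of_fract_nonzero)
  have "Fract p0 q0 = Fract p q" using pq by (metis Fract_quot_of_fract fst_conv snd_conv)
  then have "p0 * q = p * q0" using q q0 by (simp add: eq_fract)
  then have "eval_at x p0 * eval_at x q = eval_at x p * eval_at x q0" by (metis eval_at_hom(5))
  moreover have "eval_at x q \<noteq> 0" "eval_at x q0 \<noteq> 0" using x q q0 by (auto simp: transcendental_def)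
  ultimately show ?thesis unfolding expand_def pq by (simp add: field_simps)
qed

lemma fract_cases: obtains p q :: "complex poly" where "f = Fract p q" "q \<noteq> 0"
  by (cases f) auto

lemma expand_hom:
  assumes x: "transcendental x"
  shows "comm_ring_hom (expand x)"
proof
  have nz: "eval_at x q \<noteq> 0" if "q \<noteq> 0" for q using x that by (auto simp: transcendental_def)
  show "expand x 0 = 0" "expand x 1 = 1"
    using expand_Fract[OF x, of 1 0] expand_Fract[OF x, of 1 1]
    by (simp_all add: eval_at_hom Zero_fract_def One_fract_def)
  fix f g :: ratfun
  obtain p q where f: "f = Fract p q" "q \<noteq> 0" by (rule fract_cases)
  obtain r s where g: "g = Fract r s" "s \<noteq> 0" by (rule fract_cases)
  show "expand x (f + g) = expand x f + expand x g" "expand x (f * g) = expand x f * expand x g"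
    unfolding f(1) g(1) using f(2) g(2) nz
    by (simp_all add: expand_Fract[OF x] eval_at_hom field_simps)
qed

lemma expand_0 [simp]:
  assumes "transcendental x" shows "expand x 0 = 0"
proof -
  interpret comm_ring_hom "expand x" by (rule expand_hom[OF assms])
  show ?thesis by (rule hom_zero)
qed

lemma expand_eq_0:
  assumes x: "transcendental x" and "expand x f = 0"
  shows "f = 0"
proof -
  obtain p q where f: "f = Fract p q" "q \<noteq> 0" by (rule fract_cases)
  then have "eval_at x p / eval_at x q = 0" "eval_at x q \<noteq> 0"
    using assms expand_Fract[OF x f(2)] by (auto simp: transcendental_def)
  then have "p = 0" using x by (auto simp: transcendental_def)
  then show ?thesis using f by (simp add: eq_fract Zero_fract_def)
qed

text \<open>\<open>d\<close> is \<open>1\<close> at zero and \<open>-1\<close> at infinity, where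
  \<open>z = t^-1\<close> and \<open>dt/t = - dz/z\<close>.\<close>

lemma expand_theta:
  assumes x: "transcendental x" and d: "fls_theta x = fls_const d * x"
  shows "fls_theta (expand x f) = fls_const d * expand x (rat_theta f)"
proof -
  interpret comm_ring_hom "expand x" by (rule expand_hom[OF x])
  obtain p q where pq: "quot_of_fract f = (p, q)" by (cases "quot_of_fract f")
  have q: "q \<noteq> 0" using pq by (metis snd_conv snd_quot_of_fract_nonzero)
  have nz: "eval_at x q \<noteq> 0" using x q by (auto simp: transcendental_def)
  have t: "expand x rat_t = x"
    using expand_Fract[OF x, of 1 "[:0, 1:]"] by (simp add: to_fract_def eval_at_hom eval_at_pCons)
  have 1: "expand x (rat_theta f) = x * ((eval_at x (pderiv p) * eval_at x q - eval_at x p * eval_at x (pderiv q)) / (eval_at x q)\<^sup>2)"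
    unfolding rat_theta_def pq using q
    by (simp add: hom_mult t expand_Fract[OF x] eval_at_hom power2_eq_square)
  have 2: "expand x f = eval_at x p * inverse (eval_at x q)"
    unfolding expand_def pq by (simp add: field_class.field_divide_inverse)
  show ?thesis unfolding 1 2 fls_theta.mult fls_theta.inverse[OF nz] theta_eval_at[OF d]
    using nz by (simp add: field_simps power2_eq_square)
qed

lemma expand_theta_X: "expand fls_X (rat_theta f) = fls_theta (expand fls_X f)"
  using expand_theta[OF transcendental_X, of 1 f] by (simp add: fls_theta_X)

lemma fls_theta_X_inv: "fls_theta fls_X_inv = - fls_X_inv"
  by (rule fls_eqI) simp

lemma expand_theta_X_inv: "expand fls_X_inv (rat_theta f) = - fls_theta (expand fls_X_inv f)"
  using expand_theta[OF transcendental_X_inv, of "-1" f] by (simp add: fls_theta_X_inv fls_const_uminus[symmetric])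

text \<open>Adding or multiplying quotient rules in lowest terms is avoided: expansion at zero is
  injective and carries \<open>rat_theta\<close> to \<open>fls_theta\<close>, so the laws are
  inherited.\<close>

interpretation rat_theta: derivation rat_theta
proof
  interpret comm_ring_hom "expand fls_X" by (rule expand_hom[OF transcendental_X])
  have inj: "f = g" if "expand fls_X f = expand fls_X g" for f g
    using expand_eq_0[OF transcendental_X, of "f - g"] that by (simp add: hom_minus)
  fix f g :: ratfun
  show "rat_theta (f + g) = rat_theta f + rat_theta g"
    by (rule inj) (simp add: hom_add expand_theta_X fls_theta.add)
  show "rat_theta (f * g) = rat_theta f * g + f * rat_theta g"
    by (rule inj) (simp add: hom_add hom_mult expand_theta_X fls_theta.mult)
qed

lemma expand_t: "transcendental x \<Longrightarrow> expand x rat_t = x"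
  using expand_Fract[of x 1 "[:0, 1:]"] by (simp add: to_fract_def eval_at_hom eval_at_pCons)

lemma expand_const: "transcendental x \<Longrightarrow> expand x (rat_const c) = fls_const c"
  using expand_Fract[of x 1 "[:c:]"] by (simp add: to_fract_def eval_at_hom)

lemma expand_inj:
  assumes x: "transcendental x" and "expand x f = expand x g" shows "f = g"
proof -
  interpret comm_ring_hom "expand x" by (rule expand_hom[OF x])
  show ?thesis using expand_eq_0[OF x, of "f - g"] assms by (simp add: hom_minus)
qed

lemma rat_t_nonzero [simp]: "rat_t \<noteq> 0"
  by simp

lemma rat_theta_t: "rat_theta rat_t = rat_t"
  by (rule expand_inj[OF transcendental_X]) (simp add: expand_theta_X expand_t transcendental_X fls_theta_X)

lemma rat_theta_inverse_t: "rat_theta (inverse rat_t) = - inverse rat_t"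
  unfolding rat_theta.inverse[OF rat_t_nonzero] rat_theta_t by (simp add: power2_eq_square field_simps)

lemma rat_theta_const: "rat_theta (rat_const c) = 0"
  by (rule expand_inj[OF transcendental_X]) (simp add: expand_theta_X expand_const transcendental_X)

lemma rat_theta_eq_0:
  assumes "rat_theta f = 0" shows "\<exists>c. f = rat_const c"
proof -
  have "fls_theta (expand fls_X f) = 0"
    unfolding expand_theta_X[symmetric] using assms by (simp add: transcendental_X)
  then have "of_int m * fls_nth (expand fls_X f) m = 0" for m
    by (metis fls_theta_nth fls_zero_nth)
  then have "expand fls_X f = fls_const (fls_nth (expand fls_X f) 0)"
    by (intro fls_eqI) auto
  also have "\<dots> = expand fls_X (rat_const (fls_nth (expand fls_X f) 0))"
    by (simp add: expand_const transcendental_X)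
  finally show ?thesis using expand_inj[OF transcendental_X] by blast
qed

lemma expand_inverse:
  assumes x: "transcendental x" shows "expand x (inverse f) = inverse (expand x f)"
proof (cases "f = 0")
  case False
  interpret comm_ring_hom "expand x" by (rule expand_hom[OF x])
  have "expand x f * expand x (inverse f) = 1" using False by (simp flip: hom_mult)
  then show ?thesis by (metis inverse_unique)
qed (use x in simp)

text \<open>A denominator in lowest terms divides every other denominator, so regularity may be
  tested point by point with any fraction. Closure under sums and products is then
  immediate.\<close>

lemma regular_on_iff:
  "f \<in> regular_on U \<longleftrightarrow> (\<forall>a\<in>U. \<exists>p q. poly q a \<noteq> 0 \<and> f = Fract p q)"
proof
  assume "f \<in> regular_on U"
  then show "\<forall>a\<in>U. \<exists>p q. poly q a \<noteq> 0 \<and> f = Fract p q"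
    unfolding regular_on_def by (metis (mono_tags, lifting) Fract_quot_of_fract mem_Collect_eq)
next
  assume *: "\<forall>a\<in>U. \<exists>p q. poly q a \<noteq> 0 \<and> f = Fract p q"
  show "f \<in> regular_on U" unfolding regular_on_def
  proof (clarify)
    fix a assume a: "a \<in> U" "poly (snd (quot_of_fract f)) a = 0"
    obtain p q where pq: "poly q a \<noteq> 0" "f = Fract p q" using * a by blast
    define p0 q0 where "p0 = fst (quot_of_fract f)" and "q0 = snd (quot_of_fract f)"
    have "Fract p0 q0 = Fract p q" "q0 \<noteq> 0" "q \<noteq> 0" using pq by (auto simp: p0_def q0_def)
    then have e: "p0 * q = p * q0" by (simp add: eq_fract)
    have "coprime p0 q0" unfolding p0_def q0_def by (rule coprime_quot_of_fract)
    moreover have "q0 dvd p0 * q" unfolding e by simp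
    ultimately have "q0 dvd q" by (simp add: coprime_dvd_mult_right_iff coprime_commute)
    then have "poly q a = 0" using a(2) by (auto simp: q0_def elim!: dvdE)
    with pq show False by simp
  qed
qed

lemma regular_on_mono: "f \<in> regular_on U \<Longrightarrow> V \<subseteq> U \<Longrightarrow> f \<in> regular_on V"
  by (auto simp: regular_on_def)

lemma regular_on_Union: "(\<And>i. i \<in> I \<Longrightarrow> f \<in> regular_on (U i)) \<Longrightarrow> f \<in> regular_on (\<Union>i\<in>I. U i)"
  by (auto simp: regular_on_def)

lemma regular_on_to_fract: "to_fract p \<in> regular_on U"
  unfolding regular_on_iff to_fract_def by (intro ballI exI[of _ p] exI[of _ 1]) simp

lemma regular_on_add:
  assumes "f \<in> regular_on U" "g \<in> regular_on U" shows "f + g \<in> regular_on U"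
  unfolding regular_on_iff
proof
  fix a assume a: "a \<in> U"
  obtain p q r s where *: "poly q a \<noteq> 0" "f = Fract p q" "poly s a \<noteq> 0" "g = Fract r s"
    using assms a unfolding regular_on_iff by meson
  then have "f + g = Fract (p * s + r * q) (q * s)" by (auto intro!: add_fract)
  with * show "\<exists>p q. poly q a \<noteq> 0 \<and> f + g = Fract p q" by (metis mult_eq_0_iff poly_mult)
qed

lemma regular_on_mult:
  assumes "f \<in> regular_on U" "g \<in> regular_on U" shows "f * g \<in> regular_on U"
  unfolding regular_on_iff
proof
  fix a assume a: "a \<in> U"
  obtain p q r s where *: "poly q a \<noteq> 0" "f = Fract p q" "poly s a \<noteq> 0" "g = Fract r s"
    using assms a unfolding regular_on_iff by meson
  then have "f * g = Fract (p * r) (q * s)" by simp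
  with * show "\<exists>p q. poly q a \<noteq> 0 \<and> f * g = Fract p q" by (metis mult_eq_0_iff poly_mult)
qed

lemma regular_on_0 [simp]: "0 \<in> regular_on U" and regular_on_1 [simp]: "1 \<in> regular_on U"
  using regular_on_to_fract[of 0 U] regular_on_to_fract[of 1 U] by simp_all

lemma regular_on_uminus: "f \<in> regular_on U \<Longrightarrow> - f \<in> regular_on U"
  using regular_on_mult[OF regular_on_to_fract[of "- 1" U]] by simp

lemma regular_on_sum: "(\<And>x. x \<in> S \<Longrightarrow> f x \<in> regular_on U) \<Longrightarrow> (\<Sum>x\<in>S. f x) \<in> regular_on U"
  by (induction S rule: infinite_finite_induct) (auto intro: regular_on_add)

lemma regular_on_prod: "(\<And>x. x \<in> S \<Longrightarrow> f x \<in> regular_on U) \<Longrightarrow> (\<Prod>x\<in>S. f x) \<in> regular_on U"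
  by (induction S rule: infinite_finite_induct) (auto intro: regular_on_mult)

lemma regular_on_rat_theta:
  assumes "f \<in> regular_on U" shows "rat_theta f \<in> regular_on U"
proof -
  obtain p q where pq: "quot_of_fract f = (p, q)" by (cases "quot_of_fract f")
  have "Fract (pderiv p * q - p * pderiv q) (q ^ 2) \<in> regular_on U"
    unfolding regular_on_iff
  proof
    fix a assume "a \<in> U"
    then have "poly (q ^ 2) a \<noteq> 0" using assms pq by (auto simp: regular_on_def)
    then show "\<exists>p' q'. poly q' a \<noteq> 0 \<and> Fract (pderiv p * q - p * pderiv q) (q ^ 2) = Fract p' q'" by blast
  qed
  then show ?thesis unfolding rat_theta_def pq using regular_on_mult[OF regular_on_to_fract] by simp
qed

lemma regular_on_inverse_t: "0 \<notin> U \<Longrightarrow> inverse rat_t \<in> regular_on U"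
  unfolding regular_on_iff to_fract_def by (intro ballI exI[of _ 1] exI[of _ "[:0, 1:]"]) auto

lemma regular_on_det:
  assumes "M \<in> carrier_mat n n" "\<And>i j. i < n \<Longrightarrow> j < n \<Longrightarrow> M $$ (i,j) \<in> regular_on U"
  shows "det M \<in> regular_on U"
  unfolding det_def'[OF assms(1)]
proof (rule regular_on_sum)
  fix p assume "p \<in> {p. p permutes {0..<n}}"
  then have "i < n \<Longrightarrow> p i < n" for i using permutes_in_image[of p "{0..<n}" i] by simp
  then have "(\<Prod>i=0..<n. M $$ (i, p i)) \<in> regular_on U" by (intro regular_on_prod assms(2)) auto
  then show "signof p * (\<Prod>i=0..<n. M $$ (i, p i)) \<in> regular_on U"
    by (auto simp: sign_def regular_on_uminus)
qed

text \<open>The divisor of a rational function has degree \<open>0\<close>, and away from zero and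
  infinity \<open>f\<close> has no poles. Concretely, the denominator is a constant times a power of
  \<open>t\<close> by the fundamental theorem of algebra.\<close>

lemma laurent_polynomial_orders:
  assumes f: "f \<in> regular_on (- {0})" "f \<noteq> 0"
  shows "fls_subdegree (expand fls_X f) + fls_subdegree (expand fls_X_inv f) \<le> 0"
proof -
  define p q where "p = fst (quot_of_fract f)" and "q = snd (quot_of_fract f)"
  have pq: "p \<noteq> 0" "q \<noteq> 0" "f = Fract p q" using f by (auto simp: p_def q_def)
  have q0: "poly q a \<noteq> 0" if "a \<noteq> 0" for a using f that by (auto simp: regular_on_def q_def)
  obtain q' where q': "q = [:- 0, 1:] ^ Polynomial.order 0 q * q'" "\<not> [:- 0, 1:] dvd q'"
    using order_decomp[OF pq(2)] by blast
  have "poly q' 0 \<noteq> 0" using q'(2) by (simp add: poly_eq_0_iff_dvd)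
  moreover have "poly q' a \<noteq> 0" if "a \<noteq> 0" for a using q0[OF that] by (subst (asm) q'(1)) simp
  ultimately have "\<forall>a. poly q' a \<noteq> 0" by metis
  then have "constant (poly q')" using fundamental_theorem_of_algebra by blast
  then have "degree q' = 0" by (simp add: constant_degree)
  then obtain c where c: "q' = [:c:]" by (rule degree_eq_zeroE)
  define e where "e = Polynomial.order 0 q"
  have q: "q = [:0, 1:] ^ e * [:c:]" using q'(1) c by (simp add: e_def)
  have c0: "c \<noteq> 0" using pq(2) q by auto
  have pw: "eval_at x ([:0, 1:] ^ e) = x ^ e" for x
    by (induction e) (simp_all add: eval_at_hom eval_at_pCons)
  have nzp: "eval_at fls_X p \<noteq> 0" "eval_at fls_X_inv p \<noteq> 0"
    using pq transcendental_X transcendental_X_inv by (auto simp: transcendental_def)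
  have "fls_subdegree (expand fls_X f) = fls_subdegree (eval_at fls_X p) - int e"
    unfolding pq(3) expand_Fract[OF transcendental_X pq(2)] unfolding q eval_at_hom pw
    using nzp c0 by (simp add: fls_divide_subdegree)
  moreover have "fls_subdegree (expand fls_X_inv f) = fls_subdegree (eval_at fls_X_inv p) + int e"
    unfolding pq(3) expand_Fract[OF transcendental_X_inv pq(2)] unfolding q eval_at_hom pw
    using nzp c0 by (simp add: fls_divide_subdegree)
  moreover have "fls_subdegree (eval_at fls_X p) \<le> int (degree p)"
    by (rule fls_subdegree_leI) (simp add: eval_at_X_nth pq)
  moreover have "fls_subdegree (eval_at fls_X_inv p) \<le> - int (degree p)"
    by (rule fls_subdegree_leI) (simp add: eval_at_X_inv_nth pq)
  ultimately show ?thesis by linarith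
qed

section \<open>A generator of the lattice\<close>

text \<open>\<open>e\<close> is the sign by which an expansion changes the derivation:
  \<open>1\<close> at zero and \<open>-1\<close> at infinity.\<close>

lemma nabla_hom:
  fixes h :: "'a::field \<Rightarrow> 'b::field"
  assumes h: "comm_ring_hom h" and \<delta>: "\<And>x. h (\<delta> x) = e * \<delta>' (h x)" and e: "e * e = 1"
    and A: "A \<in> carrier_mat n n" and v: "v \<in> carrier_vec n"
  shows "map_vec h (nabla \<delta> A v) = e \<cdot>\<^sub>v nabla \<delta>' (e \<cdot>\<^sub>m map_mat h A) (map_vec h v)"
proof (rule eq_vecI)
  interpret comm_ring_hom h by fact
  have hA: "e \<cdot>\<^sub>m map_mat h A \<in> carrier_mat n n" and hv: "map_vec h v \<in> carrier_vec n" using A v by auto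
  fix i assume "i < dim_vec (e \<cdot>\<^sub>v nabla \<delta>' (e \<cdot>\<^sub>m map_mat h A) (map_vec h v))"
  then have i: "i < n" using A by simp
  have "map_vec h (nabla \<delta> A v) $ i = e * \<delta>' (h (v $ i)) + (\<Sum>j<n. h (A $$ (i,j)) * h (v $ j))"
    using i A v index_nabla[OF i A v, of \<delta>] by (simp add: hom_add hom_sum hom_mult \<delta>)
  also have "(\<Sum>j<n. h (A $$ (i,j)) * h (v $ j)) = (\<Sum>j<n. e * (e * h (A $$ (i,j)) * h (v $ j)))"
  proof (rule sum.cong)
    fix j
    have "e * (e * h (A $$ (i,j)) * h (v $ j)) = (e * e) * (h (A $$ (i,j)) * h (v $ j))" by (simp only: mult_ac)
    then show "h (A $$ (i,j)) * h (v $ j) = e * (e * h (A $$ (i,j)) * h (v $ j))" unfolding e by simp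
  qed simp
  also have "e * \<delta>' (h (v $ i)) + \<dots> = e * (\<delta>' (h (v $ i)) + (\<Sum>j<n. e * h (A $$ (i,j)) * h (v $ j)))"
    by (simp add: distrib_left sum_distrib_left)
  also have "\<dots> = (e \<cdot>\<^sub>v nabla \<delta>' (e \<cdot>\<^sub>m map_mat h A) (map_vec h v)) $ i"
    using i A v index_nabla[OF i hA hv, of \<delta>'] by simp
  finally show "map_vec h (nabla \<delta> A v) $ i = (e \<cdot>\<^sub>v nabla \<delta>' (e \<cdot>\<^sub>m map_mat h A) (map_vec h v)) $ i" .
qed (use A in simp)

text \<open>What the global argument uses of the connection: a companion frame \<open>W0\<close> at
  zero, a frame \<open>g\<close> at infinity with strictly upper triangular residue, and the module
  \<open>M\<close> of sections over the punctured line, known through closure properties.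
  \<open>M_det\<close> reflects that the bundle has trivial determinant, so that \<open>n\<close>
  sections have a regular function as their determinant; it stands in for local freeness.\<close>

locale lattice_pair =
  fixes n :: nat and A :: "ratfun mat" and W0 :: "complex fls mat" and c :: "complex fls vec"
    and g :: "complex fls mat" and M :: "ratfun vec set"
  assumes n2: "n \<ge> 2" and A: "A \<in> carrier_mat n n"
    and W0: "W0 \<in> carrier_mat n n" "det W0 \<noteq> 0"
    and comp: "gauge fls_theta (minv W0) (map_mat (expand fls_X) A) = companion n c"
    and c_pos: "\<And>i. i < n \<Longrightarrow> i > 0 \<Longrightarrow> fls_ge 1 0 (c $ i)"
    and c_zero: "fls_ge 1 (-1) (c $ 0)" and c_lead: "fls_nth (c $ 0) (-1) \<noteq> 0"
    and g: "g \<in> carrier_mat n n" "det g \<noteq> 0"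
    and J_int: "\<And>i j. i < n \<Longrightarrow> j < n \<Longrightarrow> fls_ge 1 0 (gauge fls_theta g (- map_mat (expand fls_X_inv) A) $$ (i,j))"
    and J_nil: "\<And>i j. i < n \<Longrightarrow> j \<le> i \<Longrightarrow> fls_nth (gauge fls_theta g (- map_mat (expand fls_X_inv) A) $$ (i,j)) 0 = 0"
    and M_carrier: "\<And>v. v \<in> M \<Longrightarrow> v \<in> carrier_vec n"
    and M_add: "\<And>v w. v \<in> M \<Longrightarrow> w \<in> M \<Longrightarrow> v + w \<in> M"
    and M_smult: "\<And>v f. v \<in> M \<Longrightarrow> f \<in> regular_on (- {0}) \<Longrightarrow> f \<cdot>\<^sub>v v \<in> M"
    and M_nabla: "\<And>v. v \<in> M \<Longrightarrow> nabla rat_theta A v \<in> M"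
    and M_det: "\<And>v. v \<in> M \<Longrightarrow> det (cyclic_mat n rat_theta A v) \<in> regular_on (- {0})"
    and M_nonzero: "\<exists>v\<in>M. v \<noteq> 0\<^sub>v n"
begin

abbreviation "D \<equiv> nabla rat_theta A"
abbreviation "e0 \<equiv> expand fls_X"
abbreviation "ei \<equiv> expand fls_X_inv"

definition J where "J = gauge fls_theta g (- map_mat ei A)"
text \<open>Coordinates of a section in the local frames at zero (\<open>y\<close>) and at infinity
  (\<open>z\<close>).\<close>

definition y where "y v = minv W0 *\<^sub>v map_vec e0 v"
definition z where "z v = g *\<^sub>v map_vec ei v"

sublocale e0: comm_ring_hom e0
  by (rule expand_hom[OF transcendental_X])

sublocale ei: comm_ring_hom ei
  by (rule expand_hom[OF transcendental_X_inv])

lemma mW: "minv W0 \<in> carrier_mat n n" "det (minv W0) \<noteq> 0"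
  using minv[OF W0] det_minv[OF W0] W0 by auto

lemma D_carrier [simp]: "v \<in> carrier_vec n \<Longrightarrow> (D ^^ k) v \<in> carrier_vec n"
  using A by simp

lemma y_carrier [simp]: "v \<in> carrier_vec n \<Longrightarrow> y v \<in> carrier_vec n"
  and z_carrier [simp]: "v \<in> carrier_vec n \<Longrightarrow> z v \<in> carrier_vec n"
  unfolding y_def z_def using mW(1) g(1) by (auto intro!: mult_mat_vec_carrier)

lemma dim_y [simp]: "dim_vec (y v) = n" and dim_z [simp]: "dim_vec (z v) = n"
  using mW(1) g(1) by (auto simp: y_def z_def)

lemma J_carrier: "J \<in> carrier_mat n n"
  unfolding J_def by (rule gauge_closed[OF g]) (use A in simp)

lemma y_add: "v \<in> carrier_vec n \<Longrightarrow> w \<in> carrier_vec n \<Longrightarrow> y (v + w) = y v + y w"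
  and z_add: "v \<in> carrier_vec n \<Longrightarrow> w \<in> carrier_vec n \<Longrightarrow> z (v + w) = z v + z w"
proof -
  assume vw: "v \<in> carrier_vec n" "w \<in> carrier_vec n"
  have "map_vec e0 (v + w) = map_vec e0 v + map_vec e0 w" "map_vec ei (v + w) = map_vec ei v + map_vec ei w"
    by (rule eq_vecI; use vw in \<open>simp add: e0.hom_add ei.hom_add\<close>)+
  then show "y (v + w) = y v + y w" "z (v + w) = z v + z w"
    unfolding y_def z_def using vw by (simp_all add: mult_add_distrib_mat_vec[OF mW(1)] mult_add_distrib_mat_vec[OF g(1)])
qed

lemma y_smult: "v \<in> carrier_vec n \<Longrightarrow> y (f \<cdot>\<^sub>v v) = e0 f \<cdot>\<^sub>v y v"
  and z_smult: "v \<in> carrier_vec n \<Longrightarrow> z (f \<cdot>\<^sub>v v) = ei f \<cdot>\<^sub>v z v"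
proof -
  assume v: "v \<in> carrier_vec n"
  have "map_vec e0 (f \<cdot>\<^sub>v v) = e0 f \<cdot>\<^sub>v map_vec e0 v" "map_vec ei (f \<cdot>\<^sub>v v) = ei f \<cdot>\<^sub>v map_vec ei v"
    by (rule eq_vecI; simp add: e0.hom_mult ei.hom_mult)+
  then show "y (f \<cdot>\<^sub>v v) = e0 f \<cdot>\<^sub>v y v" "z (f \<cdot>\<^sub>v v) = ei f \<cdot>\<^sub>v z v"
    unfolding y_def z_def using v by (simp_all add: mult_mat_vec[OF mW(1)] mult_mat_vec[OF g(1)])
qed

lemma y_D: "v \<in> carrier_vec n \<Longrightarrow> y (D v) = nabla fls_theta (companion n c) (y v)"
proof -
  assume v: "v \<in> carrier_vec n"
  have "map_vec e0 (D v) = 1 \<cdot>\<^sub>v nabla fls_theta (1 \<cdot>\<^sub>m map_mat e0 A) (map_vec e0 v)"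
    by (rule nabla_hom[OF e0.comm_ring_hom_axioms _ _ A v]) (simp_all add: expand_theta_X)
  moreover have "1 \<cdot>\<^sub>m map_mat e0 A = map_mat e0 A" by (rule eq_matI) auto
  ultimately have "map_vec e0 (D v) = nabla fls_theta (map_mat e0 A) (map_vec e0 v)" by simp
  then show ?thesis unfolding y_def comp[symmetric]
    by (simp only: fls_theta.nabla_gauge[OF mW map_carrier_mat[THEN iffD2, OF A] map_carrier_vec[THEN iffD2, OF v]])
qed

lemma z_D: "v \<in> carrier_vec n \<Longrightarrow> z (D v) = (-1) \<cdot>\<^sub>v nabla fls_theta J (z v)"
proof -
  assume v: "v \<in> carrier_vec n"
  have "map_vec ei (D v) = (-1) \<cdot>\<^sub>v nabla fls_theta ((-1) \<cdot>\<^sub>m map_mat ei A) (map_vec ei v)"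
    by (rule nabla_hom[OF ei.comm_ring_hom_axioms _ _ A v]) (simp_all add: expand_theta_X_inv)
  moreover have "(-1) \<cdot>\<^sub>m map_mat ei A = - map_mat ei A" by (rule eq_matI) auto
  ultimately have e: "map_vec ei (D v) = (-1) \<cdot>\<^sub>v nabla fls_theta (- map_mat ei A) (map_vec ei v)" by simp
  have mA: "- map_mat ei A \<in> carrier_mat n n" and mv: "map_vec ei v \<in> carrier_vec n" using A v by auto
  show ?thesis unfolding z_def e mult_mat_vec[OF g(1) nabla_closed[OF mA mv]] J_def
    by (simp only: fls_theta.nabla_gauge[OF g mA mv])
qed

text \<open>Valuation at least \<open>k / n\<close>, where the \<open>i\<close>-th vector of the
  companion frame has valuation \<open>- i / n\<close>. The weights are forced: each frame vector is
  the derivative of the previous one, and the connection is to lower the valuation by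
  \<open>1 / n\<close>.\<close>

definition L :: "int \<Rightarrow> ratfun vec \<Rightarrow> bool" where
  "L k v \<longleftrightarrow> (\<forall>i<n. fls_ge n (k + int i) (y v $ i))"

lemma L_mono: "L k v \<Longrightarrow> k' \<le> k \<Longrightarrow> L k' v"
  unfolding L_def by (auto intro: fls_ge_mono)

text \<open>Division of \<open>- k\<close> by \<open>n\<close> finds the coordinate \<open>i\<close>
  whose order can equal \<open>(k + i) / n\<close> exactly.\<close>

lemma L_index: obtains i m where "i < n" "k = int n * m - int i"
proof -
  define i where "i = nat ((- k) mod int n)"
  have i: "int i = (- k) mod int n" using n2 by (simp add: i_def)
  have "k + int i = int n * (- ((- k) div int n))"
    unfolding i mult.commute[of "int n"] using div_mult_mod_eq[of "- k" "int n"] by linarith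
  moreover have "i < n" using i n2 by (metis of_nat_less_iff pos_mod_bound of_nat_0_less_iff less_le_trans zero_less_numeral)
  ultimately show thesis using that[of i "- ((- k) div int n)"] by simp
qed

lemma L_lead_nth:
  assumes "L (int n * m - int i) v" "i < n"
  shows "fls_ge 1 m (y v $ i)"
  using assms unfolding L_def fls_ge_def
proof (intro allI impI)
  fix m' assume *: "\<forall>j<n. \<forall>m'. int n * m' < int n * m - int i + int j \<longrightarrow> fls_nth (y v $ j) m' = 0" "i < n" "int 1 * m' < m"
  then have "int n * m' < int n * m" by simp
  then show "fls_nth (y v $ i) m' = 0" using * by auto
qed

text \<open>The graded pieces are one-dimensional: passing from \<open>k\<close> to
  \<open>k + 1\<close> is a condition on one coefficient of one coordinate, since
  \<open>k + j\<close> is divisible by \<open>n\<close> for a single \<open>j < n\<close>.\<close>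

lemma L_Suc:
  assumes i: "i < n" and k: "k = int n * m - int i"
  shows "L (k + 1) v \<longleftrightarrow> L k v \<and> fls_nth (y v $ i) m = 0"
proof
  assume *: "L (k + 1) v"
  then show "L k v \<and> fls_nth (y v $ i) m = 0"
    using L_mono[OF *, of k] i unfolding L_def fls_ge_def by (auto simp: k)
next
  assume *: "L k v \<and> fls_nth (y v $ i) m = 0"
  show "L (k + 1) v" unfolding L_def fls_ge_def
  proof (intro allI impI)
    fix j m' assume j: "j < n" and lt: "int n * m' < k + 1 + int j"
    show "fls_nth (y v $ j) m' = 0"
    proof (cases "int n * m' < k + int j")
      case True
      then show ?thesis using * j unfolding L_def fls_ge_def by blast
    next
      case False
      then have e: "int n * m' - int j = int n * m - int i" using lt k by simp
      then have "int j mod int n = int i mod int n"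
        by (metis (no_types, opaque_lifting) add.commute diff_add_cancel diff_diff_eq2 mod_mult_self2 mult.commute)
      then have "j = i" using i j by simp
      then have "m' = m" using e n2 by simp
      then show ?thesis using * \<open>j = i\<close> by simp
    qed
  qed
qed

lemma L_add: "v \<in> carrier_vec n \<Longrightarrow> w \<in> carrier_vec n \<Longrightarrow> L k v \<Longrightarrow> L k w \<Longrightarrow> L k (v + w)"
  unfolding L_def y_add by (auto intro!: fls_ge_add)

lemma L_const: "v \<in> carrier_vec n \<Longrightarrow> L k v \<Longrightarrow> L k (rat_const a \<cdot>\<^sub>v v)"
  unfolding L_def
proof (intro allI impI)
  fix i assume v: "v \<in> carrier_vec n" and *: "\<forall>i<n. fls_ge n (k + int i) (y v $ i)" and i: "i < n"
  have "fls_ge n (0 + (k + int i)) (fls_const a * y v $ i)"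
    by (rule fls_ge_mult[OF _ fls_ge_const]) (use * i n2 in auto)
  then show "fls_ge n (k + int i) (y (rat_const a \<cdot>\<^sub>v v) $ i)"
    using v i y_carrier[OF v] by (simp add: y_smult expand_const transcendental_X)
qed

lemma L_t:
  assumes v: "v \<in> carrier_vec n" and L: "L k v"
  shows "L (k + int n) (rat_t \<cdot>\<^sub>v v)" "L (k - int n) (inverse rat_t \<cdot>\<^sub>v v)"
proof -
  have X: "fls_ge n (int n) (fls_X :: complex fls)" "fls_ge n (- int n) (fls_X_inv :: complex fls)"
    using n2 by (auto simp: fls_ge_def)
  have "fls_ge n (int n + (k + int i)) (fls_X * y v $ i)" "fls_ge n (- int n + (k + int i)) (fls_X_inv * y v $ i)"
    if "i < n" for i
    by (rule fls_ge_mult[OF _ X(1)] fls_ge_mult[OF _ X(2)]; use L that n2 in \<open>simp add: L_def\<close>)+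
  then show "L (k + int n) (rat_t \<cdot>\<^sub>v v)" "L (k - int n) (inverse rat_t \<cdot>\<^sub>v v)"
    unfolding L_def using v y_carrier[OF v]
    by (auto simp: y_smult expand_t expand_inverse transcendental_X fls_inverse_X algebra_simps)
qed

text \<open>The companion matrix moves coordinate \<open>i\<close> to \<open>i + 1\<close>, which
  lowers the valuation by \<open>1 / n\<close>, and the simple pole of \<open>c $ 0\<close> sends
  the last coordinate back to the first with the same loss. The derivatives of the coordinates and
  the other \<open>c $ i\<close> stay at level \<open>k\<close>, so the leading term
  survives.\<close>

lemma L_D:
  assumes v: "v \<in> carrier_vec n" and L: "L k v"
  shows "L (k - 1) (D v)" "\<not> L (k + 1) v \<Longrightarrow> \<not> L k (D v)"
proof -
  have Y: "fls_ge n (k + int i) (y v $ i)" if "i < n" for i using L that by (simp add: L_def)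
  have ix: "y (D v) $ i = fls_theta (y v $ i) + ((if i = 0 then 0 else y v $ (i - 1)) + c $ i * y v $ (n - 1))" if i: "i < n" for i
  proof -
    have "y (D v) $ i = fls_theta (y v $ i) + (companion n c *\<^sub>v y v) $ i"
    proof -
      have "companion n c *\<^sub>v y v \<in> carrier_vec n"
        by (rule mult_mat_vec_carrier[OF companion_carrier y_carrier[OF v]])
      then have "nabla fls_theta (companion n c) (y v) $ i = fls_theta (y v $ i) + (companion n c *\<^sub>v y v) $ i"
        unfolding nabla_def using i carrier_matD(1)[OF companion_carrier[of n c]]
        by (simp del: index_mult_mat_vec)
      then show ?thesis unfolding y_D[OF v] .
    qed
    then show ?thesis unfolding companion_mult_vec[OF y_carrier[OF v] i] .
  qed
  have th: "fls_ge n (k + int i) (fls_theta (y v $ i))" if "i < n" for i by (rule fls_ge_theta[OF Y[OF that]])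
  have ci: "fls_ge n (k + int i) (c $ i * y v $ (n - 1))" if "i < n" "i > 0" for i
  proof -
    have "fls_ge n 0 (c $ i)" using c_pos[OF that] n2 unfolding fls_ge_def
      by (auto simp: mult_less_0_iff)
    then have "fls_ge n (0 + (k + int (n - 1))) (c $ i * y v $ (n - 1))"
      by (intro fls_ge_mult Y) (use n2 in auto)
    then show ?thesis by (rule fls_ge_mono) (use that in auto)
  qed
  have c0: "fls_ge n (- int n + (k + int (n - 1))) (c $ 0 * y v $ (n - 1))"
  proof -
    have "fls_ge n (- int n) (c $ 0)" unfolding fls_ge_def
    proof (intro allI impI)
      fix m assume "int n * m < - int n"
      then have "int n * m < int n * (-1)" by simp
      then have "m < -1" using n2 by (subst (asm) mult_less_cancel_left_pos) auto
      then show "fls_nth (c $ 0) m = 0" using c_zero by (simp add: fls_ge_def)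
    qed
    then show ?thesis by (intro fls_ge_mult Y) (use n2 in auto)
  qed
  show LD: "L (k - 1) (D v)" unfolding L_def
  proof (intro allI impI)
    fix i assume i: "i < n"
    show "fls_ge n (k - 1 + int i) (y (D v) $ i)"
    proof (cases "i = 0")
      case True
      have "fls_ge n (k - 1 + int i) (c $ 0 * y v $ (n - 1))"
        by (rule fls_ge_mono[OF c0]) (use True n2 in auto)
      moreover have "fls_ge n (k - 1 + int i) (fls_theta (y v $ 0))"
        by (rule fls_ge_mono[OF th]) (use True n2 in auto)
      ultimately show ?thesis unfolding ix[OF i] using True by (auto intro!: fls_ge_add)
    next
      case False
      have "fls_ge n (k - 1 + int i) (y v $ (i - 1))"
        by (rule fls_ge_mono[OF Y]) (use False i in auto)
      moreover have "fls_ge n (k - 1 + int i) (fls_theta (y v $ i))" by (rule fls_ge_mono[OF th[OF i]]) simp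
      moreover have "fls_ge n (k - 1 + int i) (c $ i * y v $ (n - 1))"
        by (rule fls_ge_mono[OF ci]) (use False i in auto)
      ultimately show ?thesis unfolding ix[OF i] using False by (auto intro!: fls_ge_add)
    qed
  qed
  assume nL: "\<not> L (k + 1) v"
  obtain i m where i: "i < n" and k: "k = int n * m - int i" by (rule L_index)
  have lead: "fls_nth (y v $ i) m \<noteq> 0" using nL L L_Suc[OF i k] by simp
  show "\<not> L k (D v)"
  proof (cases "i = n - 1")
    case False
    have i': "i + 1 < n" and k': "k - 1 = int n * m - int (i + 1)" using i False k by auto
    have "fls_nth (fls_theta (y v $ (i + 1))) m = 0" "fls_nth (c $ (i + 1) * y v $ (n - 1)) m = 0"
      using th[OF i'] ci[OF i'] k unfolding fls_ge_def by auto
    then have "fls_nth (y (D v) $ (i + 1)) m = fls_nth (y v $ i) m"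
      unfolding ix[OF i'] by simp
    then show ?thesis using L_Suc[OF i' k', of "D v"] lead by simp
  next
    case True
    \<comment> \<open>Wrap-around: level \<open>k - 1\<close> is seen in coordinate \<open>0\<close>
      at exponent \<open>m - 1\<close>, where the nonzero coefficient of \<open>c $ 0\<close> at
      \<open>-1\<close> enters.\<close>
    have k': "k - 1 = int n * (m - 1) - int 0" using True k n2 by (simp add: algebra_simps of_nat_diff)
    have n0: "0 < n" using n2 by simp
    have th0: "fls_nth (fls_theta (y v $ 0)) (m - 1) = 0"
    proof -
      have "int n * (m - 1) < k + int 0" using True k n2 by (simp add: algebra_simps of_nat_diff)
      then show ?thesis using th[OF n0] unfolding fls_ge_def by blast
    qed
    have ym: "fls_ge 1 m (y v $ (n - 1))"
      using L_lead_nth[of m i v] L i k True by simp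
    have "fls_nth (c $ 0 * y v $ (n - 1)) (-1 + m) = fls_nth (c $ 0) (-1) * fls_nth (y v $ (n - 1)) m"
      by (rule fls_nth_mult_leading[OF c_zero ym])
    then have "fls_nth (y (D v) $ 0) (m - 1) \<noteq> 0"
      unfolding ix[OF n0] using th0 lead True c_lead by (simp del: fls_theta_nth)
    then show ?thesis using L_Suc[OF n0 k', of "D v"] by simp
  qed
qed

lemma L_D_pow:
  assumes v: "v \<in> carrier_vec n" and L: "L k v"
  shows "L (k - int j) ((D ^^ j) v)" "\<not> L (k + 1) v \<Longrightarrow> \<not> L (k - int j + 1) ((D ^^ j) v)"
proof -
  show 1: "L (k - int j) ((D ^^ j) v)" for j
  proof (induction j)
    case (Suc j)
    have "L (k - int j - 1) (D ((D ^^ j) v))" by (rule L_D(1)[OF D_carrier[OF v] Suc])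
    then show ?case by (simp add: algebra_simps)
  qed (use L in simp)
  show "\<not> L (k - int j + 1) ((D ^^ j) v)" if "\<not> L (k + 1) v"
  proof (induction j)
    case (Suc j)
    have "\<not> L (k - int j) (D ((D ^^ j) v))" by (rule L_D(2)[OF D_carrier[OF v] 1 Suc])
    then show ?case by (simp add: algebra_simps)
  qed (use that in simp)
qed

lemma L_line:
  assumes v: "v \<in> carrier_vec n" "L k v" and w: "w \<in> carrier_vec n" "L k w" "\<not> L (k + 1) w"
  shows "\<exists>a. L (k + 1) (v + rat_const a \<cdot>\<^sub>v w)"
proof -
  obtain i m where i: "i < n" and k: "k = int n * m - int i" by (rule L_index)
  have nz: "fls_nth (y w $ i) m \<noteq> 0" using w L_Suc[OF i k] by simp
  define a where "a = - fls_nth (y v $ i) m / fls_nth (y w $ i) m"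
  have "fls_nth (y (v + rat_const a \<cdot>\<^sub>v w) $ i) m = fls_nth (y v $ i) m + a * fls_nth (y w $ i) m"
    using v w i y_carrier[of v] y_carrier[of w]
    by (simp add: y_add y_smult expand_const transcendental_X)
  also have "\<dots> = 0" using nz by (simp add: a_def)
  finally show ?thesis using L_Suc[OF i k] L_add[OF v(1) _ v(2) L_const[OF w(1,2)]] w(1) by auto
qed

lemma L_exists: "\<exists>k. L k v"
proof -
  obtain b where "\<And>i. i < n \<Longrightarrow> fls_ge n (- int b) (y v $ i)"
    using fls_ge_exists_uniform[of n "{..<n}" "\<lambda>i. y v $ i"] n2 by auto
  then have "fls_ge n (- int b - int n + int i) (y v $ i)" if "i < n" for i
    by (rule fls_ge_mono[where q = "- int b"]) (use that in auto)
  then show ?thesis unfolding L_def by blast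
qed

lemma L_bounded:
  assumes v: "v \<in> carrier_vec n" "v \<noteq> 0\<^sub>v n"
  shows "\<exists>K. \<forall>k. L k v \<longrightarrow> k \<le> K"
proof -
  have "y v \<noteq> 0\<^sub>v n"
  proof
    assume "y v = 0\<^sub>v n"
    moreover have "W0 *\<^sub>v 0\<^sub>v n = 0\<^sub>v n" by (rule eq_vecI) (use W0 in auto)
    ultimately have "W0 *\<^sub>v (minv W0 *\<^sub>v map_vec e0 v) = 0\<^sub>v n" by (simp add: y_def)
    then have e: "map_vec e0 v = 0\<^sub>v n"
      using assoc_mult_mat_vec[OF W0(1) mW(1), of "map_vec e0 v"] minv(2)[OF W0] v by simp
    have "v $ i = 0" if "i < n" for i
      using arg_cong[OF e, of "\<lambda>w. w $ i"] that v expand_eq_0[OF transcendental_X, of "v $ i"] by simp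
    then have "v = 0\<^sub>v n" using v(1) by (intro eq_vecI) auto
    with v show False by simp
  qed
  then obtain i where i: "i < n" "y v $ i \<noteq> 0"
    using eq_vecI[of "y v" "0\<^sub>v n"] y_carrier[OF v(1)] by fastforce
  have "k \<le> int n * fls_subdegree (y v $ i)" if "L k v" for k
  proof (rule ccontr)
    assume "\<not> ?thesis"
    then have "fls_nth (y v $ i) (fls_subdegree (y v $ i)) = 0"
      using that i unfolding L_def fls_ge_def by auto
    then show False using nth_fls_subdegree_nonzero[OF i(2)] by simp
  qed
  then show ?thesis by blast
qed

lemma L_exact:
  assumes v: "v \<in> carrier_vec n" "v \<noteq> 0\<^sub>v n" and L: "L k v"
  shows "\<exists>k'\<ge>k. L k' v \<and> \<not> L (k' + 1) v"
proof -
  obtain K where K: "\<And>k. L k v \<Longrightarrow> k \<le> K" using L_bounded[OF v] by blast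
  define S where "S = {k'. k \<le> k' \<and> k' \<le> K \<and> L k' v}"
  have S: "finite S" "k \<in> S" using L K by (auto simp: S_def intro: finite_subset[of _ "{k..K}"])
  then have m: "Max S \<in> S" by (intro Max_in) auto
  have "\<not> L (Max S + 1) v"
  proof
    assume l: "L (Max S + 1) v"
    then have "Max S + 1 \<in> S" using m K[OF l] by (auto simp: S_def)
    then show False using Max_ge[OF S(1)] by fastforce
  qed
  then show ?thesis using m by (auto simp: S_def)
qed

end

section \<open>Regularity at infinity and sections over the complement of zero\<close>

context lattice_pair
begin

text \<open>Membership in the extension to infinity on which the residue is nilpotent.\<close>

definition I :: "ratfun vec \<Rightarrow> bool" where
  "I v \<longleftrightarrow> (\<forall>i<n. fls_ge 1 0 (z v $ i))"

lemma I_add: "v \<in> carrier_vec n \<Longrightarrow> w \<in> carrier_vec n \<Longrightarrow> I v \<Longrightarrow> I w \<Longrightarrow> I (v + w)"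
  unfolding I_def z_add by (auto intro!: fls_ge_add)

lemma I_const: "v \<in> carrier_vec n \<Longrightarrow> I v \<Longrightarrow> I (rat_const a \<cdot>\<^sub>v v)"
  unfolding I_def
proof (intro allI impI)
  fix i assume v: "v \<in> carrier_vec n" and *: "\<forall>i<n. fls_ge 1 0 (z v $ i)" and i: "i < n"
  have "fls_ge 1 (0 + 0) (fls_const a * z v $ i)"
    by (rule fls_ge_mult[OF _ fls_ge_const]) (use * i in auto)
  then show "fls_ge 1 0 (z (rat_const a \<cdot>\<^sub>v v) $ i)"
    using v i by (simp add: z_smult expand_const transcendental_X_inv)
qed

lemma z_D_index:
  assumes v: "v \<in> carrier_vec n" and i: "i < n"
  shows "z (D v) $ i = - (fls_theta (z v $ i) + (\<Sum>j<n. J $$ (i,j) * z v $ j))"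
  unfolding z_D[OF v] using index_nabla[OF i J_carrier z_carrier[OF v], of fls_theta] i J_carrier by simp

text \<open>As \<open>J\<close> is integral, the lattice at infinity is stable, and \<open>D\<close>
  induces minus the residue of \<open>J\<close> on its fibre.\<close>

lemma I_D:
  assumes v: "v \<in> carrier_vec n" and Iv: "I v"
  shows "I (D v)" and "i < n \<Longrightarrow> fls_nth (z (D v) $ i) 0 = - (\<Sum>j<n. fls_nth (J $$ (i,j)) 0 * fls_nth (z v $ j) 0)"
proof -
  have zi: "fls_ge 1 0 (z v $ i)" if "i < n" for i using Iv that by (simp add: I_def)
  have p: "fls_ge 1 (0 + 0) (J $$ (i,j) * z v $ j)" if "i < n" "j < n" for i j
    by (rule fls_ge_mult) (use J_int that zi in \<open>auto simp: J_def\<close>)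
  show "I (D v)" unfolding I_def
  proof (intro allI impI)
    fix i assume i: "i < n"
    show "fls_ge 1 0 (z (D v) $ i)" unfolding z_D_index[OF v i]
      using p i zi by (intro fls_ge_uminus fls_ge_add fls_ge_sum fls_ge_theta) auto
  qed
  assume i: "i < n"
  have "fls_nth (J $$ (i,j) * z v $ j) 0 = fls_nth (J $$ (i,j)) 0 * fls_nth (z v $ j) 0" if "j < n" for j
    using fls_nth_mult_leading[of 0 "J $$ (i,j)" 0 "z v $ j"] J_int i that zi by (simp add: J_def)
  then show "fls_nth (z (D v) $ i) 0 = - (\<Sum>j<n. fls_nth (J $$ (i,j)) 0 * fls_nth (z v $ j) 0)"
    unfolding z_D_index[OF v i] by (simp add: fls_nth_sum)
qed

lemma I_D_pow: "v \<in> carrier_vec n \<Longrightarrow> I v \<Longrightarrow> I ((D ^^ k) v)"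
  by (induction k) (auto intro: I_D)

text \<open>\<open>inverse rat_t\<close> is the coordinate at infinity, so multiplication by it
  makes a section vanish there; \<open>I_t\<close> is the converse.\<close>

lemma I_inverse_t:
  assumes v: "v \<in> carrier_vec n" and Iv: "I v"
  shows "I (inverse rat_t \<cdot>\<^sub>v v)" and "i < n \<Longrightarrow> fls_nth (z (inverse rat_t \<cdot>\<^sub>v v) $ i) 0 = 0"
proof -
  have e: "z (inverse rat_t \<cdot>\<^sub>v v) $ i = fls_X * z v $ i" if "i < n" for i
    using v that by (simp add: z_smult expand_inverse expand_t transcendental_X_inv fls_inverse_X_inv)
  have "fls_ge 1 (1 + 0) (fls_X * z v $ i)" if "i < n" for i
    by (rule fls_ge_mult) (use Iv that in \<open>auto simp: I_def fls_ge_def\<close>)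
  then show "I (inverse rat_t \<cdot>\<^sub>v v)" "i < n \<Longrightarrow> fls_nth (z (inverse rat_t \<cdot>\<^sub>v v) $ i) 0 = 0"
    unfolding I_def using e by (auto simp: fls_ge_def)
qed

lemma I_t:
  assumes v: "v \<in> carrier_vec n" and Iv: "I v" and 0: "\<And>i. i < n \<Longrightarrow> fls_nth (z v $ i) 0 = 0"
  shows "I (rat_t \<cdot>\<^sub>v v)"
  unfolding I_def
proof (intro allI impI)
  fix i assume i: "i < n"
  have "fls_ge 1 1 (z v $ i)" unfolding fls_ge_def
  proof (intro allI impI)
    fix m assume "int 1 * m < 1"
    then have "m = 0 \<or> m < 0" by auto
    then show "fls_nth (z v $ i) m = 0" using Iv 0[OF i] i by (auto simp: I_def fls_ge_def)
  qed
  then have "fls_ge 1 (-1 + 1) (fls_X_inv * z v $ i)" by (intro fls_ge_mult) (auto simp: fls_ge_def)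
  then show "fls_ge 1 0 (z (rat_t \<cdot>\<^sub>v v) $ i)"
    using v i by (simp add: z_smult expand_t transcendental_X_inv)
qed

definition V :: "ratfun vec set" where
  "V = {v \<in> M. I v}"

lemma V_carrier: "v \<in> V \<Longrightarrow> v \<in> carrier_vec n" and V_I: "v \<in> V \<Longrightarrow> I v" and V_M: "v \<in> V \<Longrightarrow> v \<in> M"
  using M_carrier by (auto simp: V_def)

lemma V_D_pow: "v \<in> V \<Longrightarrow> (D ^^ k) v \<in> V"
  by (induction k) (auto simp: V_def intro: M_nabla I_D M_carrier)

lemma V_add: "v \<in> V \<Longrightarrow> w \<in> V \<Longrightarrow> v + w \<in> V"
  by (auto simp: V_def intro: M_add I_add M_carrier)

lemma V_const: "v \<in> V \<Longrightarrow> rat_const a \<cdot>\<^sub>v v \<in> V"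
  by (auto simp: V_def intro: M_smult I_const M_carrier regular_on_to_fract)

lemma V_nonzero: "\<exists>v\<in>V. v \<noteq> 0\<^sub>v n"
proof -
  obtain v where v: "v \<in> M" "v \<noteq> 0\<^sub>v n" using M_nonzero by blast
  have vc: "v \<in> carrier_vec n" using v M_carrier by simp
  obtain b where b: "\<And>i. i < n \<Longrightarrow> fls_ge 1 (- int b) (z v $ i)"
    using fls_ge_vec_exists[of n "z v"] by blast
  define f where "f = inverse rat_t ^ b"
  have f: "f \<noteq> 0" by (simp add: f_def)
  have fr: "f \<in> regular_on (- {0})" unfolding f_def
    by (induction b) (auto intro: regular_on_mult regular_on_inverse_t)
  have "ei f = fls_X ^ b" unfolding f_def
    by (induction b) (simp_all add: ei.hom_mult expand_inverse expand_t transcendental_X_inv fls_inverse_X_inv)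
  then have e: "z (f \<cdot>\<^sub>v v) $ i = fls_X ^ b * z v $ i" if "i < n" for i
    using vc that by (simp add: z_smult)
  have "fls_ge 1 (int b + - int b) (fls_X ^ b * z v $ i)" if "i < n" for i
    by (rule fls_ge_mult[OF _ _ b[OF that]]) (auto simp: fls_ge_def fls_X_power_nth)
  then have "I (f \<cdot>\<^sub>v v)" unfolding I_def using e by simp
  moreover have "f \<cdot>\<^sub>v v \<in> M" using M_smult[OF v(1) fr] .
  moreover have "f \<cdot>\<^sub>v v \<noteq> 0\<^sub>v n"
  proof -
    obtain i where i: "i < n" "v $ i \<noteq> 0" using v(2) vc eq_vecI[of v "0\<^sub>v n"] by fastforce
    then have "(f \<cdot>\<^sub>v v) $ i \<noteq> 0" using f vc by simp
    then show ?thesis using i by auto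
  qed
  ultimately show ?thesis by (auto simp: V_def)
qed

text \<open>A single rational function, the determinant of the cyclic matrix, governs both
  expansions. This links levels at zero with integrality at infinity.\<close>

lemma det_y:
  assumes v: "v \<in> carrier_vec n"
  shows "det (mat n n (\<lambda>(i,j). y ((D ^^ j) v) $ i)) = det (minv W0) * e0 (det (cyclic_mat n rat_theta A v))"
    and "det (mat n n (\<lambda>(i,j). z ((D ^^ j) v) $ i)) = det g * ei (det (cyclic_mat n rat_theta A v))"
proof -
  let ?W = "cyclic_mat n rat_theta A v"
  have c: "map_mat e0 ?W \<in> carrier_mat n n" "map_mat ei ?W \<in> carrier_mat n n" by auto
  have "map_mat e0 ?W = mat n n (\<lambda>(i,j). map_vec e0 ((D ^^ j) v) $ i)"
    "map_mat ei ?W = mat n n (\<lambda>(i,j). map_vec ei ((D ^^ j) v) $ i)"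
    by (rule eq_matI; use carrier_vecD[OF D_carrier[OF v]] in \<open>auto simp: cyclic_mat_def\<close>)+
  then have "minv W0 * map_mat e0 ?W = mat n n (\<lambda>(i,j). y ((D ^^ j) v) $ i)"
    "g * map_mat ei ?W = mat n n (\<lambda>(i,j). z ((D ^^ j) v) $ i)"
    unfolding y_def z_def using D_carrier[OF v]
    by (simp_all add: mat_mult_col_mat[OF mW(1)] mat_mult_col_mat[OF g(1)])
  then show "det (mat n n (\<lambda>(i,j). y ((D ^^ j) v) $ i)) = det (minv W0) * e0 (det ?W)"
    "det (mat n n (\<lambda>(i,j). z ((D ^^ j) v) $ i)) = det g * ei (det ?W)"
    using det_mult[OF mW(1) c(1)] det_mult[OF g(1) c(2)] by simp_all
qed

text \<open>The iterates of \<open>v\<close> have levels that are distinct modulo \<open>n\<close>, hence are independent.\<close>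

lemma det_cyclic_nonzero:
  assumes v: "v \<in> carrier_vec n" and L: "L k v" "\<not> L (k + 1) v"
  shows "det (cyclic_mat n rat_theta A v) \<noteq> 0"
proof
  assume "det (cyclic_mat n rat_theta A v) = 0"
  then have "det (mat n n (\<lambda>(i,j). y ((D ^^ j) v) $ i)) = 0" using det_y(1)[OF v] by simp
  then obtain w p where w: "w \<in> carrier_vec n" "p < n" "w $ p \<noteq> 0"
    and rel: "\<And>i. i < n \<Longrightarrow> (\<Sum>j<n. mat n n (\<lambda>(i,j). y ((D ^^ j) v) $ i) $$ (i,j) * w $ j) = 0"
    by (rule det_zeroE[OF mat_carrier]) (rule that)
  \<comment> \<open>Level of the term \<open>w $ j\<close> times the \<open>j\<close>-th iterate.
    Modulo \<open>n\<close> it is \<open>k - j\<close>, so no two terms share a level and the lowest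
    one cannot cancel.\<close>
  define \<mu> where "\<mu> j = int n * fls_subdegree (w $ j) + k - int j" for j
  define S where "S = {j. j < n \<and> w $ j \<noteq> 0}"
  have S: "finite S" "S \<noteq> {}" using w by (auto simp: S_def)
  then have "Min (\<mu> ` S) \<in> \<mu> ` S" by (intro Min_in) auto
  then obtain q where q: "q \<in> S" "\<mu> q = Min (\<mu> ` S)" by auto
  have le: "\<mu> q \<le> \<mu> j" if "j \<in> S" for j unfolding q(2) using S that by simp
  have inj: "\<mu> q < \<mu> j" if j: "j \<in> S" "j \<noteq> q" for j
  proof (rule ccontr)
    assume "\<not> \<mu> q < \<mu> j"
    then have "\<mu> q = \<mu> j" using le[OF j(1)] by simp
    then have e: "int j = int q + int n * (fls_subdegree (w $ j) - fls_subdegree (w $ q))"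
      by (simp add: \<mu>_def algebra_simps)
    have "int j mod int n = int q mod int n" unfolding e by simp
    then show False using j q by (simp add: S_def)
  qed
  have qn: "q < n" "w $ q \<noteq> 0" using q by (auto simp: S_def)
  obtain i m where i: "i < n" and km: "k - int q = int n * m - int i" by (rule L_index)
  have Lq: "L (k - int q) ((D ^^ q) v)" "\<not> L (k - int q + 1) ((D ^^ q) v)"
    using L_D_pow[OF v L(1)] L(2) by auto
  have lead: "fls_nth (y ((D ^^ q) v) $ i) m \<noteq> 0" using L_Suc[OF i km] Lq by simp
  let ?s = "fls_subdegree (w $ q)"
  have wq: "fls_ge 1 ?s (w $ q)" by (auto simp: fls_ge_def)
  have yq: "fls_ge 1 m (y ((D ^^ q) v) $ i)" by (rule L_lead_nth[OF _ i]) (use Lq km in simp)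
  have other: "fls_nth (y ((D ^^ j) v) $ i * w $ j) (m + ?s) = 0" if j: "j < n" "j \<noteq> q" for j
  proof (cases "w $ j = 0")
    case False
    have "L (k - int j) ((D ^^ j) v)" using L_D_pow[OF v L(1)] by simp
    then have "fls_ge n (k - int j + int i) (y ((D ^^ j) v) $ i)" using i by (simp add: L_def)
    moreover have "fls_ge n (int n * fls_subdegree (w $ j)) (w $ j)"
      using n2 by (auto simp: fls_ge_def)
    ultimately have ge: "fls_ge n (k - int j + int i + int n * fls_subdegree (w $ j)) (y ((D ^^ j) v) $ i * w $ j)"
      using n2 by (intro fls_ge_mult) auto
    have "\<mu> q < \<mu> j" using inj False j by (simp add: S_def)
    then have "int n * (m + ?s) < k - int j + int i + int n * fls_subdegree (w $ j)"
      using km by (simp add: \<mu>_def algebra_simps)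
    then show ?thesis using ge by (simp add: fls_ge_def)
  qed simp
  have "0 = fls_nth (\<Sum>j<n. y ((D ^^ j) v) $ i * w $ j) (m + ?s)"
    using rel[OF i] i by simp
  also have "\<dots> = (\<Sum>j<n. fls_nth (y ((D ^^ j) v) $ i * w $ j) (m + ?s))" by (rule fls_nth_sum)
  also have "\<dots> = fls_nth (y ((D ^^ q) v) $ i * w $ q) (m + ?s) + (\<Sum>j\<in>{..<n}-{q}. fls_nth (y ((D ^^ j) v) $ i * w $ j) (m + ?s))"
    using qn by (simp add: sum.remove)
  also have "(\<Sum>j\<in>{..<n}-{q}. fls_nth (y ((D ^^ j) v) $ i * w $ j) (m + ?s)) = 0"
    by (rule sum.neutral) (use other in auto)
  also have "fls_nth (y ((D ^^ q) v) $ i * w $ q) (m + ?s) = fls_nth (y ((D ^^ q) v) $ i) m * fls_nth (w $ q) ?s"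
    by (rule fls_nth_mult_leading[OF yq wq])
  finally show False using lead nth_fls_subdegree_nonzero[OF qn(2)] by simp
qed

text \<open>Level \<open>k\<close> at zero bounds the order of the determinant of the iterates there
  from below by \<open>k\<close> up to a constant, integrality bounds its order at infinity from
  below, and the two orders add up to at most \<open>0\<close>.\<close>

lemma level_bound: "\<exists>K. \<forall>v\<in>V. v \<noteq> 0\<^sub>v n \<longrightarrow> (\<forall>k. L k v \<longrightarrow> k \<le> K)"
proof (intro exI ballI allI impI)
  fix v k assume v: "v \<in> V" "v \<noteq> 0\<^sub>v n" and L: "L k v"
  have vc: "v \<in> carrier_vec n" using v V_carrier by simp
  obtain k' where k': "k \<le> k'" "L k' v" "\<not> L (k' + 1) v" using L_exact[OF vc v(2) L] by blast
  let ?d = "det (cyclic_mat n rat_theta A v)"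
  have d: "?d \<noteq> 0" by (rule det_cyclic_nonzero[OF vc k'(2,3)])
  have nz: "e0 ?d \<noteq> 0" "ei ?d \<noteq> 0"
    using d expand_eq_0[OF transcendental_X] expand_eq_0[OF transcendental_X_inv] by blast+
  have sub: "fls_subdegree (e0 ?d) + fls_subdegree (ei ?d) \<le> 0"
    by (rule laurent_polynomial_orders[OF _ d]) (use v M_det V_M in blast)
  have Lj: "L (k' - int j) ((D ^^ j) v)" for j using L_D_pow(1)[OF vc k'(2)] .
  have "fls_ge n ((\<Sum>i<n. int i) + (\<Sum>j<n. k' - int j)) (det (mat n n (\<lambda>(i,j). y ((D ^^ j) v) $ i)))"
  proof (rule fls_ge_det)
    fix i j assume ij: "i < n" "j < n"
    have "fls_ge n (k' - int j + int i) (y ((D ^^ j) v) $ i)" using Lj[of j] ij by (simp add: L_def)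
    then show "fls_ge n (int i + (k' - int j)) (mat n n (\<lambda>(i,j). y ((D ^^ j) v) $ i) $$ (i,j))"
      using ij by (simp add: add.commute)
  qed (use n2 in auto)
  \<comment> \<open>The frame weights \<open>i\<close> cancel against the losses \<open>j\<close>,
    leaving order at least \<open>k'\<close> for the determinant.\<close>
  moreover have "(\<Sum>i<n. int i) + (\<Sum>j<n. k' - int j) = int n * k'" by (simp add: sum_subtractf)
  ultimately have g0: "fls_ge n (int n * k') (det (minv W0) * e0 ?d)" by (simp add: det_y[OF vc])
  have p0: "det (minv W0) * e0 ?d \<noteq> 0" using nz mW by simp
  have "int n * k' \<le> int n * fls_subdegree (det (minv W0) * e0 ?d)"
    using g0 nth_fls_subdegree_nonzero[OF p0] unfolding fls_ge_def by (metis linorder_not_less)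
  then have s0: "k' \<le> fls_subdegree (det (minv W0)) + fls_subdegree (e0 ?d)"
    using n2 nz mW by simp
  have Ij: "I ((D ^^ j) v)" for j using V_D_pow[OF v(1)] V_I by blast
  have "fls_ge 1 ((\<Sum>i<n. 0) + (\<Sum>j<n. 0)) (det (mat n n (\<lambda>(i,j). z ((D ^^ j) v) $ i)))"
    by (rule fls_ge_det) (use Ij in \<open>auto simp: I_def\<close>)
  then have gi: "fls_ge 1 0 (det g * ei ?d)" by (simp add: det_y[OF vc])
  have pi: "det g * ei ?d \<noteq> 0" using nz g by simp
  have "0 \<le> fls_subdegree (det g * ei ?d)"
    using gi nth_fls_subdegree_nonzero[OF pi] unfolding fls_ge_def by (metis linorder_not_less mult_1 of_nat_1)
  then have "0 \<le> fls_subdegree (det g) + fls_subdegree (ei ?d)" using nz g by simp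
  then show "k \<le> fls_subdegree (det (minv W0)) + fls_subdegree (det g)" using s0 sub k' by linarith
qed

section \<open>Relations with constant coefficients between iterated derivatives\<close>

primrec lincomb :: "nat \<Rightarrow> (nat \<Rightarrow> complex) \<Rightarrow> ratfun vec \<Rightarrow> ratfun vec" where
  "lincomb 0 a v = 0\<^sub>v n"
| "lincomb (Suc r) a v = lincomb r a v + rat_const (a r) \<cdot>\<^sub>v (D ^^ r) v"

lemma lincomb_carrier [simp]: "v \<in> carrier_vec n \<Longrightarrow> lincomb r a v \<in> carrier_vec n"
  by (induction r) auto

lemma D_zero: "D (0\<^sub>v n) = 0\<^sub>v n"
  by (rule eq_vecI) (use A in \<open>auto simp: nabla_def\<close>)

lemma D_lincomb:
  assumes v: "v \<in> carrier_vec n"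
  shows "D (lincomb r a v) = lincomb r a (D v)"
proof (induction r)
  case (Suc r)
  have c: "(D ^^ r) v \<in> carrier_vec n" using v by simp
  have "D v \<in> carrier_vec n" using A v by simp
  then have c2: "(D ^^ r) (D v) \<in> carrier_vec n" by (rule D_carrier)
  have "D (rat_const (a r) \<cdot>\<^sub>v (D ^^ r) v) = 0 \<cdot>\<^sub>v (D ^^ r) v + rat_const (a r) \<cdot>\<^sub>v D ((D ^^ r) v)"
    unfolding rat_theta.nabla_smult[OF A c] rat_theta_const ..
  also have "\<dots> = rat_const (a r) \<cdot>\<^sub>v (D ^^ r) (D v)"
    unfolding funpow_swap1
    by (rule eq_vecI) (use carrier_vecD[OF c] carrier_vecD[OF c2] in auto)
  finally show ?case using Suc v c by (simp add: rat_theta.nabla_add[OF A])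
qed (simp add: D_zero)

lemma D_pow_lincomb:
  assumes v: "v \<in> carrier_vec n" shows "(D ^^ b) (lincomb r a v) = lincomb r a ((D ^^ b) v)"
  by (induction b) (use v D_lincomb in auto)

lemma z_lincomb_nth:
  assumes v: "v \<in> carrier_vec n" and i: "i < n"
  shows "fls_nth (z (lincomb r a v) $ i) 0 = (\<Sum>j<r. a j * fls_nth (z ((D ^^ j) v) $ i) 0)"
proof (induction r)
  case 0
  have "z (0\<^sub>v n) = 0\<^sub>v n" unfolding z_def by (rule eq_vecI) (use g in \<open>auto simp: scalar_prod_def\<close>)
  then show ?case using i by simp
next
  case (Suc r)
  have "z (lincomb (Suc r) a v) = z (lincomb r a v) + fls_const (a r) \<cdot>\<^sub>v z ((D ^^ r) v)"
    using v by (simp add: z_add z_smult expand_const transcendental_X_inv)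
  then show ?case using Suc i by simp
qed

text \<open>Successive elimination: \<open>(D ^^ j) v\<close> has level exactly
  \<open>k - j\<close>, and since graded pieces are lines, adding a constant multiple of it raises
  the level of \<open>u\<close> by one. After \<open>r\<close> steps the level exceeds the maximum
  \<open>k\<close>, where \<open>top\<close> leaves only zero.\<close>

lemma lincomb_exists:
  assumes v: "v \<in> V" "L k v" "\<not> L (k + 1) v" and top: "\<And>u. u \<in> V \<Longrightarrow> L (k + 1) u \<Longrightarrow> u = 0\<^sub>v n"
    and u: "u \<in> V" "L (k + 1 - int r) u"
  shows "\<exists>a. u = lincomb r a v"
  using u
proof (induction r arbitrary: u)
  case 0
  then show ?case using top by simp
next
  case (Suc r)
  have vc: "v \<in> carrier_vec n" and uc: "u \<in> carrier_vec n" using v Suc V_carrier by auto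
  let ?w = "(D ^^ r) v"
  have wc: "?w \<in> carrier_vec n" using vc by simp
  have Lw: "L (k - int r) ?w" "\<not> L (k - int r + 1) ?w" using L_D_pow[OF vc v(2)] v(3) by auto
  obtain b where b: "L (k - int r + 1) (u + rat_const b \<cdot>\<^sub>v ?w)"
    using L_line[OF uc _ wc Lw] Suc.prems by (auto simp: algebra_simps)
  have "u + rat_const b \<cdot>\<^sub>v ?w \<in> V" using V_add V_const V_D_pow v Suc by simp
  moreover have "k - int r + 1 = k + 1 - int r" by simp
  ultimately obtain a where a: "u + rat_const b \<cdot>\<^sub>v ?w = lincomb r a v" using Suc.IH b by metis
  define a' where "a' = a(r := - b)"
  have "lincomb s a' v = lincomb s a v" if "s \<le> r" for s
    using that by (induction s) (auto simp: a'_def)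
  then have "lincomb (Suc r) a' v = u + rat_const b \<cdot>\<^sub>v ?w + rat_const (- b) \<cdot>\<^sub>v ?w"
    using a by (simp add: a'_def)
  also have "\<dots> = u"
  proof (rule eq_vecI)
    have "rat_const (- b) = - rat_const b" by (simp flip: to_fract_uminus)
    then show "(u + rat_const b \<cdot>\<^sub>v ?w + rat_const (- b) \<cdot>\<^sub>v ?w) $ i = u $ i" if "i < dim_vec u" for i
      using that uc carrier_vecD[OF wc] by simp
  qed (use uc carrier_vecD[OF wc] in simp)
  finally show ?case by metis
qed

text \<open>\<open>D\<close> maps \<open>t^-1 u\<close> to \<open>t^-1 (D - 1) u\<close>, so all
  iterates keep the factor \<open>t^-1\<close> and vanish at infinity.\<close>

lemma D_pow_inverse_t:
  assumes v: "v \<in> carrier_vec n" "I v"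
  shows "\<exists>u. u \<in> carrier_vec n \<and> I u \<and> (D ^^ b) (inverse rat_t \<cdot>\<^sub>v v) = inverse rat_t \<cdot>\<^sub>v u"
proof (induction b)
  case 0
  show ?case using v by auto
next
  case (Suc b)
  then obtain u where u: "u \<in> carrier_vec n" "I u" "(D ^^ b) (inverse rat_t \<cdot>\<^sub>v v) = inverse rat_t \<cdot>\<^sub>v u" by blast
  have Du: "D u \<in> carrier_vec n" using u A by simp
  have "D (inverse rat_t \<cdot>\<^sub>v u) = inverse rat_t \<cdot>\<^sub>v (D u + rat_const (-1) \<cdot>\<^sub>v u)"
    unfolding rat_theta.nabla_smult[OF A u(1)] rat_theta_inverse_t
  proof (rule eq_vecI)
    have "[:- 1:] = - (1 :: complex poly)" by (simp add: one_pCons)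
    then have "rat_const (- 1) = - 1" by (simp only: to_fract_uminus to_fract_1)
    then show "(- inverse rat_t \<cdot>\<^sub>v u + inverse rat_t \<cdot>\<^sub>v D u) $ i = (inverse rat_t \<cdot>\<^sub>v (D u + rat_const (-1) \<cdot>\<^sub>v u)) $ i"
      if "i < dim_vec (inverse rat_t \<cdot>\<^sub>v (D u + rat_const (-1) \<cdot>\<^sub>v u))" for i
      using that u(1) A by (simp add: algebra_simps)
  qed (use u A in simp)
  moreover have "I (D u + rat_const (-1) \<cdot>\<^sub>v u)" by (intro I_add Du I_D I_const u) (use u in simp)
  ultimately show ?case using u(3) Du u(1) by (intro exI[of _ "D u + rat_const (-1) \<cdot>\<^sub>v u"]) simp
qed

text \<open>The values at infinity evolve by minus the residue of \<open>J\<close>, a strictly upper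
  triangular matrix of size \<open>n\<close>.\<close>

lemma z_D_pow_nilpotent:
  assumes v: "v \<in> carrier_vec n" "I v" and i: "i < n"
  shows "fls_nth (z ((D ^^ n) v) $ i) 0 = 0"
proof -
  define N where "N = mat n n (\<lambda>(i,j). - fls_nth (J $$ (i,j)) 0)"
  have N: "N \<in> carrier_mat n n" "\<And>i j. i < n \<Longrightarrow> j \<le> i \<Longrightarrow> N $$ (i,j) = 0"
    using J_nil by (auto simp: N_def J_def)
  define x where "x k = vec n (\<lambda>i. fls_nth (z ((D ^^ k) v) $ i) 0)" for k
  have x: "x k \<in> carrier_vec n" for k by (simp add: x_def)
  have xk: "x k = ((\<lambda>u. N *\<^sub>v u) ^^ k) (x 0)" for k
  proof (induction k)
    case (Suc k)
    have "x (Suc k) = N *\<^sub>v x k"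
    proof (rule eq_vecI)
      fix i assume "i < dim_vec (N *\<^sub>v x k)"
      then have i: "i < n" using N by simp
      have c: "(D ^^ k) v \<in> carrier_vec n" using v by simp
      have "x (Suc k) $ i = - (\<Sum>j<n. fls_nth (J $$ (i,j)) 0 * fls_nth (z ((D ^^ k) v) $ j) 0)"
        using I_D(2)[OF c I_D_pow[OF v] i] i by (simp add: x_def)
      also have "\<dots> = (\<Sum>j<n. N $$ (i,j) * x k $ j)"
        unfolding sum_negf[symmetric] by (rule sum.cong) (use i in \<open>auto simp: N_def x_def\<close>)
      finally show "x (Suc k) $ i = (N *\<^sub>v x k) $ i"
        unfolding index_mult_mat_vec_sum[OF i N(1) x] .
    qed (use N in \<open>simp add: x_def\<close>)
    then show ?case using Suc by simp
  qed simp
  have "x n = 0\<^sub>v n" unfolding xk[of n] by (rule strictly_upper_nilpotent[OF N x])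
  then have "x n $ i = 0" using i by simp
  then show ?thesis using i by (simp add: x_def)
qed

text \<open>
  Take \<open>v\<close> of maximal level \<open>k\<close> in \<open>V\<close>.  Then the vectors of level at least \<open>k - j\<close> are spanned by
  \<open>v, D v, \<dots>, D\<^sup>j v\<close>, so \<open>t\<^sup>-\<^sup>1 v = p(D) v\<close> with \<open>p\<close> of degree \<open>n\<close>.  At infinity the left hand side
  vanishes and \<open>D\<close> is nilpotent, whence \<open>p\<close> is a monomial.
\<close>

theorem bessel_generator:
  "\<exists>v\<in>V. \<exists>a. a \<noteq> 0 \<and> det (cyclic_mat n rat_theta A v) \<noteq> 0 \<and> (D ^^ n) v = (rat_const a * inverse rat_t) \<cdot>\<^sub>v v"
proof -
  obtain K where K: "\<And>v k. v \<in> V \<Longrightarrow> v \<noteq> 0\<^sub>v n \<Longrightarrow> L k v \<Longrightarrow> k \<le> K" using level_bound by blast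
  define S where "S = {k. \<exists>v\<in>V. v \<noteq> 0\<^sub>v n \<and> L k v}"
  obtain v0 k0 where v0: "v0 \<in> V" "v0 \<noteq> 0\<^sub>v n" "L k0 v0" using V_nonzero L_exists by blast
  have fin: "finite (S \<inter> {k0..})" by (rule finite_subset[of _ "{k0..K}"]) (use K in \<open>auto simp: S_def\<close>)
  have "k0 \<in> S \<inter> {k0..}" using v0 by (auto simp: S_def)
  then have "S \<inter> {k0..} \<noteq> {}" by blast
  then have "Max (S \<inter> {k0..}) \<in> S \<inter> {k0..}" by (rule Max_in[OF fin])
  moreover have mx: "\<And>k. k \<in> S \<inter> {k0..} \<Longrightarrow> k \<le> Max (S \<inter> {k0..})" by (rule Max_ge[OF fin])
  ultimately obtain k v where k: "k = Max (S \<inter> {k0..})" "k0 \<le> k" and v: "v \<in> V" "v \<noteq> 0\<^sub>v n" "L k v"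
    by (auto simp: S_def)
  have top: "u = 0\<^sub>v n" if "u \<in> V" "L (k + 1) u" for u
  proof (rule ccontr)
    assume "u \<noteq> 0\<^sub>v n"
    then have "k + 1 \<in> S \<inter> {k0..}" using that k by (auto simp: S_def)
    then show False using mx k by fastforce
  qed
  have Lv: "\<not> L (k + 1) v" using top v by blast
  have vc: "v \<in> carrier_vec n" and Iv: "I v" using v V_carrier V_I by auto
  let ?w = "inverse rat_t \<cdot>\<^sub>v v"
  have wV: "?w \<in> V" using v M_smult[OF _ regular_on_inverse_t] I_inverse_t[OF vc Iv] by (auto simp: V_def)
  \<comment> \<open>Multiplication by \<open>t^-1\<close> lowers the level by \<open>n\<close>, so
    the \<open>n + 1\<close> iterates up to \<open>(D ^^ n) v\<close> suffice.\<close>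
  have "L (k + 1 - int (Suc n)) ?w" using L_t(2)[OF vc v(3)] by simp
  then obtain a where a: "?w = lincomb (Suc n) a v"
    using lincomb_exists[OF v(1,3) Lv top wV] by blast
  define x where "x j = (\<lambda>i. fls_nth (z ((D ^^ j) v) $ i) 0)" for j
  have rel: "(\<Sum>j<Suc n. a j * x (j + b) i) = 0" if i: "i < n" for b i
  proof -
    obtain u where u: "u \<in> carrier_vec n" "I u" "(D ^^ b) ?w = inverse rat_t \<cdot>\<^sub>v u"
      using D_pow_inverse_t[OF vc Iv] by blast
    have "0 = fls_nth (z ((D ^^ b) ?w) $ i) 0" unfolding u(3) using I_inverse_t(2)[OF u(1,2) i] by simp
    also have "\<dots> = (\<Sum>j<Suc n. a j * fls_nth (z ((D ^^ j) ((D ^^ b) v)) $ i) 0)"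
      unfolding a D_pow_lincomb[OF vc] by (rule z_lincomb_nth[OF D_carrier[OF vc] i])
    also have "\<dots> = (\<Sum>j<Suc n. a j * x (j + b) i)" by (simp add: x_def funpow_add)
    finally show ?thesis ..
  qed
  have xn: "x j i = 0" if "j \<ge> n" "i < n" for j i
  proof -
    have "(D ^^ j) v = (D ^^ n) ((D ^^ (j - n)) v)" using that by (metis add_diff_inverse_nat funpow_add o_apply linorder_not_less)
    then show ?thesis unfolding x_def
      using z_D_pow_nilpotent[OF D_carrier[OF vc] I_D_pow[OF vc Iv] that(2)] by simp
  qed
  \<comment> \<open>If an iterate vanished at infinity, then \<open>t\<close> times it would lie in
    \<open>V\<close> at level \<open>k - j + n > k\<close>, contradicting maximality.\<close>
  have xnz: "\<exists>i<n. x j i \<noteq> 0" if j: "j < n" for j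
  proof (rule ccontr)
    assume *: "\<not> (\<exists>i<n. x j i \<noteq> 0)"
    let ?u = "(D ^^ j) v"
    have uV: "?u \<in> V" using V_D_pow v by simp
    have uc: "?u \<in> carrier_vec n" using vc by simp
    have "rat_t \<cdot>\<^sub>v ?u \<in> V"
      using I_t[OF uc V_I[OF uV]] * M_smult[OF V_M[OF uV], of rat_t] regular_on_to_fract by (auto simp: V_def x_def)
    moreover have "L (k + 1) (rat_t \<cdot>\<^sub>v ?u)"
      by (rule L_mono[OF L_t(1)[OF uc L_D_pow(1)[OF vc v(3)]]]) (use j in simp)
    ultimately have z: "rat_t \<cdot>\<^sub>v ?u = 0\<^sub>v n" by (rule top)
    have "?u $ i = 0" if "i < n" for i
      using arg_cong[OF z, of "\<lambda>u. u $ i"] that carrier_vecD[OF uc] by simp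
    then have u0: "?u = 0\<^sub>v n" using carrier_vecD[OF uc] by (intro eq_vecI) auto
    have "L (k - int j + 1) (0\<^sub>v n)"
    proof -
      have "y (0\<^sub>v n) = 0\<^sub>v n" unfolding y_def by (rule eq_vecI) (use mW in \<open>auto simp: scalar_prod_def transcendental_X\<close>)
      then show ?thesis by (simp add: L_def)
    qed
    then show False using L_D_pow(2)[OF vc v(3) Lv, of j] u0 by simp
  qed
  have a0: "a j = 0" if "j < n" for j
  proof (rule ccontr)
    assume "a j \<noteq> 0"
    \<comment> \<open>Applying \<open>n - 1 - q\<close> further derivatives to the relation pushes
      all terms beyond \<open>q\<close> into the range killed by nilpotency; the term at
      \<open>q\<close> becomes the \<open>(n - 1)\<close>-st iterate, which is nonzero at
      infinity.\<close>
    define q where "q = (LEAST j. a j \<noteq> 0)"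
    have q: "a q \<noteq> 0" "q \<le> j" unfolding q_def
      using \<open>a j \<noteq> 0\<close> LeastI[of "\<lambda>j. a j \<noteq> 0" j] Least_le[of "\<lambda>j. a j \<noteq> 0" j] by auto
    have ql: "a i = 0" if "i < q" for i using that not_less_Least unfolding q_def by blast
    have qn: "q < n" using q that by simp
    obtain i where i: "i < n" "x (n - 1) i \<noteq> 0" using xnz[of "n - 1"] n2 by auto
    have "(\<Sum>j<Suc n. a j * x (j + (n - 1 - q)) i) = (\<Sum>j\<in>{q}. a j * x (j + (n - 1 - q)) i)"
    proof (rule sum.mono_neutral_right)
      show "\<forall>j\<in>{..<Suc n} - {q}. a j * x (j + (n - 1 - q)) i = 0"
      proof
        fix j assume "j \<in> {..<Suc n} - {q}"
        then consider "j < q" | "j > q" by fastforce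
        then show "a j * x (j + (n - 1 - q)) i = 0"
        proof cases
          case 2
          then have "j + (n - 1 - q) \<ge> n" using qn by simp
          then show ?thesis using xn i by simp
        qed (use ql in simp)
      qed
    qed (use qn in auto)
    also have "\<dots> = a q * x (n - 1) i" using qn by simp
    finally show False using rel[OF i(1)] q i by simp
  qed
  have lz: "lincomb r a v = 0\<^sub>v n" if "r \<le> n" for r
    using that
  proof (induction r)
    case (Suc r)
    then show ?case using a0[of r] carrier_vecD[OF D_carrier[OF vc, of r]] by (intro eq_vecI) auto
  qed simp
  have w: "?w = rat_const (a n) \<cdot>\<^sub>v (D ^^ n) v"
    using a lz[of n] D_carrier[OF vc, of n] by simp
  have an: "a n \<noteq> 0"
  proof
    assume "a n = 0"
    then have w0: "?w = 0\<^sub>v n" unfolding w using carrier_vecD[OF D_carrier[OF vc, of n]] by (intro eq_vecI) auto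
    have "v $ i = 0" if "i < n" for i
      using arg_cong[OF w0, of "\<lambda>u. u $ i"] that vc by simp
    then have "v = 0\<^sub>v n" using vc by (intro eq_vecI) auto
    with v show False by simp
  qed
  have "(D ^^ n) v = (rat_const (inverse (a n)) * inverse rat_t) \<cdot>\<^sub>v v"
  proof (rule eq_vecI)
    fix i assume "i < dim_vec ((rat_const (inverse (a n)) * inverse rat_t) \<cdot>\<^sub>v v)"
    then have i: "i < n" using vc by simp
    have "rat_const (inverse (a n)) * rat_const (a n) = to_fract ([:inverse (a n):] * [:a n:])"
      by (simp only: to_fract_mult)
    also have "\<dots> = 1" using an by (simp flip: one_pCons)
    finally have u: "rat_const (inverse (a n)) * rat_const (a n) = 1" .
    have "inverse rat_t * v $ i = rat_const (a n) * (D ^^ n) v $ i"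
      using arg_cong[OF w, of "\<lambda>u. u $ i"] i vc carrier_vecD[OF D_carrier[OF vc, of n]] by simp
    then have "(rat_const (inverse (a n)) * inverse rat_t) * v $ i = (rat_const (inverse (a n)) * rat_const (a n)) * (D ^^ n) v $ i"
      by (simp only: mult.assoc)
    then show "(D ^^ n) v $ i = ((rat_const (inverse (a n)) * inverse rat_t) \<cdot>\<^sub>v v) $ i"
      unfolding u using i vc by simp
  qed (use vc carrier_vecD[OF D_carrier[OF vc, of n]] in simp)
  moreover have "det (cyclic_mat n rat_theta A v) \<noteq> 0" by (rule det_cyclic_nonzero[OF vc v(3) Lv])
  moreover have "inverse (a n) \<noteq> 0" using an by simp
  ultimately show ?thesis using v(1) by blast
qed

end

section \<open>Frenkel-Gross connections\<close>

lemma elements_mat_subset_iff: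
  "B \<in> carrier_mat n m \<Longrightarrow> elements_mat B \<subseteq> R \<longleftrightarrow> (\<forall>i<n. \<forall>j<m. B $$ (i,j) \<in> R)"
  by (auto dest!: elements_matD)

lemma SL_mats_iff:
  "B \<in> SL_mats n R \<longleftrightarrow> B \<in> carrier_mat n n \<and> (\<forall>i<n. \<forall>j<n. B $$ (i,j) \<in> R) \<and> det B = 1"
  using elements_mat_subset_iff[of B n n R] by (auto simp: SL_mats_def)

text \<open>The inverse of a matrix of determinant \<open>1\<close> is its adjugate, whose entries
  are polynomials in those of the matrix.\<close>

lemma minv_regular:
  assumes U: "U \<in> carrier_mat n n" "\<And>i j. i < n \<Longrightarrow> j < n \<Longrightarrow> U $$ (i,j) \<in> regular_on S" and d: "det U = 1"
    and ij: "i < n" "j < n"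
  shows "minv U $$ (i,j) \<in> regular_on S"
proof -
  note a = adj_mat[OF U(1)]
  have "1 \<cdot>\<^sub>m 1\<^sub>m n = (1\<^sub>m n :: ratfun mat)" by (rule eq_matI) auto
  then have "minv U = adj_mat U" using a d by (intro minv_eqI[OF U(1)]) auto
  then have "minv U $$ (i,j) = cofactor U j i" using U ij by (simp add: adj_mat_def)
  moreover have "det (mat_delete U j i) \<in> regular_on S"
  proof (rule regular_on_det)
    show "mat_delete U j i \<in> carrier_mat (n - 1) (n - 1)" by (rule mat_delete_carrier[OF U(1)])
    fix k l assume kl: "k < n - 1" "l < n - 1"
    then show "mat_delete U j i $$ (k,l) \<in> regular_on S"
      using U by (auto simp: mat_delete_def)
  qed
  moreover have "(- 1) ^ m \<in> regular_on S" for m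
    by (induction m) (auto intro: regular_on_uminus)
  ultimately show ?thesis by (auto simp: cofactor_def intro: regular_on_mult)
qed

lemma mult_regular:
  assumes "B \<in> carrier_mat n n" "C \<in> carrier_mat n n" "i < n" "j < n"
    and "\<And>i j. i < n \<Longrightarrow> j < n \<Longrightarrow> B $$ (i,j) \<in> regular_on S"
    and "\<And>i j. i < n \<Longrightarrow> j < n \<Longrightarrow> C $$ (i,j) \<in> regular_on S"
  shows "(B * C) $$ (i,j) \<in> regular_on S"
  unfolding index_mult_mat_sum[OF assms(3,4,1,2)] by (intro regular_on_sum regular_on_mult) (use assms in auto)

text \<open>This is \<open>b P E_ij P^-1\<close>, a root vector for the diagonal torus conjugated by
  \<open>P\<close>.\<close>

definition root_vector :: "nat \<Rightarrow> complex mat \<Rightarrow> nat \<Rightarrow> nat \<Rightarrow> complex \<Rightarrow> complex mat" where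
  "root_vector n P i j b = mat n n (\<lambda>(k,l). b * P $$ (k,i) * minv P $$ (j,l))"

lemma root_vector_carrier [simp]: "root_vector n P i j b \<in> carrier_mat n n"
  by (simp add: root_vector_def)

text \<open>Column \<open>i\<close> of \<open>P\<close> and row \<open>j\<close> of its inverse are
  right and left eigenvectors of \<open>h = P D P^-1\<close>, with eigenvalues
  \<open>D $$ (i,i)\<close> and \<open>D $$ (j,j)\<close>.\<close>

lemma root_vector:
  assumes P: "P \<in> SL_mats n UNIV" and ij: "i < n" "j < n" "i \<noteq> j"
  shows "root_vector n P i j b \<in> root_space n P i j"
proof -
  let ?X = "root_vector n P i j b"
  have Pc: "P \<in> carrier_mat n n" "det P \<noteq> 0" using P by (auto simp: SL_mats_iff)
  note m = minv[OF Pc]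
  have PP: "(\<Sum>k<n. minv P $$ (p,k) * P $$ (k,q)) = (if p = q then 1 else 0)" if "p < n" "q < n" for p q
    using index_mult_mat_sum[OF that m(1) Pc(1)] m(3) that by simp
  have "mtrace ?X = b * (\<Sum>k<n. minv P $$ (j,k) * P $$ (k,i))"
    by (simp add: mtrace_def root_vector_def sum_distrib_left mult_ac)
  then have sl: "?X \<in> sl_mats n UNIV" using PP[OF ij(2,1)] ij(3) by (simp add: sl_mats_UNIV)
  show ?thesis unfolding root_space_def Let_def
  proof (intro CollectI conjI ballI impI sl)
    fix D :: "complex mat" assume D: "D \<in> SL_mats n UNIV" "diagonal_mat D"
    have Dc: "D \<in> carrier_mat n n" "det D \<noteq> 0" using D by (auto simp: SL_mats_iff)
    have Dd: "D $$ (p,q) = 0" if "p < n" "q < n" "p \<noteq> q" for p q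
      using D(2) Dc that by (auto simp: diagonal_mat_def)
    have "det D = (\<Prod>i<n. D $$ (i,i))"
      by (rule det_key_triangular[OF Dc(1), of "\<lambda>_. 0"]) (use Dd in auto)
    then have "(\<Prod>i<n. D $$ (i,i)) \<noteq> 0" using Dc(2) by simp
    then have Dnz: "D $$ (p,p) \<noteq> 0" if "p < n" for p using that by (simp add: prod_zero_iff)
    define h where "h = P * D * minv P"
    have PD: "P * D \<in> carrier_mat n n" using Pc Dc by auto
    have h: "h \<in> carrier_mat n n" using PD m by (auto simp: h_def)
    have dh: "det h \<noteq> 0"
      unfolding h_def det_mult[OF PD m(1)] det_mult[OF Pc(1) Dc(1)] det_minv[OF Pc] using Pc Dc by simp
    note mh = minv[OF h dh]
    have hP: "h * P = P * D"
      unfolding h_def assoc_mult_mat[OF PD m(1) Pc(1)] m(3) by (rule right_mult_one_mat[OF PD])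
    have Ph: "minv P * h = D * minv P"
    proof -
      have DP: "D * minv P \<in> carrier_mat n n" using Dc m by auto
      have "h = P * (D * minv P)" unfolding h_def by (rule assoc_mult_mat[OF Pc(1) Dc(1) m(1)])
      then have "minv P * h = minv P * P * (D * minv P)" using assoc_mult_mat[OF m(1) Pc(1) DP] by simp
      then show ?thesis unfolding m(3) left_mult_one_mat[OF DP] .
    qed
    have hX: "h * ?X = D $$ (i,i) \<cdot>\<^sub>m ?X"
    proof (rule eq_matI)
      fix k l assume "k < dim_row (D $$ (i,i) \<cdot>\<^sub>m ?X)" "l < dim_col (D $$ (i,i) \<cdot>\<^sub>m ?X)"
      then have kl: "k < n" "l < n" by (auto simp: root_vector_def)
      have "(h * ?X) $$ (k,l) = (\<Sum>p<n. h $$ (k,p) * ?X $$ (p,l))"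
        by (rule index_mult_mat_sum[OF kl h]) simp
      also have "\<dots> = (\<Sum>p<n. h $$ (k,p) * P $$ (p,i)) * (b * minv P $$ (j,l))"
        unfolding sum_distrib_right by (rule sum.cong) (use kl in \<open>auto simp: root_vector_def mult_ac\<close>)
      also have "(\<Sum>p<n. h $$ (k,p) * P $$ (p,i)) = (\<Sum>p<n. P $$ (k,p) * D $$ (p,i))"
        using index_mult_mat_sum[OF kl(1) ij(1) h Pc(1)] index_mult_mat_sum[OF kl(1) ij(1) Pc(1) Dc(1)] hP by simp
      also have "\<dots> = P $$ (k,i) * D $$ (i,i)"
        using ij Dd by (subst sum.remove[of _ i]) (auto simp: sum.neutral)
      finally show "(h * ?X) $$ (k,l) = (D $$ (i,i) \<cdot>\<^sub>m ?X) $$ (k,l)"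
        using kl by (simp add: root_vector_def mult_ac)
    qed (use h in \<open>auto simp: root_vector_def\<close>)
    have Xh: "?X * h = D $$ (j,j) \<cdot>\<^sub>m ?X"
    proof (rule eq_matI)
      fix k l assume "k < dim_row (D $$ (j,j) \<cdot>\<^sub>m ?X)" "l < dim_col (D $$ (j,j) \<cdot>\<^sub>m ?X)"
      then have kl: "k < n" "l < n" by (auto simp: root_vector_def)
      have "(?X * h) $$ (k,l) = (\<Sum>p<n. ?X $$ (k,p) * h $$ (p,l))"
        by (rule index_mult_mat_sum[OF kl _ h]) simp
      also have "\<dots> = (b * P $$ (k,i)) * (\<Sum>p<n. minv P $$ (j,p) * h $$ (p,l))"
        unfolding sum_distrib_left by (rule sum.cong) (use kl in \<open>auto simp: root_vector_def mult_ac\<close>)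
      also have "(\<Sum>p<n. minv P $$ (j,p) * h $$ (p,l)) = (\<Sum>p<n. D $$ (j,p) * minv P $$ (p,l))"
        using index_mult_mat_sum[OF ij(2) kl(2) m(1) h] index_mult_mat_sum[OF ij(2) kl(2) Dc(1) m(1)] Ph by simp
      also have "\<dots> = D $$ (j,j) * minv P $$ (j,l)"
        using ij Dd by (subst sum.remove[of _ j]) (auto simp: sum.neutral)
      finally show "(?X * h) $$ (k,l) = (D $$ (j,j) \<cdot>\<^sub>m ?X) $$ (k,l)"
        using kl by (simp add: root_vector_def mult_ac)
    qed (use h in \<open>auto simp: root_vector_def\<close>)
    have Xc: "?X \<in> carrier_mat n n" by simp
    have "D $$ (j,j) \<cdot>\<^sub>m (?X * minv h) = (?X * h) * minv h"
      unfolding Xh by (rule mult_smult_assoc_mat[OF Xc mh(1), symmetric])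
    also have "\<dots> = ?X" using assoc_mult_mat[OF Xc h mh(1)] mh(2) Xc by simp
    finally have e: "D $$ (j,j) \<cdot>\<^sub>m (?X * minv h) = ?X" .
    have "h * ?X * minv h = D $$ (i,i) \<cdot>\<^sub>m (?X * minv h)"
      unfolding hX by (rule mult_smult_assoc_mat[OF Xc mh(1)])
    also have "\<dots> = (D $$ (i,i) / D $$ (j,j)) \<cdot>\<^sub>m (D $$ (j,j) \<cdot>\<^sub>m (?X * minv h))"
      by (rule eq_matI) (use Dnz[OF ij(2)] in auto)
    finally show "P * D * minv P * ?X * minv (P * D * minv P) = (D $$ (i,i) / D $$ (j,j)) \<cdot>\<^sub>m ?X"
      unfolding e h_def[symmetric] .
  qed
qed

lemma root_vector_nonzero:
  assumes P: "P \<in> SL_mats n UNIV" and ij: "i < n" "j < n" and b: "b \<noteq> 0"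
  shows "root_vector n P i j b \<noteq> 0\<^sub>m n n"
proof
  assume z: "root_vector n P i j b = 0\<^sub>m n n"
  have Pc: "P \<in> carrier_mat n n" "det P \<noteq> 0" using P by (auto simp: SL_mats_iff)
  note m = minv[OF Pc]
  have PP: "(\<Sum>k<n. minv P $$ (p,k) * P $$ (k,p)) = 1" if "p < n" for p
    using index_mult_mat_sum[OF that that m(1) Pc(1)] m(3) that by simp
  have X0: "b * P $$ (k,i) * minv P $$ (j,l) = 0" if "k < n" "l < n" for k l
    using arg_cong[OF z, of "\<lambda>M. M $$ (k,l)"] that by (simp add: root_vector_def)
  \<comment> \<open>Recovers \<open>b\<close> by placing the root vector between row
    \<open>i\<close> of the inverse of \<open>P\<close> and column \<open>j\<close> of
    \<open>P\<close>.\<close>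
  have "b = b * ((\<Sum>k<n. minv P $$ (i,k) * P $$ (k,i)) * (\<Sum>l<n. minv P $$ (j,l) * P $$ (l,j)))"
    using PP ij by simp
  also have "\<dots> = (\<Sum>k<n. \<Sum>l<n. minv P $$ (i,k) * (b * P $$ (k,i) * minv P $$ (j,l)) * P $$ (l,j))"
    unfolding sum_product by (simp add: sum_distrib_left mult_ac)
  also have "\<dots> = 0" using X0 by (intro sum.neutral ballI) simp
  finally show False using b by simp
qed

lemma rat_const_hom: "comm_ring_hom rat_const"
proof
  fix a b :: complex
  have "[:a + b:] = [:a:] + [:b:]" "[:a * b:] = [:a:] * [:b:]" by simp_all
  then show "rat_const (a + b) = rat_const a + rat_const b" "rat_const (a * b) = rat_const a * rat_const b"
    by (simp_all only: to_fract_add to_fract_mult)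
  show "rat_const 0 = 0" "rat_const 1 = 1" by (simp_all flip: one_pCons)
qed

text \<open>The companion matrix is \<open>a t^-1 E_(0,n-1)\<close> plus the sum of the
  \<open>E_(i+1,i)\<close>: the highest root space carries the pole and the negative simple root
  spaces form the subdiagonal. A constant \<open>P\<close> merely conjugates.\<close>

lemma gauge_companion_frenkel_gross:
  assumes n: "n \<ge> 2" and P: "P \<in> SL_mats n UNIV"
  shows "gauge rat_theta (map_mat rat_const P) (companion n ((rat_const a * inverse rat_t) \<cdot>\<^sub>v unit_vec n 0)) =
    frenkel_gross_mat n (root_vector n P 0 (n - 1) a) (\<lambda>i. root_vector n P (i + 1) i 1)"
proof -
  interpret comm_ring_hom rat_const by (rule rat_const_hom)
  let ?C = "companion n ((rat_const a * inverse rat_t) \<cdot>\<^sub>v unit_vec n 0)"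
  let ?P = "map_mat rat_const P" and ?Q = "map_mat rat_const (minv P)"
  have Pc: "P \<in> carrier_mat n n" "det P \<noteq> 0" using P by (auto simp: SL_mats_iff)
  note m = minv[OF Pc]
  have c: "?P \<in> carrier_mat n n" "?Q \<in> carrier_mat n n" using Pc m by auto
  have PQ: "?P * ?Q = 1\<^sub>m n" using mat_hom_mult[OF Pc(1) m(1)] m(2) by (simp add: mat_hom_one)
  have "gauge rat_theta ?P ?C = ?P * ?C * ?Q - map_mat rat_theta ?P * ?Q"
    by (rule rat_theta.gauge_eqI[OF c PQ])
  also have "map_mat rat_theta ?P = 0\<^sub>m n n" by (rule eq_matI) (use Pc in \<open>auto simp: rat_theta_const\<close>)
  also have "?P * ?C * ?Q - 0\<^sub>m n n * ?Q = ?P * ?C * ?Q" by (rule eq_matI) (use c in auto)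
  also have "?P * ?C * ?Q = frenkel_gross_mat n (root_vector n P 0 (n - 1) a) (\<lambda>i. root_vector n P (i + 1) i 1)"
    (is "_ = ?F")
  proof (rule eq_matI)
    fix k l assume "k < dim_row ?F" "l < dim_col ?F"
    then have kl: "k < n" "l < n" by (auto simp: frenkel_gross_mat_def)
    let ?p = "\<lambda>i. rat_const (P $$ (k,i))" and ?q = "\<lambda>j. rat_const (minv P $$ (j,l))"
    obtain N where N: "n = Suc N" using n by (cases n) auto
    have "(?P * ?C * ?Q) $$ (k,l) = (\<Sum>i<n. \<Sum>j<n. (?P $$ (k,i) * ?Q $$ (j,l)) * ?C $$ (i,j))"
      by (rule conj_mat_index[OF c companion_carrier kl])
    also have "\<dots> = (\<Sum>j<n. \<Sum>i<n. (?p i * ?q j) * ?C $$ (i,j))"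
      by (subst sum.swap) (intro sum.cong refl, use kl Pc m in simp)
    also have "\<dots> = (\<Sum>j<n. if j = N then ?p 0 * ?q j * (rat_const a * inverse rat_t) else ?p (j + 1) * ?q j)"
    proof (intro sum.cong refl)
      fix j assume j: "j \<in> {..<n}"
      show "(\<Sum>i<n. (?p i * ?q j) * ?C $$ (i,j)) = (if j = N then ?p 0 * ?q j * (rat_const a * inverse rat_t) else ?p (j + 1) * ?q j)"
      proof (cases "j = N")
        case True
        have "(\<Sum>i<n. (?p i * ?q j) * ?C $$ (i,j)) = (\<Sum>i\<in>{0}. (?p i * ?q j) * (rat_const a * inverse rat_t))"
          by (rule sum.mono_neutral_cong_right) (use True N in \<open>auto simp: companion_def\<close>)
        then show ?thesis using True by simp
      next
        case False
        have "(\<Sum>i<n. (?p i * ?q j) * ?C $$ (i,j)) = (\<Sum>i\<in>{j + 1}. ?p i * ?q j)"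
          by (rule sum.mono_neutral_cong_right) (use False N j in \<open>auto simp: companion_def\<close>)
        then show ?thesis using False by simp
      qed
    qed
    also have "\<dots> = ?p 0 * ?q N * (rat_const a * inverse rat_t) + (\<Sum>j<N. ?p (j + 1) * ?q j)"
      by (simp add: N add.commute)
    also have "\<dots> = ?F $$ (k,l)"
      using kl unfolding frenkel_gross_mat_def root_vector_def
      by (simp add: N hom_mult field_class.field_divide_inverse mult_ac)
    finally show "(?P * ?C * ?Q) $$ (k,l) = ?F $$ (k,l)" .
  qed (use c in \<open>auto simp: frenkel_gross_mat_def\<close>)
  finally show ?thesis .
qed

text \<open>The cocycle identity makes \<open>trans X i i\<close> idempotent, and an invertible
  idempotent is the identity; the formula for inverses follows.\<close>

lemma SL_connection_minv_trans:
  assumes X: "SL_connection n X" and i: "i < nchart X" "j < nchart X"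
  shows "trans X i j \<in> carrier_mat n n" "det (trans X i j) = 1" "minv (trans X i j) = trans X j i"
    "trans X i i = 1\<^sub>m n"
proof -
  have T: "trans X p q \<in> carrier_mat n n" "det (trans X p q) = 1" if "p < nchart X" "q < nchart X" for p q
    using X that by (auto simp: SL_connection_def SL_mats_iff)
  have co: "trans X p q * trans X q r = trans X p r" if "p < nchart X" "q < nchart X" "r < nchart X" for p q r
    using X that by (auto simp: SL_connection_def)
  show "trans X i j \<in> carrier_mat n n" "det (trans X i j) = 1" using T i by auto
  have id: "trans X p p = 1\<^sub>m n" if p: "p < nchart X" for p
  proof -
    have d: "det (trans X p p) \<noteq> 0" using T p by simp
    note m = minv[OF T(1)[OF p p] d]
    have "trans X p p = minv (trans X p p) * (trans X p p * trans X p p)"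
      using assoc_mult_mat[OF m(1) T(1)[OF p p] T(1)[OF p p]] m(3) T(1)[OF p p] by simp
    then show ?thesis unfolding co[OF p p p] m(3) .
  qed
  show "trans X i i = 1\<^sub>m n" using id i by simp
  show "minv (trans X i j) = trans X j i"
    by (rule minv_eqI[OF T(1)[OF i]]) (use T i co[OF i(1,2,1)] id in auto)
qed

text \<open>Sections over the whole punctured line, written in the trivialization of chart
  \<open>0\<close>; this turns the glued bundle into a set of rational vectors.\<close>

definition regular_sections :: "nat \<Rightarrow> connection_data \<Rightarrow> ratfun vec set" where
  "regular_sections n X = {v \<in> carrier_vec n. \<forall>i<nchart X. \<forall>l<n. (trans X i 0 *\<^sub>v v) $ l \<in> regular_on (chart X i)}"

text \<open>One polynomial clears the denominators in the first columns of all transition matrices,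
  hence makes a multiple of the first unit vector regular in every chart.\<close>

lemma regular_sections_nonzero:
  assumes X: "SL_connection n X" and n: "n \<ge> 1"
  shows "\<exists>v\<in>regular_sections n X. v \<noteq> 0\<^sub>v n"
proof -
  have N: "0 < nchart X"
  proof (rule ccontr)
    assume "\<not> ?thesis"
    then have "(\<Union>i<nchart X. chart X i) = {}" by simp
    moreover have "(\<Union>i<nchart X. chart X i) = - {0}" using X by (simp add: SL_connection_def)
    moreover have "(1 :: complex) \<in> - {0}" by simp
    ultimately show False by simp
  qed
  define I where "I = {..<nchart X} \<times> {..<n}"
  define d where "d = (\<lambda>(i,l). to_fract (snd (quot_of_fract (trans X i 0 $$ (l,0)))) :: ratfun)"
  define f where "f = (\<Prod>x\<in>I. d x)"
  have f: "f \<noteq> 0" unfolding f_def by (auto simp: I_def d_def prod_zero_iff)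
  define v where "v = f \<cdot>\<^sub>v unit_vec n 0"
  have v: "v \<in> carrier_vec n" by (simp add: v_def)
  have "(trans X i 0 *\<^sub>v v) $ l \<in> regular_on (chart X i)" if il: "i < nchart X" "l < n" for i l
  proof -
    let ?a = "trans X i 0 $$ (l,0)"
    have "(trans X i 0 *\<^sub>v v) $ l = (\<Sum>j<n. trans X i 0 $$ (l,j) * v $ j)"
      by (rule index_mult_mat_vec_sum[OF il(2) SL_connection_minv_trans(1)[OF X il(1) N] v])
    also have "\<dots> = (\<Sum>j\<in>{0::nat}. ?a * f)"
      by (rule sum.mono_neutral_cong_right) (use n in \<open>auto simp: v_def\<close>)
    also have "\<dots> = (?a * d (i,l)) * (\<Prod>x\<in>I - {(i,l)}. d x)"
      unfolding f_def using il by (subst prod.remove[of _ "(i,l)"]) (auto simp: I_def)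
    finally have e: "(trans X i 0 *\<^sub>v v) $ l = (?a * d (i,l)) * (\<Prod>x\<in>I - {(i,l)}. d x)" .
    have fr: "Fract p q * to_fract q = to_fract p" if "q \<noteq> 0" for p q :: "complex poly"
      using that by (simp add: to_fract_def eq_fract)
    have "?a * d (i,l) = to_fract (fst (quot_of_fract ?a))"
      using fr[of "snd (quot_of_fract ?a)" "fst (quot_of_fract ?a)"]
      unfolding d_def prod.case Fract_quot_of_fract by simp
    then have "?a * d (i,l) \<in> regular_on (chart X i)" by (simp only: regular_on_to_fract)
    moreover have "(\<Prod>x\<in>I - {(i,l)}. d x) \<in> regular_on (chart X i)"
      by (rule regular_on_prod) (auto simp: d_def regular_on_to_fract)
    ultimately show ?thesis unfolding e by (rule regular_on_mult)
  qed
  then have "v \<in> regular_sections n X" using v by (simp add: regular_sections_def)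
  moreover have "v \<noteq> 0\<^sub>v n"
  proof
    assume "v = 0\<^sub>v n"
    then have "v $ 0 = 0" using n by simp
    then show False using f n by (simp add: v_def)
  qed
  ultimately show ?thesis by blast
qed

text \<open>The torus and the Borel subgroup are prescribed through \<open>P\<close>. The standard
  companion form is reached first, and the constant \<open>P\<close> then conjugates it into the
  prescribed position.\<close>

theorem theorem7:
  fixes n :: nat and X :: connection_data and P :: "complex mat"
  assumes "n \<ge> 2"
    and "P \<in> SL_mats n UNIV"
    and "SL_connection n X"
    and "regular_singular n (formal_at_inf X)"
    and "principal_unipotent_monodromy n (formal_at_inf X)"
    and "\<not> regular_singular n (formal_at_0 X)"
    and "has_irregularity (n\<^sup>2 - 1) (ad_mat n (formal_at_0 X)) (real (n - 1))"
  shows "\<exists>Y. frenkel_gross_connection n P Y \<and> SL_isomorphic n X Y"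
proof -
  note n = assms(1) and P = assms(2) and X = assms(3)
  have n1: "n \<ge> 1" using n by simp
  note tr = SL_connection_minv_trans[OF X]
  have ch: "(\<Union>i<nchart X. chart X i) = - {0}" using X by (simp add: SL_connection_def)
  have N: "0 < nchart X"
  proof (rule ccontr)
    assume "\<not> ?thesis"
    then have "(\<Union>i<nchart X. chart X i) = {}" by simp
    moreover have "(1 :: complex) \<in> - {0}" by simp
    ultimately show False using ch by simp
  qed
  have ch0: "chart X i \<subseteq> - {0}" if "i < nchart X" for i using ch that by blast
  have co: "trans X i j * trans X j k = trans X i k" if "i < nchart X" "j < nchart X" "k < nchart X" for i j k
    using X that unfolding SL_connection_def by blast
  have cf: "cform X i \<in> carrier_mat n n" "mtrace (cform X i) = 0"
    "\<And>k l. k < n \<Longrightarrow> l < n \<Longrightarrow> cform X i $$ (k,l) \<in> regular_on (chart X i)" if i: "i < nchart X" for i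
  proof -
    have "cform X i \<in> sl_mats n (regular_on (chart X i))" using X i unfolding SL_connection_def by blast
    then show "cform X i \<in> carrier_mat n n" "mtrace (cform X i) = 0"
      "\<And>k l. k < n \<Longrightarrow> l < n \<Longrightarrow> cform X i $$ (k,l) \<in> regular_on (chart X i)"
      using elements_mat_subset_iff[of "cform X i" n n] by (auto simp: sl_mats_def mtrace_def)
  qed
  have cg: "cform X i = gauge rat_theta (trans X i j) (cform X j)" if "i < nchart X" "j < nchart X" for i j
    using X that unfolding SL_connection_def by blast
  define A where "A = cform X 0"
  have Ac: "A \<in> carrier_mat n n" "mtrace A = 0" using cf N by (auto simp: A_def)
  let ?M = "regular_sections n X"
  interpret e0: comm_ring_hom "expand fls_X" by (rule expand_hom[OF transcendental_X])
  have f0: "formal_at_0 X = map_mat (expand fls_X) A" by (simp add: formal_at_0_def A_def)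
  have "mtrace (map_mat (expand fls_X) A) = expand fls_X (mtrace A)"
    using Ac(1) by (simp add: mtrace_def e0.hom_sum)
  then have "formal_at_0 X \<in> sl_mats n UNIV" using Ac by (simp add: f0 sl_mats_UNIV transcendental_X)
  then obtain W0 c where W0: "W0 \<in> carrier_mat n n" "det W0 \<noteq> 0" and c: "c \<in> carrier_vec n"
    "gauge fls_theta (minv W0) (map_mat (expand fls_X) A) = companion n c"
    "\<And>i. i < n \<Longrightarrow> i > 0 \<Longrightarrow> fls_ge 1 0 (c $ i)" "fls_ge 1 (-1) (c $ 0)" "fls_nth (c $ 0) (-1) \<noteq> 0"
    using local_companion_form[OF n _ assms(7)] unfolding f0 by blast
  have fi: "formal_at_inf X = - map_mat (expand fls_X_inv) A" by (simp add: formal_at_inf_def A_def)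
  have "formal_at_inf X \<in> carrier_mat n n" using Ac by (simp add: fi)
  then obtain g where g: "g \<in> carrier_mat n n" "det g \<noteq> 0"
    and gJ: "\<And>i j. i < n \<Longrightarrow> j < n \<Longrightarrow> fls_ge 1 0 (gauge fls_theta g (- map_mat (expand fls_X_inv) A) $$ (i,j))"
      "\<And>i j. i < n \<Longrightarrow> j < n \<Longrightarrow> j \<le> i \<Longrightarrow> fls_nth (gauge fls_theta g (- map_mat (expand fls_X_inv) A) $$ (i,j)) 0 = 0"
    using unipotent_normal_form[OF _ assms(5)] unfolding fi by blast
  have Mc: "v \<in> carrier_vec n" if "v \<in> ?M" for v using that by (simp add: regular_sections_def)
  have Mr: "(trans X i 0 *\<^sub>v v) $ l \<in> regular_on (chart X i)" if "v \<in> ?M" "i < nchart X" "l < n" for v i l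
    using that by (simp add: regular_sections_def)
  have MI: "v \<in> ?M" if "v \<in> carrier_vec n"
    "\<And>i l. i < nchart X \<Longrightarrow> l < n \<Longrightarrow> (trans X i 0 *\<^sub>v v) $ l \<in> regular_on (chart X i)" for v
    using that by (simp add: regular_sections_def)
  have Tv: "trans X i 0 *\<^sub>v v \<in> carrier_vec n" if "i < nchart X" "v \<in> carrier_vec n" for i v
    using tr(1)[OF that(1) N] that(2) by simp
  have M_add: "v + w \<in> ?M" if vw: "v \<in> ?M" "w \<in> ?M" for v w
  proof (rule MI)
    fix i l assume il: "i < nchart X" "l < n"
    have "trans X i 0 *\<^sub>v (v + w) = trans X i 0 *\<^sub>v v + trans X i 0 *\<^sub>v w"
      by (rule mult_add_distrib_mat_vec[OF tr(1)[OF il(1) N] Mc[OF vw(1)] Mc[OF vw(2)]])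
    moreover have "dim_vec (trans X i 0 *\<^sub>v w) = n" using Tv[OF il(1) Mc[OF vw(2)]] by (rule carrier_vecD)
    ultimately have "(trans X i 0 *\<^sub>v (v + w)) $ l = (trans X i 0 *\<^sub>v v) $ l + (trans X i 0 *\<^sub>v w) $ l"
      using il by (simp only: index_add_vec)
    then show "(trans X i 0 *\<^sub>v (v + w)) $ l \<in> regular_on (chart X i)"
      using regular_on_add[OF Mr[OF vw(1) il] Mr[OF vw(2) il]] by (simp only:)
  qed (use Mc vw in simp)
  have M_smult: "f \<cdot>\<^sub>v v \<in> ?M" if v: "v \<in> ?M" and f: "f \<in> regular_on (- {0})" for v f
  proof (rule MI)
    fix i l assume il: "i < nchart X" "l < n"
    have "trans X i 0 *\<^sub>v (f \<cdot>\<^sub>v v) = f \<cdot>\<^sub>v (trans X i 0 *\<^sub>v v)"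
      by (rule mult_mat_vec[OF tr(1)[OF il(1) N] Mc[OF v]])
    moreover have "dim_vec (trans X i 0 *\<^sub>v v) = n" using Tv[OF il(1) Mc[OF v]] by (rule carrier_vecD)
    ultimately have "(trans X i 0 *\<^sub>v (f \<cdot>\<^sub>v v)) $ l = f * (trans X i 0 *\<^sub>v v) $ l"
      using il by (simp only: index_smult_vec)
    then show "(trans X i 0 *\<^sub>v (f \<cdot>\<^sub>v v)) $ l \<in> regular_on (chart X i)"
      using regular_on_mult[OF regular_on_mono[OF f ch0[OF il(1)]] Mr[OF v il]] by (simp only:)
  qed (use Mc v in simp)
  have M_nabla: "nabla rat_theta A v \<in> ?M" if v: "v \<in> ?M" for v
  proof (rule MI)
    fix i l assume il: "i < nchart X" "l < n"
    have d: "det (trans X i 0) \<noteq> 0" using tr(2)[OF il(1) N] by simp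
    have "trans X i 0 *\<^sub>v nabla rat_theta A v = nabla rat_theta (cform X i) (trans X i 0 *\<^sub>v v)"
      unfolding cg[OF il(1) N] A_def[symmetric]
      by (rule rat_theta.nabla_gauge[OF tr(1)[OF il(1) N] d Ac(1) Mc[OF v], symmetric])
    also have "nabla rat_theta (cform X i) (trans X i 0 *\<^sub>v v) $ l = rat_theta ((trans X i 0 *\<^sub>v v) $ l)
        + (\<Sum>j<n. cform X i $$ (l,j) * (trans X i 0 *\<^sub>v v) $ j)"
      by (rule index_nabla[OF il(2) cf(1)[OF il(1)] Tv[OF il(1) Mc[OF v]]])
    also have "\<dots> \<in> regular_on (chart X i)"
      by (intro regular_on_add regular_on_sum regular_on_mult regular_on_rat_theta Mr[OF v il] cf(3)[OF il] Mr[OF v il(1)]) auto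
    finally show "(trans X i 0 *\<^sub>v nabla rat_theta A v) $ l \<in> regular_on (chart X i)" .
  qed (use Ac Mc v in simp)
  have M_pow: "(nabla rat_theta A ^^ j) v \<in> ?M" if "v \<in> ?M" for v j
    by (induction j) (use that M_nabla in auto)
  \<comment> \<open>The columns of the frame are iterated derivatives of a section, hence regular in
    chart \<open>i\<close>. As transition matrices have determinant \<open>1\<close>, all charts see
    the same determinant.\<close>
  have Tcyc: "trans X i 0 * cyclic_mat n rat_theta A v \<in> carrier_mat n n"
    "\<And>k l. k < n \<Longrightarrow> l < n \<Longrightarrow> (trans X i 0 * cyclic_mat n rat_theta A v) $$ (k,l) \<in> regular_on (chart X i)"
    "det (trans X i 0 * cyclic_mat n rat_theta A v) = det (cyclic_mat n rat_theta A v)"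
    if i: "i < nchart X" and v: "v \<in> ?M" for i v
  proof -
    have T: "trans X i 0 \<in> carrier_mat n n" by (rule tr(1)[OF i N])
    have e: "trans X i 0 * cyclic_mat n rat_theta A v = mat n n (\<lambda>(k,l). (trans X i 0 *\<^sub>v (nabla rat_theta A ^^ l) v) $ k)"
      unfolding cyclic_mat_def by (rule mat_mult_col_mat[OF T]) (use Ac Mc[OF v] in simp)
    show "trans X i 0 * cyclic_mat n rat_theta A v \<in> carrier_mat n n" unfolding e by simp
    show "(trans X i 0 * cyclic_mat n rat_theta A v) $$ (k,l) \<in> regular_on (chart X i)" if "k < n" "l < n" for k l
      unfolding e using that Mr[OF M_pow[OF v] i that(1), of l] by simp
    show "det (trans X i 0 * cyclic_mat n rat_theta A v) = det (cyclic_mat n rat_theta A v)"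
      using det_mult[OF T cyclic_mat_carrier] tr(2)[OF i N] by simp
  qed
  have M_det: "det (cyclic_mat n rat_theta A v) \<in> regular_on (- {0})" if v: "v \<in> ?M" for v
    unfolding ch[symmetric]
  proof (rule regular_on_Union)
    fix i assume "i \<in> {..<nchart X}"
    then have i: "i < nchart X" by simp
    show "det (cyclic_mat n rat_theta A v) \<in> regular_on (chart X i)"
      unfolding Tcyc(3)[OF i v, symmetric] by (rule regular_on_det[OF Tcyc(1,2)[OF i v]])
  qed
  interpret lattice_pair n A W0 c g ?M
    by unfold_locales (use n Ac W0 c g gJ Mc M_add M_smult M_nabla M_det regular_sections_nonzero[OF X n1] in auto)
  obtain v a where v: "v \<in> V" and a: "a \<noteq> 0" and dW: "det (cyclic_mat n rat_theta A v) \<noteq> 0"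
    and Dn: "(nabla rat_theta A ^^ n) v = (rat_const a * inverse rat_t) \<cdot>\<^sub>v v"
    using bessel_generator by blast
  have vM: "v \<in> ?M" and vc: "v \<in> carrier_vec n" using v V_M V_carrier by auto
  define W where "W = cyclic_mat n rat_theta A v"
  have W: "W \<in> carrier_mat n n" "det W \<noteq> 0" using dW by (auto simp: W_def)
  define b where "b = (rat_const a * inverse rat_t) \<cdot>\<^sub>v unit_vec n 0"
  have b: "b \<in> carrier_vec n" by (simp add: b_def)
  have "W *\<^sub>v unit_vec n 0 = v"
  proof (rule eq_vecI)
    fix i assume "i < dim_vec v"
    then have i: "i < n" using vc by simp
    have "(W *\<^sub>v unit_vec n 0) $ i = (\<Sum>j<n. W $$ (i,j) * unit_vec n 0 $ j)"
      by (rule index_mult_mat_vec_sum[OF i W(1)]) simp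
    also have "\<dots> = (\<Sum>j\<in>{0::nat}. v $ i)"
      by (rule sum.mono_neutral_cong_right) (use n i in \<open>auto simp: W_def cyclic_mat_def\<close>)
    finally show "(W *\<^sub>v unit_vec n 0) $ i = v $ i" by simp
  qed (use W vc in simp)
  then have Wb: "W *\<^sub>v b = (nabla rat_theta A ^^ n) v"
    unfolding Dn b_def mult_mat_vec[OF W(1) unit_vec_carrier] by simp
  let ?C = "companion n b"
  have frame: "map_mat rat_theta W + A * W = W * ?C"
    unfolding W_def by (rule rat_theta.cyclic_frame[OF n1 Ac(1) vc b Wb[unfolded W_def]])
  have mW: "minv W \<in> carrier_mat n n" "det (minv W) \<noteq> 0" using minv[OF W] det_minv[OF W] W by auto
  have gW: "gauge rat_theta (minv W) A = ?C"
    by (rule rat_theta.gauge_frame[OF W Ac(1) companion_carrier frame])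
  \<comment> \<open>Both connection matrices have trace zero, so the determinant of the frame change
    has zero logarithmic derivative and is a constant. Here \<open>n \<ge> 2\<close> matters: the
    nonzero entry of the last column lies off the diagonal.\<close>
  have "mtrace ?C = 0"
  proof -
    have "?C $$ (i,i) = 0" if "i < n" for i using that n by (auto simp: companion_def b_def)
    then show ?thesis by (simp add: mtrace_def companion_def)
  qed
  then have "rat_theta (det (minv W)) = 0"
    using rat_theta.mtrace_gauge[OF mW Ac(1)] mW(2) Ac(2) unfolding gW by simp
  then obtain d where d: "det (minv W) = rat_const d" using rat_theta_eq_0 by blast
  have d0: "d \<noteq> 0" using mW(2) d by auto
  have "card {z. z ^ n = inverse d} = n" by (rule card_nth_roots) (use d0 n in auto)
  \<comment> \<open>Scaling by a constant \<open>m\<close> multiplies the determinant by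
    \<open>m ^ n\<close> and does not affect the gauge transform.\<close>
  then obtain m where m: "m ^ n = inverse d" using n by (metis (mono_tags, lifting) card.empty empty_Collect_eq not_numeral_le_zero)
  have m0: "m \<noteq> 0" using m d0 n by (auto simp: power_0_left)
  interpret rc: comm_ring_hom rat_const by (rule rat_const_hom)
  define h0 where "h0 = rat_const m \<cdot>\<^sub>m minv W"
  have h0: "h0 \<in> carrier_mat n n" using mW by (simp add: h0_def)
  have dh0: "det h0 = 1"
  proof -
    have "det h0 = rat_const m ^ n * det (minv W)" unfolding h0_def using mW by simp
    also have "\<dots> = rat_const (m ^ n * d)" by (simp only: d rc.hom_mult rc.hom_power)
    also have "\<dots> = 1" using m d0 by (simp del: to_fract_1 flip: rc.hom_one)
    finally show ?thesis .
  qed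
  have gh0: "gauge rat_theta h0 A = ?C"
  proof -
    have mm: "rat_const (inverse m) * rat_const m = 1" unfolding rc.hom_mult[symmetric] using m0 by simp
    have W': "rat_const (inverse m) \<cdot>\<^sub>m W \<in> carrier_mat n n" using W by simp
    have "h0 * (rat_const (inverse m) \<cdot>\<^sub>m W) = rat_const m \<cdot>\<^sub>m (minv W * (rat_const (inverse m) \<cdot>\<^sub>m W))"
      unfolding h0_def by (rule mult_smult_assoc_mat[OF mW(1) W'])
    also have "\<dots> = rat_const m \<cdot>\<^sub>m (rat_const (inverse m) \<cdot>\<^sub>m 1\<^sub>m n)"
      unfolding mult_smult_distrib[OF mW(1) W(1)] minv(3)[OF W] ..
    also have "\<dots> = 1\<^sub>m n" by (rule eq_matI) (use mm in \<open>auto simp: mult.commute\<close>)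
    finally have inv: "h0 * (rat_const (inverse m) \<cdot>\<^sub>m W) = 1\<^sub>m n" .
    have "gauge rat_theta h0 A = h0 * A * (rat_const (inverse m) \<cdot>\<^sub>m W) - map_mat rat_theta h0 * (rat_const (inverse m) \<cdot>\<^sub>m W)"
      by (rule rat_theta.gauge_eqI[OF h0 W' inv])
    also have "map_mat rat_theta h0 = rat_const m \<cdot>\<^sub>m map_mat rat_theta (minv W)"
      by (rule eq_matI) (auto simp: h0_def rat_theta.mult rat_theta_const)
    also have "h0 * A = rat_const m \<cdot>\<^sub>m (minv W * A)"
      unfolding h0_def by (rule mult_smult_assoc_mat[OF mW(1) Ac(1)])
    also have "(rat_const m \<cdot>\<^sub>m (minv W * A)) * (rat_const (inverse m) \<cdot>\<^sub>m W) = minv W * A * W"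
      using mW Ac W mm by (simp add: mult_smult_assoc_mat[of _ n n _ n] mult_smult_distrib[of _ n n _ n])
        (rule eq_matI, auto simp: mult.assoc[symmetric] mult.commute)
    also have "(rat_const m \<cdot>\<^sub>m map_mat rat_theta (minv W)) * (rat_const (inverse m) \<cdot>\<^sub>m W) = map_mat rat_theta (minv W) * W"
      using mW W mm by (simp add: mult_smult_assoc_mat[of _ n n _ n] mult_smult_distrib[of _ n n _ n])
        (rule eq_matI, auto simp: mult.assoc[symmetric] mult.commute)
    also have "minv W * A * W - map_mat rat_theta (minv W) * W = gauge rat_theta (minv W) A"
      by (rule rat_theta.gauge_eqI[symmetric, OF mW(1) W(1) minv(3)[OF W]])
    finally show ?thesis unfolding gW .
  qed
  let ?P = "map_mat rat_const P"
  have Pc: "P \<in> carrier_mat n n" "det P = 1" using P by (auto simp: SL_mats_iff)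
  have P': "?P \<in> carrier_mat n n" "det ?P = 1" using Pc by simp_all
  define H where "H i = ?P * h0 * trans X 0 i" for i
  have Ph: "?P * h0 \<in> carrier_mat n n" "det (?P * h0) = 1" using P' h0 dh0 det_mult[OF P'(1) h0] by auto
  have H: "H i \<in> carrier_mat n n" "det (H i) = 1" if i: "i < nchart X" for i
    unfolding H_def using Ph tr(1,2)[OF N i] det_mult[OF Ph(1) tr(1)[OF N i]] by auto
  \<comment> \<open>Up to \<open>P\<close>, the transition to the new frame is the inverse of a
    matrix whose columns are multiples of regular sections written in chart \<open>i\<close>. That
    matrix has determinant \<open>1\<close>, so its inverse is regular as well; this is where the
    frame is seen to trivialize the bundle.\<close>
  have Hreg: "H i $$ (k,l) \<in> regular_on (- {0} \<inter> chart X i)" if i: "i < nchart X" and kl: "k < n" "l < n" for i k l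
  proof -
    let ?U = "rat_const (inverse m) \<cdot>\<^sub>m (trans X i 0 * W)"
    have U: "?U \<in> carrier_mat n n" using Tcyc(1)[OF i vM] by (simp add: W_def)
    have Ur: "?U $$ (k,l) \<in> regular_on (chart X i)" if "k < n" "l < n" for k l
    proof -
      have "?U $$ (k,l) = rat_const (inverse m) * (trans X i 0 * W) $$ (k,l)"
        by (rule index_smult_mat(1)) (use that carrier_matD[OF Tcyc(1)[OF i vM]] in \<open>simp_all only: W_def\<close>)
      then show ?thesis
        using regular_on_mult[OF regular_on_to_fract Tcyc(2)[OF i vM that]] by (simp only: W_def)
    qed
    note T = tr(1)[OF i N] and T0 = tr(1)[OF N i]
    have TW: "trans X i 0 * W \<in> carrier_mat n n" using T W by auto
    have hT: "h0 * trans X 0 i \<in> carrier_mat n n" using h0 T0 by auto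
    have mm: "rat_const (inverse m) * rat_const m = 1" unfolding rc.hom_mult[symmetric] using m0 by simp
    have "?U * (h0 * trans X 0 i) = 1\<^sub>m n"
    proof -
      have "W * (h0 * trans X 0 i) = rat_const m \<cdot>\<^sub>m trans X 0 i"
      proof -
        have "W * (h0 * trans X 0 i) = W * h0 * trans X 0 i" by (rule assoc_mult_mat[OF W(1) h0 T0, symmetric])
        also have "W * h0 = rat_const m \<cdot>\<^sub>m 1\<^sub>m n"
          unfolding h0_def mult_smult_distrib[OF W(1) mW(1)] minv(2)[OF W] ..
        also have "(rat_const m \<cdot>\<^sub>m 1\<^sub>m n) * trans X 0 i = rat_const m \<cdot>\<^sub>m (1\<^sub>m n * trans X 0 i)"
          by (rule mult_smult_assoc_mat[OF one_carrier_mat T0])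
        finally show ?thesis using T0 by simp
      qed
      then have "(trans X i 0 * W) * (h0 * trans X 0 i) = trans X i 0 * (rat_const m \<cdot>\<^sub>m trans X 0 i)"
        using assoc_mult_mat[OF T W(1) hT] by simp
      also have "\<dots> = rat_const m \<cdot>\<^sub>m 1\<^sub>m n"
        unfolding mult_smult_distrib[OF T T0] co[OF i N i] tr(4)[OF i i] ..
      finally have "?U * (h0 * trans X 0 i) = rat_const (inverse m) \<cdot>\<^sub>m (rat_const m \<cdot>\<^sub>m 1\<^sub>m n)"
        unfolding mult_smult_assoc_mat[OF TW hT] by simp
      also have "\<dots> = 1\<^sub>m n" by (rule eq_matI) (use mm in auto)
      finally show ?thesis .
    qed
    then have mU: "minv ?U = h0 * trans X 0 i" by (rule minv_eqI[OF U hT])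
    have "det ?U * det (h0 * trans X 0 i) = 1"
      using det_mult[OF U hT] \<open>?U * (h0 * trans X 0 i) = 1\<^sub>m n\<close> by simp
    moreover have "det (h0 * trans X 0 i) = 1" using det_mult[OF h0 T0] dh0 tr(2)[OF N i] by simp
    ultimately have "det ?U = 1" by simp
    then have r: "(h0 * trans X 0 i) $$ (k,l) \<in> regular_on (chart X i)" if "k < n" "l < n" for k l
      unfolding mU[symmetric] using that by (intro minv_regular[OF U Ur]) auto
    have "H i = ?P * (h0 * trans X 0 i)" unfolding H_def by (rule assoc_mult_mat[OF P'(1) h0 T0])
    moreover have "(?P * (h0 * trans X 0 i)) $$ (k,l) \<in> regular_on (chart X i)"
      by (rule mult_regular[OF P'(1) hT kl]) (use r Pc regular_on_to_fract in auto)
    ultimately have "H i $$ (k,l) \<in> regular_on (chart X i)" by simp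
    then show ?thesis by (rule regular_on_mono) simp
  qed
  define x0 where "x0 = root_vector n P 0 (n - 1) a"
  define x where "x = (\<lambda>i. root_vector n P (i + 1) i 1)"
  define Y where "Y = on_trivial_bundle n (frenkel_gross_mat n x0 x)"
  have "frenkel_gross_connection n P Y"
    unfolding frenkel_gross_connection_def
  proof (intro exI conjI allI impI)
    show "x0 \<in> root_space n P 0 (n - 1)" unfolding x0_def by (rule root_vector[OF P]) (use n in auto)
    show "x0 \<noteq> 0\<^sub>m n n" unfolding x0_def by (rule root_vector_nonzero[OF P]) (use n a in auto)
    fix i assume i: "i < n - 1"
    show "x i \<in> root_space n P (i + 1) i" unfolding x_def by (rule root_vector[OF P]) (use i in auto)
    show "x i \<noteq> 0\<^sub>m n n" unfolding x_def by (rule root_vector_nonzero[OF P]) (use i in auto)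
  qed (simp add: Y_def)
  moreover have "SL_isomorphic n X Y"
    unfolding SL_isomorphic_def
  proof (rule exI[of _ "\<lambda>a i. H i"], intro conjI allI impI)
    fix a i assume "a < nchart Y" and i: "i < nchart X"
    show "H i \<in> SL_mats n (regular_on (chart Y a \<inter> chart X i))"
      unfolding SL_mats_iff using H[OF i] Hreg[OF i] by (simp add: Y_def on_trivial_bundle_def)
    have d: "det (trans X 0 i) \<noteq> 0" "det (?P * h0) \<noteq> 0" "det ?P \<noteq> 0" "det h0 \<noteq> 0"
      using tr(2)[OF N i] Ph P' dh0 by auto
    have "gauge rat_theta (H i) (cform X i) = gauge rat_theta (?P * h0) (gauge rat_theta (trans X 0 i) (cform X i))"
      unfolding H_def by (rule rat_theta.gauge_mult[OF Ph(1) d(2) tr(1)[OF N i] d(1) cf(1)[OF i], symmetric])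
    also have "gauge rat_theta (trans X 0 i) (cform X i) = A" unfolding A_def by (rule cg[OF N i, symmetric])
    also have "gauge rat_theta (?P * h0) A = gauge rat_theta ?P (gauge rat_theta h0 A)"
      by (rule rat_theta.gauge_mult[OF P'(1) d(3) h0 d(4) Ac(1), symmetric])
    also have "\<dots> = frenkel_gross_mat n x0 x"
      unfolding gh0 b_def x0_def x_def by (rule gauge_companion_frenkel_gross[OF n P])
    finally show "cform Y a = gauge rat_theta (H i) (cform X i)" by (simp add: Y_def on_trivial_bundle_def)
  next
    fix a b' i j assume "a < nchart Y" "b' < nchart Y" and ij: "i < nchart X" "j < nchart X"
    have "H i * trans X i j = ?P * h0 * (trans X 0 i * trans X i j)"
      unfolding H_def by (rule assoc_mult_mat[OF Ph(1) tr(1)[OF N ij(1)] tr(1)[OF ij]])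
    also have "\<dots> = H j" unfolding co[OF N ij] H_def ..
    also have "\<dots> = 1\<^sub>m n * H j" using H[OF ij(2)] by simp
    finally show "H i * trans X i j = trans Y a b' * H j" by (simp add: Y_def on_trivial_bundle_def)
  qed
  ultimately show ?thesis by blast
qed

end
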